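(* Let $q\in\mathbb{C}$ be a root of unity of order $d\geq3$, and set $e=d$ if $d$ is odd and $e=d/2$ if $d$ is even. Let $U_q=U_q\,\mathfrak{sl}(2)$ be the quantum enveloping algebra of $\mathfrak{sl}(2)$, and let $\mathfrak{u}_d=U_q/I$, where $I$ is the two-sided ideal of $U_q$ generated by $E^e$, $F^e$ and $K^e-1$. Let $\mathcal{A}_{U_q}$ and $\mathcal{A}_{\mathfrak{u}_d}$ be the generic Galois extensions associated with the Hopf algebras $U_q$ and $\mathfrak{u}_d$, with product denoted $*$, and let $(\ )^{*e}$ denote the $e$-th power for the product $*$. Then the algebra $\mathcal{A}_{\mathfrak{u}_d}$ is the quotient of $\mathcal{A}_{U_q}$ by the two-sided ideal generated by the relations $$K^{*e}-\frac{t_K^e}{t_1}=0,\qquad\left(E-\frac{t_E}{t_K}\,K\right)^{*e}=0,\qquad\left(F-\frac{t_F}{t_1}\right)^{*e}=0.$$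
   Context: All algebras are associative unital $\mathbb{C}$-algebras. The Heyneman–Sweedler notation $\Delta(x)=\sum_{(x)}x_{(1)}\otimes x_{(2)}$ is used for coproducts. The Hopf algebras $U_q$ and $\mathfrak{u}_d$. For $q\ne0,\pm1$, $U_q=U_q\,\mathfrak{sl}(2)$ is the algebra generated by $E,F,K,K^{-1}$ with relations $KK^{-1}=K^{-1}K=1$, $KE=q^2EK$, $KF=q^{-2}FK$, $EF-FE=\frac{K-K^{-1}}{q-q^{-1}}$. It is a Hopf algebra whose coproduct and counit are given by $\Delta(K^{\pm1})=K^{\pm1}\otimes K^{\pm1}$, $\Delta(E)=1\otimes E+E\otimes K$, $\Delta(F)=K^{-1}\otimes F+F\otimes1$, $\varepsilon(K^{\pm1})=1$, $\varepsilon(E)=\varepsilon(F)=0$ (the antipode is determined by these). The set $\{E^iF^jK^\ell\}_{i,j\in\mathbb{N},\,\ell\in\mathbb{Z}}$ is a basis of $U_q$. The quotient $\mathfrak{u}_d$ has a unique Hopf algebra structure for which the projection $U_q\to\mathfrak{u}_d$ is a Hopf algebra morphism; it has dimension $e^3$, with basis the images of $E^iF^jK^\ell$, $0\le i,j,\ell\le e-1$. The free commutative Hopf algebra $\mathcal{S}_H$. Let $H$ be a Hopf algebra. Let $t_H$ be a copy of the vector space $H$, with linear isomorphism $x\mapsto t_x$, let $\mathrm{Sym}(t_H)$ be its symmetric algebra, and let $\mathrm{Frac}\,\mathrm{Sym}(t_H)$ be the field of fractions of the latter. There is a unique linear map $t^{-1}:H\to\mathrm{Frac}\,\mathrm{Sym}(t_H)$,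 $x\mapsto t^{-1}_x$, such that $\sum_{(x)}t^{-1}_{x_{(1)}}t_{x_{(2)}}=\varepsilon(x)1=\sum_{(x)}t_{x_{(1)}}t^{-1}_{x_{(2)}}$ for all $x\in H$ (for group-like $x$, $t^{-1}_x=1/t_x$). Then $\mathcal{S}_H$ is the subalgebra of $\mathrm{Frac}\,\mathrm{Sym}(t_H)$ generated by all $t_x$ and $t_x^{-1}$, $x\in H$. It is a commutative Hopf algebra with $\Delta(t_x)=\sum_{(x)}t_{x_{(1)}}\otimes t_{x_{(2)}}$, $\Delta(t_x^{-1})=\sum_{(x)}t^{-1}_{x_{(2)}}\otimes t^{-1}_{x_{(1)}}$, $\varepsilon(t_x)=\varepsilon(t_x^{-1})=\varepsilon(x)$, $S(t_x)=t_x^{-1}$, $S(t_x^{-1})=t_x$. One has $\mathcal{S}_{U_q}=\mathbb{C}[t_{E^iF^jK^\ell}]_{i,j\in\mathbb{N},\,\ell\in\mathbb{Z}}\,[1/t_{K^m}]_{m\in\mathbb{Z}}$ and $\mathcal{S}_{\mathfrak{u}_d}=\mathbb{C}[t_{E^iF^jK^\ell}]_{0\le i,j,\ell\le e-1}\,[1/t_{K^m}]_{0\le m\le e-1}$. The generic base algebra $\mathcal{B}_H$. Let $H_{\mathrm{ab}}$ be the quotient Hopf algebra of $H$ by the ideal generated by all commutators $xy-yx$, and let $\pi:H\to H_{\mathrm{ab}}$ be the projection. Let $\widetilde\pi:\mathcal{S}_H\to H_{\mathrm{ab}}$ be the unique Hopf algebra morphism with $\widetilde\pi(t_x)=\pi(x)$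 for all $x\in H$. Put $\delta=(\mathrm{id}\otimes\widetilde\pi)\circ\Delta:\mathcal{S}_H\to\mathcal{S}_H\otimes H_{\mathrm{ab}}$. Then $\mathcal{B}_H=\{a\in\mathcal{S}_H\mid\delta(a)=a\otimes1\}$. One has $(U_q)_{\mathrm{ab}}\cong\mathbb{C}[\mathbb{Z}/2]$, and $\mathcal{B}_{U_q}$ is the degree-$0$ part of $\mathcal{S}_{U_q}$ for the $\mathbb{Z}/2$-grading in which $t_{E^iF^jK^\ell}$ has degree $i+\ell$ mod $2$. If $e$ is odd, $(\mathfrak{u}_d)_{\mathrm{ab}}=\mathbb{C}$ and $\mathcal{B}_{\mathfrak{u}_d}=\mathcal{S}_{\mathfrak{u}_d}$; if $e$ is even, $(\mathfrak{u}_d)_{\mathrm{ab}}\cong\mathbb{C}[\mathbb{Z}/2]$ and $\mathcal{B}_{\mathfrak{u}_d}$ is the degree-$0$ part of $\mathcal{S}_{\mathfrak{u}_d}$ for the analogous grading. The generic $H$-Galois extension $\mathcal{A}_H$. Define the bilinear map $\sigma(x,y)=\sum_{(x)(y)}t_{x_{(1)}}t_{y_{(1)}}t^{-1}_{x_{(2)}y_{(2)}}$ for $x,y\in H$; it takes values in $\mathcal{B}_H$. Then $\mathcal{A}_H=\mathcal{B}_H\otimes H$ as a vector space, with product $(b\otimes x)*(c\otimes y)=\sum_{(x)(y)}bc\,\sigma(x_{(1)},y_{(1)})\otimes x_{(2)}y_{(2)}$ for $b,c\in\mathcal{B}_H$, $x,y\in H$. This product is associative with unit $t_1^{-1}\otimes1$,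 where $t_1$ is $t_x$ for $x=1\in H$. $\mathcal{A}_H$ is a $\mathcal{B}_H$-algebra via $b\cdot(c\otimes x)=bc\otimes x$. Notation in the relations: $x$ stands for $1\otimes x$, $b\,x$ for $b\otimes x$, and a scalar $b$ alone for $b\otimes1$.
   Formalization: The ideal also contains b⊗1 for all b in B_{U_q} mapping to 0 under t_x ↦ t_{π(x)}, and t_K^e/t_1 is read as any b in B_{U_q} with that image; with the three relations alone the claim fails (for e odd the first is not in A_{U_q}). *)

theory Defs
  imports
    Complex_Main
    "HOL-Library.Poly_Mapping"
    "HOL-Computational_Algebra.Fraction_Field"
    "HOL-Algebra.QuotRing"
    "HOL-Algebra.Module"
begin

section \<open>Complex algebras and their quotients\<close>

text \<open>
  A complex algebra, not necessarily commutative, is carried by a record of the type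
  \<open>(complex, 'a) module\<close> of HOL-Algebra: a ring together with a scalar multiplication.
\<close>

text \<open>The algebra on a full type, with scalars acting through a ring homomorphism into its centre.\<close>

definition univ_alg :: "(complex \<Rightarrow> 'a::ring_1) \<Rightarrow> (complex, 'a) module" where
  "univ_alg \<eta> = \<lparr>carrier = UNIV, mult = (*), one = 1, zero = 0, add = (+),
     smult = (\<lambda>c x. \<eta> c * x)\<rparr>"

definition complex_alg :: "(complex, complex) module" where
  "complex_alg = univ_alg id"

definition lin_hom ::
  "(complex, 'a, 'm) module_scheme \<Rightarrow> (complex, 'b, 'n) module_scheme \<Rightarrow> ('a \<Rightarrow> 'b) set" where
  "lin_hom A B = {h \<in> carrier A \<rightarrow> carrier B.
     (\<forall>x\<in>carrier A. \<forall>y\<in>carrier A. h (x \<oplus>\<^bsub>A\<^esub> y) = h x \<oplus>\<^bsub>B\<^esub> h y) \<and>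
     (\<forall>c. \<forall>x\<in>carrier A. h (c \<odot>\<^bsub>A\<^esub> x) = c \<odot>\<^bsub>B\<^esub> h x)}"

definition alg_hom ::
  "(complex, 'a, 'm) module_scheme \<Rightarrow> (complex, 'b, 'n) module_scheme \<Rightarrow> ('a \<Rightarrow> 'b) set" where
  "alg_hom A B = ring_hom A B \<inter> lin_hom A B"

inductive_set subalg_gen :: "(complex, 'a, 'm) module_scheme \<Rightarrow> 'a set \<Rightarrow> 'a set"
  for A and G where
  one: "\<one>\<^bsub>A\<^esub> \<in> subalg_gen A G"
| incl: "x \<in> G \<Longrightarrow> x \<in> subalg_gen A G"
| add: "x \<in> subalg_gen A G \<Longrightarrow> y \<in> subalg_gen A G \<Longrightarrow> x \<oplus>\<^bsub>A\<^esub> y \<in> subalg_gen A G"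
| mult: "x \<in> subalg_gen A G \<Longrightarrow> y \<in> subalg_gen A G \<Longrightarrow> x \<otimes>\<^bsub>A\<^esub> y \<in> subalg_gen A G"
| smult: "x \<in> subalg_gen A G \<Longrightarrow> c \<odot>\<^bsub>A\<^esub> x \<in> subalg_gen A G"

definition alg_quot ::
  "(complex, 'a, 'm) module_scheme \<Rightarrow> 'a set \<Rightarrow> (complex, 'a set) module" where
  "alg_quot A I = ring.extend (A Quot I)
     (module.fields (\<lambda>c X. \<Union>x\<in>X. I +>\<^bsub>A\<^esub> (c \<odot>\<^bsub>A\<^esub> x)))"

section \<open>Tensor products\<close>

text \<open>
  \<open>formal_alg A B\<close> is the algebra of formal complex combinations of pairs \<open>(a, b)\<close>,
  with \<open>(a, b) (a', b') = (a a', b b')\<close>. The tensor product is its quotient by the linear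
  span \<open>bilin A B\<close> of the bilinearity relations (this span is a two-sided ideal).
\<close>

definition formal_alg ::
  "(complex, 'a, 'm) module_scheme \<Rightarrow> (complex, 'b, 'n) module_scheme
    \<Rightarrow> (complex, ('a \<times> 'b) \<Rightarrow>\<^sub>0 complex) module" where
  "formal_alg A B =
    \<lparr>carrier = {f. Poly_Mapping.keys f \<subseteq> carrier A \<times> carrier B},
     mult = (\<lambda>f g. \<Sum>k\<in>Poly_Mapping.keys f. \<Sum>l\<in>Poly_Mapping.keys g.
       Poly_Mapping.single (fst k \<otimes>\<^bsub>A\<^esub> fst l, snd k \<otimes>\<^bsub>B\<^esub> snd l)
         (Poly_Mapping.lookup f k * Poly_Mapping.lookup g l)),
     one = Poly_Mapping.single (\<one>\<^bsub>A\<^esub>, \<one>\<^bsub>B\<^esub>) 1,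
     zero = 0,
     add = (+),
     smult = (\<lambda>c. Poly_Mapping.map ((*) c))\<rparr>"

inductive_set bilin ::
  "(complex, 'a, 'm) module_scheme \<Rightarrow> (complex, 'b, 'n) module_scheme
    \<Rightarrow> (('a \<times> 'b) \<Rightarrow>\<^sub>0 complex) set"
  for A and B where
  zero: "0 \<in> bilin A B"
| add: "f \<in> bilin A B \<Longrightarrow> g \<in> bilin A B \<Longrightarrow> f + g \<in> bilin A B"
| add_left: "a \<in> carrier A \<Longrightarrow> a' \<in> carrier A \<Longrightarrow> b \<in> carrier B \<Longrightarrow>
    Poly_Mapping.single (a \<oplus>\<^bsub>A\<^esub> a', b) c
      - Poly_Mapping.single (a, b) c - Poly_Mapping.single (a', b) c \<in> bilin A B"
| add_right: "a \<in> carrier A \<Longrightarrow> b \<in> carrier B \<Longrightarrow> b' \<in> carrier B \<Longrightarrow>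
    Poly_Mapping.single (a, b \<oplus>\<^bsub>B\<^esub> b') c
      - Poly_Mapping.single (a, b) c - Poly_Mapping.single (a, b') c \<in> bilin A B"
| smult_left: "a \<in> carrier A \<Longrightarrow> b \<in> carrier B \<Longrightarrow>
    Poly_Mapping.single (k \<odot>\<^bsub>A\<^esub> a, b) c - Poly_Mapping.single (a, b) (k * c) \<in> bilin A B"
| smult_right: "a \<in> carrier A \<Longrightarrow> b \<in> carrier B \<Longrightarrow>
    Poly_Mapping.single (a, k \<odot>\<^bsub>B\<^esub> b) c - Poly_Mapping.single (a, b) (k * c) \<in> bilin A B"

definition tensor ::
  "(complex, 'a, 'm) module_scheme \<Rightarrow> (complex, 'b, 'n) module_scheme
    \<Rightarrow> (complex, (('a \<times> 'b) \<Rightarrow>\<^sub>0 complex) set) module" where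
  "tensor A B = alg_quot (formal_alg A B) (bilin A B)"

definition pure ::
  "(complex, 'a, 'm) module_scheme \<Rightarrow> (complex, 'b, 'n) module_scheme
    \<Rightarrow> 'a \<Rightarrow> 'b \<Rightarrow> (('a \<times> 'b) \<Rightarrow>\<^sub>0 complex) set" where
  "pure A B a b = bilin A B +>\<^bsub>formal_alg A B\<^esub> Poly_Mapping.single (a, b) 1"

text \<open>
  For a bilinear map \<open>f\<close> with values in \<open>C\<close>, \<open>tlift C f\<close> is the induced linear map on the
  tensor product: the common value of \<open>\<Sum> c\<^sub>i f a\<^sub>i b\<^sub>i\<close> over all formal
  sums \<open>\<Sum> c\<^sub>i (a\<^sub>i, b\<^sub>i)\<close> representing the tensor. A Sweedler sum
  \<open>\<Sum> f x\<^sub>(\<^sub>1\<^sub>) x\<^sub>(\<^sub>2\<^sub>)\<close> is \<open>tlift C f\<close> applied to the coproduct of \<open>x\<close>.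
\<close>

definition tlift ::
  "(complex, 'c, 'm) module_scheme \<Rightarrow> ('a \<Rightarrow> 'b \<Rightarrow> 'c) \<Rightarrow> (('a \<times> 'b) \<Rightarrow>\<^sub>0 complex) set \<Rightarrow> 'c" where
  "tlift C f T = the_elem
     ((\<lambda>r. \<Oplus>\<^bsub>C\<^esub>k\<in>Poly_Mapping.keys r. Poly_Mapping.lookup r k \<odot>\<^bsub>C\<^esub> f (fst k) (snd k)) ` T)"

text \<open>\<open>tmap A B f g\<close> is \<open>f \<otimes> g\<close> with values in \<open>tensor A B\<close>.\<close>

definition tmap ::
  "(complex, 'c, 'm) module_scheme \<Rightarrow> (complex, 'd, 'n) module_scheme
    \<Rightarrow> ('a \<Rightarrow> 'c) \<Rightarrow> ('b \<Rightarrow> 'd)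
    \<Rightarrow> (('a \<times> 'b) \<Rightarrow>\<^sub>0 complex) set \<Rightarrow> (('c \<times> 'd) \<Rightarrow>\<^sub>0 complex) set" where
  "tmap A B f g = tlift (tensor A B) (\<lambda>a b. pure A B (f a) (g b))"

section \<open>Hopf algebras\<close>

text \<open>
  The antipode of a Hopf algebra is determined by the bialgebra structure and preserved by
  every bialgebra morphism, so it is not part of the data.
\<close>

record 'a hopf = "(complex, 'a) module" +
  comult :: "'a \<Rightarrow> (('a \<times> 'a) \<Rightarrow>\<^sub>0 complex) set"
  counit :: "'a \<Rightarrow> complex"

definition hopf_hom :: "('a, 'm) hopf_scheme \<Rightarrow> ('b, 'n) hopf_scheme \<Rightarrow> ('a \<Rightarrow> 'b) set" where
  "hopf_hom G H = {h \<in> alg_hom G H. \<forall>x\<in>carrier G.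
     comult H (h x) = tmap H H h h (comult G x) \<and> counit H (h x) = counit G x}"

text \<open>The quotient by a Hopf ideal, with the structure making the projection a Hopf algebra morphism.\<close>

definition hopf_quot :: "('a, 'm) hopf_scheme \<Rightarrow> 'a set \<Rightarrow> 'a set hopf" where
  "hopf_quot H I = module.extend (alg_quot H I)
     (hopf.fields
       (\<lambda>X. the_elem ((\<lambda>x. tmap (alg_quot H I) (alg_quot H I)
          (\<lambda>y. I +>\<^bsub>H\<^esub> y) (\<lambda>y. I +>\<^bsub>H\<^esub> y) (comult H x)) ` X))
       (\<lambda>X. the_elem (counit H ` X)))"

definition comm_ideal :: "('a, 'm) hopf_scheme \<Rightarrow> 'a set" where
  "comm_ideal H = Idl\<^bsub>H\<^esub> {x \<otimes>\<^bsub>H\<^esub> y \<ominus>\<^bsub>H\<^esub> y \<otimes>\<^bsub>H\<^esub> x | x y. x \<in> carrier H \<and> y \<in> carrier H}"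

definition hopf_ab :: "('a, 'm) hopf_scheme \<Rightarrow> 'a set hopf" where
  "hopf_ab H = hopf_quot H (comm_ideal H)"

section \<open>The field of fractions of the symmetric algebra\<close>

text \<open>
  A linearly ordered copy of an arbitrary type, so that \<open>Poly_Mapping\<close> provides the integral
  domain of polynomials with variables indexed by that type. The order itself plays no role.
\<close>

typedef 'a ordcopy = "UNIV :: 'a set" ..

instantiation ordcopy :: (type) linorder
begin

definition less_eq_ordcopy :: "'a ordcopy \<Rightarrow> 'a ordcopy \<Rightarrow> bool" where
  "x \<le> y \<longleftrightarrow> (Rep_ordcopy x, Rep_ordcopy y) \<in> (SOME r. well_order_on UNIV r)"

definition less_ordcopy :: "'a ordcopy \<Rightarrow> 'a ordcopy \<Rightarrow> bool" where
  "(x :: 'a ordcopy) < y \<longleftrightarrow> x \<le> y \<and> \<not> y \<le> x"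

instance
proof -
  let ?r = "SOME r :: 'a rel. well_order_on UNIV r"
  have "well_order_on UNIV ?r"
    using well_order_on[of "UNIV :: 'a set"] by (rule someI_ex)
  then have lin: "linear_order_on UNIV ?r"
    by (simp add: well_order_on_def)
  then have r: "refl ?r" "trans ?r" "antisym ?r" "total ?r"
    by (simp_all add: linear_order_on_def partial_order_on_def preorder_on_def)
  show "OFCLASS('a ordcopy, linorder_class)"
  proof
    fix x y z :: "'a ordcopy"
    show "(x < y) = (x \<le> y \<and> \<not> y \<le> x)" by (rule less_ordcopy_def)
    show "x \<le> x" using r(1) by (simp add: less_eq_ordcopy_def refl_on_def)
    show "x \<le> y \<Longrightarrow> y \<le> z \<Longrightarrow> x \<le> z"
      using r(2) unfolding less_eq_ordcopy_def by (rule transD)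
    show "x \<le> y \<Longrightarrow> y \<le> x \<Longrightarrow> x = y"
      using r(3) unfolding less_eq_ordcopy_def by (metis Rep_ordcopy_inject antisymD)
    show "x \<le> y \<or> y \<le> x"
      using r(1,4) unfolding less_eq_ordcopy_def
      by (metis UNIV_I refl_on_def total_on_def)
  qed
qed

end

type_synonym 'a sympoly = "('a ordcopy \<Rightarrow>\<^sub>0 nat) \<Rightarrow>\<^sub>0 complex"
type_synonym 'a symfrac = "'a sympoly fract"

definition sym_const :: "complex \<Rightarrow> 'a symfrac" where
  "sym_const c = Fract (Poly_Mapping.single 0 c) 1"

definition sym_var :: "'a \<Rightarrow> 'a symfrac" where
  "sym_var x = Fract (Poly_Mapping.single (Poly_Mapping.single (Abs_ordcopy x) 1) 1) 1"

definition symfrac_alg :: "(complex, 'a symfrac) module" where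
  "symfrac_alg = univ_alg sym_const"

definition lincomb :: "(complex, 'a, 'm) module_scheme \<Rightarrow> ('a \<Rightarrow>\<^sub>0 complex) \<Rightarrow> 'a" where
  "lincomb V c = (\<Oplus>\<^bsub>V\<^esub>b\<in>Poly_Mapping.keys c. Poly_Mapping.lookup c b \<odot>\<^bsub>V\<^esub> b)"

definition is_basis :: "(complex, 'a, 'm) module_scheme \<Rightarrow> 'a set \<Rightarrow> bool" where
  "is_basis V X \<longleftrightarrow> X \<subseteq> carrier V \<and>
     (\<forall>x\<in>carrier V. \<exists>!c. Poly_Mapping.keys c \<subseteq> X \<and> lincomb V c = x)"

definition some_basis :: "(complex, 'a, 'm) module_scheme \<Rightarrow> 'a set" where
  "some_basis V = (SOME X. is_basis V X)"

definition coords :: "(complex, 'a, 'm) module_scheme \<Rightarrow> 'a \<Rightarrow> ('a \<Rightarrow>\<^sub>0 complex)" where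
  "coords V x = (THE c. Poly_Mapping.keys c \<subseteq> some_basis V \<and> lincomb V c = x)"

text \<open>
  \<open>Sym(t\<^sub>H)\<close> is realised as the polynomial algebra on the variables \<open>t\<^sub>b\<close>, for \<open>b\<close> in
  a basis of \<open>H\<close>; different bases give the same algebra up to an isomorphism compatible
  with the linear map \<open>x \<mapsto> t\<^sub>x\<close>. Only the variables
  of basis elements occur in the image of \<open>tvar\<close>.
\<close>

definition tvar :: "(complex, 'a, 'm) module_scheme \<Rightarrow> 'a \<Rightarrow> 'a symfrac" where
  "tvar H x = (\<Sum>b\<in>Poly_Mapping.keys (coords H x).
     sym_const (Poly_Mapping.lookup (coords H x) b) * sym_var b)"

definition tinv :: "('a, 'm) hopf_scheme \<Rightarrow> 'a \<Rightarrow> 'a symfrac" where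
  "tinv H = (THE s. s \<in> lin_hom H (symfrac_alg :: (complex, 'a symfrac) module)
     \<and> s \<in> extensional (carrier H)
     \<and> (\<forall>x\<in>carrier H.
          tlift symfrac_alg (\<lambda>x1 x2. s x1 * tvar H x2) (comult H x) = sym_const (counit H x)
        \<and> tlift symfrac_alg (\<lambda>x1 x2. tvar H x1 * s x2) (comult H x) = sym_const (counit H x)))"

section \<open>The free commutative Hopf algebra and the generic base algebra\<close>

definition S_alg :: "('a, 'm) hopf_scheme \<Rightarrow> (complex, 'a symfrac) module" where
  "S_alg H = symfrac_alg
     \<lparr>carrier := subalg_gen symfrac_alg (tvar H ` carrier H \<union> tinv H ` carrier H)\<rparr>"

definition S_comult ::
  "('a, 'm) hopf_scheme \<Rightarrow> 'a symfrac \<Rightarrow> (('a symfrac \<times> 'a symfrac) \<Rightarrow>\<^sub>0 complex) set" where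
  "S_comult H = (THE D. D \<in> alg_hom (S_alg H) (tensor (S_alg H) (S_alg H))
     \<and> D \<in> extensional (carrier (S_alg H))
     \<and> (\<forall>x\<in>carrier H.
          D (tvar H x) = tmap (S_alg H) (S_alg H) (tvar H) (tvar H) (comult H x)
        \<and> D (tinv H x) = tlift (tensor (S_alg H) (S_alg H))
             (\<lambda>x1 x2. pure (S_alg H) (S_alg H) (tinv H x2) (tinv H x1)) (comult H x)))"

definition S_counit :: "('a, 'm) hopf_scheme \<Rightarrow> 'a symfrac \<Rightarrow> complex" where
  "S_counit H = (THE \<epsilon>. \<epsilon> \<in> alg_hom (S_alg H) complex_alg
     \<and> \<epsilon> \<in> extensional (carrier (S_alg H))
     \<and> (\<forall>x\<in>carrier H. \<epsilon> (tvar H x) = counit H x \<and> \<epsilon> (tinv H x) = counit H x))"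

definition S_hopf :: "('a, 'm) hopf_scheme \<Rightarrow> 'a symfrac hopf" where
  "S_hopf H = module.extend (S_alg H) (hopf.fields (S_comult H) (S_counit H))"

definition pi_tilde :: "('a, 'm) hopf_scheme \<Rightarrow> 'a symfrac \<Rightarrow> 'a set" where
  "pi_tilde H = (THE h. h \<in> hopf_hom (S_hopf H) (hopf_ab H)
     \<and> h \<in> extensional (carrier (S_hopf H))
     \<and> (\<forall>x\<in>carrier H. h (tvar H x) = comm_ideal H +>\<^bsub>H\<^esub> x))"

definition base_alg :: "('a, 'm) hopf_scheme \<Rightarrow> (complex, 'a symfrac) module" where
  "base_alg H = S_alg H
     \<lparr>carrier := {a \<in> carrier (S_alg H).
        tmap (S_alg H) (hopf_ab H) id (pi_tilde H) (S_comult H a)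
          = pure (S_alg H) (hopf_ab H) a \<one>\<^bsub>hopf_ab H\<^esub>}\<rparr>"

text \<open>The algebra morphism \<open>S\<^sub>G \<rightarrow> S\<^sub>H\<close> induced by a Hopf algebra morphism \<open>f : G \<rightarrow> H\<close>.\<close>

definition S_map ::
  "('a, 'm) hopf_scheme \<Rightarrow> ('b, 'n) hopf_scheme \<Rightarrow> ('a \<Rightarrow> 'b) \<Rightarrow> 'a symfrac \<Rightarrow> 'b symfrac" where
  "S_map G H f = (THE p. p \<in> alg_hom (S_alg G) (S_alg H)
     \<and> p \<in> extensional (carrier (S_alg G))
     \<and> (\<forall>x\<in>carrier G. p (tvar G x) = tvar H (f x) \<and> p (tinv G x) = tinv H (f x)))"

section \<open>The generic Galois extension\<close>

definition gen_cocycle :: "('a, 'm) hopf_scheme \<Rightarrow> 'a \<Rightarrow> 'a \<Rightarrow> 'a symfrac" where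
  "gen_cocycle H x y =
     tlift symfrac_alg (\<lambda>x1 x2.
       tlift symfrac_alg (\<lambda>y1 y2. tvar H x1 * tvar H y1 * tinv H (x2 \<otimes>\<^bsub>H\<^esub> y2))
         (comult H y))
       (comult H x)"

text \<open>The element \<open>b \<otimes> x\<close> of the generic extension.\<close>

definition gen_elem ::
  "('a, 'm) hopf_scheme \<Rightarrow> 'a symfrac \<Rightarrow> 'a \<Rightarrow> (('a symfrac \<times> 'a) \<Rightarrow>\<^sub>0 complex) set" where
  "gen_elem H b x = pure (base_alg H) H b x"

definition gen_mult ::
  "('a, 'm) hopf_scheme \<Rightarrow> (('a symfrac \<times> 'a) \<Rightarrow>\<^sub>0 complex) set
     \<Rightarrow> (('a symfrac \<times> 'a) \<Rightarrow>\<^sub>0 complex) set \<Rightarrow> (('a symfrac \<times> 'a) \<Rightarrow>\<^sub>0 complex) set" where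
  "gen_mult H X Y =
     (let T = tensor (base_alg H) H in
       tlift T (\<lambda>b x. tlift T (\<lambda>c y.
         tlift T (\<lambda>x1 x2. tlift T (\<lambda>y1 y2.
           gen_elem H (b * c * gen_cocycle H x1 y1) (x2 \<otimes>\<^bsub>H\<^esub> y2))
         (comult H y)) (comult H x)) Y) X)"

definition gen_ext ::
  "('a, 'm) hopf_scheme \<Rightarrow> (complex, (('a symfrac \<times> 'a) \<Rightarrow>\<^sub>0 complex) set) module" where
  "gen_ext H = tensor (base_alg H) H
     \<lparr>mult := gen_mult H, one := gen_elem H (tinv H \<one>\<^bsub>H\<^esub>) \<one>\<^bsub>H\<^esub>\<rparr>"

text \<open>
  For a Hopf algebra morphism \<open>f : G \<rightarrow> H\<close>, the map \<open>b \<otimes> x \<mapsto> S_map f b \<otimes> f x\<close> between the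
  generic extensions.
  If \<open>f\<close> maps the base algebra of \<open>G\<close> onto that of \<open>H\<close>, then dividing
  \<open>gen_ext G\<close> by the elements \<open>b \<otimes> 1\<close> with \<open>S_map f b = 0\<close> is the extension of scalars to
  \<open>base_alg H\<close>; there, a scalar \<open>c\<close> of \<open>base_alg H\<close> is represented by \<open>b \<otimes> 1\<close> for any
  \<open>b\<close> with \<open>S_map f b = c\<close>.
\<close>

definition gen_ext_map ::
  "('a, 'm) hopf_scheme \<Rightarrow> ('b, 'n) hopf_scheme \<Rightarrow> ('a \<Rightarrow> 'b)
    \<Rightarrow> (('a symfrac \<times> 'a) \<Rightarrow>\<^sub>0 complex) set \<Rightarrow> (('b symfrac \<times> 'b) \<Rightarrow>\<^sub>0 complex) set" where
  "gen_ext_map G H f = tmap (base_alg H) H (S_map G H f) f"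

section \<open>The quantum enveloping algebra of sl(2) and its finite-dimensional quotient\<close>

datatype uq_gen = Gen_E | Gen_F | Gen_K | Gen_Kinv

text \<open>
  Words form a monoid under concatenation, so that \<open>uq_gen list \<Rightarrow>\<^sub>0 complex\<close>, with the
  convolution product of \<open>Poly_Mapping\<close>, is the free algebra on the four generators.
\<close>

instantiation list :: (type) monoid_add
begin

definition zero_list :: "'a list" where "zero_list = []"

definition plus_list :: "'a list \<Rightarrow> 'a list \<Rightarrow> 'a list" where "plus_list = (@)"

instance by standard (simp_all add: zero_list_def plus_list_def)

end

type_synonym uq_free = "uq_gen list \<Rightarrow>\<^sub>0 complex"

definition free_scalar :: "complex \<Rightarrow> uq_free" where
  "free_scalar c = Poly_Mapping.single [] c"

definition free_gen :: "uq_gen \<Rightarrow> uq_free" where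
  "free_gen g = Poly_Mapping.single [g] 1"

definition free_alg :: "(complex, uq_free) module" where
  "free_alg = univ_alg free_scalar"

definition Uq_ideal :: "complex \<Rightarrow> uq_free set" where
  "Uq_ideal q =
    (let E = free_gen Gen_E; F = free_gen Gen_F; K = free_gen Gen_K; K' = free_gen Gen_Kinv in
     Idl\<^bsub>free_alg\<^esub>
      {K * K' - 1, K' * K - 1,
       K * E - free_scalar (q ^ 2) * E * K,
       K * F - free_scalar (inverse (q ^ 2)) * F * K,
       E * F - F * E - free_scalar (1 / (q - inverse q)) * (K - K')})"

definition Uq_alg :: "complex \<Rightarrow> (complex, uq_free set) module" where
  "Uq_alg q = alg_quot free_alg (Uq_ideal q)"

definition Uq_gen :: "complex \<Rightarrow> uq_gen \<Rightarrow> uq_free set" where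
  "Uq_gen q g = Uq_ideal q +>\<^bsub>free_alg\<^esub> free_gen g"

definition Uq_comult ::
  "complex \<Rightarrow> uq_free set \<Rightarrow> ((uq_free set \<times> uq_free set) \<Rightarrow>\<^sub>0 complex) set" where
  "Uq_comult q =
    (let U = Uq_alg q; UU = tensor U U;
         E = Uq_gen q Gen_E; F = Uq_gen q Gen_F; K = Uq_gen q Gen_K; K' = Uq_gen q Gen_Kinv in
     THE D. D \<in> alg_hom U UU \<and> D \<in> extensional (carrier U)
       \<and> D K = pure U U K K \<and> D K' = pure U U K' K'
       \<and> D E = pure U U \<one>\<^bsub>U\<^esub> E \<oplus>\<^bsub>UU\<^esub> pure U U E K
       \<and> D F = pure U U K' F \<oplus>\<^bsub>UU\<^esub> pure U U F \<one>\<^bsub>U\<^esub>)"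

definition Uq_counit :: "complex \<Rightarrow> uq_free set \<Rightarrow> complex" where
  "Uq_counit q =
    (THE \<epsilon>. \<epsilon> \<in> alg_hom (Uq_alg q) complex_alg \<and> \<epsilon> \<in> extensional (carrier (Uq_alg q))
       \<and> \<epsilon> (Uq_gen q Gen_K) = 1 \<and> \<epsilon> (Uq_gen q Gen_Kinv) = 1
       \<and> \<epsilon> (Uq_gen q Gen_E) = 0 \<and> \<epsilon> (Uq_gen q Gen_F) = 0)"

definition Uq :: "complex \<Rightarrow> uq_free set hopf" where
  "Uq q = module.extend (Uq_alg q) (hopf.fields (Uq_comult q) (Uq_counit q))"

definition ud_ideal :: "complex \<Rightarrow> nat \<Rightarrow> uq_free set set" where
  "ud_ideal q e = Idl\<^bsub>Uq q\<^esub>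
     {Uq_gen q Gen_E [^]\<^bsub>Uq q\<^esub> e, Uq_gen q Gen_F [^]\<^bsub>Uq q\<^esub> e,
      Uq_gen q Gen_K [^]\<^bsub>Uq q\<^esub> e \<ominus>\<^bsub>Uq q\<^esub> \<one>\<^bsub>Uq q\<^esub>}"

definition ud :: "complex \<Rightarrow> nat \<Rightarrow> uq_free set set hopf" where
  "ud q e = hopf_quot (Uq q) (ud_ideal q e)"

definition ud_proj :: "complex \<Rightarrow> nat \<Rightarrow> uq_free set \<Rightarrow> uq_free set set" where
  "ud_proj q e x = ud_ideal q e +>\<^bsub>Uq q\<^esub> x"

end

theory Submission
  imports Defs
begin

text \<open>
  Under \<open>b \<otimes> x \<mapsto> b t_{x_1} \<otimes> x_2\<close> the twisted product \<open>*\<close> becomes the componentwise product of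
  \<open>S_H \<otimes> H\<close>. For a word \<open>w\<close> in the generators and \<open>s\<close> of the same degree as \<open>w\<close>, let \<open>theta s w\<close> be
  the preimage of \<open>s \<otimes> w\<close>; then \<open>theta s w * theta s' w' = theta (s s') (w w')\<close>, and the relations
  become \<open>theta (t_K^e) (K^e) = theta (b t_1) 1\<close>, where \<open>b\<close> is homogeneous of degree 0 with image
  \<open>t_K^e / t_1\<close>, together with \<open>theta (t_1^e) (E^e) = 0\<close> and \<open>theta (t_{K^{-1}}^e) (F^e) = 0\<close>.
  As \<open>t_K\<close> is an invertible element of odd degree, the coefficients can be adjusted freely, and the
  ideal of the relations contains \<open>b \<otimes> x\<close> as soon as \<open>b\<close> or \<open>x\<close> is killed by the projection from
  \<open>U_q\<close> to \<open>u_d\<close>. Hence \<open>b \<otimes> x\<close> depends, modulo the ideal, only on the images of \<open>b\<close> and \<open>x\<close>, which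
  gives an inverse of the induced map.
\<close>

section \<open>Complex modules and algebras\<close>

text \<open>No PBW basis enters. All Hopf algebras involved are spanned by words in
  \<open>E\<close>, \<open>F\<close>, \<open>K\<close>, \<open>K^{-1}\<close>, so linear maps are
  controlled by their values on words. The one linear independence required is that of distinct
  group-like elements, and a coproduct argument gives it in each of these Hopf algebras. It allows
  \<open>g \<mapsto> 1/t_g\<close> to be extended linearly, which is the first approximation to the
  convolution inverse of \<open>t\<close>, and it separates the two degrees. The parity of
  \<open>e\<close> shapes the relations. In \<open>S_{U_q}\<close> the fraction
  \<open>t_K^e / t_1\<close> has degree \<open>e\<close>, so for odd \<open>e\<close> it lies
  outside the base algebra of \<open>U_q\<close>; it becomes a scalar only over \<open>u_d\<close>.
  Hence the relation for \<open>K\<close> is imposed for every preimage \<open>b\<close> of degree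
  0, and any two of them differ by a scalar killed by the projection. Since \<open>q^2\<close> has
  order exactly \<open>e\<close>, the intermediate q-binomial coefficients vanish and the coproducts
  of \<open>E^e\<close> and \<open>F^e\<close> have two terms each. A relator in the left tensor
  factor enters the coefficient, one in the right factor enters the word; these are the two cases of
  the ideal computation.\<close>

locale cmod = abelian_group A for A :: "(complex, 'a, 'm) module_scheme" (structure) +
  assumes smult_closed [simp, intro]: "x \<in> carrier A \<Longrightarrow> c \<odot> x \<in> carrier A"
    and smult_l_distr: "x \<in> carrier A \<Longrightarrow> (c + d) \<odot> x = c \<odot> x \<oplus> d \<odot> x"
    and smult_r_distr: "x \<in> carrier A \<Longrightarrow> y \<in> carrier A \<Longrightarrow> c \<odot> (x \<oplus> y) = c \<odot> x \<oplus> c \<odot> y"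
    and smult_assoc: "x \<in> carrier A \<Longrightarrow> c \<odot> (d \<odot> x) = (c * d) \<odot> x"
    and smult_one [simp]: "x \<in> carrier A \<Longrightarrow> 1 \<odot> x = x"
begin

lemma smult_zero_left [simp]: "x \<in> carrier A \<Longrightarrow> 0 \<odot> x = \<zero>"
  using smult_l_distr[of x 0 0] by (simp add: add.r_cancel_one')

lemma smult_zero_right [simp]: "c \<odot> \<zero> = \<zero>"
  using smult_r_distr[of \<zero> \<zero> c] by (simp add: add.r_cancel_one')

lemma smult_minus_one: "x \<in> carrier A \<Longrightarrow> (- 1) \<odot> x = \<ominus> x"
  using smult_l_distr[of x "-1" 1] by (simp add: minus_equality)

lemma smult_uminus: "x \<in> carrier A \<Longrightarrow> (- c) \<odot> x = \<ominus> (c \<odot> x)"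
  using smult_minus_one[of "c \<odot> x"] smult_assoc[of x "-1" c] by simp

lemma minus_eq_smult: "x \<in> carrier A \<Longrightarrow> y \<in> carrier A \<Longrightarrow> x \<ominus> y = x \<oplus> (- 1) \<odot> y"
  by (simp add: smult_minus_one a_minus_def)

end

locale calg = cmod A + ring A for A :: "(complex, 'a, 'm) module_scheme" (structure) +
  assumes smult_mult_left: "x \<in> carrier A \<Longrightarrow> y \<in> carrier A \<Longrightarrow> (c \<odot> x) \<otimes> y = c \<odot> (x \<otimes> y)"
    and smult_mult_right: "x \<in> carrier A \<Longrightarrow> y \<in> carrier A \<Longrightarrow> x \<otimes> (c \<odot> y) = c \<odot> (x \<otimes> y)"

locale ccalg = calg A + cring A for A :: "(complex, 'a, 'm) module_scheme" (structure)

text \<open>Scalar multiplication by -1 supplies the additive inverses: the algebras below come with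
  explicit scalars but without an explicit negation.\<close>

lemma calgI:
  fixes A :: "(complex, 'a, 'm) module_scheme" (structure)
  assumes "\<And>x y. x \<in> carrier A \<Longrightarrow> y \<in> carrier A \<Longrightarrow> x \<oplus> y \<in> carrier A" "\<zero> \<in> carrier A"
    "\<And>x y z. x \<in> carrier A \<Longrightarrow> y \<in> carrier A \<Longrightarrow> z \<in> carrier A \<Longrightarrow> (x \<oplus> y) \<oplus> z = x \<oplus> (y \<oplus> z)"
    "\<And>x y. x \<in> carrier A \<Longrightarrow> y \<in> carrier A \<Longrightarrow> x \<oplus> y = y \<oplus> x"
    "\<And>x. x \<in> carrier A \<Longrightarrow> \<zero> \<oplus> x = x"
    "\<And>x. x \<in> carrier A \<Longrightarrow> ((- 1) \<odot> x) \<oplus> x = \<zero>"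
    "\<And>x y. x \<in> carrier A \<Longrightarrow> y \<in> carrier A \<Longrightarrow> x \<otimes> y \<in> carrier A" "\<one> \<in> carrier A"
    "\<And>x y z. x \<in> carrier A \<Longrightarrow> y \<in> carrier A \<Longrightarrow> z \<in> carrier A \<Longrightarrow> (x \<otimes> y) \<otimes> z = x \<otimes> (y \<otimes> z)"
    "\<And>x. x \<in> carrier A \<Longrightarrow> \<one> \<otimes> x = x" "\<And>x. x \<in> carrier A \<Longrightarrow> x \<otimes> \<one> = x"
    "\<And>x y z. x \<in> carrier A \<Longrightarrow> y \<in> carrier A \<Longrightarrow> z \<in> carrier A \<Longrightarrow> (x \<oplus> y) \<otimes> z = x \<otimes> z \<oplus> y \<otimes> z"
    "\<And>x y z. x \<in> carrier A \<Longrightarrow> y \<in> carrier A \<Longrightarrow> z \<in> carrier A \<Longrightarrow> z \<otimes> (x \<oplus> y) = z \<otimes> x \<oplus> z \<otimes> y"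
    "\<And>x c. x \<in> carrier A \<Longrightarrow> c \<odot> x \<in> carrier A"
    "\<And>x c d. x \<in> carrier A \<Longrightarrow> (c + d) \<odot> x = c \<odot> x \<oplus> d \<odot> x"
    "\<And>x y c. x \<in> carrier A \<Longrightarrow> y \<in> carrier A \<Longrightarrow> c \<odot> (x \<oplus> y) = c \<odot> x \<oplus> c \<odot> y"
    "\<And>x c d. x \<in> carrier A \<Longrightarrow> c \<odot> (d \<odot> x) = (c * d) \<odot> x"
    "\<And>x. x \<in> carrier A \<Longrightarrow> 1 \<odot> x = x"
    "\<And>x y c. x \<in> carrier A \<Longrightarrow> y \<in> carrier A \<Longrightarrow> (c \<odot> x) \<otimes> y = c \<odot> (x \<otimes> y)"
    "\<And>x y c. x \<in> carrier A \<Longrightarrow> y \<in> carrier A \<Longrightarrow> x \<otimes> (c \<odot> y) = c \<odot> (x \<otimes> y)"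
  shows "calg A"
proof -
  have ag: "abelian_group A"
  proof (rule abelian_groupI)
    fix x assume "x \<in> carrier A"
    then show "\<exists>y\<in>carrier A. y \<oplus> x = \<zero>"
      by (intro bexI[of _ "(- 1) \<odot> x"] assms(6,14))
  qed (rule assms; assumption)+
  have m: "monoid A"
    by (rule monoidI; rule assms; assumption)
  have r: "ring A"
    by (rule ringI[OF ag m]; rule assms; assumption)
  have cm: "cmod A"
    by (intro cmod.intro cmod_axioms.intro ag) (rule assms; assumption)+
  show ?thesis
    by (rule calg.intro[OF cm r calg_axioms.intro]; rule assms; assumption)
qed

text \<open>Adding a coproduct and a counit to an algebra changes the record type, so algebra and
  Hopf algebra cannot be compared by equality. This relation transports axioms, morphisms and tensor
  products between them.\<close>

definition same_alg ::
  "(complex, 'a, 'm) module_scheme \<Rightarrow> (complex, 'a, 'n) module_scheme \<Rightarrow> bool" where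
  "same_alg A B \<longleftrightarrow> carrier A = carrier B \<and> mult A = mult B \<and> one A = one B \<and> zero A = zero B
     \<and> add A = add B \<and> smult A = smult B"

lemma same_alg_sym: "same_alg A B \<Longrightarrow> same_alg B A"
  by (simp add: same_alg_def)

lemma calg_cong:
  assumes "same_alg A B" "calg A" shows "calg B"
proof -
  interpret calg A by fact
  have s: "carrier B = carrier A" "mult B = mult A" "one B = one A" "zero B = zero A"
     "add B = add A" "smult B = smult A"
    using assms(1) by (simp_all add: same_alg_def)
  show ?thesis
    by (rule calgI; simp only: s)
      (auto simp: a_assoc a_comm m_assoc l_distr r_distr smult_l_distr smult_r_distr smult_assoc
        smult_mult_left smult_mult_right smult_minus_one l_neg r_neg a_lcomm)
qed

lemma ccalgI: "calg A \<Longrightarrow> (\<And>x y. x \<in> carrier A \<Longrightarrow> y \<in> carrier A \<Longrightarrow> x \<otimes>\<^bsub>A\<^esub> y = y \<otimes>\<^bsub>A\<^esub> x) \<Longrightarrow> ccalg A"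
  unfolding ccalg_def cring_def comm_monoid_def comm_monoid_axioms_def calg_def ring_def by blast

lemma calg_univ_alg:
  fixes \<eta> :: "complex \<Rightarrow> 'a::ring_1"
  assumes "\<And>c d. \<eta> (c + d) = \<eta> c + \<eta> d" "\<And>c d. \<eta> (c * d) = \<eta> c * \<eta> d" "\<eta> 1 = 1"
    "\<And>c x. \<eta> c * x = x * \<eta> c"
  shows "calg (univ_alg \<eta>)"
proof -
  have "\<eta> (c + d) = \<eta> c + \<eta> d" for c d by (rule assms)
  from this[of 0 0] have 0: "\<eta> 0 = 0" by simp
  have neg: "\<eta> (- 1) = - 1"
    using assms(1)[of 1 "-1"] assms(3) 0 by (simp add: eq_neg_iff_add_eq_0 add.commute)
  have r: "x * (\<eta> c * y) = \<eta> c * (x * y)" for c x y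
    by (metis assms(4) mult.assoc)
  show ?thesis
    by (rule calgI; simp add: univ_alg_def assms(1-3) neg
        distrib_left distrib_right mult.assoc add.assoc add.commute) (rule r)
qed

lemma univ_alg_simps [simp]:
  "carrier (univ_alg \<eta>) = UNIV" "mult (univ_alg \<eta>) = (*)" "one (univ_alg \<eta>) = 1"
  "zero (univ_alg \<eta>) = 0" "add (univ_alg \<eta>) = (+)" "smult (univ_alg \<eta>) = (\<lambda>c x. \<eta> c * x)"
  by (simp_all add: univ_alg_def)

lemma ccalg_complex: "ccalg complex_alg"
  unfolding complex_alg_def
  by (rule ccalgI, rule calg_univ_alg) auto

section \<open>Linear maps\<close>

lemma lin_homI:
  assumes "\<And>x. x \<in> carrier A \<Longrightarrow> h x \<in> carrier B"
    "\<And>x y. x \<in> carrier A \<Longrightarrow> y \<in> carrier A \<Longrightarrow> h (x \<oplus>\<^bsub>A\<^esub> y) = h x \<oplus>\<^bsub>B\<^esub> h y"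
    "\<And>c x. x \<in> carrier A \<Longrightarrow> h (c \<odot>\<^bsub>A\<^esub> x) = c \<odot>\<^bsub>B\<^esub> h x"
  shows "h \<in> lin_hom A B"
  using assms by (auto simp: lin_hom_def)

lemma lin_homD:
  assumes "h \<in> lin_hom A B"
  shows "x \<in> carrier A \<Longrightarrow> h x \<in> carrier B"
    "x \<in> carrier A \<Longrightarrow> y \<in> carrier A \<Longrightarrow> h (x \<oplus>\<^bsub>A\<^esub> y) = h x \<oplus>\<^bsub>B\<^esub> h y"
    "x \<in> carrier A \<Longrightarrow> h (c \<odot>\<^bsub>A\<^esub> x) = c \<odot>\<^bsub>B\<^esub> h x"
  using assms by (auto simp: lin_hom_def)

lemma lin_hom_zero:
  assumes "h \<in> lin_hom A B" "cmod A" "cmod B"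
  shows "h \<zero>\<^bsub>A\<^esub> = \<zero>\<^bsub>B\<^esub>"
proof -
  interpret A: cmod A by fact
  interpret B: cmod B by fact
  have "h (0 \<odot>\<^bsub>A\<^esub> \<zero>\<^bsub>A\<^esub>) = 0 \<odot>\<^bsub>B\<^esub> h \<zero>\<^bsub>A\<^esub>"
    using lin_homD(3)[OF assms(1)] by blast
  then show ?thesis
    using lin_homD(1)[OF assms(1)] by simp
qed

lemma lin_hom_minus:
  assumes "h \<in> lin_hom A B" "cmod A" "cmod B" "x \<in> carrier A" "y \<in> carrier A"
  shows "h (x \<ominus>\<^bsub>A\<^esub> y) = h x \<ominus>\<^bsub>B\<^esub> h y"
proof -
  interpret A: cmod A by fact
  interpret B: cmod B by fact
  show ?thesis
    using assms(4,5) lin_homD[OF assms(1)] by (simp add: A.minus_eq_smult B.minus_eq_smult)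
qed

lemma lin_hom_compose: "g \<in> lin_hom A B \<Longrightarrow> h \<in> lin_hom B C \<Longrightarrow> (\<lambda>x. h (g x)) \<in> lin_hom A C"
  by (auto simp: lin_hom_def Pi_iff)

lemma lin_hom_id: "(\<lambda>x. x) \<in> lin_hom A A"
  by (auto simp: lin_hom_def)

lemma lin_hom_cong: "h \<in> lin_hom A B \<Longrightarrow> (\<And>x. x \<in> carrier A \<Longrightarrow> h x = g x) \<Longrightarrow> cmod A \<Longrightarrow> g \<in> lin_hom A B"
  by (rule lin_homI)
    (metis lin_homD(1), metis (no_types, lifting) cmod_def abelian_groupE(1) lin_homD(2),
     metis (no_types, lifting) cmod.smult_closed lin_homD(3))

lemma alg_homI:
  assumes "h \<in> lin_hom A B"
    "\<And>x y. x \<in> carrier A \<Longrightarrow> y \<in> carrier A \<Longrightarrow> h (x \<otimes>\<^bsub>A\<^esub> y) = h x \<otimes>\<^bsub>B\<^esub> h y" "h \<one>\<^bsub>A\<^esub> = \<one>\<^bsub>B\<^esub>"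
  shows "h \<in> alg_hom A B"
  using assms lin_homD[OF assms(1)] by (auto simp: alg_hom_def intro!: ring_hom_memI)

lemma alg_hom_lin: "h \<in> alg_hom A B \<Longrightarrow> h \<in> lin_hom A B"
  by (simp add: alg_hom_def)

lemma alg_homD:
  assumes "h \<in> alg_hom A B"
  shows "x \<in> carrier A \<Longrightarrow> h x \<in> carrier B"
    "x \<in> carrier A \<Longrightarrow> y \<in> carrier A \<Longrightarrow> h (x \<oplus>\<^bsub>A\<^esub> y) = h x \<oplus>\<^bsub>B\<^esub> h y"
    "x \<in> carrier A \<Longrightarrow> h (c \<odot>\<^bsub>A\<^esub> x) = c \<odot>\<^bsub>B\<^esub> h x"
    "x \<in> carrier A \<Longrightarrow> y \<in> carrier A \<Longrightarrow> h (x \<otimes>\<^bsub>A\<^esub> y) = h x \<otimes>\<^bsub>B\<^esub> h y"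
    "h \<one>\<^bsub>A\<^esub> = \<one>\<^bsub>B\<^esub>"
  using assms by (auto simp: alg_hom_def lin_hom_def ring_hom_def)

lemma alg_hom_compose: "g \<in> alg_hom A B \<Longrightarrow> h \<in> alg_hom B C \<Longrightarrow> (\<lambda>x. h (g x)) \<in> alg_hom A C"
  by (auto simp: alg_hom_def lin_hom_def ring_hom_def Pi_iff)

lemma alg_hom_id: "(\<lambda>x. x) \<in> alg_hom A A"
  by (auto simp: alg_hom_def lin_hom_def ring_hom_def)

lemma alg_hom_cong:
  assumes "h \<in> alg_hom A B" "\<And>x. x \<in> carrier A \<Longrightarrow> h x = g x" "calg A"
  shows "g \<in> alg_hom A B"
proof -
  interpret calg A by fact
  show ?thesis
    using alg_homD[OF assms(1)]
    by (intro alg_homI lin_homI) (simp_all flip: assms(2))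
qed

lemma alg_hom_zero:
  assumes "h \<in> alg_hom A B" "calg A" "calg B" shows "h \<zero>\<^bsub>A\<^esub> = \<zero>\<^bsub>B\<^esub>"
  using lin_hom_zero[OF alg_hom_lin[OF assms(1)]] assms(2,3) by (simp add: calg_def)

lemma alg_hom_minus:
  assumes "h \<in> alg_hom A B" "calg A" "calg B" "x \<in> carrier A" "y \<in> carrier A"
  shows "h (x \<ominus>\<^bsub>A\<^esub> y) = h x \<ominus>\<^bsub>B\<^esub> h y"
  using lin_hom_minus[OF alg_hom_lin[OF assms(1)]] assms(2-) by (simp add: calg_def)

lemma alg_hom_pow:
  assumes "h \<in> alg_hom A B" "calg A" "calg B" "x \<in> carrier A"
  shows "h (x [^]\<^bsub>A\<^esub> (n::nat)) = h x [^]\<^bsub>B\<^esub> n"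
proof -
  interpret A: calg A by fact
  interpret B: calg B by fact
  show ?thesis
    using assms(4) alg_homD[OF assms(1)] by (induction n) simp_all
qed

lemma alg_hom_unit:
  assumes "h \<in> alg_hom A B" "calg A" "x \<in> Units A"
  shows "h x \<in> Units B"
proof -
  interpret A: calg A by fact
  obtain y where y: "y \<in> carrier A" "x \<otimes>\<^bsub>A\<^esub> y = \<one>\<^bsub>A\<^esub>" "y \<otimes>\<^bsub>A\<^esub> x = \<one>\<^bsub>A\<^esub>"
    using assms(3) by (auto simp: Units_def)
  have x: "x \<in> carrier A" using assms(3) by auto
  have "h y \<otimes>\<^bsub>B\<^esub> h x = \<one>\<^bsub>B\<^esub>" "h x \<otimes>\<^bsub>B\<^esub> h y = \<one>\<^bsub>B\<^esub>"
    using alg_homD(4,5)[OF assms(1)] x y by metis+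
  then show ?thesis
    using x y alg_homD(1)[OF assms(1)] by (auto simp: Units_def)
qed

lemma alg_hom_ring_hom: "h \<in> alg_hom A B \<Longrightarrow> ring A \<Longrightarrow> ring B \<Longrightarrow> ring_hom_ring A B h"
  by (simp add: alg_hom_def ring_hom_ringI2)

lemma subalg_gen_subset:
  assumes "calg A" "G \<subseteq> carrier A" shows "subalg_gen A G \<subseteq> carrier A"
proof
  interpret calg A by fact
  fix x assume "x \<in> subalg_gen A G"
  then show "x \<in> carrier A" by induction (use assms in auto)
qed

lemma alg_hom_eqI:
  assumes "h \<in> alg_hom A B" "g \<in> alg_hom A B" "calg A" "G \<subseteq> carrier A"
    "\<And>x. x \<in> G \<Longrightarrow> h x = g x" "x \<in> subalg_gen A G"
  shows "h x = g x"
proof -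
  have sub: "y \<in> carrier A" if "y \<in> subalg_gen A G" for y
    using that subalg_gen_subset[OF assms(3,4)] by blast
  show ?thesis using assms(6)
  proof induction
  case (add x y)
  then show ?case using sub[of x] sub[of y]
    by (simp add: alg_homD(2)[OF assms(1)] alg_homD(2)[OF assms(2)])
next
  case (mult x y)
  then show ?case using sub[of x] sub[of y]
    by (simp add: alg_homD(4)[OF assms(1)] alg_homD(4)[OF assms(2)])
next
  case (smult x c)
  then show ?case using sub[of x]
    by (simp add: alg_homD(3)[OF assms(1)] alg_homD(3)[OF assms(2)])
qed (simp_all add: assms(5) alg_homD(5)[OF assms(1)] alg_homD(5)[OF assms(2)])
qed

lemma calg_subalg:
  fixes A :: "(complex, 'a, 'm) module_scheme"
  assumes "calg A" "S \<subseteq> carrier A" "\<one>\<^bsub>A\<^esub> \<in> S" "\<zero>\<^bsub>A\<^esub> \<in> S"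
    "\<And>x y. x \<in> S \<Longrightarrow> y \<in> S \<Longrightarrow> x \<oplus>\<^bsub>A\<^esub> y \<in> S" "\<And>x y. x \<in> S \<Longrightarrow> y \<in> S \<Longrightarrow> x \<otimes>\<^bsub>A\<^esub> y \<in> S"
    "\<And>x c. x \<in> S \<Longrightarrow> c \<odot>\<^bsub>A\<^esub> x \<in> S"
  shows "calg (A\<lparr>carrier := S\<rparr>)"
proof -
  interpret calg A by fact
  have c: "x \<in> S \<Longrightarrow> x \<in> carrier A" for x using assms(2) by auto
  show ?thesis
    by (rule calgI) (simp_all add: assms c a_assoc a_comm m_assoc l_distr r_distr smult_l_distr
        smult_r_distr smult_assoc smult_mult_left smult_mult_right smult_minus_one l_neg r_neg a_lcomm)
qed

lemma calg_subalg_gen: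
  fixes A :: "(complex, 'a, 'm) module_scheme"
  assumes "calg A" "G \<subseteq> carrier A"
  shows "calg (A\<lparr>carrier := subalg_gen A G\<rparr>)"
proof -
  interpret calg A by fact
  have "0 \<odot>\<^bsub>A\<^esub> \<one>\<^bsub>A\<^esub> \<in> subalg_gen A G"
    by (intro subalg_gen.intros)
  then have "\<zero>\<^bsub>A\<^esub> \<in> subalg_gen A G" by simp
  then show ?thesis
    using subalg_gen_subset[OF assms]
    by (intro calg_subalg assms) (auto intro: subalg_gen.intros)
qed

section \<open>Finite linear combinations\<close>

text \<open>Induction on the number of keys. The set \<open>X\<close> preserves the information that
  all keys lie in a carrier or in a basis.\<close>

lemma pm_induct [consumes 1, case_names zero add]:
  fixes f :: "'k \<Rightarrow>\<^sub>0 'c::ab_group_add"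
  assumes "Poly_Mapping.keys f \<subseteq> X" "P 0"
    "\<And>k c g. k \<in> X \<Longrightarrow> Poly_Mapping.keys g \<subseteq> X \<Longrightarrow> P g \<Longrightarrow> P (Poly_Mapping.single k c + g)"
  shows "P f"
  using assms(1)
proof (induction "card (Poly_Mapping.keys f)" arbitrary: f)
  case 0
  then have "f = 0" by simp
  then show ?case using assms(2) by simp
next
  case (Suc n)
  then obtain k where k: "k \<in> Poly_Mapping.keys f"
    by (metis card.empty equals0I nat.distinct(1))
  let ?g = "f - Poly_Mapping.single k (Poly_Mapping.lookup f k)"
  have keys: "Poly_Mapping.keys ?g = Poly_Mapping.keys f - {k}"
    by (auto simp: in_keys_iff lookup_minus lookup_single when_def split: if_splits)
  then have "card (Poly_Mapping.keys ?g) = n"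
    using Suc.hyps(2) k by simp
  then have "P ?g"
    using Suc keys by blast
  then have "P (Poly_Mapping.single k (Poly_Mapping.lookup f k) + ?g)"
    using assms(3) k keys Suc.prems by (metis Diff_subset subset_iff)
  then show ?case by simp
qed

text \<open>The linear extension of a family to formal combinations. It serves for coordinates in a
  basis, formal sums of pairs, words in generators and monomials alike.\<close>

definition psum ::
  "(complex, 'a, 'm) module_scheme \<Rightarrow> ('k \<Rightarrow> 'a) \<Rightarrow> ('k \<Rightarrow>\<^sub>0 complex) \<Rightarrow> 'a" where
  "psum V \<mu> c = (\<Oplus>\<^bsub>V\<^esub>k\<in>Poly_Mapping.keys c. Poly_Mapping.lookup c k \<odot>\<^bsub>V\<^esub> \<mu> k)"

lemma lookup_map_times [simp]:
  fixes c :: "'k \<Rightarrow>\<^sub>0 complex"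
  shows "Poly_Mapping.lookup (Poly_Mapping.map ((*) a) c) k = a * Poly_Mapping.lookup c k"
  by (simp add: Poly_Mapping.map.rep_eq when_def)

lemma keys_map_times: "Poly_Mapping.keys (Poly_Mapping.map ((*) a) c) \<subseteq> Poly_Mapping.keys c"
  for c :: "'k \<Rightarrow>\<^sub>0 complex"
  by (auto simp: in_keys_iff)

lemma keys_plus_subset: "Poly_Mapping.keys c \<subseteq> X \<Longrightarrow> Poly_Mapping.keys d \<subseteq> X
  \<Longrightarrow> Poly_Mapping.keys (c + d) \<subseteq> X"
  using Poly_Mapping.keys_add[of c d] by blast

lemma keys_minus_subset:
  fixes c :: "'k \<Rightarrow>\<^sub>0 complex"
  assumes "Poly_Mapping.keys c \<subseteq> X" "Poly_Mapping.keys d \<subseteq> X"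
  shows "Poly_Mapping.keys (c - d) \<subseteq> X"
proof
  fix k assume "k \<in> Poly_Mapping.keys (c - d)"
  then have "k \<in> Poly_Mapping.keys c \<or> k \<in> Poly_Mapping.keys d"
    by (auto simp: in_keys_iff lookup_minus)
  then show "k \<in> X" using assms by blast
qed

context cmod
begin

lemma psum_superset:
  assumes "finite K" "Poly_Mapping.keys c \<subseteq> K" "\<mu> \<in> K \<rightarrow> carrier A"
  shows "psum A \<mu> c = (\<Oplus>k\<in>K. Poly_Mapping.lookup c k \<odot> \<mu> k)"
  unfolding psum_def
  by (rule add.finprod_mono_neutral_cong_left)
    (use assms in \<open>auto simp: in_keys_iff Pi_iff\<close>)

lemma psum_closed [simp]:
  "(\<And>k. k \<in> X \<Longrightarrow> \<mu> k \<in> carrier A) \<Longrightarrow> Poly_Mapping.keys c \<subseteq> X \<Longrightarrow> psum A \<mu> c \<in> carrier A"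
  unfolding psum_def by (rule finsum_closed) auto

lemma psum_zero [simp]: "psum A \<mu> 0 = \<zero>"
  by (simp add: psum_def)

lemma psum_single: "\<mu> k \<in> carrier A \<Longrightarrow> psum A \<mu> (Poly_Mapping.single k c) = c \<odot> \<mu> k"
  using psum_superset[of "{k}" "Poly_Mapping.single k c" \<mu>] by (simp add: finsum_insert)

lemma psum_add:
  assumes "\<And>k. k \<in> X \<Longrightarrow> \<mu> k \<in> carrier A" "Poly_Mapping.keys c \<subseteq> X" "Poly_Mapping.keys d \<subseteq> X"
  shows "psum A \<mu> (c + d) = psum A \<mu> c \<oplus> psum A \<mu> d"
proof -
  let ?K = "Poly_Mapping.keys c \<union> Poly_Mapping.keys d"
  have \<mu>: "\<mu> \<in> ?K \<rightarrow> carrier A" using assms by auto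
  have "psum A \<mu> (c + d) = (\<Oplus>k\<in>?K. Poly_Mapping.lookup c k \<odot> \<mu> k \<oplus> Poly_Mapping.lookup d k \<odot> \<mu> k)"
    using psum_superset[OF _ _ \<mu>, of "c + d"] Poly_Mapping.keys_add[of c d] \<mu>
    by (simp add: lookup_add smult_l_distr Pi_iff cong: finsum_cong)
  also have "\<dots> = psum A \<mu> c \<oplus> psum A \<mu> d"
    using \<mu> by (subst finsum_addf) (auto simp: psum_superset[OF _ _ \<mu>])
  finally show ?thesis .
qed

lemma psum_smult:
  fixes \<mu> :: "'k \<Rightarrow> 'a"
  assumes "\<And>k. k \<in> X \<Longrightarrow> \<mu> k \<in> carrier A" "Poly_Mapping.keys c \<subseteq> X"
  shows "psum A \<mu> (Poly_Mapping.map ((*) a) c) = a \<odot> psum A \<mu> c"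
  using assms(2)
proof (induction rule: pm_induct)
  case zero
  have "Poly_Mapping.map ((*) a) (0 :: 'k \<Rightarrow>\<^sub>0 complex) = 0" by (simp add: map_eq_zero_iff)
  then show ?case by simp
next
  case (add k c g)
  have eq: "Poly_Mapping.map ((*) a) (Poly_Mapping.single k c + g)
    = Poly_Mapping.single k (a * c) + Poly_Mapping.map ((*) a) g"
    by (rule poly_mapping_eqI) (simp add: lookup_add lookup_single when_def algebra_simps)
  show ?case unfolding eq using add assms(1) keys_map_times[of a g]
    by (subst (1 2) psum_add[where X = X])
      (auto simp: psum_single smult_r_distr smult_assoc psum_closed[of X])
qed

lemma psum_minus:
  assumes "\<And>k. k \<in> X \<Longrightarrow> \<mu> k \<in> carrier A" "Poly_Mapping.keys c \<subseteq> X" "Poly_Mapping.keys d \<subseteq> X"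
  shows "psum A \<mu> (c - d) = psum A \<mu> c \<ominus> psum A \<mu> d"
proof -
  have eq: "c - d = c + Poly_Mapping.map ((*) (- 1)) d"
    by (rule poly_mapping_eqI) (simp add: lookup_add lookup_minus)
  show ?thesis
    unfolding eq using order_trans[OF keys_map_times[of "-1" d] assms(3)] assms
    by (subst psum_add[where X = X])
      (simp_all add: psum_smult[where X = X] minus_eq_smult psum_closed[of X \<mu>])
qed

end

lemma psum_hom:
  assumes "h \<in> lin_hom A B" "cmod A" "cmod B" "\<And>k. k \<in> X \<Longrightarrow> \<mu> k \<in> carrier A" "Poly_Mapping.keys c \<subseteq> X"
  shows "h (psum A \<mu> c) = psum B (\<lambda>k. h (\<mu> k)) c"
proof -
  interpret A: cmod A by fact
  interpret B: cmod B by fact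
  note hD = lin_homD[OF assms(1)]
  show ?thesis using assms(5)
  proof (induction rule: pm_induct)
    case zero
    then show ?case by (simp add: lin_hom_zero[OF assms(1-3)])
  next
    case (add k c g)
    then show ?case
      using assms(4)
      by (subst A.psum_add[where X = X], simp_all, subst B.psum_add[where X = X])
        (auto simp: A.psum_single B.psum_single hD A.psum_closed[of X])
  qed
qed

section \<open>Bases\<close>

lemma lincomb_psum: "lincomb V c = psum V (\<lambda>b. b) c"
  by (simp add: lincomb_def psum_def)

definition indep :: "(complex, 'a, 'm) module_scheme \<Rightarrow> 'a set \<Rightarrow> bool" where
  "indep V X \<longleftrightarrow> X \<subseteq> carrier V \<and>
     (\<forall>c. Poly_Mapping.keys c \<subseteq> X \<longrightarrow> lincomb V c = \<zero>\<^bsub>V\<^esub> \<longrightarrow> c = 0)"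

context cmod
begin

lemma indep_unique:
  assumes "indep A X" "Poly_Mapping.keys c \<subseteq> X" "Poly_Mapping.keys d \<subseteq> X" "lincomb A c = lincomb A d"
  shows "c = d"
proof -
  have X: "k \<in> X \<Longrightarrow> k \<in> carrier A" for k using assms(1) by (auto simp: indep_def)
  then have "lincomb A (c - d) = \<zero>"
    unfolding lincomb_psum
    using assms(2-4) psum_minus[of X "\<lambda>k. k" c d] psum_closed[of X "\<lambda>k. k" d]
    by (simp add: lincomb_psum a_minus_def r_neg)
  then show ?thesis
    using assms(1) keys_minus_subset[OF assms(2,3)] by (auto simp: indep_def)
qed

text \<open>If \<open>x\<close> is outside \<open>M\<close>, then \<open>insert x M\<close> is
  dependent. The coefficient of \<open>x\<close> in a dependence is nonzero because \<open>M\<close>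
  is independent, so the dependence can be solved for \<open>x\<close>.\<close>

lemma maximal_indep_spans:
  assumes "indep A M" "indep A (insert x M) \<Longrightarrow> x \<in> M" "x \<in> carrier A"
  shows "\<exists>c. Poly_Mapping.keys c \<subseteq> M \<and> lincomb A c = x"
proof (cases "x \<in> M")
  case True
  then show ?thesis
    using assms(3) by (intro exI[of _ "Poly_Mapping.single x 1"]) (simp add: lincomb_psum psum_single)
next
  case False
  then have "\<not> indep A (insert x M)"
    using assms(2) by blast
  then obtain c where c: "Poly_Mapping.keys c \<subseteq> insert x M" "lincomb A c = \<zero>" "c \<noteq> 0"
    using assms(1,3) by (auto simp: indep_def)
  have M: "k \<in> insert x M \<Longrightarrow> k \<in> carrier A" for k
    using assms(1,3) by (auto simp: indep_def)
  define a where "a = Poly_Mapping.lookup c x"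
  define d where "d = c - Poly_Mapping.single x a"
  have a0: "a \<noteq> 0"
  proof
    assume "a = 0"
    then have "Poly_Mapping.keys c \<subseteq> M" using c(1) by (auto simp: a_def in_keys_iff subset_iff)
    then show False using c(2,3) assms(1) by (auto simp: indep_def)
  qed
  have dM: "Poly_Mapping.keys d \<subseteq> M"
    using c(1) by (auto simp: d_def a_def in_keys_iff lookup_minus lookup_single when_def split: if_splits)
  then have [simp]: "psum A (\<lambda>b. b) d \<in> carrier A"
    using M by (auto intro: psum_closed)
  have "a \<odot> x \<oplus> psum A (\<lambda>b. b) d = psum A (\<lambda>b. b) (Poly_Mapping.single x a + d)"
    using M dM assms(3) by (subst psum_add[where X = "insert x M"]) (auto simp: psum_single)
  also have "\<dots> = \<zero>" using c(2) by (simp add: d_def lincomb_psum)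
  finally have "a \<odot> x \<oplus> psum A (\<lambda>b. b) d = \<zero>" .
  then have "psum A (\<lambda>b. b) d = \<ominus> (a \<odot> x)"
    using assms(3) by (metis \<open>psum A (\<lambda>b. b) d \<in> carrier A\<close> a_comm minus_equality smult_closed)
  then have "psum A (\<lambda>b. b) d = (- a) \<odot> x"
    using assms(3) by (simp add: smult_uminus)
  then have "psum A (\<lambda>b. b) (Poly_Mapping.map ((*) (- inverse a)) d) = x"
    using a0 assms(3) dM M by (subst psum_smult[where X = M]) (auto simp: smult_assoc)
  then show ?thesis
    using dM keys_map_times[of "- inverse a" d] by (metis lincomb_psum subset_trans)
qed

text \<open>Zorn's lemma relative to \<open>C\<close>: with \<open>C\<close> the whole space it
  extends an independent set to a basis, with \<open>C\<close> the set of group-likes it starts the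
  proof of their independence.\<close>

lemma indep_maximal:
  assumes "indep A G" "G \<subseteq> C"
  obtains M where "G \<subseteq> M" "M \<subseteq> C" "indep A M" "\<And>x. x \<in> C \<Longrightarrow> indep A (insert x M) \<Longrightarrow> x \<in> M"
proof -
  let ?F = "{X. indep A X \<and> G \<subseteq> X \<and> X \<subseteq> C}"
  have "\<exists>M\<in>?F. \<forall>X\<in>?F. M \<subseteq> X \<longrightarrow> X = M"
  proof (rule subset_Zorn_nonempty)
    show "?F \<noteq> {}" using assms by auto
  next
    fix \<C> assume C: "\<C> \<noteq> {}" "subset.chain ?F \<C>"
    have "indep A (\<Union>\<C>)"
      unfolding indep_def
    proof (intro conjI allI impI)
      show "\<Union>\<C> \<subseteq> carrier A" using C by (auto simp: subset.chain_def indep_def)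
      fix c assume c: "Poly_Mapping.keys c \<subseteq> \<Union>\<C>" "lincomb A c = \<zero>"
      obtain B where "B \<in> \<C>" "Poly_Mapping.keys c \<subseteq> B"
        using finite_subset_Union_chain[OF _ c(1) C] by auto
      then show "c = 0" using C c by (auto simp: subset.chain_def indep_def)
    qed
    then show "\<Union>\<C> \<in> ?F" using C unfolding subset.chain_def by blast
  qed
  then obtain M where M: "M \<in> ?F" "\<forall>X\<in>?F. M \<subseteq> X \<longrightarrow> X = M" by (rule bexE)
  have "x \<in> M" if "x \<in> C" "indep A (insert x M)" for x
  proof -
    have "insert x M \<in> ?F" using M(1) that by (simp add: subset_insertI2)
    then have "insert x M = M" using M(2) by (metis subset_insertI)
    then show ?thesis by blast
  qed
  then show thesis using M(1) by (intro that[of M]) auto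
qed

lemma basis_extend:
  assumes "indep A G" obtains X where "G \<subseteq> X" "is_basis A X"
proof -
  have "G \<subseteq> carrier A" using assms by (simp add: indep_def)
  then obtain M where M: "G \<subseteq> M" "M \<subseteq> carrier A" "indep A M"
      "\<And>x. x \<in> carrier A \<Longrightarrow> indep A (insert x M) \<Longrightarrow> x \<in> M"
    using indep_maximal[OF assms] by metis
  have "is_basis A M"
    unfolding is_basis_def
  proof (intro conjI ballI ex_ex1I)
    fix x assume "x \<in> carrier A"
    then show "\<exists>c. Poly_Mapping.keys c \<subseteq> M \<and> lincomb A c = x"
      by (intro maximal_indep_spans M(3,4))
  qed (use M(2) indep_unique[OF M(3)] in blast)+
  then show ?thesis using that M(1) by blast
qed

lemma indep_empty: "indep A {}"
  by (auto simp: indep_def)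

end

text \<open>Coordinates in an arbitrary basis: besides the fixed basis behind \<open>coords\<close>,
  bases extending the group-likes occur.\<close>

definition crd :: "(complex, 'a, 'm) module_scheme \<Rightarrow> 'a set \<Rightarrow> 'a \<Rightarrow> ('a \<Rightarrow>\<^sub>0 complex)" where
  "crd V X x = (THE c. Poly_Mapping.keys c \<subseteq> X \<and> lincomb V c = x)"

lemma coords_crd: "coords V = crd V (some_basis V)"
  by (simp add: coords_def crd_def fun_eq_iff)

context cmod
begin

lemma is_basis_some_basis: "is_basis A (some_basis A)"
  unfolding some_basis_def using basis_extend[OF indep_empty] by (rule someI_ex) blast

context
  fixes X assumes X: "is_basis A X"
begin

lemma basis_carrier: "b \<in> X \<Longrightarrow> b \<in> carrier A"
  using X by (auto simp: is_basis_def)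

lemma crd: "x \<in> carrier A \<Longrightarrow> Poly_Mapping.keys (crd A X x) \<subseteq> X"
   "x \<in> carrier A \<Longrightarrow> psum A (\<lambda>b. b) (crd A X x) = x"
  using theI'[of "\<lambda>c. Poly_Mapping.keys c \<subseteq> X \<and> lincomb A c = x"] X
  by (auto simp: is_basis_def crd_def lincomb_psum)

lemma crd_unique: "Poly_Mapping.keys c \<subseteq> X \<Longrightarrow> psum A (\<lambda>b. b) c = x \<Longrightarrow> crd A X x = c"
  using X psum_closed[of X "\<lambda>b. b" c] crd[of x] basis_carrier
  by (auto simp: is_basis_def lincomb_psum)

lemma crd_add: "x \<in> carrier A \<Longrightarrow> y \<in> carrier A \<Longrightarrow> crd A X (x \<oplus> y) = crd A X x + crd A X y"
  by (rule crd_unique) (simp_all add: keys_plus_subset crd psum_add[where X = X] basis_carrier)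

lemma crd_smult: "x \<in> carrier A \<Longrightarrow> crd A X (a \<odot> x) = Poly_Mapping.map ((*) a) (crd A X x)"
  by (rule crd_unique)
    (simp_all add: order_trans[OF keys_map_times] crd psum_smult[where X = X] basis_carrier)

lemma crd_basis: "b \<in> X \<Longrightarrow> crd A X b = Poly_Mapping.single b 1"
  by (rule crd_unique) (simp_all add: psum_single basis_carrier)

lemma psum_crd_lin_hom:
  assumes "cmod C" "\<And>b. b \<in> X \<Longrightarrow> g b \<in> carrier C"
  shows "(\<lambda>x. psum C g (crd A X x)) \<in> lin_hom A C"
proof -
  interpret C: cmod C by fact
  show ?thesis
    by (rule lin_homI) (use assms(2) in \<open>simp_all add: crd_add crd_smult
      C.psum_closed[of X] C.psum_add[where X = X] C.psum_smult[where X = X] crd\<close>)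
qed

lemma basis_lin_hom:
  assumes "cmod C" "\<And>b. b \<in> X \<Longrightarrow> g b \<in> carrier C"
  obtains h where "h \<in> lin_hom A C" "\<And>b. b \<in> X \<Longrightarrow> h b = g b"
proof
  interpret C: cmod C by fact
  show "(\<lambda>x. psum C g (crd A X x)) \<in> lin_hom A C" by (rule psum_crd_lin_hom) fact+
  fix b assume "b \<in> X"
  then show "psum C g (crd A X b) = g b" using assms(2) by (simp add: crd_basis C.psum_single)
qed

end

end

section \<open>Quotient algebras\<close>

lemma ideal_smult:
  assumes "calg A" "ideal I A" "x \<in> I" shows "c \<odot>\<^bsub>A\<^esub> x \<in> I"
proof -
  interpret calg A by fact
  interpret ideal I A by fact
  have "(c \<odot>\<^bsub>A\<^esub> \<one>\<^bsub>A\<^esub>) \<otimes>\<^bsub>A\<^esub> x \<in> I" using assms(3) by (simp add: I_l_closed)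
  then show ?thesis using a_subset assms(3) by (simp add: smult_mult_left subset_iff)
qed

lemma calg_surj:
  fixes A :: "(complex, 'a, 'm) module_scheme" and B :: "(complex, 'b, 'n) module_scheme"
  assumes "calg A" "carrier B = \<pi> ` carrier A" "\<zero>\<^bsub>B\<^esub> = \<pi> \<zero>\<^bsub>A\<^esub>" "\<one>\<^bsub>B\<^esub> = \<pi> \<one>\<^bsub>A\<^esub>"
    "\<And>x y. x \<in> carrier A \<Longrightarrow> y \<in> carrier A \<Longrightarrow> \<pi> x \<oplus>\<^bsub>B\<^esub> \<pi> y = \<pi> (x \<oplus>\<^bsub>A\<^esub> y)"
    "\<And>x y. x \<in> carrier A \<Longrightarrow> y \<in> carrier A \<Longrightarrow> \<pi> x \<otimes>\<^bsub>B\<^esub> \<pi> y = \<pi> (x \<otimes>\<^bsub>A\<^esub> y)"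
    "\<And>x c. x \<in> carrier A \<Longrightarrow> c \<odot>\<^bsub>B\<^esub> \<pi> x = \<pi> (c \<odot>\<^bsub>A\<^esub> x)"
  shows "calg B"
proof -
  interpret A: calg A by fact
  show ?thesis
    by (rule calgI; simp only: assms(2); (elim imageE)?; hypsubst_thin?;
        simp add: assms(3-7) A.a_assoc A.m_assoc A.l_distr A.r_distr A.smult_l_distr
        A.smult_r_distr A.smult_assoc A.smult_mult_left A.smult_mult_right A.smult_minus_one
        A.l_neg A.r_neg; simp add: A.a_comm)
qed

context
  fixes A :: "(complex, 'a, 'm) module_scheme" and I
  assumes A: "calg A" and I: "ideal I A"
begin

interpretation A: calg A by (rule A)
interpretation I: ideal I A by (rule I)

lemma coset_eq_iff: "x \<in> carrier A \<Longrightarrow> y \<in> carrier A \<Longrightarrow> I +>\<^bsub>A\<^esub> x = I +>\<^bsub>A\<^esub> y \<longleftrightarrow> x \<ominus>\<^bsub>A\<^esub> y \<in> I"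
  using A.quotient_eq_iff_same_a_r_cos[OF I] by simp

lemma coset_zero_iff: "x \<in> carrier A \<Longrightarrow> I +>\<^bsub>A\<^esub> x = I \<longleftrightarrow> x \<in> I"
  using coset_eq_iff[of x "\<zero>\<^bsub>A\<^esub>"] A.a_coset_add_zero[OF I.a_subset] by (simp add: a_minus_def)

lemma mem_coset_iff: "x \<in> carrier A \<Longrightarrow> y \<in> I +>\<^bsub>A\<^esub> x \<longleftrightarrow> y \<in> carrier A \<and> y \<ominus>\<^bsub>A\<^esub> x \<in> I"
  using A.a_r_coset_subset_G[OF I.a_subset, of x] I.a_rcos_self[of y]
    A.a_repr_independence[OF _ _ I.a_subgroup, of y x] coset_eq_iff[of y x] by blast

lemma alg_quot_simps:
  "carrier (alg_quot A I) = (\<lambda>x. I +>\<^bsub>A\<^esub> x) ` carrier A"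
  "zero (alg_quot A I) = I" "one (alg_quot A I) = I +>\<^bsub>A\<^esub> \<one>\<^bsub>A\<^esub>"
  "x \<in> carrier A \<Longrightarrow> y \<in> carrier A \<Longrightarrow>
    (I +>\<^bsub>A\<^esub> x) \<oplus>\<^bsub>alg_quot A I\<^esub> (I +>\<^bsub>A\<^esub> y) = I +>\<^bsub>A\<^esub> (x \<oplus>\<^bsub>A\<^esub> y)"
  "x \<in> carrier A \<Longrightarrow> y \<in> carrier A \<Longrightarrow>
    (I +>\<^bsub>A\<^esub> x) \<otimes>\<^bsub>alg_quot A I\<^esub> (I +>\<^bsub>A\<^esub> y) = I +>\<^bsub>A\<^esub> (x \<otimes>\<^bsub>A\<^esub> y)"
  "x \<in> carrier A \<Longrightarrow> c \<odot>\<^bsub>alg_quot A I\<^esub> (I +>\<^bsub>A\<^esub> x) = I +>\<^bsub>A\<^esub> (c \<odot>\<^bsub>A\<^esub> x)"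
proof -
  show "carrier (alg_quot A I) = (\<lambda>x. I +>\<^bsub>A\<^esub> x) ` carrier A"
    by (auto simp: alg_quot_def ring.extend_def module.fields_def FactRing_simps)
  show "zero (alg_quot A I) = I" "one (alg_quot A I) = I +>\<^bsub>A\<^esub> \<one>\<^bsub>A\<^esub>"
    by (simp_all add: alg_quot_def ring.extend_def module.fields_def FactRing_def)
  show "x \<in> carrier A \<Longrightarrow> y \<in> carrier A \<Longrightarrow>
    (I +>\<^bsub>A\<^esub> x) \<oplus>\<^bsub>alg_quot A I\<^esub> (I +>\<^bsub>A\<^esub> y) = I +>\<^bsub>A\<^esub> (x \<oplus>\<^bsub>A\<^esub> y)"
    by (simp add: alg_quot_def ring.extend_def module.fields_def FactRing_def I.a_rcos_sum)
  show "x \<in> carrier A \<Longrightarrow> y \<in> carrier A \<Longrightarrow>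
    (I +>\<^bsub>A\<^esub> x) \<otimes>\<^bsub>alg_quot A I\<^esub> (I +>\<^bsub>A\<^esub> y) = I +>\<^bsub>A\<^esub> (x \<otimes>\<^bsub>A\<^esub> y)"
    by (simp add: alg_quot_def ring.extend_def module.fields_def FactRing_def I.rcoset_mult_add)
  assume x: "x \<in> carrier A"
  have "I +>\<^bsub>A\<^esub> (c \<odot>\<^bsub>A\<^esub> y) = I +>\<^bsub>A\<^esub> (c \<odot>\<^bsub>A\<^esub> x)" if "y \<in> I +>\<^bsub>A\<^esub> x" for y
  proof -
    have y: "y \<in> carrier A" "y \<ominus>\<^bsub>A\<^esub> x \<in> I" using that x by (simp_all add: mem_coset_iff)
    then have "c \<odot>\<^bsub>A\<^esub> (y \<ominus>\<^bsub>A\<^esub> x) \<in> I" by (intro ideal_smult[OF A I])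
    then show ?thesis using x y
      by (simp add: coset_eq_iff A.minus_eq_smult A.smult_r_distr A.smult_assoc mult.commute)
  qed
  then have "(\<Union>y\<in>I +>\<^bsub>A\<^esub> x. I +>\<^bsub>A\<^esub> (c \<odot>\<^bsub>A\<^esub> y)) = I +>\<^bsub>A\<^esub> (c \<odot>\<^bsub>A\<^esub> x)"
    using I.a_rcos_self[OF x] by blast
  then show "c \<odot>\<^bsub>alg_quot A I\<^esub> (I +>\<^bsub>A\<^esub> x) = I +>\<^bsub>A\<^esub> (c \<odot>\<^bsub>A\<^esub> x)"
    by (simp add: alg_quot_def ring.extend_def module.fields_def FactRing_def)
qed

lemma calg_alg_quot: "calg (alg_quot A I)"
proof -
  have z: "zero (alg_quot A I) = I +>\<^bsub>A\<^esub> \<zero>\<^bsub>A\<^esub>"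
    using A.a_coset_add_zero[OF I.a_subset] by (simp add: alg_quot_simps)
  show ?thesis
    by (rule calg_surj[OF A, where \<pi> = "\<lambda>x. I +>\<^bsub>A\<^esub> x"]) (rule z alg_quot_simps(1,3-6); assumption?)+
qed

lemma coset_alg_hom: "(\<lambda>x. I +>\<^bsub>A\<^esub> x) \<in> alg_hom A (alg_quot A I)"
  by (intro alg_homI lin_homI) (simp_all add: alg_quot_simps)

lemma quot_lift_coset:
  assumes "\<And>x y. x \<in> carrier A \<Longrightarrow> y \<in> carrier A \<Longrightarrow> x \<ominus>\<^bsub>A\<^esub> y \<in> I \<Longrightarrow> h x = h y" "x \<in> carrier A"
  shows "the_elem (h ` (I +>\<^bsub>A\<^esub> x)) = h x"
proof -
  have "h y = h x" if "y \<in> I +>\<^bsub>A\<^esub> x" for y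
  proof -
    have "y \<in> carrier A" "y \<ominus>\<^bsub>A\<^esub> x \<in> I"
      using iffD1[OF mem_coset_iff[OF assms(2)] that] by blast+
    then show ?thesis by (intro assms(1)[OF _ assms(2)])
  qed
  then show ?thesis
    using I.a_rcos_self[OF assms(2)] by (intro the_elem_image_unique) blast+
qed

lemma quot_lift_lin:
  assumes h: "h \<in> lin_hom A C" and C: "cmod C" and k: "\<And>x. x \<in> I \<Longrightarrow> h x = \<zero>\<^bsub>C\<^esub>"
  shows "x \<in> carrier A \<Longrightarrow> the_elem (h ` (I +>\<^bsub>A\<^esub> x)) = h x"
    and "(\<lambda>X. the_elem (h ` X)) \<in> lin_hom (alg_quot A I) C"
proof -
  interpret C: cmod C by fact
  have *: "the_elem (h ` (I +>\<^bsub>A\<^esub> x)) = h x" if "x \<in> carrier A" for x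
  proof (rule quot_lift_coset[OF _ that])
    fix x y assume xy: "x \<in> carrier A" "y \<in> carrier A" "x \<ominus>\<^bsub>A\<^esub> y \<in> I"
    then have "h x \<ominus>\<^bsub>C\<^esub> h y = \<zero>\<^bsub>C\<^esub>"
      using lin_hom_minus[OF h A.cmod_axioms C xy(1,2)] k[OF xy(3)] by simp
    then show "h x = h y"
      using lin_homD(1)[OF h] xy C.minus_equality[of "h x" "\<ominus>\<^bsub>C\<^esub> h y"] by (simp add: a_minus_def)
  qed
  then show "x \<in> carrier A \<Longrightarrow> the_elem (h ` (I +>\<^bsub>A\<^esub> x)) = h x" .
  show "(\<lambda>X. the_elem (h ` X)) \<in> lin_hom (alg_quot A I) C"
    by (rule lin_homI; simp only: alg_quot_simps(1); elim imageE)
      (simp_all add: alg_quot_simps(4-6) * lin_homD[OF h])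
qed

lemma quot_lift_alg:
  assumes h: "h \<in> alg_hom A C" and C: "calg C" and k: "\<And>x. x \<in> I \<Longrightarrow> h x = \<zero>\<^bsub>C\<^esub>"
  shows "(\<lambda>X. the_elem (h ` X)) \<in> alg_hom (alg_quot A I) C"
proof -
  note * = quot_lift_lin[OF alg_hom_lin[OF h] calg.axioms(1)[OF C] k]
  show ?thesis
  proof (rule alg_homI)
    show "(\<lambda>X. the_elem (h ` X)) \<in> lin_hom (alg_quot A I) C" by (rule *(2))
  qed (simp only: alg_quot_simps(1,3), (elim imageE)?, simp add: alg_quot_simps(5) *(1) alg_homD[OF h])+
qed

end

text \<open>The kernel of \<open>h\<close> is an ideal containing \<open>G\<close>.\<close>

lemma genideal_hom_zero:
  assumes "h \<in> alg_hom A C" "calg A" "calg C" "G \<subseteq> carrier A" "\<And>x. x \<in> G \<Longrightarrow> h x = \<zero>\<^bsub>C\<^esub>"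
    "x \<in> Idl\<^bsub>A\<^esub> G"
  shows "h x = \<zero>\<^bsub>C\<^esub>"
proof -
  interpret A: calg A by fact
  interpret C: calg C by fact
  interpret h: ring_hom_ring A C h
    by (rule alg_hom_ring_hom[OF assms(1)]) unfold_locales
  have "G \<subseteq> a_kernel A C h" unfolding a_kernel_def' using assms(4,5) by blast
  then have "Idl\<^bsub>A\<^esub> G \<subseteq> a_kernel A C h" by (rule A.genideal_minimal[OF h.kernel_is_ideal])
  from subsetD[OF this assms(6)] show ?thesis unfolding a_kernel_def' by blast
qed

text \<open>The finite sums of products \<open>x r y\<close> with \<open>r\<close> in
  \<open>G\<close>. They permit an induction over the elements of a generated ideal for a property
  that is additive but not visibly stable under multiplication.\<close>

inductive_set ideal_span :: "(complex, 'a, 'm) module_scheme \<Rightarrow> 'a set \<Rightarrow> 'a set"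
  for A G where
  zero: "\<zero>\<^bsub>A\<^esub> \<in> ideal_span A G"
| gen: "x \<in> carrier A \<Longrightarrow> r \<in> G \<Longrightarrow> y \<in> carrier A \<Longrightarrow> x \<otimes>\<^bsub>A\<^esub> r \<otimes>\<^bsub>A\<^esub> y \<in> ideal_span A G"
| add: "x \<in> ideal_span A G \<Longrightarrow> y \<in> ideal_span A G \<Longrightarrow> x \<oplus>\<^bsub>A\<^esub> y \<in> ideal_span A G"

lemma genideal_subset_ideal_span:
  assumes "calg A" "G \<subseteq> carrier A" shows "Idl\<^bsub>A\<^esub> G \<subseteq> ideal_span A G"
proof -
  interpret calg A by fact
  have G: "r \<in> carrier A" if "r \<in> G" for r using that assms(2) by auto
  have c: "x \<in> carrier A" if "x \<in> ideal_span A G" for x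
    using that by induction (simp_all add: G)
  have l: "z \<otimes>\<^bsub>A\<^esub> x \<in> ideal_span A G" if "x \<in> ideal_span A G" "z \<in> carrier A" for x z
    using that(1)
  proof induction
    case (gen x r y)
    have "z \<otimes>\<^bsub>A\<^esub> (x \<otimes>\<^bsub>A\<^esub> r \<otimes>\<^bsub>A\<^esub> y) = (z \<otimes>\<^bsub>A\<^esub> x) \<otimes>\<^bsub>A\<^esub> r \<otimes>\<^bsub>A\<^esub> y"
      using gen G that(2) by (simp add: m_assoc)
    then show ?case using ideal_span.gen[of "z \<otimes>\<^bsub>A\<^esub> x" A r G y] gen that(2) by simp
  qed (use that(2) c in \<open>simp_all add: r_distr ideal_span.intros\<close>)
  have r: "x \<otimes>\<^bsub>A\<^esub> z \<in> ideal_span A G" if "x \<in> ideal_span A G" "z \<in> carrier A" for x z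
    using that(1)
  proof induction
    case (gen x r y)
    have "(x \<otimes>\<^bsub>A\<^esub> r \<otimes>\<^bsub>A\<^esub> y) \<otimes>\<^bsub>A\<^esub> z = x \<otimes>\<^bsub>A\<^esub> r \<otimes>\<^bsub>A\<^esub> (y \<otimes>\<^bsub>A\<^esub> z)"
      using gen G that(2) by (simp add: m_assoc)
    then show ?case using ideal_span.gen[of x A r G "y \<otimes>\<^bsub>A\<^esub> z"] gen that(2) by simp
  qed (use that(2) c in \<open>simp_all add: l_distr ideal_span.intros\<close>)
  have "subgroup (ideal_span A G) (add_monoid A)"
  proof (rule add.subgroupI)
    fix x assume x: "x \<in> ideal_span A G"
    have "(\<ominus>\<^bsub>A\<^esub> \<one>\<^bsub>A\<^esub>) \<otimes>\<^bsub>A\<^esub> x \<in> ideal_span A G" by (rule l[OF x]) simp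
    then show "\<ominus>\<^bsub>A\<^esub> x \<in> ideal_span A G"
      using c[OF x] by (simp add: l_minus)
  qed (use c in \<open>auto intro: ideal_span.intros\<close>)
  then have "ideal (ideal_span A G) A"
    by (intro idealI ring_axioms) (auto intro: l r)
  moreover have "G \<subseteq> ideal_span A G"
  proof
    fix r assume "r \<in> G"
    then show "r \<in> ideal_span A G" using ideal_span.gen[of "\<one>\<^bsub>A\<^esub>" A r G "\<one>\<^bsub>A\<^esub>"] G by simp
  qed
  ultimately show ?thesis by (rule genideal_minimal)
qed

section \<open>Tensor products\<close>

definition blin ::
  "(complex, 'a, 'm) module_scheme \<Rightarrow> (complex, 'b, 'n) module_scheme
    \<Rightarrow> (complex, 'c, 'k) module_scheme \<Rightarrow> ('a \<Rightarrow> 'b \<Rightarrow> 'c) \<Rightarrow> bool" where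
  "blin A B C f \<longleftrightarrow> (\<forall>a\<in>carrier A. f a \<in> lin_hom B C) \<and> (\<forall>b\<in>carrier B. (\<lambda>a. f a b) \<in> lin_hom A C)"

lemma blinI:
  "(\<And>a. a \<in> carrier A \<Longrightarrow> f a \<in> lin_hom B C) \<Longrightarrow> (\<And>b. b \<in> carrier B \<Longrightarrow> (\<lambda>a. f a b) \<in> lin_hom A C)
    \<Longrightarrow> blin A B C f"
  by (simp add: blin_def)

lemma blinD:
  assumes "blin A B C f"
  shows "a \<in> carrier A \<Longrightarrow> f a \<in> lin_hom B C" "b \<in> carrier B \<Longrightarrow> (\<lambda>a. f a b) \<in> lin_hom A C"
    "a \<in> carrier A \<Longrightarrow> b \<in> carrier B \<Longrightarrow> f a b \<in> carrier C"
  using assms lin_homD(1) by (fastforce simp: blin_def)+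

lemma blin_compose: "blin A B C f \<Longrightarrow> g \<in> lin_hom A' A \<Longrightarrow> h \<in> lin_hom B' B
  \<Longrightarrow> blin A' B' C (\<lambda>a b. f (g a) (h b))"
  by (auto simp: blin_def intro!: lin_hom_compose[of h B' B] lin_hom_compose[of g A' A]
    dest: lin_homD(1))

definition fmul ::
  "(complex, 'a, 'm) module_scheme \<Rightarrow> (complex, 'b, 'n) module_scheme
    \<Rightarrow> ('a \<times> 'b \<Rightarrow>\<^sub>0 complex) \<Rightarrow> ('a \<times> 'b \<Rightarrow>\<^sub>0 complex) \<Rightarrow> ('a \<times> 'b \<Rightarrow>\<^sub>0 complex)" where
  "fmul A B f g = (\<Sum>k\<in>Poly_Mapping.keys f. \<Sum>l\<in>Poly_Mapping.keys g.
       Poly_Mapping.single (fst k \<otimes>\<^bsub>A\<^esub> fst l, snd k \<otimes>\<^bsub>B\<^esub> snd l)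
         (Poly_Mapping.lookup f k * Poly_Mapping.lookup g l))"

lemma fmul_add_left: "fmul A B (f + f') g = fmul A B f g + fmul A B f' g"
  unfolding fmul_def
  by (rule setsum_keys_plus_distrib) (simp_all add: single_add distrib_right sum.distrib)

lemma fmul_add_right: "fmul A B f (g + g') = fmul A B f g + fmul A B f g'"
proof -
  have "(\<Sum>l\<in>Poly_Mapping.keys (g + g'). Poly_Mapping.single (fst k \<otimes>\<^bsub>A\<^esub> fst l, snd k \<otimes>\<^bsub>B\<^esub> snd l)
         (Poly_Mapping.lookup f k * Poly_Mapping.lookup (g + g') l))
    = (\<Sum>l\<in>Poly_Mapping.keys g. Poly_Mapping.single (fst k \<otimes>\<^bsub>A\<^esub> fst l, snd k \<otimes>\<^bsub>B\<^esub> snd l)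
         (Poly_Mapping.lookup f k * Poly_Mapping.lookup g l))
    + (\<Sum>l\<in>Poly_Mapping.keys g'. Poly_Mapping.single (fst k \<otimes>\<^bsub>A\<^esub> fst l, snd k \<otimes>\<^bsub>B\<^esub> snd l)
         (Poly_Mapping.lookup f k * Poly_Mapping.lookup g' l))" for k
    by (rule setsum_keys_plus_distrib) (simp_all add: single_add distrib_left)
  then show ?thesis unfolding fmul_def by (simp add: sum.distrib)
qed

lemma fmul_zero [simp]: "fmul A B 0 g = 0" "fmul A B f 0 = 0"
  by (simp_all add: fmul_def)

lemma fmul_single: "fmul A B (Poly_Mapping.single k c) (Poly_Mapping.single l d)
  = Poly_Mapping.single (fst k \<otimes>\<^bsub>A\<^esub> fst l, snd k \<otimes>\<^bsub>B\<^esub> snd l) (c * d)"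
  by (cases "c = 0"; cases "d = 0") (simp_all add: fmul_def)

lemma fmul_minus_left: "fmul A B (f - f') g = fmul A B f g - fmul A B f' g"
  using fmul_add_left[of A B "f - f'" f' g] by (simp add: algebra_simps)

lemma fmul_minus_right: "fmul A B f (g - g') = fmul A B f g - fmul A B f g'"
  using fmul_add_right[of A B f "g - g'" g'] by (simp add: algebra_simps)

lemma map_times_add: "Poly_Mapping.map ((*) c) (f + g)
  = Poly_Mapping.map ((*) c) f + Poly_Mapping.map ((*) c) g" for f :: "'k \<Rightarrow>\<^sub>0 complex"
  by (rule poly_mapping_eqI) (simp add: lookup_add distrib_left)

lemma map_times_zero [simp]: "Poly_Mapping.map ((*) c) 0 = 0" for c :: complex
  by (rule poly_mapping_eqI) simp

lemma map_times_single [simp]: "Poly_Mapping.map ((*) c) (Poly_Mapping.single k d)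
  = Poly_Mapping.single k (c * d)" for c :: complex
  by (rule poly_mapping_eqI) (simp add: lookup_single when_def)

lemma formal_alg_simps [simp]:
  "carrier (formal_alg A B) = {f. Poly_Mapping.keys f \<subseteq> carrier A \<times> carrier B}"
  "mult (formal_alg A B) = fmul A B" "zero (formal_alg A B) = 0" "add (formal_alg A B) = (+)"
  "one (formal_alg A B) = Poly_Mapping.single (\<one>\<^bsub>A\<^esub>, \<one>\<^bsub>B\<^esub>) 1"
  "smult (formal_alg A B) = (\<lambda>c. Poly_Mapping.map ((*) c))"
  by (simp_all add: formal_alg_def fmul_def fun_eq_iff)

lemma bilin_mono:
  assumes "same_alg A A'" "same_alg B B'" "f \<in> bilin A B" shows "f \<in> bilin A' B'"
  using assms(3)
proof induction
  case zero show ?case by (rule bilin.zero)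
next
  case add then show ?case by (intro bilin.add)
next
  case (add_left a a' b c)
  then show ?case using bilin.add_left[of a A' a' b B' c] assms(1,2) by (simp add: same_alg_def)
next
  case (add_right a b b' c)
  then show ?case using bilin.add_right[of a A' b B' b' c] assms(1,2) by (simp add: same_alg_def)
next
  case (smult_left a b k c)
  then show ?case using bilin.smult_left[of a A' b B' k c] assms(1,2) by (simp add: same_alg_def)
next
  case (smult_right a b k c)
  then show ?case using bilin.smult_right[of a A' b B' k c] assms(1,2) by (simp add: same_alg_def)
qed

text \<open>Only the algebra fields enter the construction, so a Hopf algebra and its underlying
  algebra have literally the same tensor square.\<close>

lemma tensor_cong:
  assumes "same_alg A A'" "same_alg B B'"
  shows "tensor A B = tensor A' B'" "pure A B = pure A' B'"
proof -
  have "formal_alg A B = formal_alg A' B'"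
    using assms by (simp add: formal_alg_def same_alg_def)
  moreover have "bilin A B = bilin A' B'"
    using bilin_mono[OF assms] bilin_mono[OF assms[THEN same_alg_sym]] by blast
  ultimately show "tensor A B = tensor A' B'" "pure A B = pure A' B'"
    by (simp_all add: tensor_def pure_def fun_eq_iff)
qed

locale tens = A: calg A + B: calg B
  for A :: "(complex, 'a, 'm) module_scheme" and B :: "(complex, 'b, 'n) module_scheme"
begin

lemma fmul_closed:
  assumes "Poly_Mapping.keys f \<subseteq> carrier A \<times> carrier B" "Poly_Mapping.keys g \<subseteq> carrier A \<times> carrier B"
  shows "Poly_Mapping.keys (fmul A B f g) \<subseteq> carrier A \<times> carrier B"
  using assms(1)
proof (induction rule: pm_induct)
  case (add k c f)
  have "Poly_Mapping.keys (fmul A B (Poly_Mapping.single k c) g) \<subseteq> carrier A \<times> carrier B"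
    using assms(2) by (induction rule: pm_induct)
      (use add in \<open>simp_all add: fmul_add_right fmul_single keys_plus_subset mem_Times_iff\<close>)
  then show ?case using add by (simp add: fmul_add_left keys_plus_subset)
qed simp

lemma fmul_assoc:
  assumes "Poly_Mapping.keys f \<subseteq> carrier A \<times> carrier B" "Poly_Mapping.keys g \<subseteq> carrier A \<times> carrier B"
    "Poly_Mapping.keys h \<subseteq> carrier A \<times> carrier B"
  shows "fmul A B (fmul A B f g) h = fmul A B f (fmul A B g h)"
  using assms(1)
proof (induction rule: pm_induct)
  case (add k c f)
  have "fmul A B (fmul A B (Poly_Mapping.single k c) g) h = fmul A B (Poly_Mapping.single k c) (fmul A B g h)"
    using assms(2)
  proof (induction rule: pm_induct)
    case (add l d g)
    have "fmul A B (fmul A B (Poly_Mapping.single k c) (Poly_Mapping.single l d)) h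
       = fmul A B (Poly_Mapping.single k c) (fmul A B (Poly_Mapping.single l d) h)"
      using assms(3)
      by (induction rule: pm_induct) (use add(1) \<open>k \<in> carrier A \<times> carrier B\<close> in
         \<open>auto simp: fmul_add_right fmul_single A.m_assoc B.m_assoc mult.assoc\<close>)
    then show ?case using add by (simp add: fmul_add_left fmul_add_right)
  qed simp
  then show ?case using add by (simp add: fmul_add_left)
qed simp

lemma fmul_one:
  assumes "Poly_Mapping.keys f \<subseteq> carrier A \<times> carrier B"
  shows "fmul A B (Poly_Mapping.single (\<one>\<^bsub>A\<^esub>, \<one>\<^bsub>B\<^esub>) 1) f = f"
    "fmul A B f (Poly_Mapping.single (\<one>\<^bsub>A\<^esub>, \<one>\<^bsub>B\<^esub>) 1) = f"
  using assms by (induction rule: pm_induct) (auto simp: fmul_add_left fmul_add_right fmul_single)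

lemma fmul_smult:
  assumes "Poly_Mapping.keys f \<subseteq> carrier A \<times> carrier B" "Poly_Mapping.keys g \<subseteq> carrier A \<times> carrier B"
  shows "fmul A B (Poly_Mapping.map ((*) c) f) g = Poly_Mapping.map ((*) c) (fmul A B f g)"
    "fmul A B f (Poly_Mapping.map ((*) c) g) = Poly_Mapping.map ((*) c) (fmul A B f g)"
proof -
  have *: "fmul A B (Poly_Mapping.map ((*) c) f) g = Poly_Mapping.map ((*) c) (fmul A B f g)
    \<and> fmul A B f (Poly_Mapping.map ((*) c) g) = Poly_Mapping.map ((*) c) (fmul A B f g)"
    using assms(1)
  proof (induction rule: pm_induct)
    case (add k d f)
    have "fmul A B (Poly_Mapping.single k (c * d)) g
        = Poly_Mapping.map ((*) c) (fmul A B (Poly_Mapping.single k d) g)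
      \<and> fmul A B (Poly_Mapping.single k d) (Poly_Mapping.map ((*) c) g)
        = Poly_Mapping.map ((*) c) (fmul A B (Poly_Mapping.single k d) g)"
      using assms(2) by (induction rule: pm_induct)
        (simp_all add: fmul_add_right fmul_single map_times_add mult.assoc mult.left_commute[of c])
    then show ?case using add by (simp add: fmul_add_left map_times_add)
  qed simp
  then show "fmul A B (Poly_Mapping.map ((*) c) f) g = Poly_Mapping.map ((*) c) (fmul A B f g)"
    "fmul A B f (Poly_Mapping.map ((*) c) g) = Poly_Mapping.map ((*) c) (fmul A B f g)" by auto
qed

lemma calg_formal: "calg (formal_alg A B)"
proof -
  have 1: "Poly_Mapping.map ((*) (- 1)) f + f = 0" "f + Poly_Mapping.map ((*) (- 1)) f = 0"
    for f :: "'a \<times> 'b \<Rightarrow>\<^sub>0 complex"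
    by (rule poly_mapping_eqI, simp add: lookup_add)+
  have 2: "Poly_Mapping.map ((*) (c + d)) f
    = Poly_Mapping.map ((*) c) f + Poly_Mapping.map ((*) d) f" for c d and f :: "'a \<times> 'b \<Rightarrow>\<^sub>0 complex"
    by (rule poly_mapping_eqI) (simp add: lookup_add distrib_right)
  have 3: "Poly_Mapping.map ((*) c) (Poly_Mapping.map ((*) d) f)
    = Poly_Mapping.map ((*) (c * d)) f" "Poly_Mapping.map ((*) 1) f = f"
    for c d and f :: "'a \<times> 'b \<Rightarrow>\<^sub>0 complex"
    by (rule poly_mapping_eqI, simp add: mult.assoc)+
  show ?thesis
    by (rule calgI) (simp_all add: fmul_closed fmul_assoc fmul_one fmul_smult fmul_add_left
        fmul_add_right map_times_add keys_plus_subset order_trans[OF keys_map_times] 1 2 3 add_ac)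
qed

sublocale F: calg "formal_alg A B" by (rule calg_formal)

lemma bilin_carrier: "f \<in> bilin A B \<Longrightarrow> Poly_Mapping.keys f \<subseteq> carrier A \<times> carrier B"
  by (induction rule: bilin.induct) (simp_all add: keys_plus_subset keys_minus_subset)

lemma bilin_uminus: "f \<in> bilin A B \<Longrightarrow> - f \<in> bilin A B"
proof (induction rule: bilin.induct)
  case (add f g)
  then show ?case using bilin.add[of "- f" A B "- g"] by simp
next
  case (add_left a a' b c)
  then show ?case using bilin.add_left[of a A a' b B "- c"] by (simp add: single_uminus algebra_simps)
next
  case (add_right a b b' c)
  then show ?case using bilin.add_right[of a A b B b' "- c"] by (simp add: single_uminus algebra_simps)
next
  case (smult_left a b k c)
  then show ?case using bilin.smult_left[of a A b B k "- c"] by (simp add: single_uminus)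
next
  case (smult_right a b k c)
  then show ?case using bilin.smult_right[of a A b B k "- c"] by (simp add: single_uminus)
qed (simp add: bilin.zero)

text \<open>Multiplying a bilinearity relation by a pair, on either side, yields a relation of the
  same kind.\<close>

lemma bilin_fmul_single:
  assumes "f \<in> bilin A B" "x \<in> carrier A" "y \<in> carrier B"
  shows "fmul A B (Poly_Mapping.single (x, y) e) f \<in> bilin A B"
    "fmul A B f (Poly_Mapping.single (x, y) e) \<in> bilin A B"
proof -
  have "fmul A B (Poly_Mapping.single (x, y) e) f \<in> bilin A B
    \<and> fmul A B f (Poly_Mapping.single (x, y) e) \<in> bilin A B"
    using assms(1)
  proof induction
    case zero
    show ?case by (simp add: bilin.zero)
  next
    case (add f g)
    then show ?case by (simp add: fmul_add_left fmul_add_right bilin.add)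
  next
    case (add_left a a' b c)
    then show ?case using assms(2,3) bilin.add_left[of "x \<otimes>\<^bsub>A\<^esub> a" A "x \<otimes>\<^bsub>A\<^esub> a'" "y \<otimes>\<^bsub>B\<^esub> b" B "e * c"]
        bilin.add_left[of "a \<otimes>\<^bsub>A\<^esub> x" A "a' \<otimes>\<^bsub>A\<^esub> x" "b \<otimes>\<^bsub>B\<^esub> y" B "c * e"]
      by (simp add: fmul_minus_left fmul_minus_right fmul_single A.l_distr A.r_distr)
  next
    case (add_right a b b' c)
    then show ?case using assms(2,3) bilin.add_right[of "x \<otimes>\<^bsub>A\<^esub> a" A "y \<otimes>\<^bsub>B\<^esub> b" B "y \<otimes>\<^bsub>B\<^esub> b'" "e * c"]
        bilin.add_right[of "a \<otimes>\<^bsub>A\<^esub> x" A "b \<otimes>\<^bsub>B\<^esub> y" B "b' \<otimes>\<^bsub>B\<^esub> y" "c * e"]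
      by (simp add: fmul_minus_left fmul_minus_right fmul_single B.l_distr B.r_distr)
  next
    case (smult_left a b k c)
    then show ?case using assms(2,3) bilin.smult_left[of "x \<otimes>\<^bsub>A\<^esub> a" A "y \<otimes>\<^bsub>B\<^esub> b" B k "e * c"]
        bilin.smult_left[of "a \<otimes>\<^bsub>A\<^esub> x" A "b \<otimes>\<^bsub>B\<^esub> y" B k "c * e"]
      by (simp add: fmul_minus_left fmul_minus_right fmul_single A.smult_mult_left A.smult_mult_right
          mult.assoc mult.left_commute)
  next
    case (smult_right a b k c)
    then show ?case using assms(2,3) bilin.smult_right[of "x \<otimes>\<^bsub>A\<^esub> a" A "y \<otimes>\<^bsub>B\<^esub> b" B k "e * c"]
        bilin.smult_right[of "a \<otimes>\<^bsub>A\<^esub> x" A "b \<otimes>\<^bsub>B\<^esub> y" B k "c * e"]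
      by (simp add: fmul_minus_left fmul_minus_right fmul_single B.smult_mult_left B.smult_mult_right
          mult.assoc mult.left_commute)
  qed
  then show "fmul A B (Poly_Mapping.single (x, y) e) f \<in> bilin A B"
    "fmul A B f (Poly_Mapping.single (x, y) e) \<in> bilin A B" by auto
qed

lemma bilin_fmul:
  assumes "f \<in> bilin A B" "Poly_Mapping.keys g \<subseteq> carrier A \<times> carrier B"
  shows "fmul A B g f \<in> bilin A B" "fmul A B f g \<in> bilin A B"
  using assms(2)
  by (induction rule: pm_induct)
    (auto simp: fmul_add_left fmul_add_right bilin.zero intro: bilin.add bilin_fmul_single assms(1))

lemma ideal_bilin: "ideal (bilin A B) (formal_alg A B)"
proof (rule idealI[OF F.ring_axioms])
  show "subgroup (bilin A B) (add_monoid (formal_alg A B))"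
  proof (rule F.add.subgroupI)
    fix f assume f: "f \<in> bilin A B"
    have "\<ominus>\<^bsub>formal_alg A B\<^esub> f = - f"
      by (rule F.minus_equality) (use bilin_carrier[OF f] bilin_carrier[OF bilin_uminus[OF f]] in simp_all)
    then show "\<ominus>\<^bsub>formal_alg A B\<^esub> f \<in> bilin A B" using bilin_uminus[OF f] by simp
  next
    show "bilin A B \<noteq> {}" using bilin.zero[of A B] by blast
  qed (use bilin_carrier bilin.add in auto)
qed (auto intro: bilin_fmul)

abbreviation T where "T \<equiv> tensor A B"

abbreviation tpure (infixl "\<Join>" 75) where "a \<Join> b \<equiv> pure A B a b"

lemmas quot = F.calg_axioms ideal_bilin

lemma calg_tensor: "calg T"
  unfolding tensor_def by (rule calg_alg_quot[OF quot])

sublocale T: calg T by (rule calg_tensor)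

lemma formal_minus: "f \<in> carrier (formal_alg A B) \<Longrightarrow> g \<in> carrier (formal_alg A B)
  \<Longrightarrow> f \<ominus>\<^bsub>formal_alg A B\<^esub> g = f - g"
  by (simp add: F.minus_eq_smult poly_mapping_eq_iff fun_eq_iff lookup_add lookup_minus)

lemma pure_closed [simp, intro]: "a \<in> carrier A \<Longrightarrow> b \<in> carrier B \<Longrightarrow> a \<Join> b \<in> carrier T"
  unfolding tensor_def pure_def by (simp add: alg_quot_simps[OF quot])

lemma pure_add_left: "a \<in> carrier A \<Longrightarrow> a' \<in> carrier A \<Longrightarrow> b \<in> carrier B
    \<Longrightarrow> (a \<oplus>\<^bsub>A\<^esub> a') \<Join> b = a \<Join> b \<oplus>\<^bsub>T\<^esub> a' \<Join> b"
  unfolding tensor_def pure_def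
  using bilin.add_left[of a A a' b B 1]
  by (simp add: alg_quot_simps[OF quot] coset_eq_iff[OF quot] formal_minus keys_plus_subset
      diff_diff_eq)

lemma pure_add_right: "a \<in> carrier A \<Longrightarrow> b \<in> carrier B \<Longrightarrow> b' \<in> carrier B
    \<Longrightarrow> a \<Join> (b \<oplus>\<^bsub>B\<^esub> b') = a \<Join> b \<oplus>\<^bsub>T\<^esub> a \<Join> b'"
  unfolding tensor_def pure_def
  using bilin.add_right[of a A b B b' 1]
  by (simp add: alg_quot_simps[OF quot] coset_eq_iff[OF quot] formal_minus keys_plus_subset
      diff_diff_eq)

lemma pure_smult_left: "a \<in> carrier A \<Longrightarrow> b \<in> carrier B \<Longrightarrow> (c \<odot>\<^bsub>A\<^esub> a) \<Join> b = c \<odot>\<^bsub>T\<^esub> (a \<Join> b)"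
  unfolding tensor_def pure_def
  using bilin.smult_left[of a A b B c 1]
  by (simp add: alg_quot_simps[OF quot] coset_eq_iff[OF quot] formal_minus)

lemma pure_smult_right: "a \<in> carrier A \<Longrightarrow> b \<in> carrier B \<Longrightarrow> a \<Join> (c \<odot>\<^bsub>B\<^esub> b) = c \<odot>\<^bsub>T\<^esub> (a \<Join> b)"
  unfolding tensor_def pure_def
  using bilin.smult_right[of a A b B c 1]
  by (simp add: alg_quot_simps[OF quot] coset_eq_iff[OF quot] formal_minus)

lemma pure_mult: "a \<in> carrier A \<Longrightarrow> a' \<in> carrier A \<Longrightarrow> b \<in> carrier B \<Longrightarrow> b' \<in> carrier B
    \<Longrightarrow> (a \<Join> b) \<otimes>\<^bsub>T\<^esub> (a' \<Join> b') = (a \<otimes>\<^bsub>A\<^esub> a') \<Join> (b \<otimes>\<^bsub>B\<^esub> b')"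
  unfolding tensor_def pure_def by (simp add: alg_quot_simps[OF quot] fmul_single)

lemma pure_one: "\<one>\<^bsub>T\<^esub> = \<one>\<^bsub>A\<^esub> \<Join> \<one>\<^bsub>B\<^esub>"
  unfolding tensor_def pure_def by (simp add: alg_quot_simps[OF quot])

lemma blin_pure: "blin A B T (\<lambda>a b. a \<Join> b)"
  by (intro blinI lin_homI)
    (simp_all add: pure_add_left pure_add_right pure_smult_left pure_smult_right)

lemma pure_zero_left [simp]: "b \<in> carrier B \<Longrightarrow> \<zero>\<^bsub>A\<^esub> \<Join> b = \<zero>\<^bsub>T\<^esub>"
  using lin_hom_zero[OF blinD(2)[OF blin_pure]] A.cmod_axioms T.cmod_axioms by blast

lemma pure_zero_right [simp]: "a \<in> carrier A \<Longrightarrow> a \<Join> \<zero>\<^bsub>B\<^esub> = \<zero>\<^bsub>T\<^esub>"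
  using lin_hom_zero[OF blinD(1)[OF blin_pure]] B.cmod_axioms T.cmod_axioms by blast

lemma tensor_coset:
  "X \<in> carrier T \<Longrightarrow> \<exists>r. Poly_Mapping.keys r \<subseteq> carrier A \<times> carrier B \<and> X = bilin A B +>\<^bsub>formal_alg A B\<^esub> r"
  unfolding tensor_def by (auto simp: alg_quot_simps[OF quot])

text \<open>Zero is the tensor of two zeros and a scalar can be moved into the left factor, so pure
  tensors and sums suffice.\<close>

lemma tensor_induct [consumes 1, case_names pure add]:
  assumes "X \<in> carrier T" "\<And>a b. a \<in> carrier A \<Longrightarrow> b \<in> carrier B \<Longrightarrow> P (a \<Join> b)"
    "\<And>X Y. X \<in> carrier T \<Longrightarrow> Y \<in> carrier T \<Longrightarrow> P X \<Longrightarrow> P Y \<Longrightarrow> P (X \<oplus>\<^bsub>T\<^esub> Y)"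
  shows "P X"
proof -
  obtain r where r: "Poly_Mapping.keys r \<subseteq> carrier A \<times> carrier B"
    "X = bilin A B +>\<^bsub>formal_alg A B\<^esub> r" using tensor_coset[OF assms(1)] by blast
  have "P (bilin A B +>\<^bsub>formal_alg A B\<^esub> r)" using r(1)
  proof (induction rule: pm_induct)
    case zero
    have "P (\<zero>\<^bsub>A\<^esub> \<Join> \<zero>\<^bsub>B\<^esub>)" by (rule assms(2)) auto
    then have "P \<zero>\<^bsub>T\<^esub>" by simp
    then show ?case
      using coset_zero_iff[OF quot, of 0] bilin.zero[of A B] unfolding tensor_def by (simp add: alg_quot_simps[OF quot])
  next
    case (add k c g)
    obtain a b where k: "k = (a, b)" "a \<in> carrier A" "b \<in> carrier B" using add by auto
    have "P ((c \<odot>\<^bsub>A\<^esub> a) \<Join> b)" using k by (intro assms(2)) auto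
    moreover have eq: "(c \<odot>\<^bsub>A\<^esub> a) \<Join> b = bilin A B +>\<^bsub>formal_alg A B\<^esub> Poly_Mapping.single k c"
      using k unfolding pure_smult_left[OF k(2,3)]
      unfolding tensor_def pure_def by (simp add: alg_quot_simps[OF quot])
    ultimately have "P ((c \<odot>\<^bsub>A\<^esub> a) \<Join> b \<oplus>\<^bsub>T\<^esub> (bilin A B +>\<^bsub>formal_alg A B\<^esub> g))"
      using add k by (intro assms(3)) (simp_all add: tensor_def alg_quot_simps[OF quot])
    then show ?case using add k unfolding eq
      by (simp add: tensor_def alg_quot_simps[OF quot])
  qed
  then show ?thesis using r by simp
qed

lemma psum_bilin_zero:
  assumes f: "blin A B C f" and C: "cmod C" and r: "r \<in> bilin A B"
  shows "psum C (\<lambda>k. f (fst k) (snd k)) r = \<zero>\<^bsub>C\<^esub>"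
proof -
  interpret C: cmod C by fact
  note fD = blinD(3)[OF f] lin_homD(2,3)[OF blinD(1)[OF f]] lin_homD(2,3)[OF blinD(2)[OF f]]
  have cl: "f (fst k) (snd k) \<in> carrier C" if "k \<in> carrier A \<times> carrier B" for k
    using that fD(1) by auto
  have cancel: "x \<in> carrier C \<Longrightarrow> x \<ominus>\<^bsub>C\<^esub> x = \<zero>\<^bsub>C\<^esub>"
    "x \<in> carrier C \<Longrightarrow> y \<in> carrier C \<Longrightarrow> x \<oplus>\<^bsub>C\<^esub> y \<ominus>\<^bsub>C\<^esub> x \<ominus>\<^bsub>C\<^esub> y = \<zero>\<^bsub>C\<^esub>" for x y
    by (simp_all add: C.minus_eq C.a_comm[of x y] C.a_assoc C.r_neg)
  note pm = C.psum_minus[OF cl] C.psum_single[of "\<lambda>k. f (fst k) (snd k)"]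
  show ?thesis using r
  proof induction
    case (add f g)
    then show ?case using bilin_carrier by (subst C.psum_add[OF cl]) auto
  qed (simp_all add: pm keys_minus_subset fD C.smult_r_distr C.smult_assoc mult.commute cancel)
qed

text \<open>The linear extension of \<open>f\<close> to formal sums kills \<open>bilin\<close> and
  is therefore constant on each coset; hence the set whose \<open>the_elem\<close> defines
  \<open>tlift\<close> is a singleton.\<close>

lemma
  assumes f: "blin A B C f" and C: "cmod C"
  shows tlift_lin_hom: "tlift C f \<in> lin_hom T C"
    and tlift_pure: "a \<in> carrier A \<Longrightarrow> b \<in> carrier B \<Longrightarrow> tlift C f (a \<Join> b) = f a b"
proof -
  interpret C: cmod C by fact
  have cl: "f (fst k) (snd k) \<in> carrier C" if "k \<in> carrier A \<times> carrier B" for k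
    using that blinD(3)[OF f] by auto
  let ?h = "psum C (\<lambda>k. f (fst k) (snd k))"
  have h: "?h \<in> lin_hom (formal_alg A B) C"
    by (rule lin_homI) (simp_all add: C.psum_add[OF cl] C.psum_smult[OF cl] C.psum_closed[OF cl])
  have e: "tlift C f = (\<lambda>X. the_elem (?h ` X))"
    by (simp add: tlift_def psum_def fun_eq_iff)
  note * = quot_lift_lin[OF quot h C psum_bilin_zero[OF f C]]
  show "tlift C f \<in> lin_hom T C" unfolding e tensor_def by (rule *(2))
  assume "a \<in> carrier A" "b \<in> carrier B"
  then show "tlift C f (a \<Join> b) = f a b"
    unfolding e pure_def using blinD(3)[OF f] by (simp add: *(1) C.psum_single)
qed

lemma alg_hom_tensorI:
  assumes h: "h \<in> lin_hom T C" and C: "calg C" and "h (\<one>\<^bsub>A\<^esub> \<Join> \<one>\<^bsub>B\<^esub>) = \<one>\<^bsub>C\<^esub>"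
    "\<And>a b a' b'. a \<in> carrier A \<Longrightarrow> b \<in> carrier B \<Longrightarrow> a' \<in> carrier A \<Longrightarrow> b' \<in> carrier B \<Longrightarrow>
      h ((a \<otimes>\<^bsub>A\<^esub> a') \<Join> (b \<otimes>\<^bsub>B\<^esub> b')) = h (a \<Join> b) \<otimes>\<^bsub>C\<^esub> h (a' \<Join> b')"
  shows "h \<in> alg_hom T C"
proof (rule alg_homI[OF h])
  interpret C: calg C by fact
  note hD = lin_homD[OF h]
  show "h (X \<otimes>\<^bsub>T\<^esub> Y) = h X \<otimes>\<^bsub>C\<^esub> h Y" if X: "X \<in> carrier T" and Y: "Y \<in> carrier T" for X Y
    using X
  proof (induction rule: tensor_induct)
    case (pure a b)
    show ?case using Y
      by (induction rule: tensor_induct)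
        (use pure in \<open>simp_all add: pure_mult assms(4) T.r_distr C.r_distr hD\<close>)
  qed (use Y in \<open>simp_all add: T.l_distr C.l_distr hD\<close>)
qed (simp add: pure_one assms(3))

end

lemma ccalg_tensor:
  assumes "ccalg A" "ccalg B" shows "ccalg (tensor A B)"
proof -
  interpret A: ccalg A by fact
  interpret B: ccalg B by fact
  interpret tens A B ..
  show ?thesis
  proof (rule ccalgI[OF calg_tensor])
    fix X Y assume X: "X \<in> carrier T" and Y: "Y \<in> carrier T"
    show "X \<otimes>\<^bsub>T\<^esub> Y = Y \<otimes>\<^bsub>T\<^esub> X" using X
    proof (induction rule: tensor_induct)
      case (pure a b)
      show ?case using Y
        by (induction rule: tensor_induct)
          (use pure in \<open>simp_all add: pure_mult A.m_comm B.m_comm T.r_distr T.l_distr\<close>)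
    qed (use Y in \<open>simp_all add: T.l_distr T.r_distr\<close>)
  qed
qed

context
  fixes A :: "(complex, 'a, 'm) module_scheme" and B :: "(complex, 'b, 'n) module_scheme"
    and A' :: "(complex, 'c, 'k) module_scheme" and B' :: "(complex, 'd, 'l) module_scheme" and f g
  assumes alg: "calg A" "calg B" "calg A'" "calg B'"
    and f: "f \<in> lin_hom A A'" and g: "g \<in> lin_hom B B'"
begin

interpretation S: tens A B using alg by (simp add: tens_def)
interpretation S': tens A' B' using alg by (simp add: tens_def)

lemma tmap_blin: "blin A B (tensor A' B') (\<lambda>a b. pure A' B' (f a) (g b))"
  by (rule blin_compose[OF S'.blin_pure f g])

lemma tmap_lin_hom: "tmap A' B' f g \<in> lin_hom (tensor A B) (tensor A' B')"
  unfolding tmap_def by (rule S.tlift_lin_hom[OF tmap_blin S'.T.cmod_axioms])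

lemma tmap_pure: "a \<in> carrier A \<Longrightarrow> b \<in> carrier B
    \<Longrightarrow> tmap A' B' f g (pure A B a b) = pure A' B' (f a) (g b)"
  unfolding tmap_def by (rule S.tlift_pure[OF tmap_blin S'.T.cmod_axioms])

lemma tmap_alg_hom:
  assumes "f \<in> alg_hom A A'" "g \<in> alg_hom B B'"
  shows "tmap A' B' f g \<in> alg_hom (tensor A B) (tensor A' B')"
  by (rule S.alg_hom_tensorI[OF tmap_lin_hom])
    (simp_all add: tmap_pure S'.T.calg_axioms S'.pure_one S'.pure_mult
      alg_homD[OF assms(1)] alg_homD[OF assms(2)])

end

section \<open>Monoid algebras and the universal property of the quantum enveloping algebra\<close>

lemma single_zero_central: "Poly_Mapping.single 0 c * x = x * Poly_Mapping.single 0 c"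
  for x :: "'k::monoid_add \<Rightarrow>\<^sub>0 complex"
proof -
  have "Poly_Mapping.keys x \<subseteq> UNIV" by simp
  then show ?thesis
    by (induction rule: pm_induct) (simp_all add: distrib_left distrib_right mult_single mult.commute)
qed

lemma calg_monoid_alg: "calg (univ_alg (Poly_Mapping.single 0) :: (complex, 'k::monoid_add \<Rightarrow>\<^sub>0 complex) module)"
  by (rule calg_univ_alg) (simp_all add: single_add mult_single single_zero_central)

text \<open>The universal property of a monoid algebra. It is applied to words, giving the free
  algebra, and to exponents, giving polynomial evaluation.\<close>

lemma monoid_alg_hom:
  fixes \<mu> :: "'k::monoid_add \<Rightarrow> 'c"
  assumes "calg C" "\<And>a. \<mu> a \<in> carrier C" "\<mu> 0 = \<one>\<^bsub>C\<^esub>" "\<And>a b. \<mu> (a + b) = \<mu> a \<otimes>\<^bsub>C\<^esub> \<mu> b"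
  shows "psum C \<mu> \<in> alg_hom (univ_alg (Poly_Mapping.single 0)) C"
proof -
  interpret calg C by fact
  have cl: "psum C \<mu> f \<in> carrier C" for f by (rule psum_closed[of UNIV]) (simp_all add: assms(2))
  have add: "psum C \<mu> (f + g) = psum C \<mu> f \<oplus>\<^bsub>C\<^esub> psum C \<mu> g" for f g
    by (rule psum_add[of UNIV]) (simp_all add: assms(2))
  have single: "psum C \<mu> (Poly_Mapping.single k c) = c \<odot>\<^bsub>C\<^esub> \<mu> k" for k c
    by (rule psum_single) (simp add: assms(2))
  show ?thesis
  proof (intro alg_homI lin_homI)
    fix c f
    show "psum C \<mu> (c \<odot>\<^bsub>univ_alg (Poly_Mapping.single 0)\<^esub> f) = c \<odot>\<^bsub>C\<^esub> psum C \<mu> f"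
      using psum_smult[of UNIV \<mu> f c] assms(2) by (simp flip: mult_map_scale_conv_mult)
  next
    fix f g :: "'k \<Rightarrow>\<^sub>0 complex"
    have "Poly_Mapping.keys f \<subseteq> UNIV" by simp
    then have "psum C \<mu> (f * g) = psum C \<mu> f \<otimes>\<^bsub>C\<^esub> psum C \<mu> g"
    proof (induction rule: pm_induct)
      case (add k c f)
      have "Poly_Mapping.keys g \<subseteq> UNIV" by simp
      then have "psum C \<mu> (Poly_Mapping.single k c * g) = psum C \<mu> (Poly_Mapping.single k c) \<otimes>\<^bsub>C\<^esub> psum C \<mu> g"
        by (induction rule: pm_induct) (simp_all add: distrib_left mult_single \<open>\<And>f g. psum C \<mu> (f + g) = _\<close>
            single cl assms(2,4) r_distr smult_mult_left smult_mult_right smult_assoc mult.commute)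
      then show ?case using add by (simp add: distrib_right \<open>\<And>f g. psum C \<mu> (f + g) = _\<close> l_distr cl)
    qed (simp add: cl)
    then show "psum C \<mu> (f \<otimes>\<^bsub>univ_alg (Poly_Mapping.single 0)\<^esub> g) = psum C \<mu> f \<otimes>\<^bsub>C\<^esub> psum C \<mu> g"
      by simp
  next
    show "psum C \<mu> \<one>\<^bsub>univ_alg (Poly_Mapping.single 0)\<^esub> = \<one>\<^bsub>C\<^esub>"
      using single[of 0 1] assms(3) by simp
  qed (simp_all add: cl add)
qed

lemma free_alg_eq: "free_alg = univ_alg (Poly_Mapping.single 0)"
  by (simp add: free_alg_def free_scalar_def[abs_def] zero_list_def)

lemma calg_free: "calg free_alg"
  unfolding free_alg_eq by (rule calg_monoid_alg)

lemma free_alg_simps [simp]: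
  "carrier free_alg = UNIV" "mult free_alg = (*)" "one free_alg = 1" "zero free_alg = 0"
  "add free_alg = (+)" "smult free_alg = (\<lambda>c x. free_scalar c * x)"
  by (simp_all add: free_alg_def)

primrec wprod :: "(complex, 'a, 'm) module_scheme \<Rightarrow> (uq_gen \<Rightarrow> 'a) \<Rightarrow> uq_gen list \<Rightarrow> 'a" where
  "wprod A \<gamma> [] = \<one>\<^bsub>A\<^esub>"
| "wprod A \<gamma> (g # w) = \<gamma> g \<otimes>\<^bsub>A\<^esub> wprod A \<gamma> w"

lemma (in calg) wprod_closed: "(\<And>g. \<gamma> g \<in> carrier A) \<Longrightarrow> wprod A \<gamma> w \<in> carrier A"
  by (induction w) auto

lemma (in calg) wprod_append: "(\<And>g. \<gamma> g \<in> carrier A) \<Longrightarrow> wprod A \<gamma> (u @ v) = wprod A \<gamma> u \<otimes> wprod A \<gamma> v"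
  by (induction u) (simp_all add: wprod_closed m_assoc)

lemma alg_hom_wprod:
  assumes "h \<in> alg_hom A B" "calg A" "\<And>g. \<gamma> g \<in> carrier A"
  shows "h (wprod A \<gamma> w) = wprod B (\<lambda>g. h (\<gamma> g)) w"
proof -
  interpret calg A by fact
  show ?thesis
    by (induction w) (simp_all add: alg_homD[OF assms(1)] assms(3) wprod_closed)
qed

text \<open>The relation between \<open>E\<close> and \<open>F\<close> is written with sums and
  scalars only, so that every relation is carried through a morphism term by term.\<close>

locale qalg = calg H for H :: "(complex, 'a, 'm) module_scheme" (structure) +
  fixes \<gamma> :: "uq_gen \<Rightarrow> 'a" and q :: complex
  assumes gen_closed [simp, intro]: "\<gamma> g \<in> carrier H"
    and K_Kinv: "\<gamma> Gen_K \<otimes> \<gamma> Gen_Kinv = \<one>" and Kinv_K: "\<gamma> Gen_Kinv \<otimes> \<gamma> Gen_K = \<one>"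
    and K_E: "\<gamma> Gen_K \<otimes> \<gamma> Gen_E = q ^ 2 \<odot> (\<gamma> Gen_E \<otimes> \<gamma> Gen_K)"
    and K_F: "\<gamma> Gen_K \<otimes> \<gamma> Gen_F = inverse (q ^ 2) \<odot> (\<gamma> Gen_F \<otimes> \<gamma> Gen_K)"
    and E_F: "\<gamma> Gen_E \<otimes> \<gamma> Gen_F = \<gamma> Gen_F \<otimes> \<gamma> Gen_E
      \<oplus> ((1 / (q - inverse q)) \<odot> \<gamma> Gen_K \<oplus> (- (1 / (q - inverse q))) \<odot> \<gamma> Gen_Kinv)"

lemma qalg_hom:
  assumes "h \<in> alg_hom A B" "qalg A \<gamma> q" "calg B"
  shows "qalg B (\<lambda>g. h (\<gamma> g)) q"
proof -
  interpret A: qalg A \<gamma> q by fact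
  interpret B: calg B by fact
  note hD = alg_homD[OF assms(1)]
  show ?thesis
  proof
    show "h (\<gamma> Gen_K) \<otimes>\<^bsub>B\<^esub> h (\<gamma> Gen_Kinv) = \<one>\<^bsub>B\<^esub>" using arg_cong[OF A.K_Kinv, of h] by (simp add: hD)
    show "h (\<gamma> Gen_Kinv) \<otimes>\<^bsub>B\<^esub> h (\<gamma> Gen_K) = \<one>\<^bsub>B\<^esub>" using arg_cong[OF A.Kinv_K, of h] by (simp add: hD)
    show "h (\<gamma> Gen_K) \<otimes>\<^bsub>B\<^esub> h (\<gamma> Gen_E) = q\<^sup>2 \<odot>\<^bsub>B\<^esub> (h (\<gamma> Gen_E) \<otimes>\<^bsub>B\<^esub> h (\<gamma> Gen_K))"
      using arg_cong[OF A.K_E, of h] by (simp add: hD)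
    show "h (\<gamma> Gen_K) \<otimes>\<^bsub>B\<^esub> h (\<gamma> Gen_F) = inverse (q\<^sup>2) \<odot>\<^bsub>B\<^esub> (h (\<gamma> Gen_F) \<otimes>\<^bsub>B\<^esub> h (\<gamma> Gen_K))"
      using arg_cong[OF A.K_F, of h] by (simp add: hD)
    show "h (\<gamma> Gen_E) \<otimes>\<^bsub>B\<^esub> h (\<gamma> Gen_F) = h (\<gamma> Gen_F) \<otimes>\<^bsub>B\<^esub> h (\<gamma> Gen_E) \<oplus>\<^bsub>B\<^esub>
      ((1 / (q - inverse q)) \<odot>\<^bsub>B\<^esub> h (\<gamma> Gen_K) \<oplus>\<^bsub>B\<^esub> - (1 / (q - inverse q)) \<odot>\<^bsub>B\<^esub> h (\<gamma> Gen_Kinv))"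
      using arg_cong[OF A.E_F, of h] by (simp add: hD)
  qed (simp add: hD)
qed

lemma qalg_cong: "same_alg A B \<Longrightarrow> qalg A \<gamma> q \<Longrightarrow> qalg B \<gamma> q"
  using calg_cong[of A B] by (simp add: qalg_def qalg_axioms_def same_alg_def)

lemma Uq_ideal_ideal: "ideal (Uq_ideal q) free_alg"
  unfolding Uq_ideal_def Let_def by (rule ring.genideal_ideal) (use calg_free in \<open>auto simp: calg_def\<close>)

lemmas Uq_quot = calg_free Uq_ideal_ideal

lemma free_minus: "x \<ominus>\<^bsub>free_alg\<^esub> y = x - y"
proof -
  interpret calg free_alg by (rule calg_free)
  have "\<ominus>\<^bsub>free_alg\<^esub> y = - y" by (rule minus_equality) simp_all
  then show ?thesis by (simp add: a_minus_def)
qed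

lemma qalg_Uq_alg: "qalg (Uq_alg q) (Uq_gen q) q"
proof -
  interpret F: calg free_alg by (rule calg_free)
  note s = alg_quot_simps[OF Uq_quot, folded Uq_alg_def]
  have self: "x \<in> Uq_ideal q" if "x \<in> {free_gen Gen_K * free_gen Gen_Kinv - 1,
       free_gen Gen_Kinv * free_gen Gen_K - 1,
       free_gen Gen_K * free_gen Gen_E - free_scalar (q ^ 2) * free_gen Gen_E * free_gen Gen_K,
       free_gen Gen_K * free_gen Gen_F - free_scalar (inverse (q ^ 2)) * free_gen Gen_F * free_gen Gen_K,
       free_gen Gen_E * free_gen Gen_F - free_gen Gen_F * free_gen Gen_E
         - free_scalar (1 / (q - inverse q)) * (free_gen Gen_K - free_gen Gen_Kinv)}" for x
    unfolding Uq_ideal_def Let_def by (rule subsetD[OF F.genideal_self that]) simp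
  have neg: "free_scalar (- c) = - free_scalar c" for c
    by (simp add: free_scalar_def single_uminus)
  interpret Q: calg "Uq_alg q" unfolding Uq_alg_def by (rule calg_alg_quot[OF Uq_quot])
  let ?E = "free_gen Gen_E" and ?F = "free_gen Gen_F" and ?K = "free_gen Gen_K" and ?L = "free_gen Gen_Kinv"
  let ?c = "1 / (q - inverse q)"
  have "?E * ?F - ?F * ?E - free_scalar ?c * (?K - ?L) \<in> Uq_ideal q" by (rule self) simp
  also have "?E * ?F - ?F * ?E - free_scalar ?c * (?K - ?L)
    = ?E * ?F - (?F * ?E + (free_scalar ?c * ?K + free_scalar (- ?c) * ?L))"
    unfolding neg by (simp add: right_diff_distrib)
  finally have EF: "?E * ?F - (?F * ?E + (free_scalar ?c * ?K + free_scalar (- ?c) * ?L)) \<in> Uq_ideal q" .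
  have rest: "?K * ?L - 1 \<in> Uq_ideal q" "?L * ?K - 1 \<in> Uq_ideal q"
    "?K * ?E - free_scalar (q ^ 2) * (?E * ?K) \<in> Uq_ideal q"
    "?K * ?F - free_scalar (inverse (q ^ 2)) * (?F * ?K) \<in> Uq_ideal q"
    by (rule self, simp add: mult.assoc)+
  have eq: "x - y \<in> Uq_ideal q \<Longrightarrow> Uq_ideal q +>\<^bsub>free_alg\<^esub> x = Uq_ideal q +>\<^bsub>free_alg\<^esub> y" for x y
    using coset_eq_iff[OF Uq_quot, of x y] by (simp add: free_minus)
  note s' = s[simplified]
  show ?thesis
  proof
    show "Uq_gen q g \<in> carrier (Uq_alg q)" for g unfolding Uq_gen_def s' by blast
  qed (unfold Uq_gen_def s', (rule eq, rule EF rest)+)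
qed

lemma free_gen_generate: "x \<in> subalg_gen free_alg (range free_gen)"
proof -
  have w: "Poly_Mapping.single w 1 \<in> subalg_gen free_alg (range free_gen)" for w
  proof (induction w)
    case Nil
    show ?case using subalg_gen.one[of free_alg "range free_gen"]
      by (simp add: zero_list_def flip: single_one)
  next
    case (Cons g w)
    have "Poly_Mapping.single (g # w) (1::complex) = free_gen g * Poly_Mapping.single w 1"
      by (simp add: free_gen_def mult_single plus_list_def)
    then show ?case using subalg_gen.mult[OF subalg_gen.incl[of "free_gen g"] Cons] by simp
  qed
  have "Poly_Mapping.keys x \<subseteq> UNIV" by simp
  then show ?thesis
  proof (induction rule: pm_induct)
    case zero
    show ?case using subalg_gen.smult[OF w, of 0] by (simp add: free_scalar_def)
  next
    case (add k c g)
    have "Poly_Mapping.single k c = free_scalar c * Poly_Mapping.single k 1"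
      by (simp add: free_scalar_def mult_single flip: zero_list_def)
    then have "Poly_Mapping.single k c \<in> subalg_gen free_alg (range free_gen)"
      using subalg_gen.smult[OF w, of c k] by simp
    then show ?case using subalg_gen.add[OF _ add(3)] by fastforce
  qed
qed

lemma subalg_gen_hom:
  assumes "h \<in> alg_hom A B" "calg A" "G \<subseteq> carrier A" "x \<in> subalg_gen A G"
  shows "h x \<in> subalg_gen B (h ` G)"
proof -
  have sub: "y \<in> carrier A" if "y \<in> subalg_gen A G" for y
    using that subalg_gen_subset[OF assms(2,3)] by blast
  show ?thesis using assms(4)
    by induction (simp_all add: alg_homD[OF assms(1)] sub subalg_gen.intros)
qed

lemma Uq_gen_generate: "carrier (Uq_alg q) \<subseteq> subalg_gen (Uq_alg q) (range (Uq_gen q))"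
  using subalg_gen_hom[OF coset_alg_hom[OF Uq_quot] calg_free _ free_gen_generate]
  by (auto simp: Uq_alg_def alg_quot_simps[OF Uq_quot] Uq_gen_def[abs_def] image_image)

text \<open>A family satisfying the relations extends along words to the free algebra, and the
  relations say that the generators of \<open>Uq_ideal\<close> are killed.\<close>

lemma Uq_universal:
  assumes "qalg C \<gamma> q"
  obtains h where "h \<in> alg_hom (Uq_alg q) C" "\<And>g. h (Uq_gen q g) = \<gamma> g"
proof -
  interpret C: qalg C \<gamma> q by fact
  define h where "h = psum C (wprod C \<gamma>)"
  have h: "h \<in> alg_hom free_alg C"
    unfolding h_def free_alg_eq
    by (rule monoid_alg_hom) (simp_all add: C.calg_axioms C.wprod_closed zero_list_def plus_list_def C.wprod_append)
  note hD = alg_homD[OF h, simplified]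
  have gen: "h (free_gen g) = \<gamma> g" for g
    unfolding h_def free_gen_def by (subst C.psum_single) simp_all
  have minus: "h (x - y) = h x \<ominus>\<^bsub>C\<^esub> h y" for x y
    using alg_hom_minus[OF h calg_free C.calg_axioms, of x y] by (simp add: free_minus)
  have sc: "h (free_scalar c) = c \<odot>\<^bsub>C\<^esub> \<one>\<^bsub>C\<^esub>" for c
    using hD(3)[of c 1] by (simp add: hD)
  have k: "h x = \<zero>\<^bsub>C\<^esub>" if "x \<in> Uq_ideal q" for x
  proof (rule genideal_hom_zero[OF h calg_free C.calg_axioms _ _ that[unfolded Uq_ideal_def Let_def]])
    have z: "x \<in> carrier C \<Longrightarrow> x \<ominus>\<^bsub>C\<^esub> x = \<zero>\<^bsub>C\<^esub>" for x by (simp add: C.minus_eq C.r_neg)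
    have z2: "x \<in> carrier C \<Longrightarrow> y \<in> carrier C \<Longrightarrow> x \<oplus>\<^bsub>C\<^esub> y \<ominus>\<^bsub>C\<^esub> x \<ominus>\<^bsub>C\<^esub> y = \<zero>\<^bsub>C\<^esub>" for x y
      by (simp add: C.minus_eq C.a_comm[of x y] C.a_assoc C.r_neg)
    have z3: "x \<oplus>\<^bsub>C\<^esub> (c \<odot>\<^bsub>C\<^esub> y \<oplus>\<^bsub>C\<^esub> - c \<odot>\<^bsub>C\<^esub> z) \<oplus>\<^bsub>C\<^esub> - 1 \<odot>\<^bsub>C\<^esub> x \<oplus>\<^bsub>C\<^esub> (- c \<odot>\<^bsub>C\<^esub> y \<oplus>\<^bsub>C\<^esub> c \<odot>\<^bsub>C\<^esub> z) = \<zero>\<^bsub>C\<^esub>"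
      if "x \<in> carrier C" "y \<in> carrier C" "z \<in> carrier C" for x y z c
    proof -
      have "x \<oplus>\<^bsub>C\<^esub> (c \<odot>\<^bsub>C\<^esub> y \<oplus>\<^bsub>C\<^esub> - c \<odot>\<^bsub>C\<^esub> z) \<oplus>\<^bsub>C\<^esub> - 1 \<odot>\<^bsub>C\<^esub> x \<oplus>\<^bsub>C\<^esub> (- c \<odot>\<^bsub>C\<^esub> y \<oplus>\<^bsub>C\<^esub> c \<odot>\<^bsub>C\<^esub> z)
        = (1 \<odot>\<^bsub>C\<^esub> x \<oplus>\<^bsub>C\<^esub> - 1 \<odot>\<^bsub>C\<^esub> x) \<oplus>\<^bsub>C\<^esub> ((c \<odot>\<^bsub>C\<^esub> y \<oplus>\<^bsub>C\<^esub> - c \<odot>\<^bsub>C\<^esub> y) \<oplus>\<^bsub>C\<^esub> (- c \<odot>\<^bsub>C\<^esub> z \<oplus>\<^bsub>C\<^esub> c \<odot>\<^bsub>C\<^esub> z))"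
        using that by (simp add: C.a_ac)
      also have "\<dots> = \<zero>\<^bsub>C\<^esub>" using that by (simp flip: C.smult_l_distr del: C.smult_one)
      finally show ?thesis .
    qed
    fix x
    assume "x \<in> {free_gen Gen_K * free_gen Gen_Kinv - 1,
       free_gen Gen_Kinv * free_gen Gen_K - 1,
       free_gen Gen_K * free_gen Gen_E - free_scalar (q ^ 2) * free_gen Gen_E * free_gen Gen_K,
       free_gen Gen_K * free_gen Gen_F - free_scalar (inverse (q ^ 2)) * free_gen Gen_F * free_gen Gen_K,
       free_gen Gen_E * free_gen Gen_F - free_gen Gen_F * free_gen Gen_E
         - free_scalar (1 / (q - inverse q)) * (free_gen Gen_K - free_gen Gen_Kinv)}"
    then show "h x = \<zero>\<^bsub>C\<^esub>"
      by (auto simp: minus sc hD gen C.smult_mult_left C.smult_mult_right C.K_Kinv C.Kinv_K C.K_E C.K_F C.E_F z C.minus_eq_smult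
          C.smult_r_distr C.smult_assoc C.r_neg z2[simplified C.minus_eq_smult] z3
          simp del: C.add.m_assoc)
  qed simp
  show thesis
  proof (rule that)
    show "(\<lambda>X. the_elem (h ` X)) \<in> alg_hom (Uq_alg q) C"
      unfolding Uq_alg_def by (rule quot_lift_alg[OF Uq_quot h C.calg_axioms k])
    fix g
    show "the_elem (h ` Uq_gen q g) = \<gamma> g"
      unfolding Uq_gen_def
      by (subst quot_lift_lin(1)[OF Uq_quot alg_hom_lin[OF h] C.cmod_axioms k]) (simp_all add: gen)
  qed
qed

section \<open>Coproducts of words\<close>

text \<open>The coproducts prescribed on the generators, for any algebra with four marked elements
  in place of \<open>U_q\<close>.\<close>

definition gcom :: "(complex, 'a, 'm) module_scheme \<Rightarrow> (uq_gen \<Rightarrow> 'a) \<Rightarrow> uq_gen \<Rightarrow> ('a \<times> 'a \<Rightarrow>\<^sub>0 complex) set" where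
  "gcom H \<gamma> g = (case g of
      Gen_E \<Rightarrow> pure H H \<one>\<^bsub>H\<^esub> (\<gamma> Gen_E) \<oplus>\<^bsub>tensor H H\<^esub> pure H H (\<gamma> Gen_E) (\<gamma> Gen_K)
    | Gen_F \<Rightarrow> pure H H (\<gamma> Gen_Kinv) (\<gamma> Gen_F) \<oplus>\<^bsub>tensor H H\<^esub> pure H H (\<gamma> Gen_F) \<one>\<^bsub>H\<^esub>
    | Gen_K \<Rightarrow> pure H H (\<gamma> Gen_K) (\<gamma> Gen_K)
    | Gen_Kinv \<Rightarrow> pure H H (\<gamma> Gen_Kinv) (\<gamma> Gen_Kinv))"

lemma gcom_simps [simp]:
  "gcom H \<gamma> Gen_E = pure H H \<one>\<^bsub>H\<^esub> (\<gamma> Gen_E) \<oplus>\<^bsub>tensor H H\<^esub> pure H H (\<gamma> Gen_E) (\<gamma> Gen_K)"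
  "gcom H \<gamma> Gen_F = pure H H (\<gamma> Gen_Kinv) (\<gamma> Gen_F) \<oplus>\<^bsub>tensor H H\<^esub> pure H H (\<gamma> Gen_F) \<one>\<^bsub>H\<^esub>"
  "gcom H \<gamma> Gen_K = pure H H (\<gamma> Gen_K) (\<gamma> Gen_K)"
  "gcom H \<gamma> Gen_Kinv = pure H H (\<gamma> Gen_Kinv) (\<gamma> Gen_Kinv)"
  by (simp_all add: gcom_def)

context qalg
begin

lemma Kinv_E:
  assumes "q \<noteq> 0"
  shows "\<gamma> Gen_Kinv \<otimes> \<gamma> Gen_E = inverse (q ^ 2) \<odot> (\<gamma> Gen_E \<otimes> \<gamma> Gen_Kinv)"
proof -
  have "\<gamma> Gen_Kinv \<otimes> (\<gamma> Gen_K \<otimes> \<gamma> Gen_E) \<otimes> \<gamma> Gen_Kinv = \<gamma> Gen_E \<otimes> \<gamma> Gen_Kinv"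
    by (simp flip: m_assoc add: Kinv_K)
  moreover have "\<gamma> Gen_Kinv \<otimes> (\<gamma> Gen_K \<otimes> \<gamma> Gen_E) \<otimes> \<gamma> Gen_Kinv = q ^ 2 \<odot> (\<gamma> Gen_Kinv \<otimes> \<gamma> Gen_E)"
    by (simp add: K_E smult_mult_left smult_mult_right m_assoc K_Kinv)
  ultimately have "inverse (q ^ 2) \<odot> (q ^ 2 \<odot> (\<gamma> Gen_Kinv \<otimes> \<gamma> Gen_E)) = inverse (q ^ 2) \<odot> (\<gamma> Gen_E \<otimes> \<gamma> Gen_Kinv)"
    by simp
  then show ?thesis using assms by (simp add: smult_assoc del: smult_one) simp
qed

interpretation HH: tens H H ..

abbreviation (input) hpure (infixl "\<Join>" 75) where "a \<Join> b \<equiv> pure H H a b"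
abbreviation (input) "T2 \<equiv> tensor H H"

lemma gcom_closed: "gcom H \<gamma> g \<in> carrier (tensor H H)"
  by (cases g) simp_all

text \<open>By the universal property of \<open>U_q\<close> this produces its coproduct. Only the
  relation between \<open>E\<close> and \<open>F\<close> needs thought: the mixed terms agree in
  both orders, and the corrections from the two commutators partly cancel.\<close>

lemma qalg_tensor:
  assumes q: "q \<noteq> 0"
  shows "qalg (tensor H H) (gcom H \<gamma>) q"
proof
  define c where "c = 1 / (q - inverse q)"
  let ?E = "\<gamma> Gen_E" and ?F = "\<gamma> Gen_F" and ?K = "\<gamma> Gen_K" and ?L = "\<gamma> Gen_Kinv"
  show "gcom H \<gamma> g \<in> carrier T2" for g by (rule gcom_closed)
  show "gcom H \<gamma> Gen_K \<otimes>\<^bsub>T2\<^esub> gcom H \<gamma> Gen_Kinv = \<one>\<^bsub>T2\<^esub>" "gcom H \<gamma> Gen_Kinv \<otimes>\<^bsub>T2\<^esub> gcom H \<gamma> Gen_K = \<one>\<^bsub>T2\<^esub>"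
    by (simp_all add: HH.pure_mult K_Kinv Kinv_K HH.pure_one)
  show "gcom H \<gamma> Gen_K \<otimes>\<^bsub>T2\<^esub> gcom H \<gamma> Gen_E = q ^ 2 \<odot>\<^bsub>T2\<^esub> (gcom H \<gamma> Gen_E \<otimes>\<^bsub>T2\<^esub> gcom H \<gamma> Gen_K)"
    by (simp add: HH.T.l_distr HH.T.r_distr HH.pure_mult K_E HH.T.smult_r_distr HH.pure_smult_left HH.pure_smult_right)
  show "gcom H \<gamma> Gen_K \<otimes>\<^bsub>T2\<^esub> gcom H \<gamma> Gen_F = inverse (q ^ 2) \<odot>\<^bsub>T2\<^esub> (gcom H \<gamma> Gen_F \<otimes>\<^bsub>T2\<^esub> gcom H \<gamma> Gen_K)"
    by (simp add: HH.T.l_distr HH.T.r_distr HH.pure_mult K_F HH.T.smult_r_distr HH.pure_smult_left HH.pure_smult_right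
        K_Kinv Kinv_K)
  have FE: "gcom H \<gamma> Gen_F \<otimes>\<^bsub>T2\<^esub> gcom H \<gamma> Gen_E
    = ?L \<Join> (?F \<otimes> ?E) \<oplus>\<^bsub>T2\<^esub> ((?L \<otimes> ?E) \<Join> (?F \<otimes> ?K) \<oplus>\<^bsub>T2\<^esub> (?F \<Join> ?E \<oplus>\<^bsub>T2\<^esub> (?F \<otimes> ?E) \<Join> ?K))"
    by (simp add: HH.T.l_distr HH.T.r_distr HH.pure_mult HH.T.a_ac)
  \<comment> \<open>Both sides carry one factor \<open>q^{-2}\<close>: on the left from
    \<open>KF\<close>, on the right from \<open>K^{-1}E\<close>.\<close>
  have mid: "(?E \<otimes> ?L) \<Join> (?K \<otimes> ?F) = (?L \<otimes> ?E) \<Join> (?F \<otimes> ?K)"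
    by (simp add: K_F Kinv_E[OF q] HH.pure_smult_left HH.pure_smult_right)
  have "gcom H \<gamma> Gen_E \<otimes>\<^bsub>T2\<^esub> gcom H \<gamma> Gen_F
    = ?L \<Join> (?E \<otimes> ?F) \<oplus>\<^bsub>T2\<^esub> ((?L \<otimes> ?E) \<Join> (?F \<otimes> ?K) \<oplus>\<^bsub>T2\<^esub> (?F \<Join> ?E \<oplus>\<^bsub>T2\<^esub> (?E \<otimes> ?F) \<Join> ?K))"
    by (simp add: HH.T.l_distr HH.T.r_distr HH.pure_mult mid HH.T.a_ac)
  also have "\<dots> = (?L \<Join> (?F \<otimes> ?E) \<oplus>\<^bsub>T2\<^esub> ((?L \<otimes> ?E) \<Join> (?F \<otimes> ?K) \<oplus>\<^bsub>T2\<^esub> (?F \<Join> ?E \<oplus>\<^bsub>T2\<^esub> (?F \<otimes> ?E) \<Join> ?K)))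
     \<oplus>\<^bsub>T2\<^esub> (c \<odot>\<^bsub>T2\<^esub> (?K \<Join> ?K) \<oplus>\<^bsub>T2\<^esub> ((- c) \<odot>\<^bsub>T2\<^esub> (?L \<Join> ?L) \<oplus>\<^bsub>T2\<^esub> (c \<odot>\<^bsub>T2\<^esub> (?L \<Join> ?K) \<oplus>\<^bsub>T2\<^esub> (- c) \<odot>\<^bsub>T2\<^esub> (?L \<Join> ?K))))"
    by (simp add: E_F flip: c_def)
      (simp add: HH.pure_add_left HH.pure_add_right HH.pure_smult_left HH.pure_smult_right HH.T.a_ac)
  \<comment> \<open>The commutator in the right tensor factor contributes \<open>c\<close> times
    this tensor, the one in the left factor \<open>-c\<close> times it.\<close>
  also have "c \<odot>\<^bsub>T2\<^esub> (?L \<Join> ?K) \<oplus>\<^bsub>T2\<^esub> (- c) \<odot>\<^bsub>T2\<^esub> (?L \<Join> ?K) = \<zero>\<^bsub>T2\<^esub>"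
    by (simp flip: HH.T.smult_l_distr)
  finally show "gcom H \<gamma> Gen_E \<otimes>\<^bsub>T2\<^esub> gcom H \<gamma> Gen_F = gcom H \<gamma> Gen_F \<otimes>\<^bsub>T2\<^esub> gcom H \<gamma> Gen_E
    \<oplus>\<^bsub>T2\<^esub> ((1 / (q - inverse q)) \<odot>\<^bsub>T2\<^esub> gcom H \<gamma> Gen_K \<oplus>\<^bsub>T2\<^esub> (- (1 / (q - inverse q))) \<odot>\<^bsub>T2\<^esub> gcom H \<gamma> Gen_Kinv)"
    unfolding FE by (simp flip: c_def)
qed

end

text \<open>Up to parity, \<open>t_w\<close> is homogeneous of degree \<open>rdeg w\<close> and \<open>t_w^{-1}\<close> of degree \<open>ldeg w\<close>;
  \<open>edeg\<close> bounds the level in the coradical filtration. \<open>splits w u v\<close> collects the invariants of the terms \<open>u \<otimes> v\<close>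
  in the coproduct of the word \<open>w\<close>, and \<open>wsum A w f\<close> is the sum of \<open>f u v\<close> over these terms,
  obtained by expanding the coproduct letter by letter.\<close>

definition edeg :: "uq_gen list \<Rightarrow> nat" where
  "edeg w = length (filter (\<lambda>g. g = Gen_E \<or> g = Gen_F) w)"
definition ldeg :: "uq_gen list \<Rightarrow> nat" where "ldeg w = length (filter (\<lambda>g. g \<noteq> Gen_E) w)"
definition rdeg :: "uq_gen list \<Rightarrow> nat" where "rdeg w = length (filter (\<lambda>g. g \<noteq> Gen_F) w)"

lemma deg_simps [simp]:
  "edeg [] = 0" "edeg (Gen_E # w) = Suc (edeg w)" "edeg (Gen_F # w) = Suc (edeg w)"
  "edeg (Gen_K # w) = edeg w" "edeg (Gen_Kinv # w) = edeg w" "edeg (u @ v) = edeg u + edeg v"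
  "ldeg [] = 0" "ldeg (Gen_E # w) = ldeg w" "ldeg (Gen_F # w) = Suc (ldeg w)"
  "ldeg (Gen_K # w) = Suc (ldeg w)" "ldeg (Gen_Kinv # w) = Suc (ldeg w)" "ldeg (u @ v) = ldeg u + ldeg v"
  "rdeg [] = 0" "rdeg (Gen_E # w) = Suc (rdeg w)" "rdeg (Gen_F # w) = rdeg w"
  "rdeg (Gen_K # w) = Suc (rdeg w)" "rdeg (Gen_Kinv # w) = Suc (rdeg w)" "rdeg (u @ v) = rdeg u + rdeg v"
  by (simp_all add: edeg_def ldeg_def rdeg_def)

definition splits :: "uq_gen list \<Rightarrow> uq_gen list \<Rightarrow> uq_gen list \<Rightarrow> bool" where
  "splits w u v \<longleftrightarrow> even (ldeg u + ldeg w) \<and> even (rdeg v + rdeg w) \<and> even (rdeg u + ldeg v)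
    \<and> edeg u + edeg v = edeg w"

primrec wsum :: "(complex, 'a, 'm) module_scheme \<Rightarrow> uq_gen list \<Rightarrow> (uq_gen list \<Rightarrow> uq_gen list \<Rightarrow> 'a) \<Rightarrow> 'a" where
  "wsum A [] = (\<lambda>f. f [] [])"
| "wsum A (g # w) = (\<lambda>f. case g of
      Gen_E \<Rightarrow> wsum A w (\<lambda>u v. f u (Gen_E # v)) \<oplus>\<^bsub>A\<^esub> wsum A w (\<lambda>u v. f (Gen_E # u) (Gen_K # v))
    | Gen_F \<Rightarrow> wsum A w (\<lambda>u v. f (Gen_Kinv # u) (Gen_F # v)) \<oplus>\<^bsub>A\<^esub> wsum A w (\<lambda>u v. f (Gen_F # u) v)
    | Gen_K \<Rightarrow> wsum A w (\<lambda>u v. f (Gen_K # u) (Gen_K # v))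
    | Gen_Kinv \<Rightarrow> wsum A w (\<lambda>u v. f (Gen_Kinv # u) (Gen_Kinv # v)))"

text \<open>Only pairs satisfying \<open>splits\<close> occur in the sum, so a property of the terms
  may be proved with all parity and degree information at hand.\<close>

lemma wsum_induct:
  assumes "\<And>x y. P x \<Longrightarrow> P y \<Longrightarrow> P (x \<oplus>\<^bsub>A\<^esub> y)" "\<And>u v. splits w u v \<Longrightarrow> P (f u v)"
  shows "P (wsum A w f)"
  using assms(2)
proof (induction w arbitrary: f)
  case Nil
  then show ?case by (simp add: splits_def)
next
  case (Cons g w)
  show ?case
    by (cases g) (auto intro!: assms(1) Cons.IH Cons.prems simp: splits_def)
qed

lemma wsum_cong:
  assumes "\<And>u v. splits w u v \<Longrightarrow> f u v = g u v" shows "wsum A w f = wsum A w g"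
  using assms
proof (induction w arbitrary: f g)
  case Nil
  then show ?case by (simp add: splits_def)
next
  case (Cons a w)
  have *: "wsum A w (\<lambda>u v. f (x u) (y v)) = wsum A w (\<lambda>u v. g (x u) (y v))"
    if "\<And>u v. splits w u v \<Longrightarrow> splits (a # w) (x u) (y v)" for x y
    by (rule Cons.IH) (rule Cons.prems, rule that)
  show ?case by (cases a) (simp, (rule arg_cong2[where f = "add A"])?; rule *; simp add: splits_def)+
qed

context cmod
begin

lemma wsum_closed [simp, intro]: "(\<And>u v. f u v \<in> carrier A) \<Longrightarrow> wsum A w f \<in> carrier A"
  by (rule wsum_induct[where P = "\<lambda>x. x \<in> carrier A"]) auto

lemma wsum_add: "(\<And>u v. f u v \<in> carrier A) \<Longrightarrow> (\<And>u v. g u v \<in> carrier A)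
  \<Longrightarrow> wsum A w (\<lambda>u v. f u v \<oplus> g u v) = wsum A w f \<oplus> wsum A w g"
proof (induction w arbitrary: f g)
  case (Cons a w)
  then show ?case by (cases a) (simp_all add: a_ac)
qed simp

lemma wsum_zero [simp]: "wsum A w (\<lambda>u v. \<zero>) = \<zero>"
proof (induction w)
  case (Cons a w)
  then show ?case by (cases a) simp_all
qed simp

lemma wsum_append: "(\<And>u v. f u v \<in> carrier A) \<Longrightarrow>
  wsum A (w @ w') f = wsum A w (\<lambda>u v. wsum A w' (\<lambda>u' v'. f (u @ u') (v @ v')))"
proof (induction w arbitrary: f)
  case (Cons a w)
  then show ?case by (cases a) simp_all
qed simp

lemma wsum_swap: "(\<And>u v u' v'. f u v u' v' \<in> carrier A) \<Longrightarrow>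
  wsum A w (\<lambda>u v. wsum A w' (\<lambda>u' v'. f u v u' v')) = wsum A w' (\<lambda>u' v'. wsum A w (\<lambda>u v. f u v u' v'))"
proof (induction w arbitrary: f)
  case (Cons a w)
  then show ?case by (cases a) (simp_all add: wsum_add)
qed simp

text \<open>For \<open>E\<close> and for \<open>F\<close>, both ways of splitting twice give the
  same three terms.\<close>

lemma wsum_coassoc: "(\<And>u v z. f u v z \<in> carrier A) \<Longrightarrow>
  wsum A w (\<lambda>u v. wsum A u (\<lambda>u1 u2. f u1 u2 v)) = wsum A w (\<lambda>u v. wsum A v (\<lambda>v1 v2. f u v1 v2))"
proof (induction w arbitrary: f)
  case (Cons a w)
  show ?case
    by (cases a) (simp_all add: wsum_add Cons.prems Cons.IH a_ac)
qed simp

end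

lemma wsum_hom:
  assumes "h \<in> lin_hom A B" "cmod A" "\<And>u v. f u v \<in> carrier A"
  shows "h (wsum A w f) = wsum B w (\<lambda>u v. h (f u v))"
proof -
  interpret cmod A by fact
  show ?thesis using assms(3)
  proof (induction w arbitrary: f)
    case (Cons a w)
    then show ?case by (cases a) (simp_all add: lin_homD(2)[OF assms(1)])
  qed simp
qed

text \<open>The only term of the coproduct of \<open>w\<close> with a group-like second factor is \<open>w \<otimes> wtop w\<close>, and the
  only one with a group-like first factor is \<open>wbot w \<otimes> w\<close>.\<close>

primrec wtop :: "uq_gen list \<Rightarrow> uq_gen list" where
  "wtop [] = []"
| "wtop (g # w) = (case g of Gen_E \<Rightarrow> Gen_K # wtop w | Gen_F \<Rightarrow> wtop w | Gen_K \<Rightarrow> Gen_K # wtop w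
     | Gen_Kinv \<Rightarrow> Gen_Kinv # wtop w)"

primrec wbot :: "uq_gen list \<Rightarrow> uq_gen list" where
  "wbot [] = []"
| "wbot (g # w) = (case g of Gen_E \<Rightarrow> wbot w | Gen_F \<Rightarrow> Gen_Kinv # wbot w | Gen_K \<Rightarrow> Gen_K # wbot w
     | Gen_Kinv \<Rightarrow> Gen_Kinv # wbot w)"

lemma edeg_wtop [simp]: "edeg (wtop w) = 0" and rdeg_wtop [simp]: "rdeg (wtop w) = rdeg w"
  by (induction w) (auto split: uq_gen.splits)

lemma edeg_wbot [simp]: "edeg (wbot w) = 0" and ldeg_wbot [simp]: "ldeg (wbot w) = ldeg w"
  by (induction w) (auto split: uq_gen.splits)

context cmod
begin

text \<open>The counit law in a general form: besides the counit it applies to the projection to the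
  abelianization, which also vanishes on all words containing \<open>E\<close> or
  \<open>F\<close>.\<close>

lemma wsum_top: "(\<And>u v. f u v \<in> carrier A) \<Longrightarrow> (\<And>u v. edeg v \<noteq> 0 \<Longrightarrow> f u v = \<zero>) \<Longrightarrow>
  wsum A w f = f w (wtop w)"
proof (induction w arbitrary: f)
  case (Cons a w)
  show ?case by (cases a) (simp_all add: Cons.prems Cons.IH)
qed simp

lemma wsum_bot: "(\<And>u v. f u v \<in> carrier A) \<Longrightarrow> (\<And>u v. edeg u \<noteq> 0 \<Longrightarrow> f u v = \<zero>) \<Longrightarrow>
  wsum A w f = f (wbot w) w"
proof (induction w arbitrary: f)
  case (Cons a w)
  show ?case by (cases a) (simp_all add: Cons.prems Cons.IH)
qed simp

end

section \<open>The q-binomial formula at a root of unity\<close>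

text \<open>Gaussian binomial coefficients. The recursion comes from writing
  \<open>(X + Y)^{n+1}\<close> as \<open>(X + Y)(X + Y)^n\<close> and moving \<open>Y\<close> past
  \<open>X^k\<close> by \<open>YX = w XY\<close>.\<close>

fun qbinom :: "complex \<Rightarrow> nat \<Rightarrow> nat \<Rightarrow> complex" where
  "qbinom w n 0 = 1"
| "qbinom w 0 (Suc k) = 0"
| "qbinom w (Suc n) (Suc k) = qbinom w n k + w ^ Suc k * qbinom w n (Suc k)"

definition qnum :: "complex \<Rightarrow> nat \<Rightarrow> complex" where "qnum w n = (\<Sum>i<n. w ^ i)"
definition qfact :: "complex \<Rightarrow> nat \<Rightarrow> complex" where "qfact w n = (\<Prod>i<n. qnum w (Suc i))"

lemma qbinom_eq_0: "n < k \<Longrightarrow> qbinom w n k = 0"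
  by (induction w n k rule: qbinom.induct) auto

lemma qbinom_diag: "qbinom w n n = 1"
  by (induction n) (simp_all add: qbinom_eq_0)

lemma qnum_add: "qnum w (m + n) = qnum w m + w ^ m * qnum w n"
  by (induction n) (simp_all add: qnum_def algebra_simps power_add)

lemma qfact_Suc: "qfact w (Suc n) = qfact w n * qnum w (Suc n)"
  by (simp add: qfact_def)

text \<open>The product form of the factorial formula avoids division by q-factorials, which may
  vanish at a root of unity.\<close>

lemma qbinom_qfact: "k \<le> n \<Longrightarrow> qbinom w n k * qfact w k * qfact w (n - k) = qfact w n"
proof (induction w n k rule: qbinom.induct)
  case (3 w n k)
  show ?case
  proof (cases "k = n")
    case True
    then show ?thesis by (simp add: qbinom_eq_0 qbinom_diag qfact_def)
  next
    case False
    then have k: "Suc k \<le> n" "k \<le> n" using 3 by auto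
    \<comment> \<open>Then \<open>n - k\<close> is visibly a successor, and its q-factorial splits
      off the last factor \<open>qnum w (n - k)\<close>.\<close>
    obtain m where m: "n = Suc (k + m)" using k(1) by (metis add_Suc less_eqE)
    have "qbinom w (Suc n) (Suc k) * qfact w (Suc k) * qfact w (Suc n - Suc k)
      = (qbinom w n k * qfact w k * qfact w (n - k)) * qnum w (Suc k)
      + w ^ Suc k * (qbinom w n (Suc k) * qfact w (Suc k) * qfact w (n - Suc k)) * qnum w (n - k)"
      by (simp add: m qfact_Suc algebra_simps)
    also have "\<dots> = qfact w n * (qnum w (Suc k) + w ^ Suc k * qnum w (n - k))"
      using 3 k by (simp add: algebra_simps)
    also have "qnum w (Suc k) + w ^ Suc k * qnum w (n - k) = qnum w (Suc n)"
      using qnum_add[of w "Suc k" "n - k"] k by simp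
    finally show ?thesis by (simp add: qfact_Suc)
  qed
qed (simp_all add: qfact_def)

text \<open>\<open>qnum w e\<close> vanishes while \<open>qnum w j\<close> does not for
  \<open>0 < j < e\<close>. In the factorial identity the right side is therefore zero and the two
  factorials on the left are not.\<close>

lemma qbinom_root:
  assumes "w ^ e = 1" "\<And>j. 0 < j \<Longrightarrow> j < e \<Longrightarrow> w ^ j \<noteq> 1" "0 < k" "k < e"
  shows "qbinom w e k = 0"
proof -
  have w: "w \<noteq> 1" using assms(2)[of 1] assms(3,4) by auto
  have qn: "(1 - w) * qnum w n = 1 - w ^ n" for n
    by (simp add: qnum_def one_diff_power_eq)
  have nz: "qfact w n \<noteq> 0" if "n < e" for n
    unfolding qfact_def using assms(2) qn that
    by (auto simp: prod_zero_iff) (metis Suc_lessI diff_self less_trans_Suc mult_zero_right right_minus_eq zero_less_Suc Suc_leI le_less_trans)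
  have "qnum w e = 0" using qn[of e] assms(1) w by simp
  then have "qfact w e = 0" using assms(3,4) by (cases e) (auto simp: qfact_Suc)
  then show ?thesis using qbinom_qfact[of k e w] nz[of k] nz[of "e - k"] assms(3,4) by simp
qed

context calg
begin

lemma pow_q_commute:
  assumes "X \<in> carrier A" "Y \<in> carrier A" "Y \<otimes> X = w \<odot> (X \<otimes> Y)"
  shows "Y \<otimes> X [^] (n::nat) = w ^ n \<odot> (X [^] n \<otimes> Y)"
proof (induction n)
  case (Suc n)
  have "Y \<otimes> X [^] Suc n = (Y \<otimes> X [^] n) \<otimes> X" using assms by (simp add: m_assoc)
  also have "\<dots> = w ^ n \<odot> (X [^] n \<otimes> (Y \<otimes> X))" using assms by (simp add: Suc smult_mult_left m_assoc)
  also have "\<dots> = w ^ Suc n \<odot> (X [^] Suc n \<otimes> Y)"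
    using assms by (simp add: smult_mult_right smult_assoc m_assoc mult.commute)
  finally show ?case .
qed (use assms in simp)

lemma lin_finsum:
  assumes "h \<in> lin_hom A A" "finite K" "f \<in> K \<rightarrow> carrier A"
  shows "h (\<Oplus>k\<in>K. f k) = (\<Oplus>k\<in>K. h (f k))"
  using assms(2,3) lin_homD[OF assms(1)]
  by (induction K rule: finite_induct) (auto simp: Pi_iff lin_hom_zero[OF assms(1) cmod_axioms cmod_axioms])

lemma q_binomial:
  assumes "X \<in> carrier A" "Y \<in> carrier A" "Y \<otimes> X = w \<odot> (X \<otimes> Y)"
  shows "(X \<oplus> Y) [^] n = (\<Oplus>k\<in>{..n}. qbinom w n k \<odot> (X [^] k \<otimes> Y [^] (n - k)))"
proof (induction n)
  case (Suc n)
  let ?m = "\<lambda>k j. X [^] (k::nat) \<otimes> Y [^] (j::nat)"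
  have m: "?m k j \<in> carrier A" for k j using assms by simp
  have XL: "(\<lambda>x. X \<otimes> x) \<in> lin_hom A A" and YL: "(\<lambda>x. Y \<otimes> x) \<in> lin_hom A A"
    by (rule lin_homI; simp add: assms r_distr smult_mult_right)+
  have Xm: "X \<otimes> ?m k j = ?m (Suc k) j" for k j
    using assms nat_pow_Suc2[of X k] by (simp flip: m_assoc)
  have Ym: "Y \<otimes> ?m k j = w ^ k \<odot> ?m k (Suc j)" for k j
  proof -
    have "Y \<otimes> ?m k j = (Y \<otimes> X [^] k) \<otimes> Y [^] j" using assms by (simp add: m_assoc)
    also have "\<dots> = w ^ k \<odot> (X [^] k \<otimes> (Y \<otimes> Y [^] j))"
      using assms by (simp add: pow_q_commute[OF assms] smult_mult_left m_assoc)
    also have "Y \<otimes> Y [^] j = Y [^] Suc j" using assms nat_pow_Suc2[of Y j] by simp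
    finally show ?thesis .
  qed
  have "(X \<oplus> Y) [^] Suc n = X \<otimes> (X \<oplus> Y) [^] n \<oplus> Y \<otimes> (X \<oplus> Y) [^] n"
    using assms nat_pow_Suc2[of "X \<oplus> Y" n] by (simp add: l_distr)
  also have "X \<otimes> (X \<oplus> Y) [^] n = (\<Oplus>k\<in>{..n}. qbinom w n k \<odot> ?m (Suc k) (n - k))"
    unfolding Suc using m assms
    by (subst lin_finsum[OF XL]) (auto simp: smult_mult_right Xm simp del: nat_pow_Suc cong: finsum_cong)
  also have "Y \<otimes> (X \<oplus> Y) [^] n = (\<Oplus>k\<in>{..n}. (w ^ k * qbinom w n k) \<odot> ?m k (Suc n - k))"
    unfolding Suc using m assms
    by (subst lin_finsum[OF YL]) (auto simp: smult_mult_right Ym smult_assoc Suc_diff_le mult.commute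
        simp del: nat_pow_Suc intro!: finsum_cong')
  also have "\<dots> = (\<Oplus>k\<in>{..Suc n}. (w ^ k * qbinom w n k) \<odot> ?m k (Suc n - k))"
    using m assms by (subst finsum_Suc) (auto simp: qbinom_eq_0)
  also have "\<dots> = (\<Oplus>k\<in>{..n}. (w ^ Suc k * qbinom w n (Suc k)) \<odot> ?m (Suc k) (n - k)) \<oplus> ?m 0 (Suc n)"
    using m assms by (subst finsum_Suc2) (auto simp del: nat_pow_Suc)
  also have "(\<Oplus>k\<in>{..n}. qbinom w n k \<odot> ?m (Suc k) (n - k)) \<oplus> \<dots>
    = (\<Oplus>k\<in>{..n}. qbinom w n k \<odot> ?m (Suc k) (n - k) \<oplus> (w ^ Suc k * qbinom w n (Suc k)) \<odot> ?m (Suc k) (n - k))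
      \<oplus> ?m 0 (Suc n)"
    using m assms by (subst finsum_addf) (auto simp: a_assoc)
  also have "\<dots> = (\<Oplus>k\<in>{..n}. qbinom w (Suc n) (Suc k) \<odot> ?m (Suc k) (n - k)) \<oplus> ?m 0 (Suc n)"
    using assms by (simp add: smult_l_distr)
  also have "\<dots> = (\<Oplus>k\<in>{..Suc n}. qbinom w (Suc n) k \<odot> ?m k (Suc n - k))"
    using m assms by (subst finsum_Suc2) (auto simp del: nat_pow_Suc)
  finally show ?case .
qed (use assms in simp)

text \<open>All coefficients with \<open>0 < k < e\<close> vanish, so only the two pure powers are
  left.\<close>

lemma q_binomial_root:
  assumes "X \<in> carrier A" "Y \<in> carrier A" "Y \<otimes> X = w \<odot> (X \<otimes> Y)"
    "w ^ e = 1" "\<And>j. 0 < j \<Longrightarrow> j < e \<Longrightarrow> w ^ j \<noteq> 1" "0 < e"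
  shows "(X \<oplus> Y) [^] e = X [^] e \<oplus> Y [^] e"
proof -
  obtain n where e: "e = Suc n" using assms(6) by (cases e) auto
  let ?f = "\<lambda>k. qbinom w e k \<odot> (X [^] k \<otimes> Y [^] (e - k))"
  have f: "?f k \<in> carrier A" for k using assms(1,2) by simp
  have "(\<Oplus>k\<in>{..n}. ?f (Suc k)) = (\<Oplus>k\<in>{n}. ?f (Suc k))"
  proof (rule add.finprod_mono_neutral_cong_right)
    show "?f (Suc i) = \<zero>" if "i \<in> {..n} - {n}" for i
      using that qbinom_root[OF assms(4,5)] assms(1,2) by (auto simp: e simp del: qbinom.simps(3))
  qed (use f assms(1,2) in auto)
  then show ?thesis
    unfolding q_binomial[OF assms(1-3)] e
    by (subst finsum_Suc2)
      (use f assms(1,2) in \<open>simp_all add: e Pi_iff qbinom_diag finsum_insert del: nat_pow_Suc qbinom.simps(3)\<close>)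
qed

end

section \<open>Hopf algebras generated like the quantum enveloping algebra\<close>

lemma same_alg_refl: "same_alg A A"
  by (simp add: same_alg_def)

lemma alg_hom_same: "same_alg A A' \<Longrightarrow> same_alg B B' \<Longrightarrow> alg_hom A B = alg_hom A' B'"
  by (simp add: alg_hom_def lin_hom_def ring_hom_def same_alg_def)

lemma subalg_gen_same:
  assumes "same_alg A A'" "x \<in> subalg_gen A G" shows "x \<in> subalg_gen A' G"
  using assms(2)
proof induction
  case one
  show ?case using subalg_gen.one[of A' G] assms(1) by (simp add: same_alg_def)
next
  case (add x y)
  then show ?case using subalg_gen.add[of x A' G y] assms(1) by (simp add: same_alg_def)
next
  case (mult x y)
  then show ?case using subalg_gen.mult[of x A' G y] assms(1) by (simp add: same_alg_def)
next
  case (smult x c)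
  then show ?case using subalg_gen.smult[of x A' G c] assms(1) by (simp add: same_alg_def)
qed (rule subalg_gen.incl)

lemma gcom_same: "same_alg A A' \<Longrightarrow> gcom A \<gamma> g = gcom A' \<gamma> g"
  using tensor_cong[of A A' A A'] by (cases g) (simp_all add: same_alg_def)

lemma tmap_same: "same_alg A A' \<Longrightarrow> same_alg B B' \<Longrightarrow> tmap A B = tmap A' B'"
  using tensor_cong[of A A' B B'] by (simp add: tmap_def fun_eq_iff)

text \<open>The structure maps are definite descriptions among extensional functions. Such a
  description is evaluated by exhibiting one solution, restricted to the carrier, and showing that
  its values are forced.\<close>

lemma the_restrict:
  assumes "P (restrict h X)" "\<And>g. P g \<Longrightarrow> g \<in> extensional X" "\<And>g x. P g \<Longrightarrow> x \<in> X \<Longrightarrow> g x = h x"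
  shows "(THE g. P g) = restrict h X"
proof (rule the_equality)
  fix g assume "P g"
  then show "g = restrict h X"
    using assms(2,3) by (intro extensionalityI[of g X]) auto
qed fact

lemma hom_gcom:
  assumes "calg A" "calg B" "h \<in> alg_hom A B" "\<And>g. \<gamma> g \<in> carrier A"
  shows "tmap B B h h (gcom A \<gamma> g) = gcom B (\<lambda>g. h (\<gamma> g)) g"
proof -
  interpret A: tens A A using assms(1) by (simp add: tens_def)
  note l = alg_hom_lin[OF assms(3)]
  note t = tmap_lin_hom[OF assms(1,1,2,2) l l] tmap_pure[OF assms(1,1,2,2) l l]
  show ?thesis
    by (cases g) (simp_all add: lin_homD[OF t(1)] t(2) assms(4) alg_homD(5)[OF assms(3)])
qed

text \<open>Bialgebras generated by images of \<open>E\<close>, \<open>F\<close>, \<open>K\<close>,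
  \<open>K^{-1}\<close> with the usual coproduct and counit on them. \<open>U_q\<close>,
  \<open>u_d\<close> and their abelianizations are all of this kind, so what is proved here is
  available for each.\<close>

locale wh = qalg H \<gamma> q for H :: "('a, 'm) hopf_scheme" (structure) and \<gamma> q +
  assumes q_nonzero: "q \<noteq> 0" and q_square: "q ^ 2 \<noteq> 1"
    and generate: "carrier H \<subseteq> subalg_gen H (range \<gamma>)"
    and comult_hom: "comult H \<in> alg_hom H (tensor H H)"
    and comult_gen: "comult H (\<gamma> g) = gcom H \<gamma> g"
    and counit_hom: "counit H \<in> alg_hom H complex_alg"
    and counit_gen: "counit H (\<gamma> g) = (if edeg [g] = 0 then 1 else 0)"
begin

abbreviation wmon ("\<phi>") where "\<phi> w \<equiv> wprod H \<gamma> w"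

lemma word_closed [simp, intro]: "\<phi> w \<in> carrier H"
  by (rule wprod_closed) simp

lemma word_append: "\<phi> (u @ v) = \<phi> u \<otimes> \<phi> v"
  by (rule wprod_append) simp

lemma word_hom: "psum H \<phi> \<in> alg_hom free_alg H"
  unfolding free_alg_eq
  by (rule monoid_alg_hom) (simp_all add: calg_axioms zero_list_def plus_list_def word_append)

lemma word_span:
  assumes "x \<in> carrier H" obtains c where "x = psum H \<phi> c"
proof -
  note hD = alg_homD[OF word_hom, simplified]
  have "x \<in> subalg_gen H (range \<gamma>)" using assms generate by auto
  then have "\<exists>c. x = psum H \<phi> c"
  proof induction
    case one show ?case using hD(5) by metis
  next
    case (incl x)
    then obtain g where "x = \<gamma> g" by auto
    then have "x = psum H \<phi> (free_gen g)" unfolding free_gen_def by (subst psum_single) simp_all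
    then show ?case by blast
  next
    case add then show ?case using hD(2) by metis
  next
    case mult then show ?case using hD(4) by metis
  next
    case smult then show ?case using hD(3) by metis
  qed
  then show thesis using that by blast
qed

lemma word_induct [consumes 1, case_names word smult add]:
  assumes "x \<in> carrier H" "\<And>w. P (\<phi> w)" "\<And>c x. x \<in> carrier H \<Longrightarrow> P x \<Longrightarrow> P (c \<odot> x)"
    "\<And>x y. x \<in> carrier H \<Longrightarrow> y \<in> carrier H \<Longrightarrow> P x \<Longrightarrow> P y \<Longrightarrow> P (x \<oplus> y)"
  shows "P x"
proof -
  obtain c where c: "x = psum H \<phi> c" by (rule word_span[OF assms(1)])
  have cl: "psum H \<phi> c \<in> carrier H" for c by (rule psum_closed[of UNIV]) simp_all
  have "Poly_Mapping.keys c \<subseteq> UNIV" by simp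
  then have "P (psum H \<phi> c)"
  proof (induction rule: pm_induct)
    case zero
    show ?case using assms(3)[OF _ assms(2), of "[]" 0] by simp
  next
    case (add k c g)
    have "P (c \<odot> \<phi> k \<oplus> psum H \<phi> g)" by (intro assms(4) assms(3) add assms(2) cl) simp_all
    then show ?case by (subst psum_add[of UNIV]) (simp_all add: psum_single)
  qed
  then show ?thesis using c by simp
qed

lemma word_lin_eqI:
  assumes "h \<in> lin_hom H C" "g \<in> lin_hom H C" "\<And>w. h (\<phi> w) = g (\<phi> w)" "x \<in> carrier H"
  shows "h x = g x"
  using assms(4)
  by (induction rule: word_induct) (simp_all add: assms(3) lin_homD[OF assms(1)] lin_homD[OF assms(2)])

sublocale HH: tens H H ..

lemma comult_closed [simp]: "x \<in> carrier H \<Longrightarrow> comult H x \<in> carrier (tensor H H)"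
  using alg_homD(1)[OF comult_hom] by simp

lemma comult_word: "comult H (\<phi> w) = wsum (tensor H H) w (\<lambda>u v. pure H H (\<phi> u) (\<phi> v))"
proof (induction w)
  case Nil
  then show ?case by (simp add: alg_homD(5)[OF comult_hom] HH.pure_one)
next
  case (Cons g w)
  have l: "(\<lambda>x. X \<otimes>\<^bsub>tensor H H\<^esub> x) \<in> lin_hom (tensor H H) (tensor H H)" if "X \<in> carrier (tensor H H)" for X
    by (rule lin_homI) (simp_all add: that HH.T.r_distr HH.T.smult_mult_right)
  have m: "pure H H a b \<otimes>\<^bsub>tensor H H\<^esub> wsum (tensor H H) w (\<lambda>u v. pure H H (\<phi> u) (\<phi> v))
    = wsum (tensor H H) w (\<lambda>u v. pure H H (a \<otimes> \<phi> u) (b \<otimes> \<phi> v))"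
    if "a \<in> carrier H" "b \<in> carrier H" for a b
    using that by (subst wsum_hom[OF l HH.T.cmod_axioms]) (simp_all add: HH.pure_mult)
  have "comult H (\<phi> (g # w)) = gcom H \<gamma> g \<otimes>\<^bsub>tensor H H\<^esub> wsum (tensor H H) w (\<lambda>u v. pure H H (\<phi> u) (\<phi> v))"
    by (simp add: alg_homD(4)[OF comult_hom] comult_gen Cons)
  then show ?case by (cases g) (simp_all add: m HH.T.l_distr)
qed

text \<open>Every Sweedler sum of a bilinear expression becomes a \<open>wsum\<close> on words; the
  computations below take place on that side.\<close>

lemma sweedler:
  assumes "blin H H C f" "cmod C"
  shows "tlift C f (comult H (\<phi> w)) = wsum C w (\<lambda>u v. f (\<phi> u) (\<phi> v))"
  unfolding comult_word
  by (subst wsum_hom[OF HH.tlift_lin_hom[OF assms] HH.T.cmod_axioms]) (simp_all add: HH.tlift_pure[OF assms])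

lemma counit_word: "counit H (\<phi> w) = (if edeg w = 0 then 1 else 0)"
proof (induction w)
  case (Cons g w)
  then show ?case
    by (cases g) (simp_all add: alg_homD(4)[OF counit_hom] counit_gen complex_alg_def)
qed (simp add: alg_homD(5)[OF counit_hom] complex_alg_def)

lemma group_word_unit: "edeg w = 0 \<Longrightarrow> \<phi> w \<in> Units H"
proof (induction w)
  case (Cons g w)
  have "\<gamma> Gen_K \<in> Units H" "\<gamma> Gen_Kinv \<in> Units H"
    using K_Kinv Kinv_K gen_closed unfolding Units_def by blast+
  then show ?case using Cons by (cases g) simp_all
qed simp

lemma word_replicate: "\<phi> (replicate n g) = \<gamma> g [^] n"
proof (induction n)
  case (Suc n)
  then show ?case using nat_pow_Suc2[of "\<gamma> g" n] by simp
qed simp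

lemma pure_pow: "a \<in> carrier H \<Longrightarrow> b \<in> carrier H \<Longrightarrow>
  pure H H a b [^]\<^bsub>tensor H H\<^esub> (n::nat) = pure H H (a [^] n) (b [^] n)"
  by (induction n) (simp_all add: HH.pure_one HH.pure_mult)

lemma Kinv_F: "\<gamma> Gen_Kinv \<otimes> \<gamma> Gen_F = q ^ 2 \<odot> (\<gamma> Gen_F \<otimes> \<gamma> Gen_Kinv)"
proof -
  have "\<gamma> Gen_Kinv \<otimes> (\<gamma> Gen_K \<otimes> \<gamma> Gen_F) \<otimes> \<gamma> Gen_Kinv = \<gamma> Gen_F \<otimes> \<gamma> Gen_Kinv"
    by (simp flip: m_assoc add: Kinv_K)
  moreover have "\<gamma> Gen_Kinv \<otimes> (\<gamma> Gen_K \<otimes> \<gamma> Gen_F) \<otimes> \<gamma> Gen_Kinv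
    = inverse (q ^ 2) \<odot> (\<gamma> Gen_Kinv \<otimes> \<gamma> Gen_F)"
    by (simp add: K_F smult_mult_left smult_mult_right m_assoc K_Kinv)
  ultimately have "q ^ 2 \<odot> (inverse (q ^ 2) \<odot> (\<gamma> Gen_Kinv \<otimes> \<gamma> Gen_F)) = q ^ 2 \<odot> (\<gamma> Gen_F \<otimes> \<gamma> Gen_Kinv)"
    by simp
  then show ?thesis using q_nonzero by (simp add: smult_assoc)
qed

context
  fixes e :: nat
  assumes root: "q ^ (2 * e) = 1" "\<And>j. 0 < j \<Longrightarrow> j < e \<Longrightarrow> q ^ (2 * j) \<noteq> 1" "0 < e"
begin

text \<open>\<open>(E \<otimes> K)(1 \<otimes> E) = q^2 (1 \<otimes> E)(E \<otimes> K)\<close>, and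
  \<open>q^2\<close> has order \<open>e\<close>.\<close>

lemma comult_E_pow: "comult H (\<gamma> Gen_E [^] e)
  = pure H H \<one> (\<gamma> Gen_E [^] e) \<oplus>\<^bsub>tensor H H\<^esub> pure H H (\<gamma> Gen_E [^] e) (\<gamma> Gen_K [^] e)"
  using HH.T.q_binomial_root[of "pure H H \<one> (\<gamma> Gen_E)" "pure H H (\<gamma> Gen_E) (\<gamma> Gen_K)" "q ^ 2" e] root
  by (simp add: alg_hom_pow[OF comult_hom calg_axioms HH.calg_tensor] comult_gen HH.pure_mult K_E
      HH.pure_smult_right pure_pow power_mult)

text \<open>Here \<open>F \<otimes> 1\<close> plays the part of \<open>X\<close>: in this order the
  commutation factor is again \<open>q^2\<close> and not its inverse.\<close>

lemma comult_F_pow: "comult H (\<gamma> Gen_F [^] e)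
  = pure H H (\<gamma> Gen_Kinv [^] e) (\<gamma> Gen_F [^] e) \<oplus>\<^bsub>tensor H H\<^esub> pure H H (\<gamma> Gen_F [^] e) \<one>"
  using HH.T.q_binomial_root[of "pure H H (\<gamma> Gen_F) \<one>" "pure H H (\<gamma> Gen_Kinv) (\<gamma> Gen_F)" "q ^ 2" e] root
  by (simp add: alg_hom_pow[OF comult_hom calg_axioms HH.calg_tensor] comult_gen HH.pure_mult Kinv_F
      HH.pure_smult_left pure_pow power_mult HH.T.a_comm)

end

lemma comult_K_pow: "comult H (\<gamma> Gen_K [^] (e::nat)) = pure H H (\<gamma> Gen_K [^] e) (\<gamma> Gen_K [^] e)"
  by (simp add: alg_hom_pow[OF comult_hom calg_axioms HH.calg_tensor] comult_gen pure_pow)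

end

lemma same_alg_extend: "same_alg A (module.extend A f)"
  by (simp add: same_alg_def module.extend_def)

section \<open>Quotients by biideals\<close>

context wh
begin

context
  fixes I :: "'a set"
  assumes I: "ideal I H"
begin

abbreviation "Q \<equiv> alg_quot H I"
abbreviation "QQ \<equiv> tensor Q Q"

lemma hopf_quot_same: "same_alg Q (hopf_quot H I)"
  unfolding hopf_quot_def by (rule same_alg_extend)

interpretation Q: calg Q by (rule calg_alg_quot[OF calg_axioms I])
interpretation TQ: tens Q Q ..

lemma quot_comult_hom: "(\<lambda>x. tmap Q Q (\<lambda>y. I +> y) (\<lambda>y. I +> y) (comult H x)) \<in> alg_hom H QQ"
  using coset_alg_hom[OF calg_axioms I]
  by (intro alg_hom_compose[OF comult_hom] tmap_alg_hom[OF calg_axioms calg_axioms Q.calg_axioms Q.calg_axioms])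
    (auto intro: alg_hom_lin)

context
  assumes kill: "\<And>x. x \<in> I \<Longrightarrow> tmap (alg_quot H I) (alg_quot H I) (\<lambda>y. I +> y) (\<lambda>y. I +> y) (comult H x)
       = \<zero>\<^bsub>tensor (alg_quot H I) (alg_quot H I)\<^esub>"
    and kill_counit: "\<And>x. x \<in> I \<Longrightarrow> counit H x = 0"
begin

lemma hopf_quot_comult: "x \<in> carrier H \<Longrightarrow> comult (hopf_quot H I) (I +> x) = tmap Q Q (\<lambda>y. I +> y) (\<lambda>y. I +> y) (comult H x)"
  using quot_lift_lin(1)[OF calg_axioms I alg_hom_lin[OF quot_comult_hom] TQ.T.cmod_axioms kill]
  by (simp add: hopf_quot_def module.extend_def hopf.fields_def)

lemma hopf_quot_counit: "x \<in> carrier H \<Longrightarrow> counit (hopf_quot H I) (I +> x) = counit H x"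
  using quot_lift_lin(1)[OF calg_axioms I alg_hom_lin[OF counit_hom] _ , of x] kill_counit ccalg_complex
  by (simp add: hopf_quot_def module.extend_def hopf.fields_def ccalg_def calg_def complex_alg_def)

text \<open>All data are inherited once \<open>I\<close> is a biideal, which is what
  \<open>kill\<close> and \<open>kill_counit\<close> express. This is applied to the ideal of
  \<open>u_d\<close> and to the commutator ideal.\<close>

lemma wh_quot: "wh (hopf_quot H I) (\<lambda>g. I +> \<gamma> g) q"
proof -
  note s = hopf_quot_same
  have qa: "qalg Q (\<lambda>g. I +> \<gamma> g) q"
    by (rule qalg_hom[OF coset_alg_hom[OF calg_axioms I] qalg_axioms Q.calg_axioms])
  show ?thesis
  proof (intro wh.intro wh_axioms.intro)
    show "qalg (hopf_quot H I) (\<lambda>g. I +> \<gamma> g) q" by (rule qalg_cong[OF s qa])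
    show "q \<noteq> 0" "q ^ 2 \<noteq> 1" by (fact q_nonzero q_square)+
    show "carrier (hopf_quot H I) \<subseteq> subalg_gen (hopf_quot H I) (range (\<lambda>g. I +> \<gamma> g))"
    proof
      fix X assume "X \<in> carrier (hopf_quot H I)"
      then have "X \<in> (\<lambda>x. I +> x) ` carrier H"
        using s by (simp add: same_alg_def alg_quot_simps[OF calg_axioms I])
      then obtain x where x: "x \<in> carrier H" "X = I +> x" by blast
      have "X \<in> subalg_gen Q ((\<lambda>x. I +> x) ` range \<gamma>)"
        unfolding x(2) by (rule subalg_gen_hom[OF coset_alg_hom[OF calg_axioms I] calg_axioms])
          (use x generate in auto)
      then show "X \<in> subalg_gen (hopf_quot H I) (range (\<lambda>g. I +> \<gamma> g))"
        using subalg_gen_same[OF s] by (simp add: image_image)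
    qed
    have "(\<lambda>X. the_elem ((\<lambda>x. tmap Q Q (\<lambda>y. I +> y) (\<lambda>y. I +> y) (comult H x)) ` X)) \<in> alg_hom Q QQ"
      by (rule quot_lift_alg[OF calg_axioms I quot_comult_hom TQ.T.calg_axioms kill])
    then show "comult (hopf_quot H I) \<in> alg_hom (hopf_quot H I) (tensor (hopf_quot H I) (hopf_quot H I))"
      using tensor_cong[OF s s] alg_hom_same[OF s, of QQ QQ]
      by (simp add: hopf_quot_def module.extend_def hopf.fields_def same_alg_def)
    have "(\<lambda>X. the_elem (counit H ` X)) \<in> alg_hom Q complex_alg"
      using kill_counit ccalg_complex
      by (intro quot_lift_alg[OF calg_axioms I counit_hom]) (simp_all add: complex_alg_def ccalg_def)
    then show "counit (hopf_quot H I) \<in> alg_hom (hopf_quot H I) complex_alg"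
      using alg_hom_same[OF s, of complex_alg complex_alg]
      by (simp add: hopf_quot_def module.extend_def hopf.fields_def same_alg_def)
    fix g
    show "comult (hopf_quot H I) (I +> \<gamma> g) = gcom (hopf_quot H I) (\<lambda>g. I +> \<gamma> g) g"
      using hom_gcom[OF calg_axioms Q.calg_axioms coset_alg_hom[OF calg_axioms I], of \<gamma> g]
      by (simp add: hopf_quot_comult comult_gen gcom_same[OF s])
    show "counit (hopf_quot H I) (I +> \<gamma> g) = (if edeg [g] = 0 then 1 else 0)"
      by (simp add: hopf_quot_counit counit_gen)
  qed
qed

lemma coset_hopf_hom: "(\<lambda>x. I +> x) \<in> hopf_hom H (hopf_quot H I)"
  using coset_alg_hom[OF calg_axioms I] alg_hom_same[OF _ hopf_quot_same, of H H]
  by (simp add: hopf_hom_def hopf_quot_comult hopf_quot_counit tmap_same[OF hopf_quot_same hopf_quot_same]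
      same_alg_def)

end

end

section \<open>The abelianization\<close>

abbreviation "CI \<equiv> comm_ideal H"

lemma comm_ideal_gens: "{x \<otimes> y \<ominus> y \<otimes> x | x y. x \<in> carrier H \<and> y \<in> carrier H} \<subseteq> carrier H"
  by auto

lemma ideal_comm_ideal: "ideal CI H"
  unfolding comm_ideal_def by (rule genideal_ideal) auto

lemma comm_ideal_mem: "x \<in> carrier H \<Longrightarrow> y \<in> carrier H \<Longrightarrow> x \<otimes> y \<ominus> y \<otimes> x \<in> CI"
  unfolding comm_ideal_def by (rule subsetD[OF genideal_self[OF comm_ideal_gens]]) blast

text \<open>Commutators die in a commutative algebra. Applied to the coproduct followed by the
  projections, and to the counit, this shows without computation that the commutator ideal is a
  biideal.\<close>

lemma comm_ideal_kill:
  assumes "h \<in> alg_hom H C" "ccalg C" "x \<in> CI" shows "h x = \<zero>\<^bsub>C\<^esub>"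
proof -
  interpret C: ccalg C by fact
  show ?thesis
  proof (rule genideal_hom_zero[OF assms(1) calg_axioms C.calg_axioms comm_ideal_gens _ assms(3)[unfolded comm_ideal_def]])
    fix z assume "z \<in> {x \<otimes> y \<ominus> y \<otimes> x | x y. x \<in> carrier H \<and> y \<in> carrier H}"
    then obtain x y where xy: "x \<in> carrier H" "y \<in> carrier H" "z = x \<otimes> y \<ominus> y \<otimes> x" by blast
    show "h z = \<zero>\<^bsub>C\<^esub>"
      using xy alg_homD[OF assms(1)]
      by (simp add: alg_hom_minus[OF assms(1) calg_axioms C.calg_axioms] C.m_comm[of "h x"] C.minus_eq C.r_neg)
  qed
qed

lemma ccalg_quot_comm: "ccalg (alg_quot H CI)"
proof (rule ccalgI[OF calg_alg_quot[OF calg_axioms ideal_comm_ideal]])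
  note s = alg_quot_simps[OF calg_axioms ideal_comm_ideal]
  fix X Y assume "X \<in> carrier (alg_quot H CI)" "Y \<in> carrier (alg_quot H CI)"
  then obtain x y where "x \<in> carrier H" "y \<in> carrier H" "X = CI +> x" "Y = CI +> y"
    by (auto simp: s(1))
  then show "X \<otimes>\<^bsub>alg_quot H CI\<^esub> Y = Y \<otimes>\<^bsub>alg_quot H CI\<^esub> X"
    by (simp add: s(5) coset_eq_iff[OF calg_axioms ideal_comm_ideal] comm_ideal_mem)
qed

lemma comm_kill: "x \<in> CI \<Longrightarrow> tmap (alg_quot H CI) (alg_quot H CI) (\<lambda>y. CI +> y) (\<lambda>y. CI +> y) (comult H x)
       = \<zero>\<^bsub>tensor (alg_quot H CI) (alg_quot H CI)\<^esub>"
  by (rule comm_ideal_kill[OF quot_comult_hom[OF ideal_comm_ideal] ccalg_tensor[OF ccalg_quot_comm ccalg_quot_comm]])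

lemma comm_kill_counit: "x \<in> CI \<Longrightarrow> counit H x = 0"
  using comm_ideal_kill[OF counit_hom ccalg_complex] by (simp add: complex_alg_def)

lemmas comm_quot = ideal_comm_ideal comm_kill comm_kill_counit

abbreviation pab where "pab x \<equiv> CI +> x"

lemma wh_ab: "wh (hopf_ab H) (\<lambda>g. pab (\<gamma> g)) q"
  unfolding hopf_ab_def by (rule wh_quot[OF comm_quot])

lemma pab_hopf_hom: "(\<lambda>x. pab x) \<in> hopf_hom H (hopf_ab H)"
  unfolding hopf_ab_def by (rule coset_hopf_hom[OF comm_quot])

lemma pab_alg_hom: "(\<lambda>x. pab x) \<in> alg_hom H (hopf_ab H)"
  using pab_hopf_hom by (simp add: hopf_hom_def)

lemma ccalg_ab: "ccalg (hopf_ab H)"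
proof (rule ccalgI)
  show "calg (hopf_ab H)"
    unfolding hopf_ab_def
    by (rule calg_cong[OF hopf_quot_same[OF ideal_comm_ideal] calg_alg_quot[OF calg_axioms ideal_comm_ideal]])
  fix X Y assume "X \<in> carrier (hopf_ab H)" "Y \<in> carrier (hopf_ab H)"
  then show "X \<otimes>\<^bsub>hopf_ab H\<^esub> Y = Y \<otimes>\<^bsub>hopf_ab H\<^esub> X"
    using hopf_quot_same[OF ideal_comm_ideal] comm_monoid.m_comm[OF cring.axioms(2)[OF ccalg.axioms(2)[OF ccalg_quot_comm]], of X Y]
    by (simp add: hopf_ab_def same_alg_def)
qed

end

section \<open>The quantum enveloping algebra and its finite-dimensional quotient\<close>

lemma restrict_alg_hom: "h \<in> alg_hom A B \<Longrightarrow> calg A \<Longrightarrow> restrict h (carrier A) \<in> alg_hom A B"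
  by (rule alg_hom_cong) simp_all

lemma Uq_same: "same_alg (Uq_alg q) (Uq q)"
  unfolding Uq_def by (rule same_alg_extend)

lemma Uq_comult_hom:
  assumes "q \<noteq> 0"
  shows "Uq_comult q \<in> alg_hom (Uq_alg q) (tensor (Uq_alg q) (Uq_alg q))"
    "Uq_comult q (Uq_gen q g) = gcom (Uq_alg q) (Uq_gen q) g"
proof -
  interpret Q: qalg "Uq_alg q" "Uq_gen q" q by (rule qalg_Uq_alg)
  obtain D where D: "D \<in> alg_hom (Uq_alg q) (tensor (Uq_alg q) (Uq_alg q))"
    "\<And>g. D (Uq_gen q g) = gcom (Uq_alg q) (Uq_gen q) g"
    using Uq_universal[OF Q.qalg_tensor[OF assms]] by metis
  have "Uq_comult q = restrict D (carrier (Uq_alg q))"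
    unfolding Uq_comult_def Let_def
  proof (rule the_restrict, goal_cases)
    case 1
    then show ?case using restrict_alg_hom[OF D(1) Q.calg_axioms] by (simp add: D(2))
  next
    case (3 g x)
    show ?case
    proof (rule alg_hom_eqI[OF _ D(1) Q.calg_axioms])
      fix y assume "y \<in> range (Uq_gen q)"
      then obtain a where "y = Uq_gen q a" by auto
      then show "g y = D y" using 3 D(2) by (cases a) simp_all
    qed (use 3 Uq_gen_generate in auto)
  qed simp
  then show "Uq_comult q \<in> alg_hom (Uq_alg q) (tensor (Uq_alg q) (Uq_alg q))"
    "Uq_comult q (Uq_gen q g) = gcom (Uq_alg q) (Uq_gen q) g"
    using restrict_alg_hom[OF D(1) Q.calg_axioms] by (simp_all add: D(2))
qed

text \<open>\<open>z = 1\<close> gives the counit; \<open>z = -1\<close> gives the character that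
  tells the two degrees apart.\<close>

lemma qalg_complex:
  assumes "z ^ 2 = 1"
  shows "qalg complex_alg (\<lambda>g. if edeg [g] = 0 then z else 0) q"
proof -
  have z: "z * z = 1" using assms by (simp add: power2_eq_square)
  interpret C: ccalg complex_alg by (rule ccalg_complex)
  show ?thesis
    by unfold_locales (simp_all add: complex_alg_def z)
qed

lemma Uq_counit_hom:
  "Uq_counit q \<in> alg_hom (Uq_alg q) complex_alg"
  "Uq_counit q (Uq_gen q g) = (if edeg [g] = 0 then 1 else 0)"
proof -
  interpret Q: qalg "Uq_alg q" "Uq_gen q" q by (rule qalg_Uq_alg)
  obtain D where D: "D \<in> alg_hom (Uq_alg q) complex_alg"
    "\<And>g. D (Uq_gen q g) = (if edeg [g] = 0 then 1 else 0)"
    using Uq_universal[OF qalg_complex[of 1]] by auto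
  have "Uq_counit q = restrict D (carrier (Uq_alg q))"
    unfolding Uq_counit_def
  proof (rule the_restrict, goal_cases)
    case 1
    then show ?case using restrict_alg_hom[OF D(1) Q.calg_axioms] by (simp add: D(2))
  next
    case (3 g x)
    show ?case
    proof (rule alg_hom_eqI[OF _ D(1) Q.calg_axioms])
      fix y assume "y \<in> range (Uq_gen q)"
      then obtain a where "y = Uq_gen q a" by auto
      then show "g y = D y" using 3 D(2) by (cases a) simp_all
    qed (use 3 Uq_gen_generate in auto)
  qed simp
  then show "Uq_counit q \<in> alg_hom (Uq_alg q) complex_alg"
    "Uq_counit q (Uq_gen q g) = (if edeg [g] = 0 then 1 else 0)"
    using restrict_alg_hom[OF D(1) Q.calg_axioms] by (simp_all add: D(2))
qed

lemma wh_Uq: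
  assumes "q \<noteq> 0" "q ^ 2 \<noteq> 1"
  shows "wh (Uq q) (Uq_gen q) q"
proof (intro wh.intro wh_axioms.intro)
  note s = Uq_same[of q]
  show "qalg (Uq q) (Uq_gen q) q" by (rule qalg_cong[OF s qalg_Uq_alg])
  show "carrier (Uq q) \<subseteq> subalg_gen (Uq q) (range (Uq_gen q))"
    using Uq_gen_generate[of q] subalg_gen_same[OF s] s by (auto simp: same_alg_def)
  have [simp]: "comult (Uq q) = Uq_comult q" "counit (Uq q) = Uq_counit q"
    by (simp_all add: Uq_def module.extend_def hopf.fields_def)
  show "comult (Uq q) \<in> alg_hom (Uq q) (tensor (Uq q) (Uq q))"
    using Uq_comult_hom(1)[OF assms(1)]
    by (simp flip: tensor_cong[OF s s] alg_hom_same[OF s same_alg_refl])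
  show "counit (Uq q) \<in> alg_hom (Uq q) complex_alg"
    using Uq_counit_hom(1)[of q] by (simp flip: alg_hom_same[OF s same_alg_refl])
  fix g
  show "comult (Uq q) (Uq_gen q g) = gcom (Uq q) (Uq_gen q) g"
    using Uq_comult_hom(2)[OF assms(1)] by (simp flip: gcom_same[OF s])
  show "counit (Uq q) (Uq_gen q g) = (if edeg [g] = 0 then 1 else 0)"
    using Uq_counit_hom(2) by simp
qed fact+

text \<open>One condition covers both parities of \<open>d\<close>: \<open>q^2\<close> has order
  exactly \<open>e\<close>, and \<open>e > 1\<close>.\<close>

locale rootq =
  fixes q :: complex and e :: nat
  assumes e_pos: "0 < e" and q_root: "q ^ (2 * e) = 1"
    and q_prim: "\<And>j. 0 < j \<Longrightarrow> j < e \<Longrightarrow> q ^ (2 * j) \<noteq> 1" and q_sq: "q ^ 2 \<noteq> 1"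
begin

lemma q_nz: "q \<noteq> 0"
  using q_root e_pos by (auto simp: power_0_left split: if_splits)

sublocale U: wh "Uq q" "Uq_gen q" q
  by (rule wh_Uq[OF q_nz q_sq])

abbreviation "UE \<equiv> Uq_gen q Gen_E"
abbreviation "UF \<equiv> Uq_gen q Gen_F"
abbreviation "UK \<equiv> Uq_gen q Gen_K"
abbreviation "UU \<equiv> Uq q"
abbreviation "I \<equiv> ud_ideal q e"

lemma ud_gens: "{UE [^]\<^bsub>UU\<^esub> e, UF [^]\<^bsub>UU\<^esub> e, UK [^]\<^bsub>UU\<^esub> e \<ominus>\<^bsub>UU\<^esub> \<one>\<^bsub>UU\<^esub>} \<subseteq> carrier UU"
  by simp

lemma ideal_ud: "ideal I UU"
  unfolding ud_ideal_def by (rule U.genideal_ideal[OF ud_gens])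

lemma ud_ideal_mem: "UE [^]\<^bsub>UU\<^esub> e \<in> I" "UF [^]\<^bsub>UU\<^esub> e \<in> I" "UK [^]\<^bsub>UU\<^esub> e \<ominus>\<^bsub>UU\<^esub> \<one>\<^bsub>UU\<^esub> \<in> I"
  unfolding ud_ideal_def using U.genideal_self[OF ud_gens] by blast+

lemma ud_kill:
  assumes "h \<in> alg_hom UU C" "calg C" "h (UE [^]\<^bsub>UU\<^esub> e) = \<zero>\<^bsub>C\<^esub>" "h (UF [^]\<^bsub>UU\<^esub> e) = \<zero>\<^bsub>C\<^esub>"
    "h (UK [^]\<^bsub>UU\<^esub> e) = \<one>\<^bsub>C\<^esub>" "x \<in> I"
  shows "h x = \<zero>\<^bsub>C\<^esub>"
proof -
  interpret C: calg C by fact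
  have K: "h (UK [^]\<^bsub>UU\<^esub> e \<ominus>\<^bsub>UU\<^esub> \<one>\<^bsub>UU\<^esub>) = \<zero>\<^bsub>C\<^esub>"
    using assms(5) alg_homD(5)[OF assms(1)]
    by (simp add: alg_hom_minus[OF assms(1) U.calg_axioms assms(2)] C.minus_eq C.r_neg)
  show ?thesis
    by (rule genideal_hom_zero[OF assms(1) U.calg_axioms assms(2) ud_gens _ assms(6)[unfolded ud_ideal_def]])
      (use assms(3,4) K in blast)
qed

abbreviation uproj ("\<psi>") where "\<psi> \<equiv> ud_proj q e"

text \<open>In each term of the coproducts of \<open>E^e\<close> and \<open>F^e\<close> one tensor
  factor lies in the ideal, and \<open>K^e\<close> is group-like with image 1.\<close>

lemma ud_quot_kill: "x \<in> I \<Longrightarrow> tmap (alg_quot UU I) (alg_quot UU I) (\<lambda>y. I +>\<^bsub>UU\<^esub> y) (\<lambda>y. I +>\<^bsub>UU\<^esub> y) (comult UU x)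
       = \<zero>\<^bsub>tensor (alg_quot UU I) (alg_quot UU I)\<^esub>"
proof -
  let ?Q = "alg_quot UU I" and ?p = "\<lambda>y. I +>\<^bsub>UU\<^esub> y"
  interpret Q: calg ?Q by (rule calg_alg_quot[OF U.calg_axioms ideal_ud])
  interpret QQ: tens ?Q ?Q ..
  note hom = U.quot_comult_hom[OF ideal_ud]
  note p = coset_alg_hom[OF U.calg_axioms ideal_ud]
  note t = tmap_lin_hom[OF U.calg_axioms U.calg_axioms Q.calg_axioms Q.calg_axioms alg_hom_lin[OF p] alg_hom_lin[OF p]]
    tmap_pure[OF U.calg_axioms U.calg_axioms Q.calg_axioms Q.calg_axioms alg_hom_lin[OF p] alg_hom_lin[OF p]]
  have pc: "x \<in> carrier UU \<Longrightarrow> ?p x \<in> carrier ?Q" for x using alg_homD(1)[OF p] .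
  have z: "?p (UE [^]\<^bsub>UU\<^esub> e) = \<zero>\<^bsub>?Q\<^esub>" "?p (UF [^]\<^bsub>UU\<^esub> e) = \<zero>\<^bsub>?Q\<^esub>"
    using coset_zero_iff[OF U.calg_axioms ideal_ud] ud_ideal_mem(1,2) alg_quot_simps(2)[OF U.calg_axioms ideal_ud]
    by simp_all
  have k: "?p (UK [^]\<^bsub>UU\<^esub> e) = ?p \<one>\<^bsub>UU\<^esub>"
    using coset_eq_iff[OF U.calg_axioms ideal_ud] ud_ideal_mem(3) by simp
  have o: "?p \<one>\<^bsub>UU\<^esub> = \<one>\<^bsub>?Q\<^esub>" using alg_homD(5)[OF p] .
  note root = q_root q_prim e_pos
  assume "x \<in> I"
  then show "tmap ?Q ?Q ?p ?p (comult UU x) = \<zero>\<^bsub>tensor ?Q ?Q\<^esub>"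
  proof (rule ud_kill[OF hom QQ.calg_tensor, rotated 3])
    show "tmap ?Q ?Q ?p ?p (comult UU (UE [^]\<^bsub>UU\<^esub> e)) = \<zero>\<^bsub>tensor ?Q ?Q\<^esub>"
      using U.comult_E_pow[OF root] by (simp add: lin_homD[OF t(1)] t(2) z pc)
    show "tmap ?Q ?Q ?p ?p (comult UU (UF [^]\<^bsub>UU\<^esub> e)) = \<zero>\<^bsub>tensor ?Q ?Q\<^esub>"
      using U.comult_F_pow[OF root] by (simp add: lin_homD[OF t(1)] t(2) z pc)
    show "tmap ?Q ?Q ?p ?p (comult UU (UK [^]\<^bsub>UU\<^esub> e)) = \<one>\<^bsub>tensor ?Q ?Q\<^esub>"
      using U.comult_K_pow by (simp add: t(2) k o QQ.pure_one)
  qed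
qed

lemma ud_quot_kill_counit: "x \<in> I \<Longrightarrow> counit UU x = 0"
proof -
  have c: "counit UU (UE [^]\<^bsub>UU\<^esub> e) = 0" "counit UU (UF [^]\<^bsub>UU\<^esub> e) = 0" "counit UU (UK [^]\<^bsub>UU\<^esub> e) = 1"
    using U.counit_word[of "replicate e Gen_E"] U.counit_word[of "replicate e Gen_F"]
      U.counit_word[of "replicate e Gen_K"] e_pos
    by (simp_all add: U.word_replicate edeg_def)
  show "x \<in> I \<Longrightarrow> counit UU x = 0"
    using ud_kill[OF U.counit_hom _ _ _ _ , of x] c ccalg_complex
    by (simp add: complex_alg_def ccalg_def)
qed

lemmas ud_quot = ideal_ud ud_quot_kill ud_quot_kill_counit

lemma wh_ud: "wh (ud q e) (\<lambda>g. \<psi> (Uq_gen q g)) q"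
  unfolding ud_def ud_proj_def by (rule U.wh_quot[OF ud_quot])

lemma ud_proj_hopf_hom: "\<psi> \<in> hopf_hom UU (ud q e)"
  unfolding ud_def ud_proj_def[abs_def] by (rule U.coset_hopf_hom[OF ud_quot])

lemma ud_proj_hom: "\<psi> \<in> alg_hom UU (ud q e)"
  using ud_proj_hopf_hom by (simp add: hopf_hom_def)

lemma ud_proj_carrier: "carrier (ud q e) = \<psi> ` carrier UU"
  using U.hopf_quot_same[OF ideal_ud] alg_quot_simps(1)[OF U.calg_axioms ideal_ud]
  by (simp add: ud_def ud_proj_def[abs_def] same_alg_def)

lemma ud_proj_zero_iff: "x \<in> carrier UU \<Longrightarrow> \<psi> x = \<zero>\<^bsub>ud q e\<^esub> \<longleftrightarrow> x \<in> I"
  using U.hopf_quot_same[OF ideal_ud] alg_quot_simps(2)[OF U.calg_axioms ideal_ud]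
    coset_zero_iff[OF U.calg_axioms ideal_ud]
  by (simp add: ud_def ud_proj_def same_alg_def)

sublocale u: wh "ud q e" "\<lambda>g. \<psi> (Uq_gen q g)" q
  by (rule wh_ud)

end

section \<open>Convolution\<close>

definition conv :: "(complex, 'a, 'm) module_scheme \<Rightarrow> (uq_gen list \<Rightarrow> 'a) \<Rightarrow> (uq_gen list \<Rightarrow> 'a)
    \<Rightarrow> uq_gen list \<Rightarrow> 'a" where
  "conv A f g w = wsum A w (\<lambda>u v. f u \<otimes>\<^bsub>A\<^esub> g v)"

text \<open>The counit, as the unit of the convolution product.\<close>

definition ceps :: "(complex, 'a, 'm) module_scheme \<Rightarrow> uq_gen list \<Rightarrow> 'a" where
  "ceps A w = (if edeg w = 0 then \<one>\<^bsub>A\<^esub> else \<zero>\<^bsub>A\<^esub>)"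

context calg
begin

lemma mult_lin_left: "a \<in> carrier A \<Longrightarrow> (\<lambda>x. a \<otimes> x) \<in> lin_hom A A"
  by (rule lin_homI) (simp_all add: r_distr smult_mult_right)

lemma mult_lin_right: "a \<in> carrier A \<Longrightarrow> (\<lambda>x. x \<otimes> a) \<in> lin_hom A A"
  by (rule lin_homI) (simp_all add: l_distr smult_mult_left)

lemma wsum_mult_left: "a \<in> carrier A \<Longrightarrow> (\<And>u v. f u v \<in> carrier A) \<Longrightarrow>
  a \<otimes> wsum A w f = wsum A w (\<lambda>u v. a \<otimes> f u v)"
  by (rule wsum_hom[OF mult_lin_left cmod_axioms])

lemma wsum_mult_right: "a \<in> carrier A \<Longrightarrow> (\<And>u v. f u v \<in> carrier A) \<Longrightarrow>
  wsum A w f \<otimes> a = wsum A w (\<lambda>u v. f u v \<otimes> a)"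
  by (rule wsum_hom[OF mult_lin_right cmod_axioms])

lemma conv_assoc:
  assumes "\<And>w. f w \<in> carrier A" "\<And>w. g w \<in> carrier A" "\<And>w. h w \<in> carrier A"
  shows "conv A (conv A f g) h w = conv A f (conv A g h) w"
  unfolding conv_def using assms wsum_coassoc[of "\<lambda>u v z. f u \<otimes> g v \<otimes> h z"]
  by (simp add: wsum_mult_left wsum_mult_right m_assoc)

lemma conv_ceps_left:
  assumes "\<And>w. f w \<in> carrier A" shows "conv A (ceps A) f w = f w"
  unfolding conv_def using assms by (subst wsum_bot) (simp_all add: ceps_def)

lemma conv_ceps_right:
  assumes "\<And>w. f w \<in> carrier A" shows "conv A f (ceps A) w = f w"
  unfolding conv_def using assms by (subst wsum_top) (simp_all add: ceps_def)

text \<open>Left and right convolution inverses agree. Through this the value of a morphism on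
  \<open>t^{-1}\<close> is recovered from its values on \<open>t\<close>.\<close>

lemma conv_inverse_unique:
  assumes "\<And>w. f w \<in> carrier A" "\<And>w. g w \<in> carrier A" "\<And>w. h w \<in> carrier A"
    "\<And>w. conv A g f w = ceps A w" "\<And>w. conv A f h w = ceps A w"
  shows "g w = h w"
proof -
  have "g w = conv A g (conv A f h) w"
    using conv_ceps_right[of g] assms by (simp add: conv_def)
  also have "\<dots> = conv A (conv A g f) h w" by (rule conv_assoc[symmetric]) fact+
  also have "\<dots> = h w"
    using conv_ceps_left[of h] assms by (simp add: conv_def)
  finally show ?thesis .
qed

lemma wsum_group: "edeg w = 0 \<Longrightarrow> (\<And>u v. f u v \<in> carrier A) \<Longrightarrow> wsum A w f = f w w"
proof (induction w arbitrary: f)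
  case (Cons a w)
  then show ?case by (cases a) simp_all
qed simp

end

section \<open>Independence of group-like elements\<close>

lemma finsum_univ_alg:
  assumes "calg (univ_alg \<eta>)" "finite K" shows "finsum (univ_alg \<eta>) f K = sum f K"
proof -
  interpret calg "univ_alg \<eta>" by fact
  show ?thesis using assms(2) by (induction rule: finite_induct) simp_all
qed

lemma psum_univ_alg:
  assumes "calg (univ_alg \<eta>)"
  shows "psum (univ_alg \<eta>) \<mu> c = (\<Sum>k\<in>Poly_Mapping.keys c. \<eta> (Poly_Mapping.lookup c k) * \<mu> k)"
  unfolding psum_def by (simp add: finsum_univ_alg[OF assms])

lemma (in cmod) psum_cong:
  assumes "\<And>k. k \<in> Poly_Mapping.keys c \<Longrightarrow> \<mu> k = \<nu> k" "\<And>k. k \<in> Poly_Mapping.keys c \<Longrightarrow> \<nu> k \<in> carrier A"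
  shows "psum A \<mu> c = psum A \<nu> c"
  unfolding psum_def by (rule finsum_cong') (use assms in auto)

lemma psum_complex: "psum complex_alg \<mu> c = (\<Sum>k\<in>Poly_Mapping.keys c. Poly_Mapping.lookup c k * \<mu> k)"
  using psum_univ_alg[of id \<mu> c] ccalg_complex by (simp add: complex_alg_def ccalg_def)

interpretation CC: ccalg complex_alg by (rule ccalg_complex)

lemma complex_alg_simps [simp]:
  "carrier complex_alg = UNIV" "mult complex_alg = (*)" "one complex_alg = 1"
  "zero complex_alg = 0" "add complex_alg = (+)" "smult complex_alg = (*)"
  by (simp_all add: complex_alg_def fun_eq_iff)

context wh
begin

definition grps :: "'a set" where "grps = {\<phi> w | w. edeg w = 0}"

lemma grps_carrier: "grps \<subseteq> carrier H"
  by (auto simp: grps_def)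

lemma grps_counit: "g \<in> grps \<Longrightarrow> counit H g = 1"
  by (auto simp: grps_def counit_word)

lemma counit_lin: "counit H \<in> lin_hom H complex_alg"
  by (rule alg_hom_lin[OF counit_hom])

text \<open>If a group-like element is a combination of independent group-likes with coefficients \<open>c\<close>,
  then comparing coefficients in its coproduct gives \<open>c i * c j = (if i = j then c i else 0)\<close>,
  so that it is one of them.\<close>

lemma indep_grps: "indep H grps"
proof -
  obtain M where "{} \<subseteq> M" and M: "M \<subseteq> grps" "indep H M" "\<And>x. x \<in> grps \<Longrightarrow> indep H (insert x M) \<Longrightarrow> x \<in> M"
    by (rule indep_maximal[OF indep_empty empty_subsetI, of grps]) (rule that; assumption)
  \<comment> \<open>Coordinate functionals for \<open>M\<close> are needed on all of
    \<open>H\<close>, hence the extension to a basis.\<close>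
  obtain X where X: "M \<subseteq> X" "is_basis H X" by (rule basis_extend[OF M(2)])
  have Mc: "k \<in> M \<Longrightarrow> k \<in> carrier H" for k using M(1) grps_carrier by auto
  have "g \<in> M" if g: "g \<in> grps" for g
  proof -
    have gc: "g \<in> carrier H" using g grps_carrier by auto
    obtain c where c: "Poly_Mapping.keys c \<subseteq> M" "lincomb H c = g"
      using maximal_indep_spans[OF M(2) M(3)[OF g] gc] by blast
    then have gp: "g = psum H (\<lambda>b. b) c" by (simp add: lincomb_psum)
    have ap: "h g = (\<Sum>k\<in>Poly_Mapping.keys c. Poly_Mapping.lookup c k * h k)"
      if "h \<in> lin_hom H complex_alg" for h
      unfolding gp using psum_hom[OF that cmod_axioms CC.cmod_axioms, of M "\<lambda>b. b" c] Mc c(1)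
      by (auto simp: psum_complex)
    have "\<exists>f. f \<in> lin_hom H complex_alg \<and> (\<forall>b\<in>X. f b = (if b = i then 1 else 0))" for i
    proof -
      obtain h where "h \<in> lin_hom H complex_alg" "\<And>b. b \<in> X \<Longrightarrow> h b = (if b = i then 1 else 0)"
        by (rule basis_lin_hom[OF X(2) CC.cmod_axioms, of "\<lambda>b. if b = i then 1 else 0"]) simp_all
      then show ?thesis by blast
    qed
    then have "\<exists>f. \<forall>i. f i \<in> lin_hom H complex_alg \<and> (\<forall>b\<in>X. f i b = (if b = i then 1 else 0))"
      by (intro choice) blast
    then obtain f where f: "\<And>i. f i \<in> lin_hom H complex_alg" "\<And>i b. b \<in> X \<Longrightarrow> f i b = (if b = i then 1 else 0)"
      by blast
    have fb: "f i k = (if k = i then 1 else 0)" if "k \<in> Poly_Mapping.keys c" for i k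
      using c(1) X(1) that by (intro f(2)) blast
    have fg: "f i g = Poly_Mapping.lookup c i" if "i \<in> M" for i
    proof -
      have "f i g = (\<Sum>k\<in>Poly_Mapping.keys c. if k = i then Poly_Mapping.lookup c k else 0)"
        unfolding ap[OF f(1)] by (rule sum.cong) (simp_all add: fb)
      also have "\<dots> = Poly_Mapping.lookup c i" by (simp add: in_keys_iff)
      finally show ?thesis .
    qed
    have prod: "f i g * f j g = (if i = j then f i g else 0)" if "i \<in> M" "j \<in> M" for i j
    proof -
      have bl: "blin H H complex_alg (\<lambda>a b. f i a * f j b)"
        using lin_homD[OF f(1)[of i]] lin_homD[OF f(1)[of j]]
        by (intro blinI lin_homI) (simp_all add: algebra_simps)
      \<comment> \<open>A product of two coordinates, taken through the coproduct. Its value at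
        \<open>g\<close> is computed twice: from \<open>g\<close> being group-like and from the
        expansion of \<open>g\<close> in \<open>M\<close>.\<close>
      define L where "L = (\<lambda>x. tlift complex_alg (\<lambda>a b. f i a * f j b) (comult H x))"
      have L: "L \<in> lin_hom H complex_alg"
        unfolding L_def by (intro lin_hom_compose[OF alg_hom_lin[OF comult_hom] HH.tlift_lin_hom[OF bl CC.cmod_axioms]])
      have Lg: "L k = f i k * f j k" if "k \<in> grps" for k
      proof -
        obtain w where w: "k = \<phi> w" "edeg w = 0" using \<open>k \<in> grps\<close> by (auto simp: grps_def)
        show ?thesis unfolding L_def w(1) sweedler[OF bl CC.cmod_axioms]
          by (subst CC.wsum_group[OF w(2)]) simp_all
      qed
      have "f i g * f j g = (\<Sum>k\<in>Poly_Mapping.keys c. Poly_Mapping.lookup c k * L k)"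
        unfolding Lg[OF g, symmetric] by (rule ap[OF L])
      also have "\<dots> = (\<Sum>k\<in>Poly_Mapping.keys c. Poly_Mapping.lookup c k * (f i k * f j k))"
      proof (rule sum.cong)
        fix k assume "k \<in> Poly_Mapping.keys c"
        then have "k \<in> grps" using c(1) M(1) by blast
        then show "Poly_Mapping.lookup c k * L k = Poly_Mapping.lookup c k * (f i k * f j k)"
          by (simp add: Lg)
      qed simp
      also have "\<dots> = (\<Sum>k\<in>Poly_Mapping.keys c. if i = j then Poly_Mapping.lookup c k * f i k else 0)"
        by (rule sum.cong) (simp_all add: fb)
      also have "\<dots> = (if i = j then f i g else 0)" using ap[OF f(1)[of i]] by auto
      finally show ?thesis .
    qed
    have "(\<Sum>k\<in>Poly_Mapping.keys c. Poly_Mapping.lookup c k * counit H k) = 1"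
      using ap[OF counit_lin] grps_counit[OF g] by simp
    \<comment> \<open>The counit is 1 on every group-like element, so the coefficients sum to 1 and
      one of them is nonzero.\<close>
    then obtain i where i: "i \<in> Poly_Mapping.keys c" by force
    then have iM: "i \<in> M" using c(1) by auto
    have fi: "f i g = 1" using prod[OF iM iM] fg[OF iM] i by (simp add: in_keys_iff)
    have z: "Poly_Mapping.lookup c k = 0" if "k \<noteq> i" for k
    proof (rule ccontr)
      assume nz: "Poly_Mapping.lookup c k \<noteq> 0"
      then have kM: "k \<in> M" using c(1) by (meson in_keys_iff subsetD)
      show False using prod[OF iM kM] fi fg[OF kM] nz that by simp
    qed
    have "c = Poly_Mapping.single i 1"
    proof (rule poly_mapping_eqI)
      fix k show "Poly_Mapping.lookup c k = Poly_Mapping.lookup (Poly_Mapping.single i 1) k"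
        using z[of k] fi fg[OF iM] by (cases "k = i") (simp_all add: lookup_single)
    qed
    then have "g = i" using gp Mc[OF iM] by (simp add: psum_single)
    then show ?thesis using iM by simp
  qed
  then have "M = grps" using M(1) by blast
  then show ?thesis using M(2) by simp
qed

section \<open>Convolution inverses\<close>

context
  fixes \<eta> :: "complex \<Rightarrow> 'b::field"
  assumes R: "calg (univ_alg \<eta>)"
begin

interpretation R: calg "univ_alg \<eta>" by (rule R)

abbreviation "RR \<equiv> univ_alg \<eta>"

lemma conv_lin_hom:
  assumes "a \<in> lin_hom H RR" "b \<in> lin_hom H RR"
  shows "(\<lambda>x. tlift RR (\<lambda>x1 x2. a x1 * b x2) (comult H x)) \<in> lin_hom H RR"
    and "tlift RR (\<lambda>x1 x2. a x1 * b x2) (comult H (\<phi> w)) = conv RR (\<lambda>u. a (\<phi> u)) (\<lambda>v. b (\<phi> v)) w"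
proof -
  have bl: "blin H H RR (\<lambda>x1 x2. a x1 * b x2)"
    using lin_homD[OF assms(1)] lin_homD[OF assms(2)] R.smult_mult_right
    by (intro blinI lin_homI) (simp_all add: algebra_simps)
  show "(\<lambda>x. tlift RR (\<lambda>x1 x2. a x1 * b x2) (comult H x)) \<in> lin_hom H RR"
    by (intro lin_hom_compose[OF alg_hom_lin[OF comult_hom] HH.tlift_lin_hom[OF bl R.cmod_axioms]])
  show "tlift RR (\<lambda>x1 x2. a x1 * b x2) (comult H (\<phi> w)) = conv RR (\<lambda>u. a (\<phi> u)) (\<lambda>v. b (\<phi> v)) w"
    by (simp add: sweedler[OF bl R.cmod_axioms] conv_def)
qed

text \<open>Invert \<open>F\<close> on the group-likes to get \<open>s0\<close>. The function \<open>h = \<epsilon> - s0 F\<close> vanishes on them, so the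
  partial sums \<open>sn\<close> of the geometric series \<open>s0 + h s0 + h h s0 + \<dots>\<close> are stationary on each word.\<close>

lemma conv_left_inverse_exists:
  assumes F: "F \<in> lin_hom H RR" and F_nz: "\<And>w. edeg w = 0 \<Longrightarrow> F (\<phi> w) \<noteq> 0"
  obtains s where "s \<in> lin_hom H RR" "\<And>w. conv RR (\<lambda>u. s (\<phi> u)) (\<lambda>v. F (\<phi> v)) w = ceps RR w"
proof -
  \<comment> \<open>Independence of the group-likes is what allows all the values
    \<open>1 / F g\<close> to be prescribed simultaneously.\<close>
  obtain X where X: "grps \<subseteq> X" "is_basis H X" by (rule basis_extend[OF indep_grps])
  obtain s0 where s0: "s0 \<in> lin_hom H RR" "\<And>b. b \<in> X \<Longrightarrow> s0 b = inverse (F b)"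
    using basis_lin_hom[OF X(2) R.cmod_axioms, of "\<lambda>b. inverse (F b)"] by auto
  have s0g: "s0 (\<phi> w) * F (\<phi> w) = 1" if "edeg w = 0" for w
    using that X(1) F_nz[OF that] by (subst s0(2)) (auto simp: grps_def)
  define cH where "cH = (\<lambda>a b x. tlift RR (\<lambda>x1 x2. a x1 * b x2) (comult H x))"
  have cH: "cH a b \<in> lin_hom H RR" if "a \<in> lin_hom H RR" "b \<in> lin_hom H RR" for a b
    unfolding cH_def by (rule conv_lin_hom(1)[OF that])
  have cHw: "cH a b (\<phi> w) = conv RR (\<lambda>u. a (\<phi> u)) (\<lambda>v. b (\<phi> v)) w"
    if "a \<in> lin_hom H RR" "b \<in> lin_hom H RR" for a b w
    unfolding cH_def by (rule conv_lin_hom(2)[OF that])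
  define h where "h = (\<lambda>x. \<eta> (counit H x) - cH s0 F x)"
  have \<eta>: "\<eta> (c + d) = \<eta> c + \<eta> d" "\<eta> (c * d) = \<eta> c * \<eta> d" "\<eta> 0 = 0" "\<eta> 1 = 1" for c d
    using R.smult_l_distr[of 1 c d] R.smult_assoc[of 1 c d] R.smult_zero_left[of 1] R.smult_one[of 1] by simp_all
  have h: "h \<in> lin_hom H RR"
    unfolding h_def using lin_homD[OF counit_lin] lin_homD[OF cH[OF s0(1) F]]
    by (intro lin_homI) (simp_all add: \<eta> algebra_simps)
  define sn where "sn = rec_nat s0 (\<lambda>_ s x. s0 x + cH h s x)"
  have sn0: "sn 0 = s0" and snS: "sn (Suc n) = (\<lambda>x. s0 x + cH h (sn n) x)" for n
    by (simp_all add: sn_def)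
  have sn: "sn n \<in> lin_hom H RR" for n
  proof (induction n)
    case (Suc n)
    then show ?case unfolding snS using lin_homD[OF s0(1)] lin_homD[OF cH[OF h Suc]]
      by (intro lin_homI) (simp_all add: algebra_simps)
  qed (simp add: sn0 s0(1))
  have hw: "h (\<phi> w) = ceps RR w - conv RR (\<lambda>u. s0 (\<phi> u)) (\<lambda>v. F (\<phi> v)) w" for w
    unfolding h_def cHw[OF s0(1) F] by (simp add: counit_word ceps_def \<eta>)
  have h0: "h (\<phi> w) = 0" if "edeg w = 0" for w
    using that s0g by (simp add: hw conv_def R.wsum_group ceps_def)
  have snw: "sn (Suc n) (\<phi> w) = s0 (\<phi> w) + conv RR (\<lambda>u. h (\<phi> u)) (\<lambda>v. sn n (\<phi> v)) w" for n w
    unfolding snS using cHw[OF h sn] by simp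
  have stable: "sn (Suc n) (\<phi> w) = sn n (\<phi> w)" if "edeg w \<le> n" for n w
    using that
  proof (induction n arbitrary: w)
    case 0
    then show ?case by (simp add: snw conv_def R.wsum_group h0) (simp add: sn0)
  next
    case (Suc n)
    \<comment> \<open>A term with \<open>edeg u = 0\<close> vanishes because \<open>h\<close> does.
      Otherwise \<open>edeg v\<close> is at most \<open>n\<close>, as the two degrees add up to
      \<open>edeg w\<close>, and the induction hypothesis applies to \<open>v\<close>.\<close>
    have "conv RR (\<lambda>u. h (\<phi> u)) (\<lambda>v. sn (Suc n) (\<phi> v)) w = conv RR (\<lambda>u. h (\<phi> u)) (\<lambda>v. sn n (\<phi> v)) w"
      unfolding conv_def
    proof (rule wsum_cong)
      fix u v assume "splits w u v"
      then show "h (\<phi> u) \<otimes>\<^bsub>RR\<^esub> sn (Suc n) (\<phi> v) = h (\<phi> u) \<otimes>\<^bsub>RR\<^esub> sn n (\<phi> v)"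
        using Suc h0[of u] by (cases "edeg u = 0") (simp_all add: splits_def)
    qed
    then show ?case by (simp only: snw)
  qed
  have stable': "sn m (\<phi> w) = sn n (\<phi> w)" if "edeg w \<le> n" "n \<le> m" for n m w
    using that(2,1) by (induction rule: dec_induct) (simp_all add: stable)
  have li: "conv RR (\<lambda>u. sn n (\<phi> u)) (\<lambda>v. F (\<phi> v)) w = ceps RR w" if "edeg w \<le> n" for n w
    using that
  proof (induction n arbitrary: w)
    case 0
    then show ?case by (simp add: sn0 conv_def R.wsum_group ceps_def s0g)
  next
    case (Suc n)
    let ?F = "\<lambda>v. F (\<phi> v)" and ?h = "\<lambda>u. h (\<phi> u)" and ?t = "\<lambda>u. s0 (\<phi> u)" and ?s = "\<lambda>u. sn n (\<phi> u)"
    have "conv RR (\<lambda>u. sn (Suc n) (\<phi> u)) ?F w = conv RR ?t ?F w + conv RR (conv RR ?h ?s) ?F w"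
      using R.wsum_add[of "\<lambda>u v. ?t u * ?F v" "\<lambda>u v. conv RR ?h ?s u * ?F v" w]
      by (simp add: conv_def[of RR _ ?F] snw distrib_right)
    also have "conv RR (conv RR ?h ?s) ?F w = conv RR ?h (conv RR ?s ?F) w"
      by (rule R.conv_assoc) simp_all
    also have "\<dots> = conv RR ?h (ceps RR) w"
      unfolding conv_def[of RR ?h]
    proof (rule wsum_cong)
      fix u v assume "splits w u v"
      then show "h (\<phi> u) \<otimes>\<^bsub>RR\<^esub> conv RR ?s ?F v = h (\<phi> u) \<otimes>\<^bsub>RR\<^esub> ceps RR v"
        using Suc h0[of u] by (cases "edeg u = 0") (simp_all add: splits_def)
    qed
    also have "\<dots> = h (\<phi> w)" by (rule R.conv_ceps_right) simp
    finally show ?case by (simp add: hw)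
  qed
  \<comment> \<open>The index from which \<open>sn\<close> is stationary grows with the word, so the
    limit is taken separately at each element; it exists on all of \<open>H\<close> because words
    span.\<close>
  define s where "s = (\<lambda>x. SOME y. \<exists>n. \<forall>m\<ge>n. sn m x = y)"
  have ex: "\<exists>y n. \<forall>m\<ge>n. sn m x = y" if "x \<in> carrier H" for x
    using that
  proof (induction rule: word_induct)
    case (word w)
    then show ?case using stable'[of w "edeg w"] by blast
  next
    case (smult c x)
    then obtain y n where "\<forall>m\<ge>n. sn m x = y" by blast
    then show ?case using lin_homD(3)[OF sn smult(1)] by (intro exI[of _ "\<eta> c * y"] exI[of _ n]) simp
  next
    case (add x x')
    then obtain y n y' n' where "\<forall>m\<ge>n. sn m x = y" "\<forall>m\<ge>n'. sn m x' = y'" by blast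
    then show ?case using lin_homD(2)[OF sn add(1,2)]
      by (intro exI[of _ "y + y'"] exI[of _ "max n n'"]) simp
  qed
  have s_eq: "s x = y" if "\<forall>m\<ge>n. sn m x = y" for x y and n :: nat
    unfolding s_def
  proof (rule some_equality)
    show "\<exists>n. \<forall>m\<ge>n. sn m x = y" using that by blast
    fix z assume "\<exists>n. \<forall>m\<ge>n. sn m x = z"
    then obtain n' where "\<forall>m\<ge>n'. sn m x = z" by blast
    then have "sn (max n n') x = z" by simp
    then show "z = y" using that by simp
  qed
  have s_ev: "\<exists>n. \<forall>m\<ge>n. sn m x = s x" if "x \<in> carrier H" for x
    using ex[OF that] s_eq by metis
  have "s \<in> lin_hom H RR"
  proof (rule lin_homI)
    fix c x assume x: "x \<in> carrier H"
    obtain n where "\<forall>m\<ge>n. sn m x = s x" using s_ev[OF x] by blast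
    then show "s (c \<odot> x) = c \<odot>\<^bsub>RR\<^esub> s x"
      using lin_homD(3)[OF sn x] by (intro s_eq[of n]) simp
  next
    fix x y assume xy: "x \<in> carrier H" "y \<in> carrier H"
    obtain n n' where "\<forall>m\<ge>n. sn m x = s x" "\<forall>m\<ge>n'. sn m y = s y"
      using s_ev xy by blast
    then show "s (x \<oplus> y) = s x \<oplus>\<^bsub>RR\<^esub> s y"
      using lin_homD(2)[OF sn xy] by (intro s_eq[of "max n n'"]) simp
  qed simp
  moreover have "conv RR (\<lambda>u. s (\<phi> u)) (\<lambda>v. F (\<phi> v)) w = ceps RR w" for w
  proof -
    \<comment> \<open>The left factors occurring for \<open>w\<close> have degree at most
      \<open>edeg w\<close>, so one index serves for the whole sum.\<close>
    have sw: "s (\<phi> u) = sn (edeg w) (\<phi> u)" if "edeg u \<le> edeg w" for u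
      by (rule s_eq[of "edeg w"]) (use stable' that in blast)
    have "conv RR (\<lambda>u. s (\<phi> u)) (\<lambda>v. F (\<phi> v)) w = conv RR (\<lambda>u. sn (edeg w) (\<phi> u)) (\<lambda>v. F (\<phi> v)) w"
      unfolding conv_def by (rule wsum_cong) (auto simp: splits_def sw)
    then show ?thesis using li by simp
  qed
  ultimately show thesis by (rule that)
qed

end

text \<open>The left inverse \<open>s\<close> is again nonzero on group-likes and so has a left
  inverse of its own, which must be \<open>F\<close>; thus \<open>s\<close> is also a right
  inverse.\<close>

lemma conv_inverse_exists:
  fixes \<eta> :: "complex \<Rightarrow> 'b::field" and F :: "'a \<Rightarrow> 'b"
  assumes R: "calg (univ_alg \<eta>)"
    and F: "F \<in> lin_hom H (univ_alg \<eta>)" and F_nz: "\<And>w. edeg w = 0 \<Longrightarrow> F (\<phi> w) \<noteq> 0"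
  obtains s where "s \<in> lin_hom H (univ_alg \<eta>)"
    "\<And>w. conv (univ_alg \<eta>) (\<lambda>u. s (\<phi> u)) (\<lambda>v. F (\<phi> v)) w = ceps (univ_alg \<eta>) w"
    "\<And>w. conv (univ_alg \<eta>) (\<lambda>u. F (\<phi> u)) (\<lambda>v. s (\<phi> v)) w = ceps (univ_alg \<eta>) w"
proof -
  interpret R: calg "univ_alg \<eta>" by fact
  obtain s where s: "s \<in> lin_hom H (univ_alg \<eta>)"
    "\<And>w. conv (univ_alg \<eta>) (\<lambda>u. s (\<phi> u)) (\<lambda>v. F (\<phi> v)) w = ceps (univ_alg \<eta>) w"
    using conv_left_inverse_exists[OF assms] by blast
  have s_nz: "s (\<phi> w) \<noteq> 0" if "edeg w = 0" for w
    using s(2)[of w] that by (auto simp: conv_def R.wsum_group ceps_def)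
  obtain F' where F': "F' \<in> lin_hom H (univ_alg \<eta>)"
    "\<And>w. conv (univ_alg \<eta>) (\<lambda>u. F' (\<phi> u)) (\<lambda>v. s (\<phi> v)) w = ceps (univ_alg \<eta>) w"
    using conv_left_inverse_exists[OF R s(1) s_nz] by blast
  have "F' (\<phi> w) = F (\<phi> w)" for w
    using R.conv_inverse_unique[of "\<lambda>w. s (\<phi> w)" "\<lambda>w. F' (\<phi> w)" "\<lambda>w. F (\<phi> w)"] F'(2) s(2) by simp
  then show thesis using that[OF s] F'(2) by simp
qed

end

section \<open>The field of fractions of the symmetric algebra\<close>

lemma Fract_eq: "b \<noteq> 0 \<Longrightarrow> d \<noteq> 0 \<Longrightarrow> Fract a b = Fract c d \<longleftrightarrow> a * d = c * b"
  by (rule eq_fract(1))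

lemma sym_const_simps:
  "sym_const (c + d) = sym_const c + sym_const d" "sym_const (c * d) = sym_const c * sym_const d"
  "sym_const 1 = 1" "sym_const 0 = 0"
  by (simp_all add: sym_const_def single_add mult_single One_fract_def Zero_fract_def)

lemma calg_symfrac: "calg (univ_alg sym_const)"
  by (rule calg_univ_alg) (simp_all add: sym_const_simps mult.commute)

lemma ccalg_symfrac: "ccalg symfrac_alg"
  unfolding symfrac_alg_def by (rule ccalgI[OF calg_symfrac]) (simp add: mult.commute)

lemma symfrac_alg_simps [simp]:
  "carrier symfrac_alg = UNIV" "mult symfrac_alg = (*)" "one symfrac_alg = 1"
  "zero symfrac_alg = 0" "add symfrac_alg = (+)" "smult symfrac_alg = (\<lambda>c x. sym_const c * x)"
  by (simp_all add: symfrac_alg_def)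

interpretation SF: ccalg symfrac_alg by (rule ccalg_symfrac)

abbreviation poly_alg :: "(complex, 'a sympoly) module" where
  "poly_alg \<equiv> univ_alg (Poly_Mapping.single 0)"

interpretation PA: calg poly_alg by (rule calg_monoid_alg)

definition pvar :: "'a \<Rightarrow> 'a sympoly" where
  "pvar b = Poly_Mapping.single (Poly_Mapping.single (Abs_ordcopy b) 1) 1"

text \<open>The polynomial behind \<open>tvar\<close>. Polynomials, unlike elements of the field of
  fractions, can be evaluated in every commutative algebra.\<close>

definition tpoly :: "(complex, 'a, 'm) module_scheme \<Rightarrow> 'a \<Rightarrow> 'a sympoly" where
  "tpoly H x = psum poly_alg pvar (coords H x)"

lemma Fract_alg_hom: "(\<lambda>p. Fract p 1) \<in> alg_hom poly_alg symfrac_alg"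
  by (intro alg_homI lin_homI) (simp_all add: sym_const_def One_fract_def)

lemma tvar_Fract: "tvar H x = Fract (tpoly H x) 1"
  unfolding tpoly_def
  by (subst psum_hom[OF alg_hom_lin[OF Fract_alg_hom] PA.cmod_axioms SF.cmod_axioms, of UNIV])
    (simp_all add: tvar_def sym_var_def pvar_def symfrac_alg_def psum_univ_alg[OF calg_symfrac])

text \<open>Distinct variables are distinct monomials, so the coordinates of \<open>x\<close> can be
  read off; hence \<open>t_x\<close> is nonzero for nonzero \<open>x\<close>.\<close>

lemma lookup_tpoly: "Poly_Mapping.lookup (tpoly H x) (Poly_Mapping.single (Abs_ordcopy b) 1)
  = Poly_Mapping.lookup (coords H x) b"
proof -
  let ?m = "Poly_Mapping.single (Abs_ordcopy b) (1::nat)"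
  have l: "(\<lambda>p. Poly_Mapping.lookup p ?m) \<in> lin_hom poly_alg complex_alg"
    by (rule lin_homI) (simp_all add: lookup_add flip: mult_map_scale_conv_mult)
  have v: "Poly_Mapping.lookup (pvar a) ?m = (if a = b then 1 else 0)" for a
  proof -
    have "a = b" if "Poly_Mapping.single (Abs_ordcopy a) (1::nat) = Poly_Mapping.single (Abs_ordcopy b) 1"
      using arg_cong[OF that, of Poly_Mapping.keys] by (simp add: Abs_ordcopy_inject)
    then show ?thesis by (auto simp: pvar_def lookup_single when_def)
  qed
  show ?thesis
    unfolding tpoly_def
    by (subst psum_hom[OF l PA.cmod_axioms CC.cmod_axioms, of UNIV]) (simp_all add: psum_complex v in_keys_iff if_distrib cong: if_cong del: One_nat_def)
qed

context cmod
begin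

lemma tvar_lin: "tvar A \<in> lin_hom A symfrac_alg"
proof -
  have "tvar A = (\<lambda>x. psum symfrac_alg sym_var (crd A (some_basis A) x))"
    by (simp add: fun_eq_iff tvar_def coords_crd symfrac_alg_def psum_univ_alg[OF calg_symfrac])
  then show ?thesis
    using psum_crd_lin_hom[OF is_basis_some_basis SF.cmod_axioms, of sym_var] by simp
qed

lemma tpoly_nonzero:
  assumes "x \<in> carrier A" "x \<noteq> \<zero>" shows "tpoly A x \<noteq> 0"
proof
  assume "tpoly A x = 0"
  then have "coords A x = 0" using lookup_tpoly[of A x] by (intro poly_mapping_eqI) simp
  then have "x = \<zero>" using crd(2)[OF is_basis_some_basis assms(1)] by (simp add: coords_crd)
  then show False using assms(2) by simp
qed

lemma tvar_nonzero: "x \<in> carrier A \<Longrightarrow> x \<noteq> \<zero> \<Longrightarrow> tvar A x \<noteq> 0"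
  using tpoly_nonzero by (simp add: tvar_Fract Zero_fract_def Fract_eq)

end

section \<open>Polynomial evaluation\<close>

context ccalg
begin

definition mono_eval :: "('i \<Rightarrow> 'a) \<Rightarrow> ('i \<Rightarrow>\<^sub>0 nat) \<Rightarrow> 'a" where
  "mono_eval v m = (\<Otimes>i\<in>Poly_Mapping.keys m. v i [^] Poly_Mapping.lookup m i)"

lemma mono_eval_superset:
  assumes "\<And>i. v i \<in> carrier A" "finite K" "Poly_Mapping.keys m \<subseteq> K"
  shows "mono_eval v m = (\<Otimes>i\<in>K. v i [^] Poly_Mapping.lookup m i)"
  unfolding mono_eval_def
  by (rule finprod_mono_neutral_cong_left) (use assms in \<open>auto simp: in_keys_iff\<close>)

lemma mono_eval_add:
  assumes "\<And>i. v i \<in> carrier A"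
  shows "mono_eval v (m + n) = mono_eval v m \<otimes> mono_eval v n"
proof -
  let ?K = "Poly_Mapping.keys m \<union> Poly_Mapping.keys n"
  have "mono_eval v (m + n) = (\<Otimes>i\<in>?K. v i [^] Poly_Mapping.lookup m i \<otimes> v i [^] Poly_Mapping.lookup n i)"
    using assms Poly_Mapping.keys_add[of m n]
    by (subst mono_eval_superset[of v ?K]) (simp_all add: lookup_add nat_pow_mult)
  also have "\<dots> = mono_eval v m \<otimes> mono_eval v n"
    using assms by (subst finprod_multf) (simp_all add: mono_eval_superset[of v ?K] Pi_iff)
  finally show ?thesis .
qed

lemma mono_eval_closed: "(\<And>i. v i \<in> carrier A) \<Longrightarrow> mono_eval v m \<in> carrier A"
  unfolding mono_eval_def by (rule finprod_closed) auto

lemma mono_eval_single: "(\<And>i. v i \<in> carrier A) \<Longrightarrow> mono_eval v (Poly_Mapping.single i 1) = v i"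
  by (subst mono_eval_superset[of v "{i}"]) (simp_all add: finprod_insert)

lemma poly_eval_hom:
  assumes "\<And>i. v i \<in> carrier A"
  shows "psum A (mono_eval v) \<in> alg_hom (univ_alg (Poly_Mapping.single 0)) A"
  by (rule monoid_alg_hom) (simp_all add: calg_axioms mono_eval_closed mono_eval_add assms,
      simp add: mono_eval_def)

end

section \<open>The free commutative Hopf algebra\<close>

context wh
begin

abbreviation tw where "tw w \<equiv> tvar H (\<phi> w)"
abbreviation iw where "iw w \<equiv> tinv H (\<phi> w)"

lemma group_word_nonzero: "edeg w = 0 \<Longrightarrow> \<phi> w \<noteq> \<zero>"
  using counit_word[of w] lin_hom_zero[OF counit_lin cmod_axioms CC.cmod_axioms] by auto

lemma tw_nonzero: "edeg w = 0 \<Longrightarrow> tw w \<noteq> 0"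
  using tvar_nonzero[OF word_closed] group_word_nonzero by blast

lemma conv_symfrac:
  assumes "a \<in> lin_hom H symfrac_alg" "b \<in> lin_hom H symfrac_alg"
  shows "(\<lambda>x. tlift symfrac_alg (\<lambda>x1 x2. a x1 * b x2) (comult H x)) \<in> lin_hom H symfrac_alg"
    and "tlift symfrac_alg (\<lambda>x1 x2. a x1 * b x2) (comult H (\<phi> w))
      = conv symfrac_alg (\<lambda>u. a (\<phi> u)) (\<lambda>v. b (\<phi> v)) w"
  using conv_lin_hom[OF calg_symfrac assms[unfolded symfrac_alg_def], folded symfrac_alg_def] .

lemma sym_counit_lin: "(\<lambda>x. sym_const (counit H x)) \<in> lin_hom H symfrac_alg"
  using lin_homD[OF counit_lin] by (intro lin_homI) (simp_all add: sym_const_simps)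

text \<open>The inverse exists because \<open>t\<close> is nonzero on group-likes. It is unique as a
  linear map because it is unique on words, which span.\<close>

lemma tinv_spec:
  "tinv H \<in> lin_hom H symfrac_alg"
  "conv symfrac_alg iw tw w = ceps symfrac_alg w"
  "conv symfrac_alg tw iw w = ceps symfrac_alg w"
proof -
  obtain s where s: "s \<in> lin_hom H symfrac_alg"
    "\<And>w. conv symfrac_alg (\<lambda>u. s (\<phi> u)) tw w = ceps symfrac_alg w"
    "\<And>w. conv symfrac_alg tw (\<lambda>u. s (\<phi> u)) w = ceps symfrac_alg w"
    using conv_inverse_exists[OF calg_symfrac tvar_lin[unfolded symfrac_alg_def] tw_nonzero, folded symfrac_alg_def]
    by blast
  have r: "restrict s (carrier H) \<in> lin_hom H symfrac_alg"
    by (rule lin_hom_cong[OF s(1)]) (simp_all add: cmod_axioms)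
  have eps: "sym_const (counit H (\<phi> w)) = ceps symfrac_alg w" for w
    by (simp add: counit_word ceps_def sym_const_simps)
  have tinv: "tinv H = restrict s (carrier H)"
    unfolding tinv_def
  proof (rule the_restrict, goal_cases)
    case 1
    have "tlift symfrac_alg (\<lambda>x1 x2. restrict s (carrier H) x1 * tvar H x2) (comult H x) = sym_const (counit H x)"
      if "x \<in> carrier H" for x
      using that by (rule word_lin_eqI[OF conv_symfrac(1)[OF r tvar_lin] sym_counit_lin, rotated])
        (simp only: conv_symfrac(2)[OF r tvar_lin] eps, simp add: s(2))
    moreover have "tlift symfrac_alg (\<lambda>x1 x2. tvar H x1 * restrict s (carrier H) x2) (comult H x) = sym_const (counit H x)"
      if "x \<in> carrier H" for x
      using that by (rule word_lin_eqI[OF conv_symfrac(1)[OF tvar_lin r] sym_counit_lin, rotated])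
        (simp only: conv_symfrac(2)[OF tvar_lin r] eps, simp add: s(3))
    ultimately show ?case using r by simp
  next
    case (2 g) then show ?case by simp
  next
    case (3 g x)
    have g: "g \<in> lin_hom H symfrac_alg" using 3 by simp
    have gi: "conv symfrac_alg (\<lambda>u. g (\<phi> u)) tw w = ceps symfrac_alg w" for w
      using 3(1) conv_symfrac(2)[OF g tvar_lin, of w] eps[of w] by (metis word_closed)
    have "g (\<phi> w) = s (\<phi> w)" for w
      using SF.conv_inverse_unique[of tw "\<lambda>w. g (\<phi> w)" "\<lambda>w. s (\<phi> w)"] gi s(3) by simp
    then show ?case using word_lin_eqI[OF g s(1)] 3(2) by blast
  qed
  show "tinv H \<in> lin_hom H symfrac_alg" unfolding tinv by (rule r)
  show "conv symfrac_alg iw tw w = ceps symfrac_alg w" "conv symfrac_alg tw iw w = ceps symfrac_alg w"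
    unfolding tinv using s(2,3) by simp_all
qed

lemma tinv_group: "edeg w = 0 \<Longrightarrow> iw w * tw w = 1"
  using tinv_spec(2)[of w] by (simp add: conv_def SF.wsum_group ceps_def)

text \<open>The multiplicative set generated by the \<open>t_g\<close> with \<open>g\<close> a
  group-like word. A map sending these to units extends from polynomials to the fractions in
  \<open>Loc\<close>, and \<open>Loc\<close> contains all of \<open>S_H\<close>.\<close>

inductive_set gpolys :: "'a sympoly set" where
  one: "1 \<in> gpolys"
| mult: "edeg w = 0 \<Longrightarrow> s \<in> gpolys \<Longrightarrow> tpoly H (\<phi> w) * s \<in> gpolys"

lemma gpolys_nonzero: "s \<in> gpolys \<Longrightarrow> s \<noteq> 0"
  by (induction rule: gpolys.induct) (simp_all add: tpoly_nonzero group_word_nonzero)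

lemma gpolys_times: "s \<in> gpolys \<Longrightarrow> s' \<in> gpolys \<Longrightarrow> s * s' \<in> gpolys"
  by (induction rule: gpolys.induct) (simp_all add: gpolys.mult mult.assoc)

definition Loc :: "'a symfrac set" where "Loc = {Fract a s | a s. s \<in> gpolys}"

lemma LocI: "s \<in> gpolys \<Longrightarrow> Fract a s \<in> Loc"
  by (auto simp: Loc_def)

lemma Loc_add: "x \<in> Loc \<Longrightarrow> y \<in> Loc \<Longrightarrow> x + y \<in> Loc"
  by (auto simp: Loc_def gpolys_nonzero) (metis gpolys_times)

lemma Loc_mult: "x \<in> Loc \<Longrightarrow> y \<in> Loc \<Longrightarrow> x * y \<in> Loc"
  by (auto simp: Loc_def) (metis gpolys_times)

lemma Loc_tvar: "tvar H x \<in> Loc"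
  unfolding tvar_Fract by (rule LocI[OF gpolys.one])

lemma Loc_const: "sym_const c \<in> Loc"
  unfolding sym_const_def by (rule LocI[OF gpolys.one])

lemma Loc_tvar_inverse: "edeg w = 0 \<Longrightarrow> inverse (tw w) \<in> Loc"
  using LocI[OF gpolys.mult[OF _ gpolys.one], of w 1] by (simp add: tvar_Fract)

text \<open>In the inverse relation at \<open>w\<close>, every term whose right factor is not
  group-like has a left factor of smaller degree. The remaining term is \<open>iw w\<close> times
  the \<open>t\<close> of \<open>wtop w\<close>, whose inverse is in \<open>Loc\<close>, so the
  relation can be solved for \<open>iw w\<close>.\<close>

lemma Loc_iw: "iw w \<in> Loc"
proof (induction "edeg w" arbitrary: w rule: less_induct)
  case less
  let ?g = "\<lambda>u v. if edeg v = 0 then iw u * tw v else 0"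
  let ?r = "\<lambda>u v. if edeg v = 0 then 0 else iw u * tw v"
  have "wsum symfrac_alg w (\<lambda>u v. iw u * tw v) = wsum symfrac_alg w (\<lambda>u v. ?g u v + ?r u v)"
    by (rule wsum_cong) simp
  also have "\<dots> = wsum symfrac_alg w ?g + wsum symfrac_alg w ?r"
    using SF.wsum_add[of ?g ?r w] by simp
  also have "wsum symfrac_alg w ?g = iw w * tw (wtop w)"
    by (subst SF.wsum_top) simp_all
  finally have eq: "iw w * tw (wtop w) = ceps symfrac_alg w - wsum symfrac_alg w ?r"
    using tinv_spec(2)[of w] by (simp add: conv_def eq_diff_eq)
  have "wsum symfrac_alg w ?r \<in> Loc"
  proof (rule wsum_induct[where P = "\<lambda>x. x \<in> Loc"])
    fix u v assume "splits w u v"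
    then show "?r u v \<in> Loc" using less Loc_const[of 0]
      by (auto simp: splits_def sym_const_simps intro: Loc_mult Loc_tvar)
  qed (simp add: Loc_add)
  moreover have "ceps symfrac_alg w \<in> Loc"
    using Loc_const[of 0] Loc_const[of 1] by (simp add: ceps_def sym_const_simps)
  ultimately have "ceps symfrac_alg w + sym_const (- 1) * wsum symfrac_alg w ?r \<in> Loc"
    by (intro Loc_add Loc_mult Loc_const)
  moreover have "sym_const (- 1) = (- 1 :: 'a symfrac)"
    using sym_const_simps(1)[of 1 "-1"] by (simp add: sym_const_simps eq_neg_iff_add_eq_0 add.commute)
  ultimately have "iw w * tw (wtop w) \<in> Loc" unfolding eq by (simp only: mult_minus1 diff_conv_add_uminus)
  then have "iw w * tw (wtop w) * inverse (tw (wtop w)) \<in> Loc"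
    by (rule Loc_mult[OF _ Loc_tvar_inverse]) simp
  then show ?case using tw_nonzero[of "wtop w"] by (simp add: mult.assoc)
qed

lemma Loc_tinv: "x \<in> carrier H \<Longrightarrow> tinv H x \<in> Loc"
  by (induction rule: word_induct)
    (simp_all add: Loc_iw lin_homD[OF tinv_spec(1)] Loc_add Loc_mult Loc_const)

abbreviation "S \<equiv> S_alg H"

lemma S_same: "mult S = (*)" "one S = 1" "zero S = 0" "add S = (+)" "smult S = (\<lambda>c x. sym_const c * x)"
  by (simp_all add: S_alg_def)

lemma S_carrier: "carrier S = subalg_gen symfrac_alg (tvar H ` carrier H \<union> tinv H ` carrier H)"
  by (simp add: S_alg_def)

declare S_same [simp]

lemma S_subset_Loc: "x \<in> carrier S \<Longrightarrow> x \<in> Loc"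
  unfolding S_carrier
  by (induction rule: subalg_gen.induct)
    (auto intro: Loc_tvar Loc_tinv Loc_add Loc_mult Loc_const simp: Loc_const[of 1, simplified sym_const_simps])

lemma S_Fract: "x \<in> carrier S \<Longrightarrow> \<exists>a s. x = Fract a s \<and> s \<in> gpolys"
  using S_subset_Loc[of x] unfolding Loc_def by simp

lemma calg_S: "calg S"
  unfolding S_alg_def by (rule calg_subalg_gen[OF SF.calg_axioms]) simp

lemma ccalg_S: "ccalg S"
  by (rule ccalgI[OF calg_S]) (simp add: mult.commute)

lemma tvar_S [simp, intro]: "x \<in> carrier H \<Longrightarrow> tvar H x \<in> carrier S"
  and tinv_S [simp, intro]: "x \<in> carrier H \<Longrightarrow> tinv H x \<in> carrier S"
  unfolding S_carrier by (auto intro: subalg_gen.incl)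

lemma tvar_S_lin: "tvar H \<in> lin_hom H S"
  using lin_homD[OF tvar_lin] by (intro lin_homI) simp_all

lemma tinv_S_lin: "tinv H \<in> lin_hom H S"
  using lin_homD[OF tinv_spec(1)] by (intro lin_homI) simp_all

sublocale S: ccalg S by (rule ccalg_S)

lemma S_closed [simp, intro]: "x \<in> carrier S \<Longrightarrow> y \<in> carrier S \<Longrightarrow> x * y \<in> carrier S"
  "x \<in> carrier S \<Longrightarrow> y \<in> carrier S \<Longrightarrow> x + y \<in> carrier S" "1 \<in> carrier S" "0 \<in> carrier S"
  "x \<in> carrier S \<Longrightarrow> sym_const c * x \<in> carrier S"
  using S.m_closed[of x y] S.a_closed[of x y] S.one_closed S.zero_closed S.smult_closed[of x c] by simp_all

sublocale SS: tens S S ..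

lemma wsum_S: "wsum S w f = wsum symfrac_alg w f"
proof (induction w arbitrary: f)
  case (Cons a w)
  then show ?case by (cases a) simp_all
qed simp

lemma S_inverse: "conv S iw tw w = ceps S w" "conv S tw iw w = ceps S w"
  using tinv_spec(2,3)[of w] by (simp_all add: conv_def wsum_S ceps_def)

lemma tw_unit: "edeg w = 0 \<Longrightarrow> tw w \<in> Units S"
  using tinv_group[of w] unfolding Units_def by (auto simp: mult.commute intro!: bexI[of _ "iw w"])

lemma hom_conv_inverse:
  assumes "h \<in> alg_hom S R" "calg R"
  shows "conv R (\<lambda>w. h (iw w)) (\<lambda>w. h (tw w)) w = ceps R w"
    "conv R (\<lambda>w. h (tw w)) (\<lambda>w. h (iw w)) w = ceps R w"
proof -
  interpret R: calg R by fact
  note hD = alg_homD[OF assms(1)]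
  have hc: "h (conv S f g w) = conv R (\<lambda>w. h (f w)) (\<lambda>w. h (g w)) w"
    if "\<And>w. f w \<in> carrier S" "\<And>w. g w \<in> carrier S" for f g
    unfolding conv_def using that hD(4)
    by (subst wsum_hom[OF alg_hom_lin[OF assms(1)] S.cmod_axioms]) simp_all
  have he: "h (ceps S w) = ceps R w"
    using hD(5) alg_hom_zero[OF assms(1) S.calg_axioms assms(2)] by (simp add: ceps_def)
  show "conv R (\<lambda>w. h (iw w)) (\<lambda>w. h (tw w)) w = ceps R w"
    using arg_cong[OF S_inverse(1)[of w], of h] hc[of iw tw] he by simp
  show "conv R (\<lambda>w. h (tw w)) (\<lambda>w. h (iw w)) w = ceps R w"
    using arg_cong[OF S_inverse(2)[of w], of h] hc[of tw iw] he by simp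
qed

text \<open>A morphism carries \<open>t^{-1}\<close> to a convolution inverse of the image of
  \<open>t\<close>, and such an inverse is unique.\<close>

lemma hom_tinv_unique:
  assumes "h \<in> alg_hom S R" "calg R" "g \<in> lin_hom H R"
    "\<And>w. conv R (\<lambda>w. h (tw w)) (\<lambda>w. g (\<phi> w)) w = ceps R w" "x \<in> carrier H"
  shows "h (tinv H x) = g x"
proof -
  interpret R: calg R by fact
  note hD = alg_homD[OF assms(1)]
  have "h (iw w) = g (\<phi> w)" for w
    using R.conv_inverse_unique[of "\<lambda>w. h (tw w)" "\<lambda>w. h (iw w)" "\<lambda>w. g (\<phi> w)"]
      hom_conv_inverse(1)[OF assms(1,2)] assms(4) hD(1) lin_homD(1)[OF assms(3)] by simp
  then show ?thesis
    by (rule word_lin_eqI[OF lin_hom_compose[OF tinv_S_lin alg_hom_lin[OF assms(1)]] assms(3)]) (rule assms(5))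
qed

text \<open>\<open>S_H\<close> is generated by \<open>t\<close> and \<open>t^{-1}\<close>, and the
  values on the latter are forced by those on the former.\<close>

lemma S_hom_eqI:
  assumes "h \<in> alg_hom S R" "g \<in> alg_hom S R" "calg R" "\<And>w. h (tw w) = g (tw w)" "x \<in> carrier S"
  shows "h x = g x"
proof (rule alg_hom_eqI[OF assms(1,2) S.calg_axioms])
  have G: "tvar H ` carrier H \<union> tinv H ` carrier H \<subseteq> carrier S" by auto
  show "tvar H ` carrier H \<union> tinv H ` carrier H \<subseteq> carrier S" by (rule G)
  have "y \<in> subalg_gen S (tvar H ` carrier H \<union> tinv H ` carrier H)"
    if "y \<in> subalg_gen symfrac_alg (tvar H ` carrier H \<union> tinv H ` carrier H)" for y
    using that
  proof induction
    case one then show ?case using subalg_gen.one[of S] by simp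
  next
    case (add x y) then show ?case using subalg_gen.add[of x S _ y] by simp
  next
    case (mult x y) then show ?case using subalg_gen.mult[of x S _ y] by simp
  next
    case (smult x c) then show ?case using subalg_gen.smult[of x S _ c] by simp
  qed (rule subalg_gen.incl)
  then show "x \<in> subalg_gen S (tvar H ` carrier H \<union> tinv H ` carrier H)"
    using assms(5) by (simp add: S_carrier)
  fix y assume "y \<in> tvar H ` carrier H \<union> tinv H ` carrier H"
  then show "h y = g y"
  proof
    assume "y \<in> tvar H ` carrier H"
    then show ?thesis
      using word_lin_eqI[OF lin_hom_compose[OF tvar_S_lin alg_hom_lin[OF assms(1)]]
          lin_hom_compose[OF tvar_S_lin alg_hom_lin[OF assms(2)]] assms(4)] by auto
  next
    assume "y \<in> tinv H ` carrier H"
    moreover have "h (tinv H x) = g (tinv H x)" if "x \<in> carrier H" for x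
      by (rule hom_tinv_unique[OF assms(1,3) lin_hom_compose[OF tinv_S_lin alg_hom_lin[OF assms(2)]] _ that])
        (simp add: assms(4) hom_conv_inverse(2)[OF assms(2,3)])
    ultimately show ?thesis by auto
  qed
qed

context
  fixes R :: "(complex, 'c, 'n) module_scheme" and F :: "'a \<Rightarrow> 'c"
  assumes R: "ccalg R" and F: "F \<in> lin_hom H R" and F_unit: "\<And>w. edeg w = 0 \<Longrightarrow> F (\<phi> w) \<in> Units R"
begin

interpretation R: ccalg R by (rule R)

text \<open>The polynomial ring has a variable for each element of the type. Those outside the
  chosen basis do not occur in \<open>tvar\<close>; they receive the default value one.\<close>

definition var_val :: "'a ordcopy \<Rightarrow> 'c" where
  "var_val i = (if Rep_ordcopy i \<in> some_basis H then F (Rep_ordcopy i) else \<one>\<^bsub>R\<^esub>)"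

definition peval :: "'a sympoly \<Rightarrow> 'c" where "peval = psum R (R.mono_eval var_val)"

lemma var_val_closed: "var_val i \<in> carrier R"
  using lin_homD(1)[OF F] basis_carrier[OF is_basis_some_basis] by (simp add: var_val_def)

lemma peval_hom: "peval \<in> alg_hom poly_alg R"
  unfolding peval_def by (rule R.poly_eval_hom[OF var_val_closed])

lemmas pevalD = alg_homD[OF peval_hom, simplified]

lemma peval_tpoly: "x \<in> carrier H \<Longrightarrow> peval (tpoly H x) = F x"
proof -
  assume x: "x \<in> carrier H"
  let ?c = "coords H x"
  have kc: "Poly_Mapping.keys ?c \<subseteq> some_basis H" and px: "psum H (\<lambda>b. b) ?c = x"
    using crd[OF is_basis_some_basis x] by (simp_all add: coords_crd)
  have v: "peval (pvar b) = F b" if "b \<in> some_basis H" for b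
    using that var_val_closed lin_homD(1)[OF F basis_carrier[OF is_basis_some_basis that]] unfolding peval_def pvar_def
    by (subst R.psum_single)
      (simp_all add: R.mono_eval_closed R.mono_eval_single[simplified] var_val_def Abs_ordcopy_inverse)
  have "peval (tpoly H x) = psum R (\<lambda>b. peval (pvar b)) ?c"
    unfolding tpoly_def
    by (rule psum_hom[OF alg_hom_lin[OF peval_hom] PA.cmod_axioms R.cmod_axioms, of UNIV]) simp_all
  also have "\<dots> = psum R (\<lambda>b. F b) ?c"
    using kc v lin_homD(1)[OF F] basis_carrier[OF is_basis_some_basis] by (intro R.psum_cong) auto
  also have "\<dots> = F x"
    using psum_hom[OF F cmod_axioms R.cmod_axioms _ kc, of "\<lambda>b. b"] basis_carrier[OF is_basis_some_basis] px
    by simp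
  finally show ?thesis .
qed

lemma peval_unit: "s \<in> gpolys \<Longrightarrow> peval s \<in> Units R"
  by (induction rule: gpolys.induct) (simp_all add: pevalD peval_tpoly F_unit)

definition seval :: "'a symfrac \<Rightarrow> 'c" where
  "seval z = (THE r. \<exists>a s. s \<in> gpolys \<and> z = Fract a s \<and> r = peval a \<otimes>\<^bsub>R\<^esub> inv\<^bsub>R\<^esub> (peval s))"

text \<open>Equal fractions satisfy \<open>a s' = a' s\<close>; evaluating and cancelling the units
  \<open>peval s\<close> and \<open>peval s'\<close> shows that the representative does not
  matter.\<close>

lemma seval_Fract: "s \<in> gpolys \<Longrightarrow> seval (Fract a s) = peval a \<otimes>\<^bsub>R\<^esub> inv\<^bsub>R\<^esub> (peval s)"
  unfolding seval_def
proof (rule the_equality)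
  assume s: "s \<in> gpolys"
  fix r assume "\<exists>a' s'. s' \<in> gpolys \<and> Fract a s = Fract a' s' \<and> r = peval a' \<otimes>\<^bsub>R\<^esub> inv\<^bsub>R\<^esub> (peval s')"
  then obtain a' s' where s': "s' \<in> gpolys" "Fract a s = Fract a' s'"
    and r: "r = peval a' \<otimes>\<^bsub>R\<^esub> inv\<^bsub>R\<^esub> (peval s')" by blast
  have "a * s' = a' * s" using s' s by (simp add: Fract_eq gpolys_nonzero)
  then have e: "peval a \<otimes>\<^bsub>R\<^esub> peval s' = peval a' \<otimes>\<^bsub>R\<^esub> peval s" using pevalD(4) by metis
  note u = peval_unit[OF s] peval_unit[OF s'(1)]
  have c: "peval b \<in> carrier R" for b by (simp add: pevalD)
  have "peval a' \<otimes>\<^bsub>R\<^esub> inv\<^bsub>R\<^esub> (peval s') = peval a' \<otimes>\<^bsub>R\<^esub> peval s \<otimes>\<^bsub>R\<^esub> inv\<^bsub>R\<^esub> (peval s) \<otimes>\<^bsub>R\<^esub> inv\<^bsub>R\<^esub> (peval s')"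
    using u c by (simp add: R.m_assoc)
  also have "\<dots> = peval a \<otimes>\<^bsub>R\<^esub> peval s' \<otimes>\<^bsub>R\<^esub> inv\<^bsub>R\<^esub> (peval s) \<otimes>\<^bsub>R\<^esub> inv\<^bsub>R\<^esub> (peval s')"
    by (simp add: e)
  also have "\<dots> = peval a \<otimes>\<^bsub>R\<^esub> inv\<^bsub>R\<^esub> (peval s) \<otimes>\<^bsub>R\<^esub> (peval s' \<otimes>\<^bsub>R\<^esub> inv\<^bsub>R\<^esub> (peval s'))"
    using u c by (simp add: R.m_ac del: R.Units_r_inv R.Units_l_inv)
  also have "\<dots> = peval a \<otimes>\<^bsub>R\<^esub> inv\<^bsub>R\<^esub> (peval s)" using u c by simp
  finally show "r = peval a \<otimes>\<^bsub>R\<^esub> inv\<^bsub>R\<^esub> (peval s)" using r by simp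
qed blast

text \<open>The universal property of \<open>S_H\<close>: a linear map on \<open>H\<close> with unit
  values at group-likes extends to an algebra morphism. The coproduct, the counit, the map to the
  abelianization and functoriality all come from it.\<close>

lemma S_universal:
  obtains h where "h \<in> alg_hom S R" "\<And>x. x \<in> carrier H \<Longrightarrow> h (tvar H x) = F x"
proof (rule that)
  have c: "peval b \<in> carrier R" for b by (simp add: pevalD)
  note uc = R.Units_inv_closed[OF peval_unit]
  show "seval \<in> alg_hom S R"
  proof (intro alg_homI lin_homI)
    fix x assume "x \<in> carrier S"
    then obtain a s where x: "x = Fract a s" "s \<in> gpolys" using S_Fract by blast
    then show "seval x \<in> carrier R" using uc c by (simp add: seval_Fract)
    fix k
    have "k \<odot>\<^bsub>S\<^esub> x = Fract (Poly_Mapping.single 0 k * a) s"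
      using x by (simp add: sym_const_def)
    then show "seval (k \<odot>\<^bsub>S\<^esub> x) = k \<odot>\<^bsub>R\<^esub> seval x"
      using x c uc by (simp add: seval_Fract pevalD(3) R.smult_mult_left)
  next
    fix x y assume "x \<in> carrier S" "y \<in> carrier S"
    then obtain a s b t where xy: "x = Fract a s" "s \<in> gpolys" "y = Fract b t" "t \<in> gpolys"
      using S_Fract[of x] S_Fract[of y] by metis
    note u = peval_unit[OF xy(2)] peval_unit[OF xy(4)]
    have i: "inv\<^bsub>R\<^esub> (peval s \<otimes>\<^bsub>R\<^esub> peval t) = inv\<^bsub>R\<^esub> (peval s) \<otimes>\<^bsub>R\<^esub> inv\<^bsub>R\<^esub> (peval t)"
    proof (rule R.comm_inv_char)
      have "(peval s \<otimes>\<^bsub>R\<^esub> peval t) \<otimes>\<^bsub>R\<^esub> (inv\<^bsub>R\<^esub> (peval s) \<otimes>\<^bsub>R\<^esub> inv\<^bsub>R\<^esub> (peval t))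
        = (peval s \<otimes>\<^bsub>R\<^esub> inv\<^bsub>R\<^esub> (peval s)) \<otimes>\<^bsub>R\<^esub> (peval t \<otimes>\<^bsub>R\<^esub> inv\<^bsub>R\<^esub> (peval t))"
        using u c by (simp add: R.m_ac del: R.Units_r_inv R.Units_l_inv)
      then show "(peval s \<otimes>\<^bsub>R\<^esub> peval t) \<otimes>\<^bsub>R\<^esub> (inv\<^bsub>R\<^esub> (peval s) \<otimes>\<^bsub>R\<^esub> inv\<^bsub>R\<^esub> (peval t)) = \<one>\<^bsub>R\<^esub>"
        using u by simp
    qed (use u c in simp_all)
    have st: "s * t \<in> gpolys" using xy by (simp add: gpolys_times)
    have e: "peval s \<otimes>\<^bsub>R\<^esub> (X \<otimes>\<^bsub>R\<^esub> (inv\<^bsub>R\<^esub> (peval s) \<otimes>\<^bsub>R\<^esub> Y)) = X \<otimes>\<^bsub>R\<^esub> Y"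
      "peval t \<otimes>\<^bsub>R\<^esub> (X \<otimes>\<^bsub>R\<^esub> (Y \<otimes>\<^bsub>R\<^esub> inv\<^bsub>R\<^esub> (peval t))) = X \<otimes>\<^bsub>R\<^esub> Y"
      if "X \<in> carrier R" "Y \<in> carrier R" for X Y
    proof -
      have "peval s \<otimes>\<^bsub>R\<^esub> (X \<otimes>\<^bsub>R\<^esub> (inv\<^bsub>R\<^esub> (peval s) \<otimes>\<^bsub>R\<^esub> Y)) = (peval s \<otimes>\<^bsub>R\<^esub> inv\<^bsub>R\<^esub> (peval s)) \<otimes>\<^bsub>R\<^esub> (X \<otimes>\<^bsub>R\<^esub> Y)"
        using that u c by (simp add: R.m_ac del: R.Units_r_inv R.Units_l_inv)
      then show "peval s \<otimes>\<^bsub>R\<^esub> (X \<otimes>\<^bsub>R\<^esub> (inv\<^bsub>R\<^esub> (peval s) \<otimes>\<^bsub>R\<^esub> Y)) = X \<otimes>\<^bsub>R\<^esub> Y" using that u by simp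
      have "peval t \<otimes>\<^bsub>R\<^esub> (X \<otimes>\<^bsub>R\<^esub> (Y \<otimes>\<^bsub>R\<^esub> inv\<^bsub>R\<^esub> (peval t))) = (peval t \<otimes>\<^bsub>R\<^esub> inv\<^bsub>R\<^esub> (peval t)) \<otimes>\<^bsub>R\<^esub> (X \<otimes>\<^bsub>R\<^esub> Y)"
        using that u c by (simp add: R.m_ac del: R.Units_r_inv R.Units_l_inv)
      then show "peval t \<otimes>\<^bsub>R\<^esub> (X \<otimes>\<^bsub>R\<^esub> (Y \<otimes>\<^bsub>R\<^esub> inv\<^bsub>R\<^esub> (peval t))) = X \<otimes>\<^bsub>R\<^esub> Y" using that u by simp
    qed
    have "x + y = Fract (a * t + b * s) (s * t)"
      using xy by (simp add: gpolys_nonzero)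
    then have "seval (x + y) = (peval a \<otimes>\<^bsub>R\<^esub> peval t \<oplus>\<^bsub>R\<^esub> peval b \<otimes>\<^bsub>R\<^esub> peval s) \<otimes>\<^bsub>R\<^esub> (inv\<^bsub>R\<^esub> (peval s) \<otimes>\<^bsub>R\<^esub> inv\<^bsub>R\<^esub> (peval t))"
      using st by (simp add: seval_Fract pevalD i)
    also have "\<dots> = (peval a \<otimes>\<^bsub>R\<^esub> peval t) \<otimes>\<^bsub>R\<^esub> (inv\<^bsub>R\<^esub> (peval s) \<otimes>\<^bsub>R\<^esub> inv\<^bsub>R\<^esub> (peval t))
        \<oplus>\<^bsub>R\<^esub> (peval b \<otimes>\<^bsub>R\<^esub> peval s) \<otimes>\<^bsub>R\<^esub> (inv\<^bsub>R\<^esub> (peval s) \<otimes>\<^bsub>R\<^esub> inv\<^bsub>R\<^esub> (peval t))"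
      using u c by (simp add: R.l_distr)
    also have "\<dots> = peval t \<otimes>\<^bsub>R\<^esub> (peval a \<otimes>\<^bsub>R\<^esub> (inv\<^bsub>R\<^esub> (peval s) \<otimes>\<^bsub>R\<^esub> inv\<^bsub>R\<^esub> (peval t)))
        \<oplus>\<^bsub>R\<^esub> peval s \<otimes>\<^bsub>R\<^esub> (peval b \<otimes>\<^bsub>R\<^esub> (inv\<^bsub>R\<^esub> (peval s) \<otimes>\<^bsub>R\<^esub> inv\<^bsub>R\<^esub> (peval t)))"
      using u c by (simp add: R.m_ac del: R.Units_r_inv R.Units_l_inv)
    also have "\<dots> = seval x \<oplus>\<^bsub>R\<^esub> seval y"
      using e u c xy by (simp add: seval_Fract)
    finally show "seval (x \<oplus>\<^bsub>S\<^esub> y) = seval x \<oplus>\<^bsub>R\<^esub> seval y" by simp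
    have "x * y = Fract (a * b) (s * t)" using xy by simp
    then have "seval (x * y) = peval a \<otimes>\<^bsub>R\<^esub> peval b \<otimes>\<^bsub>R\<^esub> (inv\<^bsub>R\<^esub> (peval s) \<otimes>\<^bsub>R\<^esub> inv\<^bsub>R\<^esub> (peval t))"
      using st by (simp add: seval_Fract pevalD i)
    also have "\<dots> = seval x \<otimes>\<^bsub>R\<^esub> seval y"
      using u c xy by (simp add: seval_Fract R.m_ac)
    finally show "seval (x \<otimes>\<^bsub>S\<^esub> y) = seval x \<otimes>\<^bsub>R\<^esub> seval y" by simp
  next
    show "seval \<one>\<^bsub>S\<^esub> = \<one>\<^bsub>R\<^esub>"
      using seval_Fract[OF gpolys.one, of 1] by (simp add: One_fract_def pevalD)
  qed
  fix x assume "x \<in> carrier H"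
  then show "seval (tvar H x) = F x"
    using lin_homD(1)[OF F] by (simp add: tvar_Fract seval_Fract gpolys.one pevalD peval_tpoly)
qed

end

end

section \<open>The Hopf algebra structure\<close>

context wh
begin

lemma tmap_tvar_lin: "(\<lambda>x. tmap S S (tvar H) (tvar H) (comult H x)) \<in> lin_hom H (tensor S S)"
  by (rule lin_hom_compose[OF alg_hom_lin[OF comult_hom]
    tmap_lin_hom[OF calg_axioms calg_axioms S.calg_axioms S.calg_axioms tvar_S_lin tvar_S_lin]])

lemma tmap_word:
  assumes "calg B" "calg C" "f \<in> lin_hom H B" "g \<in> lin_hom H C"
  shows "tmap B C f g (comult H (\<phi> w)) = wsum (tensor B C) w (\<lambda>u v. pure B C (f (\<phi> u)) (g (\<phi> v)))"
proof -
  interpret BC: tens B C using assms by (simp add: tens_def)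
  show ?thesis
    unfolding tmap_def
    by (rule sweedler[OF tmap_blin[OF calg_axioms calg_axioms assms] BC.T.cmod_axioms])
qed

lemma S_comult_exists:
  obtains D where "D \<in> alg_hom S (tensor S S)"
    "\<And>x. x \<in> carrier H \<Longrightarrow> D (tvar H x) = tmap S S (tvar H) (tvar H) (comult H x)"
proof (rule S_universal[OF ccalg_tensor[OF ccalg_S ccalg_S] tmap_tvar_lin])
  fix w :: "uq_gen list" assume w: "edeg w = 0"
  have "tmap S S (tvar H) (tvar H) (comult H (\<phi> w)) = pure S S (tw w) (tw w)"
    by (simp add: tmap_word[OF S.calg_axioms S.calg_axioms tvar_S_lin tvar_S_lin] SS.T.wsum_group[OF w])
  moreover have "pure S S (tw w) (tw w) \<in> Units (tensor S S)"
    using tinv_group[OF w] unfolding Units_def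
    by (auto intro!: bexI[of _ "pure S S (iw w) (iw w)"] simp: SS.pure_mult SS.pure_one mult.commute)
  ultimately show "tmap S S (tvar H) (tvar H) (comult H (\<phi> w)) \<in> Units (tensor S S)" by simp
qed (rule that)

lemma anti_lin: "blin H H (tensor S S) (\<lambda>x1 x2. pure S S (tinv H x2) (tinv H x1))"
  using lin_homD[OF tinv_S_lin]
  by (intro blinI lin_homI)
    (simp_all add: SS.pure_add_left[simplified] SS.pure_add_right[simplified]
      SS.pure_smult_left[simplified] SS.pure_smult_right[simplified])

text \<open>This makes the prescribed formula for the coproduct of \<open>t^{-1}\<close> the
  convolution inverse of that of \<open>t\<close>. After regrouping by coassociativity the adjacent
  inner factors \<open>t_{x_2}\<close> and \<open>t^{-1}_{x_3}\<close> cancel first, then the outer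
  ones.\<close>

lemma comult_tinv_inverse:
  "conv (tensor S S) (\<lambda>w. wsum (tensor S S) w (\<lambda>u v. pure S S (tw u) (tw v)))
    (\<lambda>w. wsum (tensor S S) w (\<lambda>u v. pure S S (iw v) (iw u))) w = ceps (tensor S S) w"
proof -
  let ?T = "tensor S S" and ?p = "pure S S"
  define G where "G = (\<lambda>u1 u2 v1 v2. ?p (tw u1 * iw v2) (tw u2 * iw v1))"
  have Sm: "x \<in> carrier S \<Longrightarrow> y \<in> carrier S \<Longrightarrow> x * y \<in> carrier S" for x y
    using S.m_closed[of x y] by simp
  have Gc: "G u1 u2 v1 v2 \<in> carrier ?T" for u1 u2 v1 v2
    unfolding G_def by (intro SS.pure_closed Sm) simp_all
  have pl: "(\<lambda>x. ?p a x) \<in> lin_hom S ?T" "(\<lambda>x. ?p x a) \<in> lin_hom S ?T" if "a \<in> carrier S" for a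
    using blinD[OF SS.blin_pure] that by auto
  have "wsum ?T u (\<lambda>u1 u2. ?p (tw u1) (tw u2)) \<otimes>\<^bsub>?T\<^esub> wsum ?T v (\<lambda>v1 v2. ?p (iw v2) (iw v1))
    = wsum ?T v (\<lambda>v1 v2. wsum ?T u (\<lambda>u1 u2. G u1 u2 v1 v2))" for u v
    by (simp add: SS.T.wsum_mult_left SS.T.wsum_mult_right SS.pure_mult G_def)
  then have "conv ?T (\<lambda>w. wsum ?T w (\<lambda>u v. ?p (tw u) (tw v))) (\<lambda>w. wsum ?T w (\<lambda>u v. ?p (iw v) (iw u))) w
    = wsum ?T w (\<lambda>u v. wsum ?T v (\<lambda>v1 v2. wsum ?T u (\<lambda>u1 u2. G u1 u2 v1 v2)))"
    by (simp add: conv_def)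
  also have "\<dots> = wsum ?T w (\<lambda>x v2. wsum ?T x (\<lambda>u v1. wsum ?T u (\<lambda>u1 u2. G u1 u2 v1 v2)))"
    by (rule SS.T.wsum_coassoc[symmetric]) (simp add: Gc)
  also have "\<dots> = wsum ?T w (\<lambda>x v2. wsum ?T x (\<lambda>u1 y. wsum ?T y (\<lambda>u2 v1. G u1 u2 v1 v2)))"
    by (rule wsum_cong, rule SS.T.wsum_coassoc) (simp add: Gc)
  also have "\<dots> = wsum ?T w (\<lambda>x v2. ?p (tw x * iw v2) 1)"
  proof (rule wsum_cong)
    fix x v2
    have "wsum ?T y (\<lambda>u2 v1. G u1 u2 v1 v2) = ?p (tw u1 * iw v2) (ceps S y)" for u1 y
      unfolding G_def S_inverse(2)[symmetric] conv_def
      by (subst wsum_hom[OF pl(1) S.cmod_axioms]) (simp_all add: Sm)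
    then have "wsum ?T x (\<lambda>u1 y. wsum ?T y (\<lambda>u2 v1. G u1 u2 v1 v2)) = wsum ?T x (\<lambda>u1 y. ?p (tw u1 * iw v2) (ceps S y))"
      by simp
    also have "\<dots> = ?p (tw x * iw v2) 1"
      using SS.pure_zero_right[simplified] by (subst SS.T.wsum_top) (simp_all add: Sm ceps_def)
    finally show "wsum ?T x (\<lambda>u1 y. wsum ?T y (\<lambda>u2 v1. G u1 u2 v1 v2)) = ?p (tw x * iw v2) 1" .
  qed
  also have "\<dots> = ?p (ceps S w) 1"
    unfolding S_inverse(2)[symmetric] conv_def
    using S.one_closed by (subst wsum_hom[OF pl(2) S.cmod_axioms]) (simp_all add: Sm)
  also have "\<dots> = ceps ?T w"
    using SS.pure_zero_left[of 1] S.one_closed by (simp add: ceps_def SS.pure_one)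
  finally show ?thesis .
qed

lemma S_comult_spec:
  "S_comult H \<in> alg_hom S (tensor S S)"
  "x \<in> carrier H \<Longrightarrow> S_comult H (tvar H x) = tmap S S (tvar H) (tvar H) (comult H x)"
  "x \<in> carrier H \<Longrightarrow> S_comult H (tinv H x)
    = tlift (tensor S S) (\<lambda>x1 x2. pure S S (tinv H x2) (tinv H x1)) (comult H x)"
proof -
  obtain D where D: "D \<in> alg_hom S (tensor S S)"
    "\<And>x. x \<in> carrier H \<Longrightarrow> D (tvar H x) = tmap S S (tvar H) (tvar H) (comult H x)"
    using S_comult_exists by blast
  have Di: "D (tinv H x) = tlift (tensor S S) (\<lambda>x1 x2. pure S S (tinv H x2) (tinv H x1)) (comult H x)"
    if "x \<in> carrier H" for x
  proof (rule hom_tinv_unique[OF D(1) SS.T.calg_axioms _ _ that])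
    show "(\<lambda>x. tlift (tensor S S) (\<lambda>x1 x2. pure S S (tinv H x2) (tinv H x1)) (comult H x)) \<in> lin_hom H (tensor S S)"
      by (rule lin_hom_compose[OF alg_hom_lin[OF comult_hom] HH.tlift_lin_hom[OF anti_lin SS.T.cmod_axioms]])
    show "conv (tensor S S) (\<lambda>w. D (tw w))
       (\<lambda>w. tlift (tensor S S) (\<lambda>x1 x2. pure S S (tinv H x2) (tinv H x1)) (comult H (\<phi> w))) w = ceps (tensor S S) w" for w
      using comult_tinv_inverse[of w]
      by (simp add: D(2) tmap_word[OF S.calg_axioms S.calg_axioms tvar_S_lin tvar_S_lin]
          sweedler[OF anti_lin SS.T.cmod_axioms])
  qed
  have "S_comult H = restrict D (carrier S)"
    unfolding S_comult_def
  proof (rule the_restrict, goal_cases)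
    case 1
    then show ?case using restrict_alg_hom[OF D(1) S.calg_axioms] D(2) Di by simp
  next
    case (2 g) then show ?case by simp
  next
    case (3 g x)
    then have g: "g \<in> alg_hom S (tensor S S)" "\<And>w. g (tw w) = D (tw w)" by (simp_all add: D(2))
    show ?case by (rule S_hom_eqI[OF g(1) D(1) SS.T.calg_axioms g(2) 3(2)])
  qed
  then show "S_comult H \<in> alg_hom S (tensor S S)"
    "x \<in> carrier H \<Longrightarrow> S_comult H (tvar H x) = tmap S S (tvar H) (tvar H) (comult H x)"
    "x \<in> carrier H \<Longrightarrow> S_comult H (tinv H x)
    = tlift (tensor S S) (\<lambda>x1 x2. pure S S (tinv H x2) (tinv H x1)) (comult H x)"
    using restrict_alg_hom[OF D(1) S.calg_axioms] D(2) Di by simp_all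
qed

lemma S_counit_spec:
  "S_counit H \<in> alg_hom S complex_alg"
  "x \<in> carrier H \<Longrightarrow> S_counit H (tvar H x) = counit H x"
proof -
  obtain D where D: "D \<in> alg_hom S complex_alg" "\<And>x. x \<in> carrier H \<Longrightarrow> D (tvar H x) = counit H x"
    by (rule S_universal[OF ccalg_complex counit_lin]) (auto simp: counit_word Units_def)
  have cc: "counit H (\<phi> w) = ceps complex_alg w" for w by (simp add: counit_word ceps_def)
  have Di: "D (tinv H x) = counit H x" if "x \<in> carrier H" for x
    by (rule hom_tinv_unique[OF D(1) CC.calg_axioms counit_lin _ that])
      (simp add: D(2) cc CC.conv_ceps_left)
  have "S_counit H = restrict D (carrier S)"
    unfolding S_counit_def
  proof (rule the_restrict, goal_cases)
    case 1
    then show ?case using restrict_alg_hom[OF D(1) S.calg_axioms] D(2) Di by simp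
  next
    case (2 g) then show ?case by simp
  next
    case (3 g x)
    then have g: "g \<in> alg_hom S complex_alg" "\<And>w. g (tw w) = D (tw w)" by (simp_all add: D(2))
    show ?case by (rule S_hom_eqI[OF g(1) D(1) CC.calg_axioms g(2) 3(2)])
  qed
  then show "S_counit H \<in> alg_hom S complex_alg"
    "x \<in> carrier H \<Longrightarrow> S_counit H (tvar H x) = counit H x"
    using restrict_alg_hom[OF D(1) S.calg_axioms] D(2) by simp_all
qed

lemma S_hopf_same: "same_alg S (S_hopf H)"
  unfolding S_hopf_def by (rule same_alg_extend)

lemma S_hopf_simps: "comult (S_hopf H) = S_comult H" "counit (S_hopf H) = S_counit H" "carrier (S_hopf H) = carrier S"
  by (simp_all add: S_hopf_def module.extend_def hopf.fields_def)

abbreviation "Hab \<equiv> hopf_ab H"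

sublocale Hab: ccalg Hab by (rule ccalg_ab)
sublocale SB: tens S Hab ..

lemma pab_lin: "(\<lambda>x. pab x) \<in> lin_hom H Hab"
  by (rule alg_hom_lin[OF pab_alg_hom])

text \<open>Group-like words are units of \<open>H\<close>, so the projection to the abelianization
  extends to \<open>S_H\<close>; compatibility with coproducts and counits is checked on the
  \<open>t_w\<close> alone.\<close>

lemma pi_tilde_spec:
  "pi_tilde H \<in> alg_hom S Hab"
  "x \<in> carrier H \<Longrightarrow> pi_tilde H (tvar H x) = pab x"
proof -
  interpret ab: wh Hab "\<lambda>g. pab (\<gamma> g)" q by (rule wh_ab)
  obtain D where D: "D \<in> alg_hom S Hab" "\<And>x. x \<in> carrier H \<Longrightarrow> D (tvar H x) = pab x"
    by (rule S_universal[OF ccalg_ab pab_lin])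
      (auto intro: alg_hom_unit[OF pab_alg_hom calg_axioms] group_word_unit)
  note Dl = alg_hom_lin[OF D(1)]
  have E: "restrict D (carrier S) \<in> alg_hom S Hab" by (rule restrict_alg_hom[OF D(1) S.calg_axioms])
  let ?E = "restrict D (carrier S)"
  have Et: "?E (tvar H x) = pab x" if "x \<in> carrier H" for x using that D(2) by simp
  note El = alg_hom_lin[OF E]
  have tm: "tmap Hab Hab ?E ?E \<in> alg_hom (tensor S S) (tensor Hab Hab)"
    by (rule tmap_alg_hom[OF S.calg_axioms S.calg_axioms Hab.calg_axioms Hab.calg_axioms El El E E])
  have com: "comult Hab (?E s) = tmap Hab Hab ?E ?E (S_comult H s)" if "s \<in> carrier S" for s
  proof (rule S_hom_eqI[OF _ _ ab.HH.calg_tensor _ that])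
    show "(\<lambda>s. comult Hab (?E s)) \<in> alg_hom S (tensor Hab Hab)"
      by (rule alg_hom_compose[OF E ab.comult_hom])
    show "(\<lambda>s. tmap Hab Hab ?E ?E (S_comult H s)) \<in> alg_hom S (tensor Hab Hab)"
      by (rule alg_hom_compose[OF S_comult_spec(1) tm])
    fix w
    have "comult Hab (?E (tw w)) = tmap Hab Hab (\<lambda>x. pab x) (\<lambda>x. pab x) (comult H (\<phi> w))"
      using pab_hopf_hom Et by (simp add: hopf_hom_def)
    also have "\<dots> = wsum (tensor Hab Hab) w (\<lambda>u v. pure Hab Hab (pab (\<phi> u)) (pab (\<phi> v)))"
      by (rule tmap_word[OF Hab.calg_axioms Hab.calg_axioms pab_lin pab_lin])
    also have "\<dots> = tmap Hab Hab ?E ?E (wsum (tensor S S) w (\<lambda>u v. pure S S (tw u) (tw v)))"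
      using Et by (subst wsum_hom[OF alg_hom_lin[OF tm] SS.T.cmod_axioms])
        (simp_all add: tmap_pure[OF S.calg_axioms S.calg_axioms Hab.calg_axioms Hab.calg_axioms El El])
    also have "\<dots> = tmap Hab Hab ?E ?E (S_comult H (tw w))"
      by (simp add: S_comult_spec(2) tmap_word[OF S.calg_axioms S.calg_axioms tvar_S_lin tvar_S_lin])
    finally show "comult Hab (?E (tw w)) = tmap Hab Hab ?E ?E (S_comult H (tw w))" .
  qed
  have cou: "counit Hab (?E s) = S_counit H s" if "s \<in> carrier S" for s
  proof (rule S_hom_eqI[OF alg_hom_compose[OF E ab.counit_hom] S_counit_spec(1) CC.calg_axioms _ that])
    fix w
    show "counit Hab (?E (tw w)) = S_counit H (tw w)"
      using pab_hopf_hom Et by (simp add: hopf_hom_def S_counit_spec(2))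
  qed
  note ah = alg_hom_same[OF S_hopf_same same_alg_refl, of Hab]
  have "pi_tilde H = restrict D (carrier (S_hopf H))"
    unfolding pi_tilde_def
  proof (rule the_restrict, goal_cases)
    case 1
    show ?case using E ah com cou Et by (simp add: hopf_hom_def S_hopf_simps)
  next
    case (2 g) then show ?case by simp
  next
    case (3 g x)
    then have g: "g \<in> alg_hom S Hab" "\<And>w. g (tw w) = D (tw w)" using ah by (simp_all add: hopf_hom_def D(2))
    show ?case by (rule S_hom_eqI[OF g(1) D(1) Hab.calg_axioms g(2)]) (use 3(2) in \<open>simp add: S_hopf_simps\<close>)
  qed
  then show "pi_tilde H \<in> alg_hom S Hab" "x \<in> carrier H \<Longrightarrow> pi_tilde H (tvar H x) = pab x"
    using E D(2) by (simp_all add: S_hopf_simps)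
qed

end

section \<open>Functoriality\<close>

text \<open>Compatibility with the coproducts is automatic, since both are prescribed on the
  generators, which \<open>f\<close> respects.\<close>

locale wh_hom = G: wh G \<gamma> q + H: wh H \<gamma>' q
  for G :: "('a, 'm) hopf_scheme" and H :: "('b, 'n) hopf_scheme" and \<gamma> \<gamma>' q +
  fixes f
  assumes f_hom: "f \<in> alg_hom G H" and f_gen: "f (\<gamma> g) = \<gamma>' g"
begin

lemma f_word: "f (G.wmon w) = H.wmon w"
  using alg_hom_wprod[OF f_hom G.calg_axioms, of \<gamma> w] f_gen by simp

lemma S_map_spec:
  "S_map G H f \<in> alg_hom (S_alg G) (S_alg H)"
  "x \<in> carrier G \<Longrightarrow> S_map G H f (tvar G x) = tvar H (f x)"
  "x \<in> carrier G \<Longrightarrow> S_map G H f (tinv G x) = tinv H (f x)"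
proof -
  have Fl: "(\<lambda>x. tvar H (f x)) \<in> lin_hom G (S_alg H)"
    by (rule lin_hom_compose[OF alg_hom_lin[OF f_hom] H.tvar_S_lin])
  obtain D where D: "D \<in> alg_hom (S_alg G) (S_alg H)" "\<And>x. x \<in> carrier G \<Longrightarrow> D (tvar G x) = tvar H (f x)"
    by (rule G.S_universal[OF H.ccalg_S Fl]) (auto simp: f_word H.tw_unit)
  have Di: "D (tinv G x) = tinv H (f x)" if "x \<in> carrier G" for x
    by (rule G.hom_tinv_unique[OF D(1) H.S.calg_axioms lin_hom_compose[OF alg_hom_lin[OF f_hom] H.tinv_S_lin] _ that])
      (simp add: D(2) f_word H.S_inverse)
  have "S_map G H f = restrict D (carrier (S_alg G))"
    unfolding S_map_def
  proof (rule the_restrict, goal_cases)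
    case 1
    then show ?case using restrict_alg_hom[OF D(1) G.S.calg_axioms] D(2) Di by simp
  next
    case (2 g) then show ?case by simp
  next
    case (3 g x)
    then have g: "g \<in> alg_hom (S_alg G) (S_alg H)" "\<And>w. g (G.tw w) = D (G.tw w)" by (simp_all add: D(2))
    show ?case by (rule G.S_hom_eqI[OF g(1) D(1) H.S.calg_axioms g(2) 3(2)])
  qed
  then show "S_map G H f \<in> alg_hom (S_alg G) (S_alg H)"
    "x \<in> carrier G \<Longrightarrow> S_map G H f (tvar G x) = tvar H (f x)"
    "x \<in> carrier G \<Longrightarrow> S_map G H f (tinv G x) = tinv H (f x)"
    using restrict_alg_hom[OF D(1) G.S.calg_axioms] D(2) Di by simp_all
qed

end

section \<open>The grading by the abelianization\<close>

lemma lin_hom_add: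
  assumes "h \<in> lin_hom P C" "g \<in> lin_hom P C" "cmod C"
  shows "(\<lambda>p. h p \<oplus>\<^bsub>C\<^esub> g p) \<in> lin_hom P C"
proof -
  interpret cmod C by fact
  show ?thesis
    using lin_homD[OF assms(1)] lin_homD[OF assms(2)] by (intro lin_homI) (simp_all add: smult_r_distr a_ac)
qed

text \<open>The cocycle and the product of the generic extension are nested \<open>tlift\<close>s
  whose inner bilinear maps depend on outer variables; this gives linearity in those
  variables.\<close>

lemma (in tens) tlift_param:
  assumes "cmod C" "\<And>p. p \<in> carrier P \<Longrightarrow> blin A B C (f p)"
    "\<And>a b. a \<in> carrier A \<Longrightarrow> b \<in> carrier B \<Longrightarrow> (\<lambda>p. f p a b) \<in> lin_hom P C"
    "cmod P" "Y \<in> carrier T"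
  shows "(\<lambda>p. tlift C (f p) Y) \<in> lin_hom P C"
  using assms(5)
proof (induction rule: tensor_induct)
  case (pure a b)
  show ?case
    by (rule lin_hom_cong[OF assms(3)[OF pure] _ assms(4)]) (simp add: tlift_pure[OF assms(2,1)] pure)
next
  case (add X Y)
  show ?case
    by (rule lin_hom_cong[OF lin_hom_add[OF add(3,4) assms(1)] _ assms(4)])
      (simp add: lin_homD(2)[OF tlift_lin_hom[OF assms(2,1)]] add(1,2))
qed

context cmod
begin

text \<open>Coassociativity in both words at once, the form needed for a product of two
  elements.\<close>

lemma wsum_pair_coassoc:
  assumes "\<And>u1 u2 v u1' u2' v'. f u1 u2 v u1' u2' v' \<in> carrier A"
  shows "wsum A w (\<lambda>u v. wsum A w' (\<lambda>u' v'. wsum A u (\<lambda>u1 u2. wsum A u' (\<lambda>u1' u2'. f u1 u2 v u1' u2' v'))))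
    = wsum A w (\<lambda>u v. wsum A w' (\<lambda>u' v'. wsum A v (\<lambda>v1 v2. wsum A v' (\<lambda>v1' v2'. f u v1 v2 u' v1' v2'))))"
proof -
  have "wsum A w (\<lambda>u v. wsum A w' (\<lambda>u' v'. wsum A u (\<lambda>u1 u2. wsum A u' (\<lambda>u1' u2'. f u1 u2 v u1' u2' v'))))
    = wsum A w (\<lambda>u v. wsum A u (\<lambda>u1 u2. wsum A w' (\<lambda>u' v'. wsum A u' (\<lambda>u1' u2'. f u1 u2 v u1' u2' v'))))"
    by (rule wsum_cong, rule wsum_swap) (simp add: assms)
  also have "\<dots> = wsum A w (\<lambda>u v. wsum A u (\<lambda>u1 u2. wsum A w' (\<lambda>u' v'. wsum A v' (\<lambda>v1' v2'. f u1 u2 v u' v1' v2'))))"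
    by (rule wsum_cong, rule wsum_cong, rule wsum_coassoc) (simp add: assms)
  also have "\<dots> = wsum A w (\<lambda>u v. wsum A v (\<lambda>v1 v2. wsum A w' (\<lambda>u' v'. wsum A v' (\<lambda>v1' v2'. f u v1 v2 u' v1' v2'))))"
    by (rule wsum_coassoc) (simp add: assms)
  also have "\<dots> = wsum A w (\<lambda>u v. wsum A w' (\<lambda>u' v'. wsum A v (\<lambda>v1 v2. wsum A v' (\<lambda>v1' v2'. f u v1 v2 u' v1' v2'))))"
    by (rule wsum_cong, rule wsum_swap) (simp add: assms)
  finally show ?thesis .
qed

end

context wh
begin

abbreviation "kk \<equiv> pab (\<gamma> Gen_K)"

lemma pab_closed [simp, intro]: "x \<in> carrier H \<Longrightarrow> pab x \<in> carrier Hab"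
  using lin_homD(1)[OF pab_lin] .

text \<open>In a commutative quotient, \<open>KE = q^2 EK\<close> and \<open>KF = q^{-2} FK\<close>
  with \<open>K\<close> invertible and \<open>q^2 \<noteq> 1\<close> force \<open>E\<close> and
  \<open>F\<close> to vanish. The relation between \<open>E\<close> and \<open>F\<close> then says
  \<open>K = K^{-1}\<close>.\<close>

lemma ab_gens: "pab (\<gamma> Gen_E) = \<zero>\<^bsub>Hab\<^esub>" "pab (\<gamma> Gen_F) = \<zero>\<^bsub>Hab\<^esub>" "pab (\<gamma> Gen_Kinv) = kk"
  "kk \<otimes>\<^bsub>Hab\<^esub> kk = \<one>\<^bsub>Hab\<^esub>"
proof -
  interpret ab: wh Hab "\<lambda>g. pab (\<gamma> g)" q by (rule wh_ab)
  have zero: "x = \<zero>\<^bsub>Hab\<^esub>" if "x = c \<odot>\<^bsub>Hab\<^esub> x" "c \<noteq> 1" "x \<in> carrier Hab" for x c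
  proof -
    have "(c - 1) \<odot>\<^bsub>Hab\<^esub> x = c \<odot>\<^bsub>Hab\<^esub> x \<oplus>\<^bsub>Hab\<^esub> (- 1) \<odot>\<^bsub>Hab\<^esub> x"
      using Hab.smult_l_distr[of x c "-1"] that(3) by simp
    also have "\<dots> = 1 \<odot>\<^bsub>Hab\<^esub> x \<oplus>\<^bsub>Hab\<^esub> (- 1) \<odot>\<^bsub>Hab\<^esub> x" using that by simp
    also have "\<dots> = \<zero>\<^bsub>Hab\<^esub>" using that(3) by (simp flip: Hab.smult_l_distr del: Hab.smult_one)
    finally have "inverse (c - 1) \<odot>\<^bsub>Hab\<^esub> ((c - 1) \<odot>\<^bsub>Hab\<^esub> x) = \<zero>\<^bsub>Hab\<^esub>" by simp
    then show ?thesis using that(2,3) by (simp add: Hab.smult_assoc)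
  qed
  have cancel: "x = \<zero>\<^bsub>Hab\<^esub>" if "kk \<otimes>\<^bsub>Hab\<^esub> x = \<zero>\<^bsub>Hab\<^esub>" "x \<in> carrier Hab" for x
  proof -
    have "x = (pab (\<gamma> Gen_Kinv) \<otimes>\<^bsub>Hab\<^esub> kk) \<otimes>\<^bsub>Hab\<^esub> x" using that(2) by (simp add: ab.Kinv_K)
    also have "\<dots> = \<zero>\<^bsub>Hab\<^esub>" using that by (simp add: Hab.m_assoc)
    finally show ?thesis .
  qed
  have "kk \<otimes>\<^bsub>Hab\<^esub> pab (\<gamma> Gen_E) = q ^ 2 \<odot>\<^bsub>Hab\<^esub> (kk \<otimes>\<^bsub>Hab\<^esub> pab (\<gamma> Gen_E))"
    using ab.K_E by (simp add: Hab.m_comm)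
  from cancel[OF zero[OF this q_square]] show E: "pab (\<gamma> Gen_E) = \<zero>\<^bsub>Hab\<^esub>" by simp
  have "kk \<otimes>\<^bsub>Hab\<^esub> pab (\<gamma> Gen_F) = inverse (q ^ 2) \<odot>\<^bsub>Hab\<^esub> (kk \<otimes>\<^bsub>Hab\<^esub> pab (\<gamma> Gen_F))"
    using ab.K_F by (simp add: Hab.m_comm)
  from cancel[OF zero[OF this]] show F: "pab (\<gamma> Gen_F) = \<zero>\<^bsub>Hab\<^esub>" using q_square by simp
  define c where "c = 1 / (q - inverse q)"
  have c: "c \<noteq> 0" using q_square q_nonzero by (auto simp: c_def field_simps power2_eq_square)
  have "c \<odot>\<^bsub>Hab\<^esub> kk \<oplus>\<^bsub>Hab\<^esub> (- c) \<odot>\<^bsub>Hab\<^esub> pab (\<gamma> Gen_Kinv) = \<zero>\<^bsub>Hab\<^esub>"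
    using ab.E_F by (simp add: E F flip: c_def)
  then have "inverse c \<odot>\<^bsub>Hab\<^esub> (c \<odot>\<^bsub>Hab\<^esub> kk \<oplus>\<^bsub>Hab\<^esub> (- c) \<odot>\<^bsub>Hab\<^esub> pab (\<gamma> Gen_Kinv)) = \<zero>\<^bsub>Hab\<^esub>" by simp
  then have "kk \<oplus>\<^bsub>Hab\<^esub> (- 1) \<odot>\<^bsub>Hab\<^esub> pab (\<gamma> Gen_Kinv) = \<zero>\<^bsub>Hab\<^esub>"
    using c by (simp add: Hab.smult_r_distr Hab.smult_assoc)
  then show L: "pab (\<gamma> Gen_Kinv) = kk"
    using Hab.minus_equality[of kk "(- 1) \<odot>\<^bsub>Hab\<^esub> pab (\<gamma> Gen_Kinv)"]
    by (simp add: Hab.smult_minus_one)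
  show "kk \<otimes>\<^bsub>Hab\<^esub> kk = \<one>\<^bsub>Hab\<^esub>" using ab.K_Kinv L by simp
qed

text \<open>The class of \<open>K^n\<close> in the abelianization, which depends on the parity of
  \<open>n\<close> only.\<close>

definition kp :: "nat \<Rightarrow> 'a set" where "kp n = (if even n then \<one>\<^bsub>Hab\<^esub> else kk)"

lemma kp_closed [simp, intro]: "kp n \<in> carrier Hab"
  by (simp add: kp_def)

lemma kp_add: "kp m \<otimes>\<^bsub>Hab\<^esub> kp n = kp (m + n)"
  by (simp add: kp_def ab_gens)

lemma kp_0 [simp]: "kp 0 = \<one>\<^bsub>Hab\<^esub>"
  by (simp add: kp_def)

lemma kp_parity: "even (m + n) \<Longrightarrow> kp m = kp n"
  by (simp add: kp_def)

lemma pab_word: "pab (\<phi> w) = (if edeg w = 0 then kp (rdeg w) else \<zero>\<^bsub>Hab\<^esub>)"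
proof (induction w)
  case Nil
  show ?case using alg_homD(5)[OF pab_alg_hom] by simp
next
  case (Cons g w)
  have "pab (\<phi> (g # w)) = pab (\<gamma> g) \<otimes>\<^bsub>Hab\<^esub> pab (\<phi> w)"
    using alg_homD(4)[OF pab_alg_hom] by simp
  moreover have "kk = kp 1" by (simp add: kp_def)
  ultimately show ?case using Cons
    by (cases g) (simp_all add: ab_gens kp_add)
qed

lemma rdeg_eq_ldeg: "edeg w = 0 \<Longrightarrow> rdeg w = ldeg w"
proof (induction w)
  case (Cons g w)
  then show ?case by (cases g) simp_all
qed simp

text \<open>The coaction whose coinvariants are the base algebra.\<close>

definition coact :: "'a symfrac \<Rightarrow> (('a symfrac \<times> 'a set) \<Rightarrow>\<^sub>0 complex) set" where
  "coact s = tmap S Hab id (pi_tilde H) (S_comult H s)"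

lemma id_S: "id \<in> alg_hom S S"
  using alg_hom_id[of S] by (simp add: id_def)

lemma coact_tmap: "tmap S Hab id (pi_tilde H) \<in> alg_hom (tensor S S) (tensor S Hab)"
  "a \<in> carrier S \<Longrightarrow> b \<in> carrier S \<Longrightarrow> tmap S Hab id (pi_tilde H) (pure S S a b) = pure S Hab a (pi_tilde H b)"
  using tmap_alg_hom[OF S.calg_axioms S.calg_axioms S.calg_axioms Hab.calg_axioms alg_hom_lin[OF id_S]
      alg_hom_lin[OF pi_tilde_spec(1)] id_S pi_tilde_spec(1)]
    tmap_pure[OF S.calg_axioms S.calg_axioms S.calg_axioms Hab.calg_axioms alg_hom_lin[OF id_S]
      alg_hom_lin[OF pi_tilde_spec(1)]] by simp_all

lemma coact_hom: "coact \<in> alg_hom S (tensor S Hab)"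
  unfolding coact_def[abs_def] by (rule alg_hom_compose[OF S_comult_spec(1) coact_tmap(1)])

text \<open>The projection kills every right factor containing \<open>E\<close> or \<open>F\<close>,
  so one term survives.\<close>

lemma coact_tw: "coact (tw w) = pure S Hab (tw w) (kp (rdeg w))"
proof -
  have "coact (tw w) = wsum (tensor S Hab) w (\<lambda>u v. pure S Hab (tw u) (pab (\<phi> v)))"
    unfolding coact_def
    by (simp add: S_comult_spec(2) tmap_word[OF S.calg_axioms S.calg_axioms tvar_S_lin tvar_S_lin])
      (subst wsum_hom[OF alg_hom_lin[OF coact_tmap(1)] SS.T.cmod_axioms],
        simp_all add: coact_tmap(2) pi_tilde_spec(2))
  also have "\<dots> = pure S Hab (tw w) (kp (rdeg w))"
    by (subst SB.T.wsum_top) (simp_all add: pab_word del: S_same)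
  finally show ?thesis .
qed

text \<open>In the abelianization group-likes square to one, so the projection is its own
  convolution inverse.\<close>

lemma pi_tilde_iw: "pi_tilde H (iw w) = pab (\<phi> w)"
proof (rule hom_tinv_unique[OF pi_tilde_spec(1) Hab.calg_axioms pab_lin _ word_closed])
  fix w
  have "conv Hab (\<lambda>w. pab (\<phi> w)) (\<lambda>w. pab (\<phi> w)) w = pab (\<phi> w) \<otimes>\<^bsub>Hab\<^esub> pab (\<phi> (wtop w))"
    unfolding conv_def by (subst Hab.wsum_top) (simp_all add: pab_word)
  also have "\<dots> = ceps Hab w" by (simp add: pab_word kp_add ceps_def kp_parity[of "rdeg w + rdeg w" 0])
  finally show "conv Hab (\<lambda>w. pi_tilde H (tw w)) (\<lambda>w. pab (\<phi> w)) w = ceps Hab w"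
    by (simp add: pi_tilde_spec(2))
qed

text \<open>The coproduct of \<open>t^{-1}\<close> interchanges the factors. The surviving term is
  the one with a group-like left factor, so the degree is given by \<open>ldeg\<close> and not by
  \<open>rdeg\<close>.\<close>

lemma coact_iw: "coact (iw w) = pure S Hab (iw w) (kp (ldeg w))"
proof -
  have "coact (iw w) = wsum (tensor S Hab) w (\<lambda>u v. pure S Hab (iw v) (pab (\<phi> u)))"
    unfolding coact_def
    by (simp add: S_comult_spec(3) sweedler[OF anti_lin SS.T.cmod_axioms])
      (subst wsum_hom[OF alg_hom_lin[OF coact_tmap(1)] SS.T.cmod_axioms],
        simp_all add: coact_tmap(2) pi_tilde_iw)
  also have "\<dots> = pure S Hab (iw w) (kp (ldeg w))"
    by (subst SB.T.wsum_bot) (simp_all add: pab_word rdeg_eq_ldeg del: S_same)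
  finally show ?thesis .
qed

text \<open>Only the parity of \<open>n\<close> matters. If \<open>kk\<close> is trivial, as for
  \<open>u_d\<close> with odd \<open>e\<close>, this set is the same for all \<open>n\<close> and
  there is no genuine grading.\<close>

definition Sdeg :: "nat \<Rightarrow> 'a symfrac set" where
  "Sdeg n = {s \<in> carrier S. coact s = pure S Hab s (kp n)}"

lemma SdegD: "s \<in> Sdeg n \<Longrightarrow> coact s = pure S Hab s (kp n)"
  by (simp add: Sdeg_def)

lemma SdegI: "s \<in> carrier S \<Longrightarrow> coact s = pure S Hab s (kp n) \<Longrightarrow> s \<in> Sdeg n"
  by (simp add: Sdeg_def)

lemma Sdeg_S [simp]: "s \<in> Sdeg n \<Longrightarrow> s \<in> carrier S"
  by (simp add: Sdeg_def)

lemma Sdeg_parity: "s \<in> Sdeg m \<Longrightarrow> even (m + n) \<Longrightarrow> s \<in> Sdeg n"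
  using kp_parity[of m n] SdegD[of s m] by (intro SdegI) simp_all

lemma Sdeg_tw: "tw w \<in> Sdeg (rdeg w)" and Sdeg_iw: "iw w \<in> Sdeg (ldeg w)"
  by (intro SdegI; simp add: coact_tw coact_iw)+

lemma Sdeg_mult: "s \<in> Sdeg m \<Longrightarrow> s' \<in> Sdeg n \<Longrightarrow> s * s' \<in> Sdeg (m + n)"
  using alg_homD(4)[OF coact_hom, of s s'] SB.pure_mult[of s s' "kp m" "kp n"]
  by (intro SdegI) (simp_all add: SdegD kp_add)

lemma Sdeg_add: "s \<in> Sdeg n \<Longrightarrow> s' \<in> Sdeg n \<Longrightarrow> s + s' \<in> Sdeg n"
  using alg_homD(2)[OF coact_hom, of s s'] SB.pure_add_left[of s s' "kp n"]
  by (intro SdegI) (simp_all add: SdegD)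

lemma Sdeg_smult: "s \<in> Sdeg n \<Longrightarrow> sym_const c * s \<in> Sdeg n"
  using alg_homD(3)[OF coact_hom, of s c] SB.pure_smult_left[of s "kp n" c]
  by (intro SdegI) (simp_all add: SdegD)

lemma Sdeg_one: "1 \<in> Sdeg 0"
  using alg_homD(5)[OF coact_hom] by (intro SdegI) (simp_all add: SB.pure_one)

lemma Sdeg_zero: "0 \<in> Sdeg n"
  using alg_hom_zero[OF coact_hom S.calg_axioms SB.T.calg_axioms] SB.pure_zero_left[of "kp n"]
  by (intro SdegI) simp_all

text \<open>A degree certified by a construction from \<open>t\<close> and \<open>t^{-1}\<close>. In
  contrast to \<open>Sdeg\<close>, it can be transported along a morphism by induction.\<close>

inductive hgen :: "nat \<Rightarrow> 'a symfrac \<Rightarrow> bool" where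
  tw: "hgen (rdeg w) (tw w)"
| iw: "hgen (ldeg w) (iw w)"
| one: "hgen 0 1"
| add: "hgen n s \<Longrightarrow> hgen n s' \<Longrightarrow> hgen n (s + s')"
| mult: "hgen m s \<Longrightarrow> hgen n s' \<Longrightarrow> hgen (m + n) (s * s')"
| smult: "hgen n s \<Longrightarrow> hgen n (sym_const c * s)"
| parity: "hgen m s \<Longrightarrow> even (m + n) \<Longrightarrow> hgen n s"
| zero: "hgen n 0"

lemma hgen_Sdeg: "hgen n s \<Longrightarrow> s \<in> Sdeg n"
  by (induction rule: hgen.induct)
    (auto intro: Sdeg_tw Sdeg_iw Sdeg_one Sdeg_add Sdeg_mult Sdeg_smult Sdeg_parity Sdeg_zero)

text \<open>Sums of an even and an odd element contain the generators and are closed under products,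
  as degrees add modulo 2.\<close>

lemma hgen_decomp:
  assumes "s \<in> carrier S" shows "\<exists>a b. hgen 0 a \<and> hgen 1 b \<and> s = a + b"
proof -
  define P where "P = (\<lambda>s. \<exists>a b. hgen 0 a \<and> hgen 1 b \<and> s = a + b)"
  have hom: "P (s)" if "hgen n s" for n s
  proof (cases "even n")
    case True
    then have "hgen 0 s" using hgen.parity[OF that, of 0] by simp
    then show ?thesis using hgen.zero unfolding P_def by force
  next
    case False
    then have "hgen 1 s" using hgen.parity[OF that, of 1] by simp
    then show ?thesis using hgen.zero unfolding P_def by force
  qed
  have plus: "P (s + s')"
    if s: "P (s)" "P (s')" for s s'
  proof -
    obtain a b a' b' where "hgen 0 a" "hgen 1 b" "s = a + b" "hgen 0 a'" "hgen 1 b'" "s' = a' + b'"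
      using s unfolding P_def by blast
    then show ?thesis
      unfolding P_def by (intro exI[of _ "a + a'"] exI[of _ "b + b'"]) (simp add: hgen.add)
  qed
  have scal: "P (sym_const c * s)"
    if s: "P (s)" for s c
  proof -
    obtain a b where "hgen 0 a" "hgen 1 b" "s = a + b" using s unfolding P_def by blast
    then show ?thesis
      unfolding P_def by (intro exI[of _ "sym_const c * a"] exI[of _ "sym_const c * b"]) (simp add: hgen.smult distrib_left)
  qed
  have gt: "P (tvar H x)" if "x \<in> carrier H" for x
    using that
    by (induction rule: word_induct) (simp_all add: lin_homD[OF tvar_lin] plus scal hom[OF hgen.tw])
  have gi: "P (tinv H x)" if "x \<in> carrier H" for x
    using that
    by (induction rule: word_induct) (simp_all add: lin_homD[OF tinv_spec(1)] plus scal hom[OF hgen.iw])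
  have "s \<in> subalg_gen symfrac_alg (tvar H ` carrier H \<union> tinv H ` carrier H)"
    using assms by (simp add: S_carrier)
  then have "P s"
  proof induction
    case one
    then show ?case using hom[OF hgen.one] by simp
  next
    case (incl x)
    then show ?case using gt gi by blast
  next
    case (add x y)
    then show ?case using plus by simp
  next
    case (mult x y)
    then obtain a b a' b' where ab: "hgen 0 a" "hgen 1 b" "x = a + b" "hgen 0 a'" "hgen 1 b'" "y = a' + b'"
      unfolding P_def by blast
    have "hgen 0 (a * a')" "hgen 1 (a * b')" "hgen 1 (b * a')" "hgen 0 (b * b')"
      using hgen.mult[OF ab(1,4)] hgen.mult[OF ab(1,5)] hgen.mult[OF ab(2,4)]
        hgen.parity[OF hgen.mult[OF ab(2,5)], of 0] by simp_all
    then have "hgen 0 (a * a' + b * b')" "hgen 1 (a * b' + b * a')" by (auto intro: hgen.add)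
    then show ?case using ab
      unfolding P_def by (intro exI[of _ "a * a' + b * b'"] exI[of _ "a * b' + b * a'"]) (simp add: algebra_simps)
  next
    case (smult x c)
    then show ?case using scal by simp
  qed
  then show ?thesis by (simp add: P_def)
qed

text \<open>For nontrivial \<open>kk\<close> this is a coefficient of \<open>one\<close>, available
  because group-likes are independent in the abelianization; composed with the coaction it projects
  onto degree 0. For trivial \<open>kk\<close> only the value at \<open>one\<close> is prescribed,
  and the projection is the identity.\<close>

definition lam :: "'a set \<Rightarrow> complex" where
  "lam = (SOME h. h \<in> lin_hom Hab complex_alg \<and> h \<one>\<^bsub>Hab\<^esub> = 1 \<and> (kk \<noteq> \<one>\<^bsub>Hab\<^esub> \<longrightarrow> h kk = 0))"

lemma grpsI: "edeg w = 0 \<Longrightarrow> \<phi> w \<in> grps"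
  unfolding grps_def by blast

lemma lam: "lam \<in> lin_hom Hab complex_alg" "lam \<one>\<^bsub>Hab\<^esub> = 1" "kk \<noteq> \<one>\<^bsub>Hab\<^esub> \<Longrightarrow> lam kk = 0"
proof -
  interpret ab: wh Hab "\<lambda>g. pab (\<gamma> g)" q by (rule wh_ab)
  obtain X where X: "ab.grps \<subseteq> X" "is_basis Hab X" by (rule Hab.basis_extend[OF ab.indep_grps])
  obtain h where h: "h \<in> lin_hom Hab complex_alg" "\<And>b. b \<in> X \<Longrightarrow> h b = (if b = \<one>\<^bsub>Hab\<^esub> then 1 else 0)"
    by (rule Hab.basis_lin_hom[OF X(2) CC.cmod_axioms, of "\<lambda>b. if b = \<one>\<^bsub>Hab\<^esub> then 1 else 0"]) simp_all
  have "ab.wmon [] \<in> ab.grps" "ab.wmon [Gen_K] \<in> ab.grps"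
    by (rule ab.grpsI; simp)+
  then have "ab.wmon [] \<in> X" "ab.wmon [Gen_K] \<in> X" using X(1) by blast+
  then have "h \<one>\<^bsub>Hab\<^esub> = 1" "kk \<noteq> \<one>\<^bsub>Hab\<^esub> \<Longrightarrow> h kk = 0" using h(2) by simp_all
  then have "\<exists>h. h \<in> lin_hom Hab complex_alg \<and> h \<one>\<^bsub>Hab\<^esub> = 1 \<and> (kk \<noteq> \<one>\<^bsub>Hab\<^esub> \<longrightarrow> h kk = 0)" using h(1) by blast
  from someI_ex[OF this] show "lam \<in> lin_hom Hab complex_alg" "lam \<one>\<^bsub>Hab\<^esub> = 1" "kk \<noteq> \<one>\<^bsub>Hab\<^esub> \<Longrightarrow> lam kk = 0"
    unfolding lam_def by blast+
qed

text \<open>Extending \<open>gen_elem\<close> to all coefficients in \<open>S\<close> by means of the projection \<open>pr0\<close> keeps the sums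
  in \<open>theta\<close> bilinear without a side condition on the degree.\<close>

definition pr0 :: "'a symfrac \<Rightarrow> 'a symfrac" where
  "pr0 s = tlift S (\<lambda>a h. sym_const (lam h) * a) (coact s)"

lemma pr0_blin: "blin S Hab S (\<lambda>a h. sym_const (lam h) * a)"
  using lin_homD[OF lam(1)] by (intro blinI lin_homI) (simp_all add: distrib_left distrib_right mult.assoc mult.left_commute sym_const_simps)

lemma pr0_lin_S: "pr0 \<in> lin_hom S S"
  unfolding pr0_def[abs_def]
  by (rule lin_hom_compose[OF alg_hom_lin[OF coact_hom] SB.tlift_lin_hom[OF pr0_blin S.cmod_axioms]])

lemma pr0_Sdeg: "s \<in> Sdeg n \<Longrightarrow> pr0 s = sym_const (lam (kp n)) * s"
  unfolding pr0_def by (simp add: SdegD SB.tlift_pure[OF pr0_blin S.cmod_axioms])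

lemma pr0_id: "s \<in> Sdeg 0 \<Longrightarrow> pr0 s = s"
  by (simp add: pr0_Sdeg lam sym_const_simps)

lemma pr0_odd: "s \<in> Sdeg 1 \<Longrightarrow> kk \<noteq> \<one>\<^bsub>Hab\<^esub> \<Longrightarrow> pr0 s = 0"
  using pr0_Sdeg[of s 1] by (simp add: lam kp_def sym_const_simps)

lemma Sdeg_all: "kk = \<one>\<^bsub>Hab\<^esub> \<Longrightarrow> s \<in> Sdeg m \<Longrightarrow> s \<in> Sdeg n"
  using SdegD[of s m] by (intro SdegI) (simp_all add: kp_def)

lemma pr0_base: "s \<in> carrier S \<Longrightarrow> pr0 s \<in> Sdeg 0"
proof -
  assume "s \<in> carrier S"
  then obtain a b where ab: "hgen 0 a" "hgen 1 b" "s = a + b" using hgen_decomp by blast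
  note d = hgen_Sdeg[OF ab(1)] hgen_Sdeg[OF ab(2)]
  have "pr0 s = pr0 a + pr0 b" using lin_homD(2)[OF pr0_lin_S, of a b] ab(3) d by simp
  \<comment> \<open>Either the odd part is annihilated or, for trivial \<open>kk\<close>, it has
    degree 0 as well.\<close>
  moreover have "pr0 b \<in> Sdeg 0"
    using pr0_odd[OF d(2)] Sdeg_zero pr0_id Sdeg_all[OF _ d(2), of 0] by (cases "kk = \<one>\<^bsub>Hab\<^esub>") simp_all
  ultimately show ?thesis using pr0_id[OF d(1)] d(1) by (simp add: Sdeg_add)
qed

text \<open>In a genuine grading \<open>pr0\<close> separates the two components of
  \<open>s\<close>, so one of them vanishes by the degree of \<open>s\<close>.\<close>

lemma Sdeg_hgen:
  assumes "kk \<noteq> \<one>\<^bsub>Hab\<^esub>" "s \<in> Sdeg n" shows "hgen n s"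
proof -
  obtain a b where ab: "hgen 0 a" "hgen 1 b" "s = a + b" using hgen_decomp[OF Sdeg_S[OF assms(2)]] by blast
  note d = hgen_Sdeg[OF ab(1)] hgen_Sdeg[OF ab(2)]
  have p: "pr0 s = a" using lin_homD(2)[OF pr0_lin_S, of a b] ab(3) d pr0_id[OF d(1)] pr0_odd[OF d(2) assms(1)] by simp
  show ?thesis
  proof (cases "even n")
    case True
    then have "pr0 s = s" using pr0_id Sdeg_parity[OF assms(2), of 0] by simp
    then show ?thesis using p hgen.parity[OF ab(1), of n] True by simp
  next
    case False
    then have "pr0 s = 0" using pr0_odd[OF _ assms(1)] Sdeg_parity[OF assms(2), of 1] by simp
    then show ?thesis using p ab(3) hgen.parity[OF ab(2), of n] False by simp
  qed
qed

section \<open>The generic Galois extension\<close>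

abbreviation "B \<equiv> base_alg H"

lemma base_eq: "B = S\<lparr>carrier := Sdeg 0\<rparr>"
  by (simp add: base_alg_def Sdeg_def coact_def del: Sdeg_S)

lemma base_simps [simp]:
  "carrier B = Sdeg 0" "mult B = (*)" "one B = 1" "zero B = 0" "add B = (+)"
  "smult B = (\<lambda>c x. sym_const c * x)"
  by (simp_all add: base_eq)

lemma calg_base: "calg B"
  unfolding base_eq
  using Sdeg_mult[of _ 0 _ 0]
  by (intro calg_subalg[OF S.calg_axioms]) (auto simp: Sdeg_one Sdeg_zero Sdeg_add Sdeg_smult)

sublocale B: calg B by (rule calg_base)
sublocale BH: tens B H ..

abbreviation "TT \<equiv> tensor B H"
abbreviation ge where "ge \<equiv> gen_elem H"

lemma ge_pure: "ge b x = pure B H b x"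
  by (simp add: gen_elem_def)

lemma pr0_lin: "pr0 \<in> lin_hom S B"
  using lin_homD[OF pr0_lin_S] pr0_base by (intro lin_homI) simp_all

definition gp :: "'a symfrac \<Rightarrow> 'a \<Rightarrow> (('a symfrac \<times> 'a) \<Rightarrow>\<^sub>0 complex) set" where
  "gp s x = ge (pr0 s) x"

lemma gp_blin: "blin S H TT gp"
  unfolding gp_def[abs_def] ge_pure by (rule blin_compose[OF BH.blin_pure pr0_lin lin_hom_id])

lemma gp_closed [simp, intro]: "s \<in> carrier S \<Longrightarrow> x \<in> carrier H \<Longrightarrow> gp s x \<in> carrier TT"
  using blinD(3)[OF gp_blin] .

lemma gp_base: "b \<in> Sdeg 0 \<Longrightarrow> gp b x = ge b x"
  by (simp add: gp_def pr0_id)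

text \<open>The identity \<open>\<Sum> t^{-1}_{x_1} t_{x_2} \<otimes> x_3 = 1 \<otimes> x\<close>,
  followed by an arbitrary continuation \<open>K\<close> that is linear in the coefficient.\<close>

lemma cancel_it:
  assumes "cmod C" "\<And>v. (\<lambda>a. K a v) \<in> lin_hom S C"
  shows "wsum C w (\<lambda>u v. wsum C v (\<lambda>v1 v2. K (iw u * tw v1) v2)) = K 1 w"
proof -
  interpret C: cmod C by fact
  have c: "s \<in> carrier S \<Longrightarrow> K s v \<in> carrier C" for s v using lin_homD(1)[OF assms(2)] .
  have "wsum C w (\<lambda>u v. wsum C v (\<lambda>v1 v2. K (iw u * tw v1) v2))
    = wsum C w (\<lambda>x v2. wsum C x (\<lambda>u v1. K (iw u * tw v1) v2))"
    by (rule C.wsum_coassoc[symmetric]) (simp add: c)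
  also have "\<dots> = wsum C w (\<lambda>x v2. K (ceps S x) v2)"
    unfolding S_inverse(1)[symmetric] conv_def
    by (subst wsum_hom[OF assms(2) S.cmod_axioms]) simp_all
  also have "\<dots> = K 1 w"
    using lin_hom_zero[OF assms(2) S.cmod_axioms assms(1)]
    by (subst C.wsum_bot) (simp_all add: ceps_def c)
  finally show ?thesis .
qed

lemma cancel_ti:
  assumes "cmod C" "\<And>v. (\<lambda>a. K a v) \<in> lin_hom S C"
  shows "wsum C w (\<lambda>u v. wsum C v (\<lambda>v1 v2. K (tw u * iw v1) v2)) = K 1 w"
proof -
  interpret C: cmod C by fact
  have c: "s \<in> carrier S \<Longrightarrow> K s v \<in> carrier C" for s v using lin_homD(1)[OF assms(2)] .
  have "wsum C w (\<lambda>u v. wsum C v (\<lambda>v1 v2. K (tw u * iw v1) v2))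
    = wsum C w (\<lambda>x v2. wsum C x (\<lambda>u v1. K (tw u * iw v1) v2))"
    by (rule C.wsum_coassoc[symmetric]) (simp add: c)
  also have "\<dots> = wsum C w (\<lambda>x v2. K (ceps S x) v2)"
    unfolding S_inverse(2)[symmetric] conv_def
    by (subst wsum_hom[OF assms(2) S.cmod_axioms]) simp_all
  also have "\<dots> = K 1 w"
    using lin_hom_zero[OF assms(2) S.cmod_axioms assms(1)]
    by (subst C.wsum_bot) (simp_all add: ceps_def c)
  finally show ?thesis .
qed

definition theta :: "'a symfrac \<Rightarrow> uq_gen list \<Rightarrow> (('a symfrac \<times> 'a) \<Rightarrow>\<^sub>0 complex) set" where
  "theta s w = wsum TT w (\<lambda>u v. gp (s * iw u) (\<phi> v))"

lemma S_mult_lin: "a \<in> carrier S \<Longrightarrow> (\<lambda>x. a * x) \<in> lin_hom S S" "a \<in> carrier S \<Longrightarrow> (\<lambda>x. x * a) \<in> lin_hom S S"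
  using S.mult_lin_left[of a] S.mult_lin_right[of a] by simp_all

lemma gp_mult_lin: "a \<in> carrier S \<Longrightarrow> x \<in> carrier H \<Longrightarrow> (\<lambda>s. gp (a * s) x) \<in> lin_hom S TT"
  "a \<in> carrier S \<Longrightarrow> x \<in> carrier H \<Longrightarrow> (\<lambda>s. gp (s * a) x) \<in> lin_hom S TT"
  by (rule lin_hom_compose[OF S_mult_lin(1) blinD(2)[OF gp_blin]], assumption+)
    (rule lin_hom_compose[OF S_mult_lin(2) blinD(2)[OF gp_blin]], assumption+)

lemma wsum_lin:
  assumes "cmod C" "\<And>u v. (\<lambda>s. f s u v) \<in> lin_hom P C"
  shows "(\<lambda>s. wsum C w (f s)) \<in> lin_hom P C"
  using assms(2)
proof (induction w arbitrary: f)
  case Nil then show ?case by simp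
next
  case (Cons g w)
  then show ?case by (cases g) (simp_all add: lin_hom_add[OF _ _ assms(1)])
qed

lemma theta_lin: "(\<lambda>s. theta s w) \<in> lin_hom S TT"
  unfolding theta_def by (rule wsum_lin[OF BH.T.cmod_axioms gp_mult_lin(2)]) simp_all

lemma theta_closed [simp, intro]: "s \<in> carrier S \<Longrightarrow> theta s w \<in> carrier TT"
  using lin_homD(1)[OF theta_lin] .

lemma theta_base: "s \<in> Sdeg (ldeg w) \<Longrightarrow> splits w u v \<Longrightarrow> s * iw u \<in> Sdeg 0"
  using Sdeg_parity[OF Sdeg_mult[OF _ Sdeg_iw], of s "ldeg w" u 0] by (simp add: splits_def add.commute)

lemma theta_ge: "s \<in> Sdeg (ldeg w) \<Longrightarrow> theta s w = wsum TT w (\<lambda>u v. ge (s * iw u) (\<phi> v))"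
  unfolding theta_def by (rule wsum_cong) (simp add: gp_base theta_base)

text \<open>The inverse of the passage to \<open>theta\<close>: inserting the definition cancels
  \<open>t\<close> against \<open>t^{-1}\<close>.\<close>

lemma gp_theta: "b \<in> carrier S \<Longrightarrow> gp b (\<phi> w) = wsum TT w (\<lambda>u v. theta (b * tw u) v)"
  unfolding theta_def
  using cancel_ti[OF BH.T.cmod_axioms, of "\<lambda>a v. gp (b * a) (\<phi> v)" w] gp_mult_lin(1)[of b]
  by (simp add: mult.assoc)

lemma theta_deg: "b \<in> Sdeg 0 \<Longrightarrow> splits w u v \<Longrightarrow> b * tw u \<in> Sdeg (ldeg v)"
  using Sdeg_parity[OF Sdeg_mult[OF _ Sdeg_tw], of b 0 u "ldeg v"] by (simp add: splits_def)

text \<open>Every \<open>b \<otimes> w\<close> is a sum of elements \<open>theta s v\<close> with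
  \<open>s\<close> of the degree of \<open>v\<close>, so these span the extension.\<close>

lemma theta_induct [consumes 1, case_names theta add]:
  assumes "X \<in> carrier TT" "\<And>s w. s \<in> Sdeg (ldeg w) \<Longrightarrow> P (theta s w)"
    "\<And>X Y. X \<in> carrier TT \<Longrightarrow> Y \<in> carrier TT \<Longrightarrow> P X \<Longrightarrow> P Y \<Longrightarrow> P (X \<oplus>\<^bsub>TT\<^esub> Y)"
  shows "P X"
  using assms(1)
proof (induction rule: BH.tensor_induct)
  case (pure b x)
  have "\<forall>b\<in>Sdeg 0. P (pure B H b x)" using pure(2)
  proof (induction rule: word_induct)
    case (word w)
    show ?case
    proof
      fix b assume b: "b \<in> Sdeg 0"
      have "P (wsum TT w (\<lambda>u v. theta (b * tw u) v)) \<and> wsum TT w (\<lambda>u v. theta (b * tw u) v) \<in> carrier TT"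
        by (rule wsum_induct) (auto intro: assms(2,3) theta_deg b theta_closed Sdeg_S)
      then show "P (pure B H b (\<phi> w))" using b gp_theta[of b w] by (simp add: gp_base ge_pure)
    qed
  next
    case (smult c x)
    have "pure B H b (c \<odot> x) = pure B H (sym_const c * b) x" if "b \<in> Sdeg 0" for b
      using BH.pure_smult_left[of b x c] BH.pure_smult_right[of b x c] that smult(1) by simp
    then show ?case using smult(2) Sdeg_smult by simp
  next
    case (add x y)
    then show ?case by (simp add: BH.pure_add_right assms(3))
  qed
  then show ?case using pure(1) by simp
qed (use assms(3) in blast)

lemma gen_cocycle_lin4: 
  shows "\<And>x2 y1 y2. x2 \<in> carrier H \<Longrightarrow> y1 \<in> carrier H \<Longrightarrow> y2 \<in> carrier H \<Longrightarrow>
      (\<lambda>x1. tvar H x1 * tvar H y1 * tinv H (x2 \<otimes> y2)) \<in> lin_hom H S"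
    "\<And>x1 y1 y2. x1 \<in> carrier H \<Longrightarrow> y1 \<in> carrier H \<Longrightarrow> y2 \<in> carrier H \<Longrightarrow>
      (\<lambda>x2. tvar H x1 * tvar H y1 * tinv H (x2 \<otimes> y2)) \<in> lin_hom H S"
    "\<And>x1 x2 y2. x1 \<in> carrier H \<Longrightarrow> x2 \<in> carrier H \<Longrightarrow> y2 \<in> carrier H \<Longrightarrow>
      (\<lambda>y1. tvar H x1 * tvar H y1 * tinv H (x2 \<otimes> y2)) \<in> lin_hom H S"
    "\<And>x1 x2 y1. x1 \<in> carrier H \<Longrightarrow> x2 \<in> carrier H \<Longrightarrow> y1 \<in> carrier H \<Longrightarrow>
      (\<lambda>y2. tvar H x1 * tvar H y1 * tinv H (x2 \<otimes> y2)) \<in> lin_hom H S"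
  using lin_homD[OF tvar_lin] lin_homD[OF tinv_spec(1)]
  by (auto intro!: lin_homI simp: distrib_left distrib_right l_distr r_distr smult_mult_left smult_mult_right)

end

section \<open>The twisted product\<close>

context wh
begin

abbreviation "\<sigma> \<equiv> gen_cocycle H"

lemma lin_S_symfrac: "h \<in> lin_hom P S \<Longrightarrow> h \<in> lin_hom P symfrac_alg"
  by (auto simp: lin_hom_def)

lemma cocycle_inner:
  assumes "x1 \<in> carrier H" "x2 \<in> carrier H"
  shows "blin H H symfrac_alg (\<lambda>y1 y2. tvar H x1 * tvar H y1 * tinv H (x2 \<otimes> y2))"
  by (intro blinI lin_S_symfrac gen_cocycle_lin4 assms)

lemma cocycle_middle:
  assumes "y \<in> carrier H"
  shows "blin H H symfrac_alg (\<lambda>x1 x2. tlift symfrac_alg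
    (\<lambda>y1 y2. tvar H x1 * tvar H y1 * tinv H (x2 \<otimes> y2)) (comult H y))"
proof (intro blinI)
  fix x1 assume x1: "x1 \<in> carrier H"
  show "(\<lambda>x2. tlift symfrac_alg (\<lambda>y1 y2. tvar H x1 * tvar H y1 * tinv H (x2 \<otimes> y2)) (comult H y))
    \<in> lin_hom H symfrac_alg"
    by (rule HH.tlift_param[OF SF.cmod_axioms cocycle_inner lin_S_symfrac[OF gen_cocycle_lin4(2)] cmod_axioms])
      (simp_all add: x1 assms)
next
  fix x2 assume x2: "x2 \<in> carrier H"
  show "(\<lambda>x1. tlift symfrac_alg (\<lambda>y1 y2. tvar H x1 * tvar H y1 * tinv H (x2 \<otimes> y2)) (comult H y))
    \<in> lin_hom H symfrac_alg"
    by (rule HH.tlift_param[OF SF.cmod_axioms cocycle_inner lin_S_symfrac[OF gen_cocycle_lin4(1)] cmod_axioms])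
      (simp_all add: x2 assms)
qed

lemma cocycle_blin: "blin H H symfrac_alg \<sigma>"
proof (intro blinI)
  fix y assume y: "y \<in> carrier H"
  show "(\<lambda>x. \<sigma> x y) \<in> lin_hom H symfrac_alg"
    unfolding gen_cocycle_def
    by (rule lin_hom_compose[OF alg_hom_lin[OF comult_hom]
      HH.tlift_lin_hom[OF cocycle_middle[OF y] SF.cmod_axioms]])
next
  fix x assume x: "x \<in> carrier H"
  show "\<sigma> x \<in> lin_hom H symfrac_alg"
    unfolding gen_cocycle_def[abs_def]
  proof (rule HH.tlift_param[OF SF.cmod_axioms cocycle_middle _ cmod_axioms comult_closed[OF x]])
    fix x1 x2 assume "x1 \<in> carrier H" "x2 \<in> carrier H"
    then show "(\<lambda>y. tlift symfrac_alg (\<lambda>y1 y2. tvar H x1 * tvar H y1 * tinv H (x2 \<otimes> y2)) (comult H y))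
      \<in> lin_hom H symfrac_alg"
      by (intro lin_hom_compose[OF alg_hom_lin[OF comult_hom] HH.tlift_lin_hom[OF cocycle_inner SF.cmod_axioms]])
  qed
qed

lemma cocycle_word: "\<sigma> (\<phi> w) (\<phi> w')
  = wsum symfrac_alg w (\<lambda>u v. wsum symfrac_alg w' (\<lambda>u' v'. tw u * tw u' * iw (v @ v')))"
  unfolding gen_cocycle_def
  by (simp add: sweedler[OF cocycle_middle SF.cmod_axioms] sweedler[OF cocycle_inner SF.cmod_axioms] word_append)

text \<open>By the third clause of \<open>splits\<close>, \<open>t_u\<close> and
  \<open>t^{-1}_v\<close> have equal parity for each term \<open>u \<otimes> v\<close> of a
  coproduct; hence every summand of the cocycle is even.\<close>

lemma cocycle_base: "x \<in> carrier H \<Longrightarrow> y \<in> carrier H \<Longrightarrow> \<sigma> x y \<in> Sdeg 0"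
proof -
  note bD = lin_homD[OF blinD(1)[OF cocycle_blin]] lin_homD[OF blinD(2)[OF cocycle_blin]]
  assume x: "x \<in> carrier H" and y: "y \<in> carrier H"
  have ww: "\<sigma> (\<phi> w) (\<phi> w') \<in> Sdeg 0" for w w'
    unfolding cocycle_word
  proof (rule wsum_induct[where P = "\<lambda>x. x \<in> Sdeg 0"])
    fix u v assume uv: "splits w u v"
    show "wsum symfrac_alg w' (\<lambda>u' v'. tw u * tw u' * iw (v @ v')) \<in> Sdeg 0"
    proof (rule wsum_induct[where P = "\<lambda>x. x \<in> Sdeg 0"])
      fix u' v' assume uv': "splits w' u' v'"
      have "tw u * tw u' * iw (v @ v') \<in> Sdeg (rdeg u + rdeg u' + ldeg (v @ v'))"
        by (intro Sdeg_mult Sdeg_tw Sdeg_iw)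
      then show "tw u * tw u' * iw (v @ v') \<in> Sdeg 0"
        by (rule Sdeg_parity) (use uv uv' in \<open>auto simp: splits_def\<close>)
    qed (simp add: Sdeg_add)
  qed (simp add: Sdeg_add)
  have wy: "\<sigma> (\<phi> w) y \<in> Sdeg 0" for w
    using y by (induction rule: word_induct) (simp_all add: ww bD Sdeg_add Sdeg_smult)
  show "\<sigma> x y \<in> Sdeg 0"
    using x by (induction rule: word_induct) (simp_all add: wy bD y Sdeg_add Sdeg_smult)
qed

lemma cocycle_lin: "x \<in> carrier H \<Longrightarrow> \<sigma> x \<in> lin_hom H B" "y \<in> carrier H \<Longrightarrow> (\<lambda>x. \<sigma> x y) \<in> lin_hom H B"
  using lin_homD[OF blinD(1)[OF cocycle_blin]] lin_homD[OF blinD(2)[OF cocycle_blin]] cocycle_base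
  by (auto intro!: lin_homI)

lemma base_mult [simp, intro]: "a \<in> Sdeg 0 \<Longrightarrow> b \<in> Sdeg 0 \<Longrightarrow> a * b \<in> Sdeg 0"
  using Sdeg_mult[of a 0 b 0] by simp

lemma base_mult_lin: "a \<in> Sdeg 0 \<Longrightarrow> (\<lambda>x. a * x) \<in> lin_hom B B" "a \<in> Sdeg 0 \<Longrightarrow> (\<lambda>x. x * a) \<in> lin_hom B B"
  using B.mult_lin_left[of a] B.mult_lin_right[of a] by simp_all

lemma ge_blin: "blin B H TT ge"
  unfolding gen_elem_def[abs_def] by (rule BH.blin_pure)

lemma ge_closed [simp, intro]: "b \<in> Sdeg 0 \<Longrightarrow> x \<in> carrier H \<Longrightarrow> ge b x \<in> carrier TT"
  using blinD(3)[OF ge_blin] by simp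

text \<open>The product is a fourfold nested \<open>tlift\<close>. The functions \<open>m6\<close>
  down to \<open>m3\<close> are its layers from the inside outwards; each is shown to be linear in
  its variables, which the next \<open>tlift\<close> requires.\<close>

definition m6 where "m6 b c x1 x2 y1 y2 = ge (b * c * \<sigma> x1 y1) (x2 \<otimes> y2)"

lemma m6_lin:
  assumes "b \<in> Sdeg 0" "c \<in> Sdeg 0" "x1 \<in> carrier H" "x2 \<in> carrier H" "y1 \<in> carrier H" "y2 \<in> carrier H"
  shows "(\<lambda>b. m6 b c x1 x2 y1 y2) \<in> lin_hom B TT" "(\<lambda>c. m6 b c x1 x2 y1 y2) \<in> lin_hom B TT"
    "(\<lambda>x1. m6 b c x1 x2 y1 y2) \<in> lin_hom H TT" "(\<lambda>x2. m6 b c x1 x2 y1 y2) \<in> lin_hom H TT"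
    "(\<lambda>y1. m6 b c x1 x2 y1 y2) \<in> lin_hom H TT" "(\<lambda>y2. m6 b c x1 x2 y1 y2) \<in> lin_hom H TT"
proof -
  note gl = blinD(2)[OF ge_blin, of "x2 \<otimes> y2"] and gr = blinD(1)[OF ge_blin, of "b * c * \<sigma> x1 y1"]
  have s: "\<sigma> x1 y1 \<in> Sdeg 0" using cocycle_base assms by simp
  have xy: "x2 \<otimes> y2 \<in> carrier H" using assms by simp
  show "(\<lambda>b. m6 b c x1 x2 y1 y2) \<in> lin_hom B TT"
    unfolding m6_def using assms s
    by (intro lin_hom_compose[OF lin_hom_compose[OF base_mult_lin(2) base_mult_lin(2)] gl[OF xy]])
  show "(\<lambda>c. m6 b c x1 x2 y1 y2) \<in> lin_hom B TT"
    unfolding m6_def using assms s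
    by (intro lin_hom_compose[OF lin_hom_compose[OF base_mult_lin(1) base_mult_lin(2)] gl[OF xy]])
  show "(\<lambda>x1. m6 b c x1 x2 y1 y2) \<in> lin_hom H TT"
    unfolding m6_def using assms
    by (intro lin_hom_compose[OF lin_hom_compose[OF cocycle_lin(2) base_mult_lin(1)] gl[OF xy]]) auto
  show "(\<lambda>y1. m6 b c x1 x2 y1 y2) \<in> lin_hom H TT"
    unfolding m6_def using assms
    by (intro lin_hom_compose[OF lin_hom_compose[OF cocycle_lin(1) base_mult_lin(1)] gl[OF xy]]) auto
  show "(\<lambda>x2. m6 b c x1 x2 y1 y2) \<in> lin_hom H TT"
    unfolding m6_def using assms s by (intro lin_hom_compose[OF mult_lin_right gr]) auto
  show "(\<lambda>y2. m6 b c x1 x2 y1 y2) \<in> lin_hom H TT"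
    unfolding m6_def using assms s by (intro lin_hom_compose[OF mult_lin_left gr]) auto
qed

definition m5 where "m5 b c y x1 x2 = tlift TT (\<lambda>y1 y2. m6 b c x1 x2 y1 y2) (comult H y)"

lemma m6_blin: "b \<in> Sdeg 0 \<Longrightarrow> c \<in> Sdeg 0 \<Longrightarrow> x1 \<in> carrier H \<Longrightarrow> x2 \<in> carrier H \<Longrightarrow>
  blin H H TT (\<lambda>y1 y2. m6 b c x1 x2 y1 y2)"
  by (intro blinI m6_lin)

lemma m5_lin:
  assumes "b \<in> Sdeg 0" "c \<in> Sdeg 0" "x1 \<in> carrier H" "x2 \<in> carrier H" "y \<in> carrier H"
  shows "(\<lambda>b. m5 b c y x1 x2) \<in> lin_hom B TT" "(\<lambda>c. m5 b c y x1 x2) \<in> lin_hom B TT"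
    "(\<lambda>x1. m5 b c y x1 x2) \<in> lin_hom H TT" "(\<lambda>x2. m5 b c y x1 x2) \<in> lin_hom H TT"
    "(\<lambda>y. m5 b c y x1 x2) \<in> lin_hom H TT"
proof -
  note tp = HH.tlift_param[OF BH.T.cmod_axioms _ _ _ comult_closed[OF assms(5)]]
  show "(\<lambda>b. m5 b c y x1 x2) \<in> lin_hom B TT"
    unfolding m5_def by (rule tp[OF m6_blin m6_lin(1) B.cmod_axioms]) (use assms in simp_all)
  show "(\<lambda>c. m5 b c y x1 x2) \<in> lin_hom B TT"
    unfolding m5_def by (rule tp[OF m6_blin m6_lin(2) B.cmod_axioms]) (use assms in simp_all)
  show "(\<lambda>x1. m5 b c y x1 x2) \<in> lin_hom H TT"
    unfolding m5_def by (rule tp[OF m6_blin m6_lin(3) cmod_axioms]) (use assms in simp_all)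
  show "(\<lambda>x2. m5 b c y x1 x2) \<in> lin_hom H TT"
    unfolding m5_def by (rule tp[OF m6_blin m6_lin(4) cmod_axioms]) (use assms in simp_all)
  show "(\<lambda>y. m5 b c y x1 x2) \<in> lin_hom H TT"
    unfolding m5_def using assms
    by (intro lin_hom_compose[OF alg_hom_lin[OF comult_hom] HH.tlift_lin_hom[OF m6_blin BH.T.cmod_axioms]])
qed

definition m4 where "m4 b x c y = tlift TT (\<lambda>x1 x2. m5 b c y x1 x2) (comult H x)"

lemma m5_blin: "b \<in> Sdeg 0 \<Longrightarrow> c \<in> Sdeg 0 \<Longrightarrow> y \<in> carrier H \<Longrightarrow> blin H H TT (\<lambda>x1 x2. m5 b c y x1 x2)"
  by (intro blinI m5_lin)

lemma m4_lin:
  assumes "b \<in> Sdeg 0" "c \<in> Sdeg 0" "x \<in> carrier H" "y \<in> carrier H"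
  shows "(\<lambda>b. m4 b x c y) \<in> lin_hom B TT" "(\<lambda>c. m4 b x c y) \<in> lin_hom B TT"
    "(\<lambda>x. m4 b x c y) \<in> lin_hom H TT" "(\<lambda>y. m4 b x c y) \<in> lin_hom H TT"
proof -
  note tp = HH.tlift_param[OF BH.T.cmod_axioms _ _ _ comult_closed[OF assms(3)]]
  show "(\<lambda>b. m4 b x c y) \<in> lin_hom B TT"
    unfolding m4_def by (rule tp[OF m5_blin m5_lin(1) B.cmod_axioms]) (use assms in simp_all)
  show "(\<lambda>c. m4 b x c y) \<in> lin_hom B TT"
    unfolding m4_def by (rule tp[OF m5_blin m5_lin(2) B.cmod_axioms]) (use assms in simp_all)
  show "(\<lambda>x. m4 b x c y) \<in> lin_hom H TT"
    unfolding m4_def using assms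
    by (intro lin_hom_compose[OF alg_hom_lin[OF comult_hom] HH.tlift_lin_hom[OF m5_blin BH.T.cmod_axioms]])
  show "(\<lambda>y. m4 b x c y) \<in> lin_hom H TT"
    unfolding m4_def by (rule tp[OF m5_blin m5_lin(5) cmod_axioms]) (use assms in simp_all)
qed

lemma m4_blin: "b \<in> Sdeg 0 \<Longrightarrow> x \<in> carrier H \<Longrightarrow> blin B H TT (m4 b x)"
  by (intro blinI m4_lin) simp_all

definition m3 where "m3 Y b x = tlift TT (m4 b x) Y"

lemma m3_blin:
  assumes "Y \<in> carrier TT" shows "blin B H TT (m3 Y)"
proof (rule blinI)
  note tp = BH.tlift_param[OF BH.T.cmod_axioms _ _ _ assms]
  fix b assume "b \<in> carrier B"
  then show "m3 Y b \<in> lin_hom H TT"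
    unfolding m3_def[abs_def] by (intro tp[OF m4_blin m4_lin(3) cmod_axioms]) simp_all
next
  note tp = BH.tlift_param[OF BH.T.cmod_axioms _ _ _ assms]
  fix x assume "x \<in> carrier H"
  then show "(\<lambda>b. m3 Y b x) \<in> lin_hom B TT"
    unfolding m3_def by (intro tp[OF m4_blin m4_lin(1) B.cmod_axioms]) simp_all
qed

lemma gen_mult_eq: "gen_mult H X Y = tlift TT (m3 Y) X"
  by (simp add: gen_mult_def Let_def m3_def[abs_def] m4_def[abs_def] m5_def[abs_def] m6_def[abs_def])

lemma gen_mult_blin: "blin TT TT TT (gen_mult H)"
proof (rule blinI)
  fix Y assume "Y \<in> carrier TT"
  then show "(\<lambda>X. gen_mult H X Y) \<in> lin_hom TT TT"
    unfolding gen_mult_eq by (rule BH.tlift_lin_hom[OF m3_blin BH.T.cmod_axioms])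
next
  fix X assume X: "X \<in> carrier TT"
  show "gen_mult H X \<in> lin_hom TT TT"
    unfolding gen_mult_eq[abs_def]
  proof (rule BH.tlift_param[OF BH.T.cmod_axioms m3_blin _ BH.T.cmod_axioms X])
    fix b x assume "b \<in> carrier B" "x \<in> carrier H"
    then show "(\<lambda>Y. m3 Y b x) \<in> lin_hom TT TT"
      unfolding m3_def by (intro BH.tlift_lin_hom[OF m4_blin BH.T.cmod_axioms]) simp_all
  qed
qed

lemma gen_mult_ge:
  assumes "b \<in> Sdeg 0" "c \<in> Sdeg 0"
  shows "gen_mult H (ge b (\<phi> w)) (ge c (\<phi> w'))
    = wsum TT w (\<lambda>u v. wsum TT w' (\<lambda>u' v'. ge (b * c * \<sigma> (\<phi> u) (\<phi> u')) (\<phi> (v @ v'))))"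
proof -
  have "gen_mult H (ge b (\<phi> w)) (ge c (\<phi> w')) = m4 b (\<phi> w) c (\<phi> w')"
    unfolding gen_mult_eq
    by (simp add: ge_pure BH.tlift_pure[OF m3_blin BH.T.cmod_axioms] assms)
      (simp add: m3_def BH.tlift_pure[OF m4_blin BH.T.cmod_axioms] assms)
  also have "\<dots> = wsum TT w (\<lambda>u v. wsum TT w' (\<lambda>u' v'. m6 b c (\<phi> u) (\<phi> v) (\<phi> u') (\<phi> v')))"
    unfolding m4_def
    by (simp add: sweedler[OF m5_blin BH.T.cmod_axioms] assms)
      (simp add: m5_def sweedler[OF m6_blin BH.T.cmod_axioms] assms)
  finally show ?thesis by (simp add: m6_def word_append)
qed

text \<open>Unfolding the cocycle produces \<open>t^{-1}\<close> at the product of the middle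
  factors; by coassociativity it joins the right factors to form a \<open>theta\<close>.\<close>

lemma gen_mult_gp:
  assumes "b \<in> Sdeg 0" "c \<in> Sdeg 0"
  shows "gen_mult H (ge b (\<phi> w)) (ge c (\<phi> w'))
    = wsum TT w (\<lambda>u v. wsum TT w' (\<lambda>u' v'. theta (b * c * tw u * tw u') (v @ v')))"
proof -
  let ?G = "\<lambda>u1 u2 v u1' u2' v'. gp (b * c * (tw u1 * tw u1' * iw (u2 @ u2'))) (\<phi> (v @ v'))"
  have bc: "b * c \<in> carrier S" using assms by (intro S_closed) simp_all
  have G: "?G u1 u2 v u1' u2' v' \<in> carrier TT" for u1 u2 v u1' u2' v'
    using assms by (intro gp_closed S_closed) simp_all
  have e: "ge (b * c * \<sigma> (\<phi> u) (\<phi> u')) (\<phi> (v @ v'))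
    = wsum TT u (\<lambda>u1 u2. wsum TT u' (\<lambda>u1' u2'. ?G u1 u2 v u1' u2' v'))" for u v u' v'
  proof -
    have "ge (b * c * \<sigma> (\<phi> u) (\<phi> u')) (\<phi> (v @ v')) = gp (b * c * \<sigma> (\<phi> u) (\<phi> u')) (\<phi> (v @ v'))"
      using assms cocycle_base by (simp add: gp_base)
    also have "\<dots> = wsum TT u (\<lambda>u1 u2. gp (b * c * wsum S u' (\<lambda>u1' u2'. tw u1 * tw u1' * iw (u2 @ u2'))) (\<phi> (v @ v')))"
      unfolding cocycle_word wsum_S[symmetric]
      using bc by (subst wsum_hom[OF gp_mult_lin(1) S.cmod_axioms]) simp_all
    also have "\<dots> = wsum TT u (\<lambda>u1 u2. wsum TT u' (\<lambda>u1' u2'. ?G u1 u2 v u1' u2' v'))"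
      using bc by (subst wsum_hom[OF gp_mult_lin(1) S.cmod_axioms]) simp_all
    finally show ?thesis .
  qed
  have r: "theta (b * c * tw u * tw u') (v @ v')
    = wsum TT v (\<lambda>v1 v2. wsum TT v' (\<lambda>v1' v2'. ?G u v1 v2 u' v1' v2'))" for u v u' v'
    unfolding theta_def using assms by (subst BH.T.wsum_append) (simp_all add: mult.assoc)
  show ?thesis
    unfolding gen_mult_ge[OF assms] e r by (rule BH.T.wsum_pair_coassoc) (rule G)
qed

text \<open>The untwisting of the product: expanding both factors leaves an adjacent pair
  \<open>t^{-1}_{x_1} t_{x_2}\<close> in each of the two words, and both pairs cancel.\<close>

lemma theta_mult:
  assumes "s \<in> Sdeg (ldeg w)" "s' \<in> Sdeg (ldeg w')"
  shows "gen_mult H (theta s w) (theta s' w') = theta (s * s') (w @ w')"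
proof -
  have s: "s \<in> carrier S" "s' \<in> carrier S" using assms by simp_all
  define K where "K = (\<lambda>a v a' v'. theta (s * a * (s' * a')) (v @ v'))"
  have K1: "(\<lambda>a. K a v a' v') \<in> lin_hom S TT" if "a' \<in> carrier S" for v a' v'
    unfolding K_def using that s
    by (intro lin_hom_compose[OF lin_hom_compose[OF S_mult_lin(1) S_mult_lin(2)] theta_lin]) simp_all
  have K2: "(\<lambda>a'. K a v a' v') \<in> lin_hom S TT" if "a \<in> carrier S" for v a v'
    unfolding K_def using that s
    by (intro lin_hom_compose[OF lin_hom_compose[OF S_mult_lin(1) S_mult_lin(1)] theta_lin]) simp_all
  have Kc: "K a v a' v' \<in> carrier TT" if "a \<in> carrier S" "a' \<in> carrier S" for a v a' v'
    using lin_homD(1)[OF K1[OF that(2)] that(1)] .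
  note gl = lin_homD(1)[OF blinD(1)[OF gen_mult_blin]]
  have "gen_mult H (theta s w) (theta s' w')
    = wsum TT w (\<lambda>u v. gen_mult H (gp (s * iw u) (\<phi> v)) (theta s' w'))"
    unfolding theta_def[of s] using s
    by (subst wsum_hom[OF blinD(2)[OF gen_mult_blin] BH.T.cmod_axioms]) simp_all
  also have "\<dots> = wsum TT w (\<lambda>u v. wsum TT w' (\<lambda>u' v'. gen_mult H (gp (s * iw u) (\<phi> v)) (gp (s' * iw u') (\<phi> v'))))"
    unfolding theta_def using s
    by (subst wsum_hom[OF blinD(1)[OF gen_mult_blin] BH.T.cmod_axioms]) simp_all
  also have "\<dots> = wsum TT w (\<lambda>u v. wsum TT w' (\<lambda>u' v'.
      wsum TT v (\<lambda>v1 v2. wsum TT v' (\<lambda>v1' v2'. K (iw u * tw v1) v2 (iw u' * tw v1') v2'))))"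
  proof (rule wsum_cong, rule wsum_cong)
    fix u v u' v' assume uv: "splits w u v" "splits w' u' v'"
    then have b: "s * iw u \<in> Sdeg 0" "s' * iw u' \<in> Sdeg 0" using assms theta_base by blast+
    show "gen_mult H (gp (s * iw u) (\<phi> v)) (gp (s' * iw u') (\<phi> v'))
      = wsum TT v (\<lambda>v1 v2. wsum TT v' (\<lambda>v1' v2'. K (iw u * tw v1) v2 (iw u' * tw v1') v2'))"
      unfolding gp_base[OF b(1)] gp_base[OF b(2)] gen_mult_gp[OF b] K_def by (simp add: mult_ac)
  qed
  also have "\<dots> = wsum TT w (\<lambda>u v. wsum TT v (\<lambda>v1 v2. wsum TT w' (\<lambda>u' v'.
      wsum TT v' (\<lambda>v1' v2'. K (iw u * tw v1) v2 (iw u' * tw v1') v2'))))"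
    by (rule wsum_cong, rule BH.T.wsum_swap) (simp add: Kc)
  also have "\<dots> = wsum TT w (\<lambda>u v. wsum TT v (\<lambda>v1 v2. K (iw u * tw v1) v2 1 w'))"
    by (rule wsum_cong, rule wsum_cong, rule cancel_it[OF BH.T.cmod_axioms K2]) simp
  also have "\<dots> = K 1 w 1 w'"
    by (rule cancel_it[OF BH.T.cmod_axioms K1]) simp
  finally show ?thesis by (simp add: K_def)
qed

abbreviation "AA \<equiv> gen_ext H"

lemma gen_ext_simps [simp]:
  "carrier AA = carrier TT" "mult AA = gen_mult H" "zero AA = \<zero>\<^bsub>TT\<^esub>" "add AA = add TT" "smult AA = smult TT"
  by (simp_all add: gen_ext_def)

lemma gen_ext_one: "one AA = theta 1 []"
  using tinv_group[of "[]"] Sdeg_iw[of "[]"] by (simp add: gen_ext_def theta_def gp_base)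

text \<open>On elements \<open>theta s w\<close> the product multiplies coefficients and
  concatenates words, so associativity and the unit laws are immediate there.\<close>

lemma calg_gen_ext: "calg AA"
proof -
  note lD = lin_homD[OF blinD(1)[OF gen_mult_blin]] and rD = lin_homD[OF blinD(2)[OF gen_mult_blin]]
  have assoc: "gen_mult H (gen_mult H X Y) Z = gen_mult H X (gen_mult H Y Z)"
    if X: "X \<in> carrier TT" and Y: "Y \<in> carrier TT" and Z: "Z \<in> carrier TT" for X Y Z
    using X
  proof (induction rule: theta_induct)
    case (theta s w)
    note s = theta
    show ?case using Y
    proof (induction rule: theta_induct)
      case (theta s' w')
      note s' = theta
      show ?case using Z
      proof (induction rule: theta_induct)
        case (theta s'' w'')
        then show ?case
          using theta_mult[OF s s'] theta_mult[OF s' theta] Sdeg_mult[OF s s'] Sdeg_mult[OF s' theta]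
            theta_mult[of "s * s'" "w @ w'" s'' w''] theta_mult[of s w "s' * s''" "w' @ w''"] s
          by (simp add: mult.assoc)
      next
        case (add X' Y')
        then show ?case using s s' by (simp add: lD)
      qed
    next
      case (add X' Y')
      then show ?case using s Z by (simp add: lD rD)
    qed
  next
    case (add X' Y')
    then show ?case using Y Z by (simp add: lD rD)
  qed
  have one: "theta 1 [] \<in> carrier TT" by simp
  have one1: "1 \<in> Sdeg (ldeg [])" by (simp add: Sdeg_one)
  have l1: "gen_mult H (theta 1 []) X = X" if "X \<in> carrier TT" for X
    using that
  proof (induction rule: theta_induct)
    case (theta s w)
    then show ?case using theta_mult[OF one1 theta] by simp
  qed (simp add: lD one)
  have r1: "gen_mult H X (theta 1 []) = X" if "X \<in> carrier TT" for X
    using that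
  proof (induction rule: theta_induct)
    case (theta s w)
    then show ?case using theta_mult[OF theta one1] by simp
  qed (simp add: rD one)
  show ?thesis
    by (rule calgI; simp only: gen_ext_simps gen_ext_one)
      (simp_all add: lD rD assoc l1 r1 one BH.T.a_assoc BH.T.a_comm BH.T.a_lcomm BH.T.smult_l_distr
        BH.T.smult_r_distr BH.T.smult_assoc BH.T.smult_minus_one BH.T.l_neg BH.T.r_neg)
qed

sublocale AA: calg AA by (rule calg_gen_ext)

lemma theta_pow: "s \<in> Sdeg (ldeg w) \<Longrightarrow> theta s w [^]\<^bsub>AA\<^esub> (n::nat) = theta (s ^ n) (concat (replicate n w))
    \<and> s ^ n \<in> Sdeg (ldeg (concat (replicate n w)))"
proof (induction n)
  case 0
  show ?case by (simp add: gen_ext_one Sdeg_one)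
next
  case (Suc n)
  have c: "concat (replicate n w) @ w = w @ concat (replicate n w)"
    by (induction n) simp_all
  show ?case
    using Suc theta_mult[of "s ^ n" "concat (replicate n w)" s w] Sdeg_mult[of "s ^ n" "ldeg (concat (replicate n w))" s "ldeg w"]
    by (simp add: c mult.commute add.commute)
qed

end

section \<open>Functoriality of the generic extension\<close>

text \<open>Membership in \<open>Sdeg\<close> is a condition on the coaction, whose transport along
  the induced map is not evident. In a genuine grading on the source it amounts to
  \<open>hgen\<close>, which is preserved.\<close>

locale wh_hom_graded = wh_hom +
  assumes kk_nontrivial: "G.kk \<noteq> \<one>\<^bsub>G.Hab\<^esub>"
begin

abbreviation "p \<equiv> S_map G H f"

lemma p_hom: "p \<in> alg_hom (S_alg G) (S_alg H)" by (rule S_map_spec(1))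

lemmas pD = alg_homD[OF p_hom, simplified]

lemma p_hgen: "G.hgen n s \<Longrightarrow> H.hgen n (p s)"
proof (induction rule: G.hgen.induct)
  case (tw w)
  then show ?case using H.hgen.tw[of w] by (simp add: S_map_spec(2) f_word)
next
  case (iw w)
  then show ?case using H.hgen.iw[of w] by (simp add: S_map_spec(3) f_word)
next
  case zero
  then show ?case using alg_hom_zero[OF p_hom G.S.calg_axioms H.S.calg_axioms] H.hgen.zero by simp
next
  case (parity m s n)
  then show ?case using H.hgen.parity by blast
qed (simp_all add: pD G.Sdeg_S[OF G.hgen_Sdeg] H.hgen.intros)

lemma p_Sdeg: "s \<in> G.Sdeg n \<Longrightarrow> p s \<in> H.Sdeg n"
  using H.hgen_Sdeg p_hgen G.Sdeg_hgen[OF kk_nontrivial] by blast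

lemma p_base_lin: "p \<in> lin_hom G.B H.B"
  using p_Sdeg by (intro lin_homI) (simp_all add: pD)

abbreviation Phi where "Phi \<equiv> gen_ext_map G H f"

lemma Phi_lin: "Phi \<in> lin_hom G.TT H.TT"
  and Phi_ge: "b \<in> G.Sdeg 0 \<Longrightarrow> x \<in> carrier G \<Longrightarrow> Phi (G.ge b x) = H.ge (p b) (f x)"
  unfolding gen_ext_map_def G.ge_pure H.ge_pure
  using tmap_lin_hom[OF G.B.calg_axioms G.calg_axioms H.B.calg_axioms H.calg_axioms p_base_lin alg_hom_lin[OF f_hom]]
    tmap_pure[OF G.B.calg_axioms G.calg_axioms H.B.calg_axioms H.calg_axioms p_base_lin alg_hom_lin[OF f_hom]]
  by simp_all

lemma Phi_theta: "s \<in> G.Sdeg (ldeg w) \<Longrightarrow> Phi (G.theta s w) = H.theta (p s) w"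
proof -
  assume s: "s \<in> G.Sdeg (ldeg w)"
  have "Phi (G.theta s w) = wsum H.TT w (\<lambda>u v. Phi (G.gp (s * G.iw u) (G.wmon v)))"
    unfolding G.theta_def using s by (subst wsum_hom[OF Phi_lin G.BH.T.cmod_axioms]) simp_all
  also have "\<dots> = wsum H.TT w (\<lambda>u v. H.ge (p s * H.iw u) (H.wmon v))"
  proof (rule wsum_cong)
    fix u v assume "splits w u v"
    then have "s * G.iw u \<in> G.Sdeg 0" by (rule G.theta_base[OF s])
    then show "Phi (G.gp (s * G.iw u) (G.wmon v)) = H.ge (p s * H.iw u) (H.wmon v)"
      using s by (simp add: G.gp_base Phi_ge pD S_map_spec(3) f_word)
  qed
  also have "\<dots> = H.theta (p s) w" using H.theta_ge[OF p_Sdeg[OF s]] by simp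
  finally show ?thesis .
qed

text \<open>Multiplicativity has to be checked on the elements \<open>theta s w\<close> only, where
  both products are componentwise.\<close>

lemma Phi_hom: "Phi \<in> alg_hom G.AA H.AA"
proof (rule alg_homI)
  show "Phi \<in> lin_hom G.AA H.AA" using Phi_lin by (simp add: lin_hom_def)
  show "Phi \<one>\<^bsub>G.AA\<^esub> = \<one>\<^bsub>H.AA\<^esub>"
    using pD(5) by (simp add: G.gen_ext_one H.gen_ext_one Phi_theta G.Sdeg_one)
  note l = lin_homD[OF Phi_lin]
  have X: "Phi (gen_mult G X Y) = gen_mult H (Phi X) (Phi Y)"
    if "X \<in> carrier G.TT" and Y: "Y \<in> carrier G.TT" for X Y
    using that(1)
  proof (induction rule: G.theta_induct)
    case (theta s w)
    note s = theta
    show ?case using Y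
    proof (induction rule: G.theta_induct)
      case (theta s' w')
      then show ?case
        using s G.Sdeg_mult[OF s theta]
        by (simp add: G.theta_mult Phi_theta H.theta_mult p_Sdeg pD)
    next
      case (add X' Y')
      then show ?case using s
        by (simp add: l lin_homD[OF blinD(1)[OF G.gen_mult_blin]] lin_homD[OF blinD(1)[OF H.gen_mult_blin]])
    qed
  next
    case (add X' Y')
    then show ?case using Y
      by (simp add: l lin_homD[OF blinD(2)[OF G.gen_mult_blin]] lin_homD[OF blinD(2)[OF H.gen_mult_blin]])
  qed
  fix X Y assume "X \<in> carrier G.AA" "Y \<in> carrier G.AA"
  then show "Phi (X \<otimes>\<^bsub>G.AA\<^esub> Y) = Phi X \<otimes>\<^bsub>H.AA\<^esub> Phi Y" using X by simp
qed

end

lemma sym_const_minus_one: "sym_const (- 1) = - 1"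
  using sym_const_simps(1)[of 1 "- 1"] by (simp add: sym_const_simps eq_neg_iff_add_eq_0 add.commute)

section \<open>The kernel of the projection\<close>

context wh
begin

text \<open>The extension of \<open>theta s\<close> from words to a linear map on \<open>H\<close>.
  It shows that \<open>theta s w\<close> depends on \<open>w\<close> only through its value in
  \<open>H\<close>.\<close>

definition Theta :: "'a symfrac \<Rightarrow> 'a \<Rightarrow> (('a symfrac \<times> 'a) \<Rightarrow>\<^sub>0 complex) set" where
  "Theta s x = tlift TT (\<lambda>x1 x2. gp (s * tinv H x1) x2) (comult H x)"

lemma Theta_blin: "s \<in> carrier S \<Longrightarrow> blin H H TT (\<lambda>x1 x2. gp (s * tinv H x1) x2)"
  by (rule blin_compose[OF gp_blin lin_hom_compose[OF tinv_S_lin S_mult_lin(1)] lin_hom_id])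

lemma Theta_lin_right: "s \<in> carrier S \<Longrightarrow> Theta s \<in> lin_hom H TT"
  unfolding Theta_def[abs_def]
  by (rule lin_hom_compose[OF alg_hom_lin[OF comult_hom] HH.tlift_lin_hom[OF Theta_blin BH.T.cmod_axioms]])

lemma Theta_lin_left: "x \<in> carrier H \<Longrightarrow> (\<lambda>s. Theta s x) \<in> lin_hom S TT"
  unfolding Theta_def[abs_def]
  by (rule HH.tlift_param[OF BH.T.cmod_axioms Theta_blin gp_mult_lin(2) S.cmod_axioms comult_closed]) simp_all

lemma Theta_word: "s \<in> carrier S \<Longrightarrow> Theta s (\<phi> w) = theta s w"
  unfolding Theta_def theta_def by (rule sweedler[OF Theta_blin BH.T.cmod_axioms])

lemma theta_cong: "s \<in> carrier S \<Longrightarrow> \<phi> w = \<phi> w' \<Longrightarrow> theta s w = theta s w'"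
  by (simp flip: Theta_word)

lemma theta_zero_word: "s \<in> carrier S \<Longrightarrow> \<phi> w = \<zero> \<Longrightarrow> theta s w = \<zero>\<^bsub>TT\<^esub>"
  using lin_hom_zero[OF Theta_lin_right cmod_axioms BH.T.cmod_axioms] by (simp flip: Theta_word)

lemma ge_Theta_blin: "b \<in> carrier S \<Longrightarrow> blin H H TT (\<lambda>x1 x2. Theta (b * tvar H x1) x2)"
proof (rule blinI)
  fix x1 assume "b \<in> carrier S" "x1 \<in> carrier H"
  then show "Theta (b * tvar H x1) \<in> lin_hom H TT" by (intro Theta_lin_right) simp
next
  fix x2 assume "b \<in> carrier S" "x2 \<in> carrier H"
  then show "(\<lambda>x1. Theta (b * tvar H x1) x2) \<in> lin_hom H TT"
    by (intro lin_hom_compose[OF lin_hom_compose[OF tvar_S_lin S_mult_lin(1)] Theta_lin_left])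
qed

text \<open>\<open>ge b x\<close> is the value of this map at the coproduct of \<open>x\<close>.
  Having it on all of \<open>H \<otimes> H\<close> allows the two-term coproduct of
  \<open>E^e\<close> to be used in place of the expansion letter by letter.\<close>

definition unfold_ge where
  "unfold_ge b = tlift TT (\<lambda>x1 x2. Theta (b * tvar H x1) x2)"

lemma unfold_ge_lin: "b \<in> carrier S \<Longrightarrow> unfold_ge b \<in> lin_hom (tensor H H) TT"
  unfolding unfold_ge_def by (rule HH.tlift_lin_hom[OF ge_Theta_blin BH.T.cmod_axioms])

lemma unfold_ge_pure: "b \<in> carrier S \<Longrightarrow> unfold_ge b (pure H H (\<phi> u) (\<phi> v)) = theta (b * tw u) v"
  unfolding unfold_ge_def by (simp add: HH.tlift_pure[OF ge_Theta_blin BH.T.cmod_axioms] Theta_word)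

lemma ge_eq_unfold: "b \<in> Sdeg 0 \<Longrightarrow> x \<in> carrier H \<Longrightarrow> ge b x = unfold_ge b (comult H x)"
proof (rule word_lin_eqI[where h = "ge b"])
  assume b: "b \<in> Sdeg 0"
  show "ge b \<in> lin_hom H TT" using blinD(1)[OF ge_blin] b by simp
  show "(\<lambda>x. unfold_ge b (comult H x)) \<in> lin_hom H TT"
    using b by (intro lin_hom_compose[OF alg_hom_lin[OF comult_hom] unfold_ge_lin]) simp
  show "ge b (\<phi> w) = unfold_ge b (comult H (\<phi> w))" for w
    using b gp_theta[of b w] unfolding comult_word
    by (subst wsum_hom[OF unfold_ge_lin HH.T.cmod_axioms]) (simp_all add: gp_base unfold_ge_pure)
qed

definition Omega where
  "Omega b w w' \<alpha> \<beta> = wsum TT w (\<lambda>u v. wsum TT w' (\<lambda>u' v'. theta (b * tw (u @ \<alpha> @ u')) (v @ \<beta> @ v')))"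

text \<open>With \<open>Z\<close> the coproduct of a relator \<open>r\<close>, this is
  \<open>ge b\<close> at the product of \<open>w\<close>, \<open>r\<close> and \<open>w'\<close>. It
  is linear in \<open>Z\<close>; \<open>Omega\<close> is its value at a tensor of two words.\<close>

definition sandwich where
  "sandwich b w w' Z = unfold_ge b (comult H (\<phi> w) \<otimes>\<^bsub>tensor H H\<^esub> Z \<otimes>\<^bsub>tensor H H\<^esub> comult H (\<phi> w'))"

lemma sandwich_lin: "b \<in> carrier S \<Longrightarrow> sandwich b w w' \<in> lin_hom (tensor H H) TT"
  unfolding sandwich_def[abs_def]
  by (intro lin_hom_compose[OF lin_hom_compose[OF HH.T.mult_lin_left HH.T.mult_lin_right] unfold_ge_lin]) simp_all

lemma sandwich_pure: "b \<in> carrier S \<Longrightarrow> sandwich b w w' (pure H H (\<phi> \<alpha>) (\<phi> \<beta>)) = Omega b w w' \<alpha> \<beta>"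
proof -
  assume b: "b \<in> carrier S"
  have "comult H (\<phi> w) \<otimes>\<^bsub>tensor H H\<^esub> pure H H (\<phi> \<alpha>) (\<phi> \<beta>) \<otimes>\<^bsub>tensor H H\<^esub> comult H (\<phi> w')
    = wsum (tensor H H) w (\<lambda>u v. wsum (tensor H H) w' (\<lambda>u' v'. pure H H (\<phi> (u @ \<alpha> @ u')) (\<phi> (v @ \<beta> @ v'))))"
    unfolding comult_word
    by (simp add: HH.T.wsum_mult_left HH.T.wsum_mult_right HH.pure_mult word_append m_assoc)
      (rule HH.T.wsum_swap, simp)
  then show ?thesis
    unfolding sandwich_def Omega_def
    by (simp add: wsum_hom[OF unfold_ge_lin[OF b] HH.T.cmod_axioms] unfold_ge_pure b)
qed

lemma ge_sandwich:
  assumes "b \<in> Sdeg 0" "r \<in> carrier H"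
  shows "ge b (\<phi> w \<otimes> r \<otimes> \<phi> w') = sandwich b w w' (comult H r)"
  using assms by (simp add: ge_eq_unfold sandwich_def alg_homD(4)[OF comult_hom])

abbreviation "tK \<equiv> tw [Gen_K]"
abbreviation "iK \<equiv> iw [Gen_K]"

lemma Sdeg_pow: "s \<in> Sdeg m \<Longrightarrow> s ^ n \<in> Sdeg (n * m)"
proof (induction n)
  case (Suc n)
  then show ?case using Sdeg_mult[of s m "s ^ n" "n * m"] by simp
qed (simp add: Sdeg_one)

lemma tK_deg: "tK ^ n \<in> Sdeg n" "iK ^ n \<in> Sdeg n"
  using Sdeg_pow[OF Sdeg_tw, of "[Gen_K]" n] Sdeg_pow[OF Sdeg_iw, of "[Gen_K]" n] by simp_all

lemma tK_iK: "iK ^ n * tK ^ n = 1"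
  using tinv_group[of "[Gen_K]"] by (simp flip: power_mult_distrib)

lemma iw_inverse: "edeg w = 0 \<Longrightarrow> iw w = inverse (tw w)"
  using tinv_group[of w] tw_nonzero[of w] by (simp add: field_simps)

text \<open>The ideal absorbs \<open>theta z r\<close> on both sides, with any homogeneous coefficient,
  because powers of \<open>tK\<close> are homogeneous units of both degrees.\<close>

lemma ideal_theta:
  assumes J: "ideal J AA" and zr: "theta z r \<in> J" and z: "z \<in> Sdeg (ldeg r)"
    and zi: "zi \<in> Sdeg (ldeg r)" "zi * z = 1" and s: "s \<in> Sdeg (ldeg (w @ r @ w'))"
  shows "theta s (w @ r @ w') \<in> J"
proof -
  interpret J: ideal J AA by fact
  let ?n = "ldeg w'"
  \<comment> \<open>Chosen so that \<open>?s1 * z * tK ^ ?n = s\<close>, where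
    \<open>tK ^ ?n\<close> is the coefficient given to \<open>w'\<close>.\<close>
  let ?s1 = "s * iK ^ ?n * zi"
  have s1: "?s1 \<in> Sdeg (ldeg w)"
    by (rule Sdeg_parity[OF Sdeg_mult[OF Sdeg_mult[OF s tK_deg(2)] zi(1)]]) auto
  have "theta ?s1 w \<in> carrier AA" "theta (tK ^ ?n) w' \<in> carrier AA"
    using theta_closed[OF Sdeg_S[OF s1]] theta_closed[OF Sdeg_S[OF tK_deg(1)]] by simp_all
  then have "theta ?s1 w \<otimes>\<^bsub>AA\<^esub> theta z r \<otimes>\<^bsub>AA\<^esub> theta (tK ^ ?n) w' \<in> J"
    by (intro J.I_r_closed[OF J.I_l_closed[OF zr]])
  also have "theta ?s1 w \<otimes>\<^bsub>AA\<^esub> theta z r \<otimes>\<^bsub>AA\<^esub> theta (tK ^ ?n) w'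
    = theta (?s1 * z * tK ^ ?n) (w @ r @ w')"
    using s1 z tK_deg(1)[of ?n] Sdeg_mult[OF s1 z] theta_mult[OF s1 z]
      theta_mult[of "?s1 * z" "w @ r" "tK ^ ?n" w'] by simp
  also have "?s1 * z * tK ^ ?n = s * (iK ^ ?n * tK ^ ?n) * (zi * z)" by (simp add: mult_ac)
  also have "\<dots> = s" by (simp only: tK_iK zi(2) mult_1_right)
  finally show ?thesis .
qed

text \<open>The same choice of coefficients as for a single \<open>theta\<close> replaces
  \<open>r\<close> by the empty word in any context, at the price of the factor
  \<open>zi * z'\<close>.\<close>

lemma ideal_theta2:
  assumes J: "ideal J AA" and zr: "theta z r \<ominus>\<^bsub>AA\<^esub> theta z' [] \<in> J" and z: "z \<in> Sdeg (ldeg r)"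
    and zi: "zi \<in> Sdeg (ldeg r)" "zi * z = 1" and z': "z' \<in> Sdeg 0"
    and s: "s \<in> Sdeg (ldeg (w @ r @ w'))"
  shows "theta s (w @ r @ w') \<ominus>\<^bsub>AA\<^esub> theta (s * zi * z') (w @ w') \<in> J"
proof -
  interpret J: ideal J AA by fact
  let ?n = "ldeg w'"
  let ?s1 = "s * iK ^ ?n * zi"
  let ?a = "theta ?s1 w" and ?c = "theta (tK ^ ?n) w'"
  have s1: "?s1 \<in> Sdeg (ldeg w)"
    by (rule Sdeg_parity[OF Sdeg_mult[OF Sdeg_mult[OF s tK_deg(2)] zi(1)]]) auto
  have cl: "?a \<in> carrier AA" "?c \<in> carrier AA" "theta z r \<in> carrier AA" "theta z' [] \<in> carrier AA"
    using theta_closed[OF Sdeg_S[OF s1]] theta_closed[OF Sdeg_S[OF tK_deg(1)]]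
      theta_closed[OF Sdeg_S[OF z]] theta_closed[OF Sdeg_S[OF z']] by simp_all
  have "?a \<otimes>\<^bsub>AA\<^esub> (theta z r \<ominus>\<^bsub>AA\<^esub> theta z' []) \<otimes>\<^bsub>AA\<^esub> ?c \<in> J"
    by (intro J.I_r_closed[OF J.I_l_closed[OF zr]] cl)
  also have "?a \<otimes>\<^bsub>AA\<^esub> (theta z r \<ominus>\<^bsub>AA\<^esub> theta z' []) \<otimes>\<^bsub>AA\<^esub> ?c
    = ?a \<otimes>\<^bsub>AA\<^esub> theta z r \<otimes>\<^bsub>AA\<^esub> ?c \<ominus>\<^bsub>AA\<^esub> ?a \<otimes>\<^bsub>AA\<^esub> theta z' [] \<otimes>\<^bsub>AA\<^esub> ?c"
    using cl by (simp only: AA.minus_eq AA.r_distr AA.l_distr AA.r_minus AA.l_minus AA.m_closed AA.a_inv_closed)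
  also have "?a \<otimes>\<^bsub>AA\<^esub> theta z r \<otimes>\<^bsub>AA\<^esub> ?c = theta (?s1 * z * tK ^ ?n) (w @ r @ w')"
    using s1 z tK_deg(1)[of ?n] Sdeg_mult[OF s1 z] theta_mult[OF s1 z]
      theta_mult[of "?s1 * z" "w @ r" "tK ^ ?n" w'] by simp
  also have "?s1 * z * tK ^ ?n = s * (iK ^ ?n * tK ^ ?n) * (zi * z)" by (simp add: mult_ac)
  also have "\<dots> = s" by (simp only: tK_iK zi(2) mult_1_right)
  also have "?a \<otimes>\<^bsub>AA\<^esub> theta z' [] \<otimes>\<^bsub>AA\<^esub> ?c = theta (?s1 * z' * tK ^ ?n) (w @ w')"
    using s1 z' tK_deg(1)[of ?n] Sdeg_mult[OF s1 z'] theta_mult[OF s1, of z' "[]"]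
      theta_mult[of "?s1 * z'" "w" "tK ^ ?n" w'] by simp
  also have "?s1 * z' * tK ^ ?n = s * zi * z' * (iK ^ ?n * tK ^ ?n)" by (simp add: mult_ac)
  also have "\<dots> = s * zi * z'" by (simp only: tK_iK mult_1_right)
  finally show ?thesis .
qed

lemma ge_simple:
  assumes "b \<in> Sdeg 0"
  shows "ge b \<one> = theta (b * tw []) []" "ge b (\<gamma> Gen_K) = theta (b * tK) [Gen_K]"
    "ge b (\<gamma> Gen_E) = theta (b * tw []) [Gen_E] \<oplus>\<^bsub>TT\<^esub> theta (b * tw [Gen_E]) [Gen_K]"
    "ge b (\<gamma> Gen_F) = theta (b * tw [Gen_Kinv]) [Gen_F] \<oplus>\<^bsub>TT\<^esub> theta (b * tw [Gen_F]) []"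
  using assms gp_theta[of b "[]"] gp_theta[of b "[Gen_K]"] gp_theta[of b "[Gen_E]"] gp_theta[of b "[Gen_F]"]
  by (simp_all add: gp_base)

lemma add_minus_cancel: "X \<in> carrier TT \<Longrightarrow> Y \<in> carrier TT \<Longrightarrow> X \<oplus>\<^bsub>TT\<^esub> Y \<ominus>\<^bsub>AA\<^esub> Y = X"
  using AA.minus_eq[of "X \<oplus>\<^bsub>TT\<^esub> Y" Y] AA.a_assoc[of X Y "\<ominus>\<^bsub>AA\<^esub> Y"] AA.r_neg[of Y] AA.r_zero[of X] AA.a_inv_closed[of Y]
  by simp

text \<open>The subtracted term is exactly the contribution of \<open>E \<otimes> K\<close> to the
  element \<open>E\<close> of the extension. What remains is \<open>theta\<close> of
  \<open>t_1\<close> and \<open>E\<close>, whose powers are formed componentwise.\<close>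

lemma E_power:
  "(ge 1 (\<gamma> Gen_E) \<ominus>\<^bsub>AA\<^esub> ge (tvar H (\<gamma> Gen_E) / tvar H (\<gamma> Gen_K)) (\<gamma> Gen_K)) [^]\<^bsub>AA\<^esub> (n::nat)
    = theta (tw [] ^ n) (replicate n Gen_E)"
proof -
  have eq: "tvar H (\<gamma> Gen_E) / tvar H (\<gamma> Gen_K) = tw [Gen_E] * iK"
    using iw_inverse[of "[Gen_K]"] by (simp add: divide_inverse)
  have d: "tw [Gen_E] * iK \<in> Sdeg 0"
    by (rule Sdeg_parity[OF Sdeg_mult[OF Sdeg_tw Sdeg_iw]]) simp
  have c: "tw [Gen_E] * iK * tK = tw [Gen_E]"
    using tinv_group[of "[Gen_K]"] by (simp only: mult.assoc) simp
  have "ge 1 (\<gamma> Gen_E) \<ominus>\<^bsub>AA\<^esub> ge (tw [Gen_E] * iK) (\<gamma> Gen_K) = theta (tw []) [Gen_E]"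
    using ge_simple(2)[OF d, unfolded c] ge_simple(3)[OF Sdeg_one]
      add_minus_cancel[of "theta (tw []) [Gen_E]" "theta (tw [Gen_E]) [Gen_K]"] by simp
  then show ?thesis
    using theta_pow[of "tw []" "[Gen_E]" n] Sdeg_tw[of "[]"] by (simp add: eq concat_replicate_single)
qed

text \<open>Here the term stemming from \<open>F \<otimes> 1\<close> is removed, and
  \<open>theta\<close> of \<open>t_{K^{-1}}\<close> and \<open>F\<close> remains.\<close>

lemma F_power:
  "(ge 1 (\<gamma> Gen_F) \<ominus>\<^bsub>AA\<^esub> ge (tvar H (\<gamma> Gen_F) / tvar H \<one>) \<one>) [^]\<^bsub>AA\<^esub> (n::nat)
    = theta (tw [Gen_Kinv] ^ n) (replicate n Gen_F)"
proof -
  have eq: "tvar H (\<gamma> Gen_F) / tvar H \<one> = tw [Gen_F] * iw []"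
    using iw_inverse[of "[]"] by (simp add: divide_inverse)
  have d: "tw [Gen_F] * iw [] \<in> Sdeg 0"
    by (rule Sdeg_parity[OF Sdeg_mult[OF Sdeg_tw Sdeg_iw]]) simp
  have c: "tw [Gen_F] * iw [] * tw [] = tw [Gen_F]"
    using tinv_group[of "[]"] by (simp only: mult.assoc) simp
  have "ge 1 (\<gamma> Gen_F) \<ominus>\<^bsub>AA\<^esub> ge (tw [Gen_F] * iw []) \<one> = theta (tw [Gen_Kinv]) [Gen_F]"
    using ge_simple(1)[OF d, unfolded c] ge_simple(4)[OF Sdeg_one]
      add_minus_cancel[of "theta (tw [Gen_Kinv]) [Gen_F]" "theta (tw [Gen_F]) []"] by simp
  then show ?thesis
    using theta_pow[of "tw [Gen_Kinv]" "[Gen_F]" n] Sdeg_tw[of "[Gen_Kinv]"] by (simp add: eq concat_replicate_single)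
qed

lemma K_power: "ge 1 (\<gamma> Gen_K) [^]\<^bsub>AA\<^esub> (n::nat) = theta (tK ^ n) (replicate n Gen_K)"
  using theta_pow[of tK "[Gen_K]" n] Sdeg_tw[of "[Gen_K]"] ge_simple(2)[OF Sdeg_one]
  by (simp add: concat_replicate_single)

lemma replicate_degs [simp]:
  "ldeg (replicate n Gen_E) = 0" "rdeg (replicate n Gen_E) = n"
  "ldeg (replicate n Gen_F) = n" "rdeg (replicate n Gen_F) = 0"
  "ldeg (replicate n Gen_K) = n" "rdeg (replicate n Gen_K) = n" "edeg (replicate n Gen_K) = 0"
  "ldeg (replicate n Gen_Kinv) = n" "rdeg (replicate n Gen_Kinv) = n"
  by (induction n) simp_all

text \<open>Characters with \<open>K \<mapsto> -1\<close> separate the two degrees.\<close>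

lemma kk_nontrivialI:
  assumes "h \<in> alg_hom H complex_alg" "h (\<gamma> Gen_K) = - 1" shows "kk \<noteq> \<one>\<^bsub>Hab\<^esub>"
proof
  assume "kk = \<one>\<^bsub>Hab\<^esub>"
  then have "CI +> \<gamma> Gen_K = CI +> \<one>" using alg_homD(5)[OF pab_alg_hom] by simp
  then have "\<gamma> Gen_K \<ominus> \<one> \<in> CI" using coset_eq_iff[OF calg_axioms ideal_comm_ideal] by simp
  then have "h (\<gamma> Gen_K \<ominus> \<one>) = 0" using comm_ideal_kill[OF assms(1) ccalg_complex] by simp
  moreover have "h (\<gamma> Gen_K \<ominus> \<one>) = h (\<gamma> Gen_K) + (- 1) * h \<one>"
    using alg_homD(2,3)[OF assms(1)] by (simp add: minus_eq_smult)
  ultimately show False using alg_homD(5)[OF assms(1)] assms(2) by simp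
qed

end

section \<open>The projection on the free commutative Hopf algebras\<close>

context rootq
begin

lemma sign_character:
  obtains h where "h \<in> alg_hom UU complex_alg" "h UK = - 1" "h UE = 0" "h UF = 0"
proof -
  obtain h where "h \<in> alg_hom (Uq_alg q) complex_alg"
    "\<And>g. h (Uq_gen q g) = (if edeg [g] = 0 then - 1 else 0)"
    using Uq_universal[OF qalg_complex[of "- 1"]] by auto
  then show thesis using that[of h] alg_hom_same[OF Uq_same same_alg_refl, of q complex_alg] by simp
qed

lemma kk_U: "U.kk \<noteq> \<one>\<^bsub>U.Hab\<^esub>"
  using sign_character U.kk_nontrivialI by metis

text \<open>For even \<open>e\<close> the sign character sends \<open>K^e\<close> to 1 and so
  factors through \<open>u_d\<close>.\<close>

lemma kk_u: "even e \<Longrightarrow> u.kk \<noteq> \<one>\<^bsub>u.Hab\<^esub>"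
proof -
  assume e: "even e"
  obtain h where h: "h \<in> alg_hom UU complex_alg" "h UK = - 1" "h UE = 0" "h UF = 0"
    by (rule sign_character)
  have hp: "h (x [^]\<^bsub>UU\<^esub> e) = h x ^ e" if "x \<in> carrier UU" for x
  proof -
    have "c [^]\<^bsub>complex_alg\<^esub> n = c ^ n" for c and n :: nat by (induction n) simp_all
    then show ?thesis using alg_hom_pow[OF h(1) U.calg_axioms CC.calg_axioms that] by simp
  qed
  have k: "h x = \<zero>\<^bsub>complex_alg\<^esub>" if "x \<in> I" for x
    by (rule ud_kill[OF h(1) CC.calg_axioms _ _ _ that]) (use e e_pos in \<open>simp_all add: hp h(2-4)\<close>)
  let ?h = "\<lambda>X. the_elem (h ` X)"
  have "?h \<in> alg_hom (alg_quot UU I) complex_alg"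
    by (rule quot_lift_alg[OF U.calg_axioms ideal_ud h(1) CC.calg_axioms k])
  then have "?h \<in> alg_hom (ud q e) complex_alg"
    using alg_hom_same[OF U.hopf_quot_same[OF ideal_ud] same_alg_refl, of complex_alg] by (simp add: ud_def)
  moreover have "?h (\<psi> UK) = - 1"
    using quot_lift_lin(1)[OF U.calg_axioms ideal_ud alg_hom_lin[OF h(1)] CC.cmod_axioms k] h(2)
    by (simp add: ud_proj_def)
  ultimately show ?thesis by (rule u.kk_nontrivialI)
qed

sublocale P: wh_hom_graded UU "ud q e" "Uq_gen q" "\<lambda>g. \<psi> (Uq_gen q g)" q \<psi>
  by unfold_locales (simp_all add: ud_proj_hom kk_U)

abbreviation "p \<equiv> S_map UU (ud q e) \<psi>"

lemma psi_K: "\<psi> (UK [^]\<^bsub>UU\<^esub> e) = \<one>\<^bsub>ud q e\<^esub>"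
proof -
  have "\<psi> (UK [^]\<^bsub>UU\<^esub> e \<ominus>\<^bsub>UU\<^esub> \<one>\<^bsub>UU\<^esub>) = \<zero>\<^bsub>ud q e\<^esub>" using ud_ideal_mem(3) ud_proj_zero_iff by simp
  then have "\<psi> (UK [^]\<^bsub>UU\<^esub> e) \<ominus>\<^bsub>ud q e\<^esub> \<one>\<^bsub>ud q e\<^esub> = \<zero>\<^bsub>ud q e\<^esub>"
    using alg_hom_minus[OF ud_proj_hom U.calg_axioms u.calg_axioms] alg_homD(5)[OF ud_proj_hom] by simp
  then show ?thesis
    using u.minus_equality[of "\<psi> (UK [^]\<^bsub>UU\<^esub> e)" "\<ominus>\<^bsub>ud q e\<^esub> \<one>\<^bsub>ud q e\<^esub>"] alg_homD(1)[OF ud_proj_hom, of "UK [^]\<^bsub>UU\<^esub> e"]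
    by (simp add: a_minus_def)
qed

lemma u_words:
  "u.wmon (w @ replicate e Gen_K @ w') = u.wmon (w @ w')"
  "u.wmon (w @ replicate e Gen_E @ w') = \<zero>\<^bsub>ud q e\<^esub>"
  "u.wmon (w @ replicate e Gen_F @ w') = \<zero>\<^bsub>ud q e\<^esub>"
proof -
  have z: "\<psi> (UE [^]\<^bsub>UU\<^esub> e) = \<zero>\<^bsub>ud q e\<^esub>" "\<psi> (UF [^]\<^bsub>UU\<^esub> e) = \<zero>\<^bsub>ud q e\<^esub>"
    using ud_ideal_mem(1,2) ud_proj_zero_iff by simp_all
  have r: "u.wmon (replicate e g) = \<psi> (Uq_gen q g [^]\<^bsub>UU\<^esub> e)" for g
    using P.f_word[of "replicate e g"] by (simp add: U.word_replicate)
  show "u.wmon (w @ replicate e Gen_K @ w') = u.wmon (w @ w')"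
    "u.wmon (w @ replicate e Gen_E @ w') = \<zero>\<^bsub>ud q e\<^esub>"
    "u.wmon (w @ replicate e Gen_F @ w') = \<zero>\<^bsub>ud q e\<^esub>"
    by (simp_all add: u.word_append r z psi_K)
qed

lemma p_tw: "p (U.tw w) = u.tw w" and p_iw: "p (U.iw w) = u.iw w"
  by (simp_all add: P.S_map_spec P.f_word)

lemma p_surj:
  assumes "s \<in> carrier u.S" shows "\<exists>a\<in>carrier U.S. p a = s"
proof -
  have "s \<in> subalg_gen symfrac_alg (tvar (ud q e) ` carrier (ud q e) \<union> tinv (ud q e) ` carrier (ud q e))"
    using assms by (simp add: u.S_carrier)
  then show ?thesis
  proof induction
    case one
    then show ?case using P.pD(5) by auto
  next
    case (incl x)
    then obtain y where "y \<in> carrier UU" "x = tvar (ud q e) (\<psi> y) \<or> x = tinv (ud q e) (\<psi> y)"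
      unfolding ud_proj_carrier by blast
    then show ?case using P.S_map_spec(2,3)[of y] U.tvar_S[of y] U.tinv_S[of y] by metis
  next
    case (add x y)
    then obtain a b where "a \<in> carrier U.S" "b \<in> carrier U.S" "p a = x" "p b = y" by blast
    then show ?case using P.pD(2)[of a b] by (intro bexI[of _ "a + b"]) auto
  next
    case (mult x y)
    then obtain a b where "a \<in> carrier U.S" "b \<in> carrier U.S" "p a = x" "p b = y" by blast
    then show ?case using P.pD(4)[of a b] by (intro bexI[of _ "a * b"]) auto
  next
    case (smult x c)
    then obtain a where "a \<in> carrier U.S" "p a = x" by blast
    then show ?case using P.pD(3)[of a c] by (intro bexI[of _ "sym_const c * a"]) auto
  qed
qed

text \<open>When \<open>e\<close> is odd, \<open>t_{K^e} / t_1\<close> is an odd element with image \<open>1\<close>, so every odd element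
  of \<open>S_U\<close> has the same image as an even one.\<close>

lemma p_base_surj:
  assumes "b \<in> u.Sdeg 0" shows "\<exists>a\<in>U.Sdeg 0. p a = b"
proof -
  obtain a where a: "a \<in> carrier U.S" "p a = b" using p_surj[OF u.Sdeg_S[OF assms]] by blast
  obtain a0 a1 where a01: "U.hgen 0 a0" "U.hgen 1 a1" "a = a0 + a1" using U.hgen_decomp[OF a(1)] by blast
  note d = U.hgen_Sdeg[OF a01(1)] U.hgen_Sdeg[OF a01(2)]
  have pb: "b = p a0 + p a1" using P.pD(2)[of a0 a1] a a01(3) d by simp
  show ?thesis
  proof (cases "u.kk = \<one>\<^bsub>u.Hab\<^esub>")
    case True
    then have odd: "odd e" using kk_u by blast
    let ?t = "U.tw (replicate e Gen_K) * U.iw []"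
    have t: "?t \<in> U.Sdeg 1"
      by (rule U.Sdeg_parity[OF U.Sdeg_mult[OF U.Sdeg_tw U.Sdeg_iw]]) (use odd in simp)
    have k: "u.tw (replicate e Gen_K) = u.tw []" using u_words(1)[of "[]" "[]"] by simp
    have "p ?t = u.tw [] * u.iw []"
      by (simp only: P.pD(4)[OF U.tvar_S[OF U.word_closed] U.tinv_S[OF U.word_closed]] p_tw p_iw k)
    also have "\<dots> = 1" using u.tinv_group[of "[]"] by (simp only: mult.commute deg_simps(1))
    finally have pt: "p ?t = 1" .
    have t1: "a1 * ?t \<in> U.Sdeg 0" by (rule U.Sdeg_parity[OF U.Sdeg_mult[OF d(2) t]]) simp
    have "p (a0 + a1 * ?t) = p a0 + p a1 * p ?t"
      using P.pD(2)[of a0 "a1 * ?t"] P.pD(4)[of a1 ?t] d t t1 U.Sdeg_S by metis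
    then show ?thesis using pb pt U.Sdeg_add[OF d(1) t1] by auto
  next
    case False
    \<comment> \<open>In a genuine grading \<open>p a1\<close> is odd as an image of
      \<open>a1\<close> and even as a difference of even elements, hence zero.\<close>
    have p1: "p a1 \<in> u.Sdeg 1" by (rule P.p_Sdeg[OF d(2)])
    have "p a1 = b + sym_const (- 1) * p a0"
      unfolding pb sym_const_minus_one by simp
    then have "p a1 \<in> u.Sdeg 0"
      using u.Sdeg_add[OF assms u.Sdeg_smult[OF P.p_Sdeg[OF d(1)]]] by simp
    then have "p a1 = 0" using u.pr0_id u.pr0_odd[OF p1 False] by metis
    then show ?thesis using pb d(1) by auto
  qed
qed

end

lemma same_wsum_diff:
  assumes "cmod A" "\<And>u v. f u v \<in> carrier A" "\<And>u v. g u v \<in> carrier A"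
  shows "wsum A w f \<ominus>\<^bsub>A\<^esub> wsum A w g = wsum A w (\<lambda>u v. f u v \<ominus>\<^bsub>A\<^esub> g u v)"
proof -
  interpret cmod A by fact
  have "(\<lambda>x. (- 1) \<odot>\<^bsub>A\<^esub> x) \<in> lin_hom A A"
    by (rule lin_homI) (simp_all add: smult_r_distr smult_assoc)
  then have "(- 1) \<odot>\<^bsub>A\<^esub> wsum A w g = wsum A w (\<lambda>u v. (- 1) \<odot>\<^bsub>A\<^esub> g u v)"
    using wsum_hom[of "\<lambda>x. (- 1) \<odot>\<^bsub>A\<^esub> x" A A g w] cmod_axioms assms(3) by simp
  then show ?thesis
    using assms(2,3) by (simp add: minus_eq_smult wsum_add)
qed

section \<open>The ideal of the relations\<close>

context rootq
begin

definition Jgens where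
  "Jgens = {U.ge b \<one>\<^bsub>UU\<^esub> | b. b \<in> carrier U.B \<and> p b = 0}
     \<union> {U.ge 1 UK [^]\<^bsub>U.AA\<^esub> e \<ominus>\<^bsub>U.AA\<^esub> U.ge b \<one>\<^bsub>UU\<^esub> | b.
         b \<in> carrier U.B \<and> p b = tvar (ud q e) (\<psi> UK) ^ e / tvar (ud q e) \<one>\<^bsub>ud q e\<^esub>}
     \<union> {(U.ge 1 UE \<ominus>\<^bsub>U.AA\<^esub> U.ge (tvar UU UE / tvar UU UK) UK) [^]\<^bsub>U.AA\<^esub> e}
     \<union> {(U.ge 1 UF \<ominus>\<^bsub>U.AA\<^esub> U.ge (tvar UU UF / tvar UU \<one>\<^bsub>UU\<^esub>) \<one>\<^bsub>UU\<^esub>) [^]\<^bsub>U.AA\<^esub> e}"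

abbreviation "eE \<equiv> replicate e Gen_E"
abbreviation "eF \<equiv> replicate e Gen_F"
abbreviation "eK \<equiv> replicate e Gen_K"

lemma t1_deg: "U.tw [] ^ n \<in> U.Sdeg 0" "U.iw [] ^ n \<in> U.Sdeg 0" "U.iw [] ^ n * U.tw [] ^ n = 1"
  using U.Sdeg_pow[OF U.Sdeg_tw, of "[]" n] U.Sdeg_pow[OF U.Sdeg_iw, of "[]" n] U.tinv_group[of "[]"]
  by (simp_all flip: power_mult_distrib)

lemma tL_deg: "U.tw [Gen_Kinv] ^ n \<in> U.Sdeg n" "U.iw [Gen_Kinv] ^ n \<in> U.Sdeg n"
  "U.iw [Gen_Kinv] ^ n * U.tw [Gen_Kinv] ^ n = 1"
  using U.Sdeg_pow[OF U.Sdeg_tw, of "[Gen_Kinv]" n] U.Sdeg_pow[OF U.Sdeg_iw, of "[Gen_Kinv]" n]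
    U.tinv_group[of "[Gen_Kinv]"]
  by (simp_all flip: power_mult_distrib)

lemma Jgens_eq: "Jgens = {U.theta (b * U.tw []) [] | b. b \<in> U.Sdeg 0 \<and> p b = 0}
     \<union> {U.theta (U.tK ^ e) eK \<ominus>\<^bsub>U.AA\<^esub> U.theta (b * U.tw []) [] | b.
         b \<in> U.Sdeg 0 \<and> p b = u.tK ^ e / u.tw []}
     \<union> {U.theta (U.tw [] ^ e) eE} \<union> {U.theta (U.tw [Gen_Kinv] ^ e) eF}"
proof -
  have K: "u.tK = tvar (ud q e) (\<psi> UK)" "u.tw [] = tvar (ud q e) \<one>\<^bsub>ud q e\<^esub>"
    using u.gen_closed[of Gen_K] by simp_all
  have *: "{f b | b. b \<in> U.Sdeg 0 \<and> P b} = {g b | b. b \<in> U.Sdeg 0 \<and> P b}"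
    if "\<And>b. b \<in> U.Sdeg 0 \<Longrightarrow> f b = g b" for P and f g :: "uq_free set symfrac \<Rightarrow> ((uq_free set symfrac \<times> uq_free set) \<Rightarrow>\<^sub>0 complex) set"
    using that by (intro Collect_cong) metis
  show ?thesis
    unfolding Jgens_def U.E_power U.F_power U.K_power K[symmetric] U.base_simps(1)
    by (intro arg_cong2[where f = "(\<union>)"] refl *) (simp_all only: U.ge_simple(1))
qed

text \<open>The product of \<open>t_K^e / t_1\<close> and \<open>t_{K^e} / t_1\<close>. Both have
  degree \<open>e\<close>, so the product is even, and the second has image 1 because
  \<open>K^e = 1\<close> in \<open>u_d\<close>.\<close>

definition b0 where "b0 = U.tK ^ e * U.tw eK * U.iw [] ^ 2"

lemma b0: "b0 \<in> U.Sdeg 0" "p b0 = u.tK ^ e / u.tw []"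
proof -
  show "b0 \<in> U.Sdeg 0"
    unfolding b0_def
    by (rule U.Sdeg_parity[OF U.Sdeg_mult[OF U.Sdeg_mult[OF U.tK_deg(1) U.Sdeg_tw] t1_deg(2)]]) simp
  have pw: "p (x ^ n) = p x ^ n \<and> x ^ n \<in> carrier U.S" if "x \<in> carrier U.S" for x n
    using that P.pD(4,5) by (induction n) simp_all
  have k: "u.tw eK = u.tw []" using u_words(1)[of "[]" "[]"] by simp
  have c: "U.tw w \<in> carrier U.S" "U.iw w \<in> carrier U.S" for w by simp_all
  have "p b0 = u.tK ^ e * u.tw [] * u.iw [] ^ 2"
    unfolding b0_def
    using c pw by (simp only: P.pD(4) U.S_closed(1) p_tw p_iw k)
  also have "\<dots> = u.tK ^ e * (u.iw [] * u.tw []) * u.iw []" by (simp only: power2_eq_square mult_ac)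
  also have "\<dots> = u.tK ^ e / u.tw []"
    using u.iw_inverse[of "[]"] u.tinv_group[of "[]"] by (simp only: divide_inverse mult_1_right deg_simps(1))
  finally show "p b0 = u.tK ^ e / u.tw []" .
qed

definition J where "J = Idl\<^bsub>U.AA\<^esub> Jgens"

lemma Jgens_carrier: "Jgens \<subseteq> carrier U.AA"
proof -
  have th: "U.theta s w \<in> carrier U.AA" if "s \<in> U.Sdeg n" for s w n
    using U.theta_closed[OF U.Sdeg_S[OF that]] by simp
  have d: "b * U.tw [] \<in> U.Sdeg 0" if "b \<in> U.Sdeg 0" for b
    using U.Sdeg_mult[OF that U.Sdeg_tw[of "[]"]] by simp
  show ?thesis
    unfolding Jgens_eq
    by (auto intro!: U.AA.minus_closed intro: th[OF d] th[OF U.tK_deg(1)] th[OF t1_deg(1)] th[OF tL_deg(1)]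
        simp del: U.gen_ext_simps wprod.simps)
qed

lemma ideal_J: "ideal J U.AA"
  unfolding J_def by (rule U.AA.genideal_ideal[OF Jgens_carrier])

interpretation J: ideal J U.AA by (rule ideal_J)

lemma Jgens_J: "x \<in> Jgens \<Longrightarrow> x \<in> J"
  unfolding J_def using U.AA.genideal_self[OF Jgens_carrier] by blast

lemma J_add: "X \<in> J \<Longrightarrow> Y \<in> J \<Longrightarrow> X \<oplus>\<^bsub>U.TT\<^esub> Y \<in> J"
  using J.a_closed[of X Y] by simp

lemma J_zero: "\<zero>\<^bsub>U.TT\<^esub> \<in> J"
  using J.zero_closed by simp

lemma J_smult: "X \<in> J \<Longrightarrow> c \<odot>\<^bsub>U.TT\<^esub> X \<in> J"
  using ideal_smult[OF U.AA.calg_axioms ideal_J, of X c] by simp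

lemma J_theta_ker:
  assumes c: "c \<in> U.Sdeg (ldeg w)" "p c = 0" shows "U.theta c w \<in> J"
proof -
  \<comment> \<open>The coefficient is split as \<open>c = ?c * t_1 * t_K^n\<close>. The factor
    \<open>t_1\<close> belongs to the relation \<open>?c \<otimes> 1\<close>, which is
    \<open>theta (?c * t_1) []\<close>, and \<open>t_K^n\<close> has the degree of
    \<open>w\<close>.\<close>
  let ?n = "ldeg w" and ?c = "c * U.iK ^ ldeg w * U.iw []"
  have d: "?c \<in> U.Sdeg 0"
    by (rule U.Sdeg_parity[OF U.Sdeg_mult[OF U.Sdeg_mult[OF c(1) U.tK_deg(2)] U.Sdeg_iw]]) simp
  have "p ?c = 0"
    using P.pD(4) c U.Sdeg_S[OF c(1)] U.Sdeg_S[OF U.tK_deg(2)] U.tinv_S[OF U.word_closed]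
    by (simp only: U.S_closed(1) mult_zero_left)
  then have g: "U.theta (?c * U.tw []) [] \<in> J" using d by (intro Jgens_J) (auto simp: Jgens_eq)
  have t: "U.theta (U.tK ^ ?n) w \<in> carrier U.AA"
    using U.theta_closed[OF U.Sdeg_S[OF U.tK_deg(1)]] by simp
  have d1: "?c * U.tw [] \<in> U.Sdeg (ldeg [])"
    using U.Sdeg_mult[OF d U.Sdeg_tw[of "[]"]] by simp
  have "U.theta (?c * U.tw []) [] \<otimes>\<^bsub>U.AA\<^esub> U.theta (U.tK ^ ?n) w \<in> J"
    by (rule J.I_r_closed[OF g t])
  also have "U.theta (?c * U.tw []) [] \<otimes>\<^bsub>U.AA\<^esub> U.theta (U.tK ^ ?n) w = U.theta (?c * U.tw [] * U.tK ^ ?n) w"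
    using U.theta_mult[OF d1 U.tK_deg(1)] by simp
  also have "?c * U.tw [] * U.tK ^ ?n = c * (U.iK ^ ?n * U.tK ^ ?n) * (U.iw [] * U.tw [])"
    by (simp only: mult_ac)
  also have "\<dots> = c" using U.tinv_group[of "[]"] by (simp only: U.tK_iK mult_1_right deg_simps(1))
  finally show ?thesis .
qed

text \<open>Written through \<open>theta\<close>, every coefficient \<open>b t_u\<close> still has
  image zero.\<close>

lemma J_ge_ker:
  assumes b: "b \<in> U.Sdeg 0" "p b = 0" and x: "x \<in> carrier UU" shows "U.ge b x \<in> J"
  using x
proof (induction rule: U.word_induct)
  case (word w)
  have "U.ge b (U.wmon w) = wsum U.TT w (\<lambda>u v. U.theta (b * U.tw u) v)"
    using U.gp_theta[of b w] b(1) by (simp add: U.gp_base)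
  also have "\<dots> \<in> J"
  proof (rule wsum_induct[where P = "\<lambda>x. x \<in> J"])
    fix u v assume "splits w u v"
    then show "U.theta (b * U.tw u) v \<in> J"
      using b P.pD(4)[of b "U.tw u"] by (intro J_theta_ker U.theta_deg[OF b(1)]) simp_all
  qed (rule J_add)
  finally show ?case .
next
  case (smult c x)
  then show ?case using lin_homD(3)[OF blinD(1)[OF U.ge_blin], of b x c] b(1) J_smult by simp
next
  case (add x y)
  then show ?case using lin_homD(2)[OF blinD(1)[OF U.ge_blin], of b x y] b(1) J_add by simp
qed

lemma Omega_J:
  assumes "\<And>u v u' v'. splits w u v \<Longrightarrow> splits w' u' v' \<Longrightarrow> U.theta (b * U.tw (u @ \<alpha> @ u')) (v @ \<beta> @ v') \<in> J"
  shows "U.Omega b w w' \<alpha> \<beta> \<in> J"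
  unfolding U.Omega_def
proof (rule wsum_induct[where P = "\<lambda>x. x \<in> J"])
  fix u v assume uv: "splits w u v"
  show "wsum U.TT w' (\<lambda>u' v'. U.theta (b * U.tw (u @ \<alpha> @ u')) (v @ \<beta> @ v')) \<in> J"
    by (rule wsum_induct[where P = "\<lambda>x. x \<in> J"]) (use assms[OF uv] J_add in blast)+
qed (rule J_add)

lemma coef_deg:
  assumes "b \<in> U.Sdeg 0" "splits w u v" "splits w' u' v'" "even (rdeg \<alpha> + ldeg \<beta>)"
  shows "b * U.tw (u @ \<alpha> @ u') \<in> U.Sdeg (ldeg (v @ \<beta> @ v'))"
  by (rule U.Sdeg_parity[OF U.Sdeg_mult[OF assms(1) U.Sdeg_tw]])
    (use assms(2-4) in \<open>auto simp: splits_def\<close>)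

text \<open>The word \<open>\<alpha>\<close> dies in \<open>u_d\<close> in every context, so each
  coefficient \<open>b t_{u \<alpha> u'}\<close> is killed by \<open>p\<close>.\<close>

lemma Omega_ker:
  assumes "b \<in> U.Sdeg 0" "even (rdeg \<alpha> + ldeg \<beta>)" "\<And>u u'. u.wmon (u @ \<alpha> @ u') = \<zero>\<^bsub>ud q e\<^esub>"
  shows "U.Omega b w w' \<alpha> \<beta> \<in> J"
proof (rule Omega_J)
  fix u v u' v' assume uv: "splits w u v" "splits w' u' v'"
  have "u.tw (u @ \<alpha> @ u') = 0"
    using assms(3) lin_hom_zero[OF u.tvar_lin u.cmod_axioms SF.cmod_axioms] by simp
  then have "p (b * U.tw (u @ \<alpha> @ u')) = 0"
    using P.pD(4)[of b "U.tw (u @ \<alpha> @ u')"] assms(1) U.tvar_S[OF U.word_closed] by (simp add: p_tw)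
  then show "U.theta (b * U.tw (u @ \<alpha> @ u')) (v @ \<beta> @ v') \<in> J"
    by (intro J_theta_ker coef_deg[OF assms(1) uv assms(2)])
qed

lemma J_relations: "U.theta (U.tw [] ^ e) eE \<in> J" "U.theta (U.tw [Gen_Kinv] ^ e) eF \<in> J"
  "U.theta (U.tK ^ e) eK \<ominus>\<^bsub>U.AA\<^esub> U.theta (b0 * U.tw []) [] \<in> J"
  using b0 by (auto intro!: Jgens_J simp: Jgens_eq)

text \<open>Removing \<open>K^e\<close> from a word by its relation multiplies the coefficient by
  this element; since its image is 1, the image of the coefficient does not change.\<close>

lemma p_b0_quotient: "p (U.iK ^ e * (b0 * U.tw [])) = 1"
proof -
  have c: "U.tw w \<in> carrier U.S" "U.iw w \<in> carrier U.S" "U.iK ^ n \<in> carrier U.S" "b0 \<in> carrier U.S" for w n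
    using U.Sdeg_S[OF U.tK_deg(2)] U.Sdeg_S[OF b0(1)] by simp_all
  have pw: "p (U.iK ^ n) = u.iK ^ n" for n
    using c(3) c(2)[of "[Gen_K]"] P.pD(4)[of U.iK] P.pD(5)
  proof (induction n)
    case (Suc n)
    then show ?case by (simp only: power_Suc p_iw)
  qed simp
  have "p (U.iK ^ e * (b0 * U.tw [])) = u.iK ^ e * (u.tK ^ e / u.tw [] * u.tw [])"
    using c by (simp only: P.pD(4) U.S_closed(1) pw p_tw b0(2))
  also have "\<dots> = u.iK ^ e * u.tK ^ e" using u.tw_nonzero[of "[]"] by (simp only: nonzero_eq_divide_eq deg_simps(1)) simp
  also have "\<dots> = 1" by (rule u.tK_iK)
  finally show ?thesis .
qed

text \<open>For \<open>E^e\<close> and \<open>F^e\<close>, one term of the coproduct has the relator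
  on the left, where it puts the coefficient into the kernel of \<open>p\<close>, and the other has
  it on the right, where the relation in \<open>theta\<close> form applies. For
  \<open>K^e - 1\<close> both factors change at once and the two effects are combined.\<close>

lemma J_ge_relation:
  assumes b: "b \<in> U.Sdeg 0"
    and r: "r \<in> {UE [^]\<^bsub>UU\<^esub> e, UF [^]\<^bsub>UU\<^esub> e, UK [^]\<^bsub>UU\<^esub> e \<ominus>\<^bsub>UU\<^esub> \<one>\<^bsub>UU\<^esub>}"
  shows "U.ge b (U.wmon w \<otimes>\<^bsub>UU\<^esub> r \<otimes>\<^bsub>UU\<^esub> U.wmon w') \<in> J"
proof -
  have rc: "r \<in> carrier UU" using r ud_gens by blast
  note bS = U.Sdeg_S[OF b]
  note lin = U.sandwich_lin[OF bS, of w w']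
  have pw: "U.wmon (replicate n g) = Uq_gen q g [^]\<^bsub>UU\<^esub> n" for n g by (rule U.word_replicate)
  have san: "U.sandwich b w w' (pure UU UU (U.wmon \<alpha>) (U.wmon \<beta>)) = U.Omega b w w' \<alpha> \<beta>" for \<alpha> \<beta>
    by (rule U.sandwich_pure[OF bS])
  note root = q_root q_prim e_pos
  have "U.sandwich b w w' (comult UU r) \<in> J"
    using r
  proof (elim insertE emptyE)
    assume "r = UE [^]\<^bsub>UU\<^esub> e"
    then have "comult UU r = pure UU UU (U.wmon []) (U.wmon eE) \<oplus>\<^bsub>tensor UU UU\<^esub> pure UU UU (U.wmon eE) (U.wmon eK)"
      using U.comult_E_pow[OF root] by (simp add: pw)
    then have "U.sandwich b w w' (comult UU r) = U.Omega b w w' [] eE \<oplus>\<^bsub>U.TT\<^esub> U.Omega b w w' eE eK"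
      by (simp only: lin_homD(2)[OF lin] U.HH.pure_closed U.word_closed san)
    moreover have "U.Omega b w w' eE eK \<in> J"
      by (rule Omega_ker[OF b]) (simp_all only: u_words, simp)
    moreover have "U.Omega b w w' [] eE \<in> J"
    proof (rule Omega_J)
      fix u v u' v' assume uv: "splits w u v" "splits w' u' v'"
      show "U.theta (b * U.tw (u @ [] @ u')) (v @ eE @ v') \<in> J"
        by (rule U.ideal_theta[OF ideal_J J_relations(1) _ _ t1_deg(3) coef_deg[OF b uv]])
          (use t1_deg in \<open>simp_all del: wprod.simps\<close>)
    qed
    ultimately show ?thesis using J_add by simp
  next
    assume "r = UF [^]\<^bsub>UU\<^esub> e"
    then have "comult UU r = pure UU UU (U.wmon (replicate e Gen_Kinv)) (U.wmon eF)
        \<oplus>\<^bsub>tensor UU UU\<^esub> pure UU UU (U.wmon eF) (U.wmon [])"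
      using U.comult_F_pow[OF root] by (simp add: pw)
    then have "U.sandwich b w w' (comult UU r)
        = U.Omega b w w' (replicate e Gen_Kinv) eF \<oplus>\<^bsub>U.TT\<^esub> U.Omega b w w' eF []"
      by (simp only: lin_homD(2)[OF lin] U.HH.pure_closed U.word_closed san)
    moreover have "U.Omega b w w' eF [] \<in> J"
      by (rule Omega_ker[OF b]) (simp_all only: u_words, simp)
    moreover have "U.Omega b w w' (replicate e Gen_Kinv) eF \<in> J"
    proof (rule Omega_J)
      fix u v u' v' assume uv: "splits w u v" "splits w' u' v'"
      show "U.theta (b * U.tw (u @ replicate e Gen_Kinv @ u')) (v @ eF @ v') \<in> J"
        by (rule U.ideal_theta[OF ideal_J J_relations(2) _ _ tL_deg(3) coef_deg[OF b uv]])
          (use tL_deg in \<open>simp_all del: wprod.simps\<close>)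
    qed
    ultimately show ?thesis using J_add by simp
  next
    assume r: "r = UK [^]\<^bsub>UU\<^esub> e \<ominus>\<^bsub>UU\<^esub> \<one>\<^bsub>UU\<^esub>"
    have "comult UU r = pure UU UU (U.wmon eK) (U.wmon eK) \<ominus>\<^bsub>tensor UU UU\<^esub> pure UU UU (U.wmon []) (U.wmon [])"
      unfolding r using alg_hom_minus[OF U.comult_hom U.calg_axioms U.HH.calg_tensor] U.comult_K_pow
        alg_homD(5)[OF U.comult_hom] by (simp add: pw U.HH.pure_one)
    then have "U.sandwich b w w' (comult UU r) = U.Omega b w w' eK eK \<ominus>\<^bsub>U.TT\<^esub> U.Omega b w w' [] []"
      by (simp only: lin_hom_minus[OF lin U.HH.T.cmod_axioms U.BH.T.cmod_axioms] U.HH.pure_closed U.word_closed san)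
    also have "\<dots> = wsum U.TT w (\<lambda>u v. wsum U.TT w' (\<lambda>u' v'.
        U.theta (b * U.tw (u @ eK @ u')) (v @ eK @ v') \<ominus>\<^bsub>U.TT\<^esub> U.theta (b * U.tw (u @ [] @ u')) (v @ [] @ v')))"
      unfolding U.Omega_def using bS
      by (simp add: same_wsum_diff[OF U.BH.T.cmod_axioms] del: wprod.simps)
    also have "\<dots> \<in> J"
    proof (rule wsum_induct[where P = "\<lambda>x. x \<in> J"], rule J_add, assumption, assumption)
      fix u v assume uv: "splits w u v"
      show "wsum U.TT w' (\<lambda>u' v'. U.theta (b * U.tw (u @ eK @ u')) (v @ eK @ v')
          \<ominus>\<^bsub>U.TT\<^esub> U.theta (b * U.tw (u @ [] @ u')) (v @ [] @ v')) \<in> J"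
      proof (rule wsum_induct[where P = "\<lambda>x. x \<in> J"], rule J_add, assumption, assumption)
        fix u' v' assume uv': "splits w' u' v'"
        \<comment> \<open>\<open>?s * ?z * ?z'\<close> is the coefficient left after
          \<open>K^e\<close> has been removed on the right. Its image agrees with that of
          \<open>?t\<close>, because removing \<open>K^e\<close> on the left does not change the
          value in \<open>u_d\<close>; so their difference is in the kernel of
          \<open>p\<close>.\<close>
        let ?s = "b * U.tw (u @ eK @ u')" and ?t = "b * U.tw (u @ [] @ u')"
        let ?z = "U.iK ^ e" and ?z' = "b0 * U.tw []"
        let ?n = "ldeg (v @ [] @ v')"
        have s: "?s \<in> U.Sdeg (ldeg (v @ eK @ v'))" by (rule coef_deg[OF b uv uv']) simp
        have t: "?t \<in> U.Sdeg ?n" by (rule coef_deg[OF b uv uv']) simp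
        have z': "?z' \<in> U.Sdeg 0" using U.Sdeg_mult[OF b0(1) U.Sdeg_tw[of "[]"]] by simp
        have sz: "?s * ?z * ?z' \<in> U.Sdeg ?n"
          by (rule U.Sdeg_parity[OF U.Sdeg_mult[OF U.Sdeg_mult[OF s U.tK_deg(2)] z']]) (simp, blast)
        have d: "?s * ?z * ?z' + sym_const (- 1) * ?t \<in> U.Sdeg ?n"
          by (rule U.Sdeg_add[OF sz U.Sdeg_smult[OF t]])
        have 1: "U.theta ?s (v @ eK @ v') \<ominus>\<^bsub>U.AA\<^esub> U.theta (?s * ?z * ?z') (v @ v') \<in> J"
          by (rule U.ideal_theta2[OF ideal_J J_relations(3) _ _ U.tK_iK z' s])
            (use U.tK_deg in \<open>simp_all del: wprod.simps\<close>)
        have zS: "?z * ?z' \<in> carrier U.S" using U.Sdeg_S[OF U.tK_deg(2)] U.Sdeg_S[OF z'] by simp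
        have "p (?s * ?z * ?z') = p b * u.tw (u @ eK @ u') * p (?z * ?z')"
          using bS zS P.pD(4)[of ?s "?z * ?z'"] P.pD(4)[of b "U.tw (u @ eK @ u')"] U.tvar_S[OF U.word_closed]
            U.Sdeg_S[OF s] by (simp only: mult.assoc p_tw)
        also have "\<dots> = p b * u.tw (u @ [] @ u')" by (simp only: p_b0_quotient u_words(1) append.simps mult_1_right)
        also have "\<dots> = p ?t"
          using bS P.pD(4)[of b "U.tw (u @ [] @ u')"] U.tvar_S[OF U.word_closed] by (simp only: p_tw)
        finally have eq: "p (?s * ?z * ?z') = p ?t" .
        have "p (?s * ?z * ?z' + sym_const (- 1) * ?t) = p (?s * ?z * ?z') + sym_const (- 1) * p ?t"
          using P.pD(2)[OF U.Sdeg_S[OF sz] U.Sdeg_S[OF U.Sdeg_smult[OF t]]] P.pD(3)[OF U.Sdeg_S[OF t]] by simp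
        also have "\<dots> = 0" by (simp only: eq sym_const_minus_one) simp
        finally have "p (?s * ?z * ?z' + sym_const (- 1) * ?t) = 0" .
        then have 2: "U.theta (?s * ?z * ?z' + sym_const (- 1) * ?t) (v @ [] @ v') \<in> J"
          by (rule J_theta_ker[OF d])
        have 3: "U.theta (?s * ?z * ?z' + sym_const (- 1) * ?t) (v @ [] @ v')
          = U.theta (?s * ?z * ?z') (v @ v') \<ominus>\<^bsub>U.TT\<^esub> U.theta ?t (v @ [] @ v')"
          using lin_homD(2,3)[OF U.theta_lin] U.Sdeg_S[OF sz] U.Sdeg_S[OF t] U.Sdeg_S[OF U.Sdeg_smult[OF t]]
            U.theta_closed[OF U.Sdeg_S[OF t]]
          by (simp only: U.BH.T.minus_eq_smult U.theta_closed U.S_same append.simps)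
        have tm: "X \<ominus>\<^bsub>U.AA\<^esub> Y = X \<ominus>\<^bsub>U.TT\<^esub> Y" if "X \<in> carrier U.TT" "Y \<in> carrier U.TT" for X Y
          using that U.AA.minus_eq_smult[of X Y] U.BH.T.minus_eq_smult[of X Y] by simp
        let ?X = "U.theta ?s (v @ eK @ v')" and ?Y = "U.theta (?s * ?z * ?z') (v @ v')" and ?Z = "U.theta ?t (v @ [] @ v')"
        have c: "?X \<in> carrier U.TT" "?Y \<in> carrier U.TT" "?Z \<in> carrier U.TT"
          using U.theta_closed U.Sdeg_S[OF s] U.Sdeg_S[OF sz] U.Sdeg_S[OF t] by blast+
        have "?X \<ominus>\<^bsub>U.TT\<^esub> ?Z = (?X \<ominus>\<^bsub>U.TT\<^esub> ?Y) \<oplus>\<^bsub>U.TT\<^esub> (?Y \<ominus>\<^bsub>U.TT\<^esub> ?Z)"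
        proof -
          have "(?X \<ominus>\<^bsub>U.TT\<^esub> ?Y) \<oplus>\<^bsub>U.TT\<^esub> (?Y \<ominus>\<^bsub>U.TT\<^esub> ?Z) = ?X \<oplus>\<^bsub>U.TT\<^esub> ((\<ominus>\<^bsub>U.TT\<^esub> ?Y \<oplus>\<^bsub>U.TT\<^esub> ?Y) \<oplus>\<^bsub>U.TT\<^esub> (\<ominus>\<^bsub>U.TT\<^esub> ?Z))"
            using c by (simp only: U.BH.T.minus_eq U.BH.T.a_assoc U.BH.T.a_inv_closed U.BH.T.a_closed)
          then show ?thesis using c by (simp only: U.BH.T.l_neg U.BH.T.l_zero U.BH.T.a_inv_closed U.BH.T.minus_eq)
        qed
        then show "?X \<ominus>\<^bsub>U.TT\<^esub> ?Z \<in> J" using J_add[OF 1[unfolded tm[OF c(1,2)]] 2[unfolded 3]] by (simp only:)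
      qed
    qed
    finally show ?thesis .
  qed
  then show ?thesis by (simp only: U.ge_sandwich[OF b rc])
qed

text \<open>The ideal consists of sums of products \<open>x r y\<close> with \<open>r\<close> a
  relator, and linearity in both outer factors reduces these to words.\<close>

lemma J_ge_ud_ideal:
  assumes b: "b \<in> U.Sdeg 0" and x: "x \<in> I" shows "U.ge b x \<in> J"
proof -
  note l = lin_homD[OF blinD(1)[OF U.ge_blin], of b, simplified, OF b]
  let ?G = "{UE [^]\<^bsub>UU\<^esub> e, UF [^]\<^bsub>UU\<^esub> e, UK [^]\<^bsub>UU\<^esub> e \<ominus>\<^bsub>UU\<^esub> \<one>\<^bsub>UU\<^esub>}"
  have Gc: "r \<in> carrier UU" if "r \<in> ?G" for r using that ud_gens by blast
  have wy: "U.ge b (U.wmon w \<otimes>\<^bsub>UU\<^esub> r \<otimes>\<^bsub>UU\<^esub> y) \<in> J" if "r \<in> ?G" "y \<in> carrier UU" for w r y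
    using that(2)
  proof (induction rule: U.word_induct)
    case (word w')
    show ?case by (rule J_ge_relation[OF b that(1)])
  next
    case (smult c y)
    then show ?case using Gc[OF that(1)] by (simp add: U.smult_mult_right l J_smult)
  next
    case (add y y')
    then show ?case using Gc[OF that(1)] by (simp add: U.r_distr l J_add)
  qed
  have xy: "U.ge b (x \<otimes>\<^bsub>UU\<^esub> r \<otimes>\<^bsub>UU\<^esub> y) \<in> J" if "r \<in> ?G" "x \<in> carrier UU" "y \<in> carrier UU" for x r y
    using that(2)
  proof (induction rule: U.word_induct)
    case (word w)
    show ?case by (rule wy[OF that(1,3)])
  next
    case (smult c x)
    then show ?case using Gc[OF that(1)] that(3) by (simp add: U.smult_mult_left l J_smult)
  next
    case (add x x')
    then show ?case using Gc[OF that(1)] that(3) by (simp add: U.l_distr l J_add)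
  qed
  have "x \<in> ideal_span UU ?G"
    using genideal_subset_ideal_span[OF U.calg_axioms ud_gens] x unfolding ud_ideal_def by blast
  then have "x \<in> carrier UU \<and> U.ge b x \<in> J"
  proof induction
    case zero
    have "U.ge b \<zero>\<^bsub>UU\<^esub> = \<zero>\<^bsub>U.TT\<^esub>"
      using lin_hom_zero[OF blinD(1)[OF U.ge_blin] U.cmod_axioms U.BH.T.cmod_axioms] b by simp
    then show ?case by (simp add: J_zero)
  next
    case (gen x r y)
    then show ?case using xy Gc by simp
  next
    case (add x y)
    then show ?case by (simp add: l J_add)
  qed
  then show ?thesis by simp
qed

end

section \<open>The inverse of the induced map\<close>

context rootq
begin

lemma tt_minus: "X \<in> carrier U.TT \<Longrightarrow> Y \<in> carrier U.TT \<Longrightarrow> X \<ominus>\<^bsub>U.AA\<^esub> Y = X \<ominus>\<^bsub>U.TT\<^esub> Y"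
  using U.AA.minus_eq_smult[of X Y] U.BH.T.minus_eq_smult[of X Y] by simp

text \<open>\<open>Phi\<close> commutes with \<open>theta\<close>, and in \<open>u_d\<close> the
  words \<open>E^e\<close> and \<open>F^e\<close> vanish while \<open>K^e\<close> and the empty word
  coincide.\<close>

lemma Phi_Jgens:
  assumes "X \<in> Jgens" shows "P.Phi X = \<zero>\<^bsub>u.AA\<^esub>"
proof -
  have pw: "p (x ^ n) = p x ^ n \<and> x ^ n \<in> carrier U.S" if "x \<in> carrier U.S" for x n
    using that P.pD(4,5) by (induction n) simp_all
  have th: "P.Phi (U.theta (b * U.tw []) []) = u.theta (p b * u.tw []) []" if "b \<in> U.Sdeg 0" for b
    using P.Phi_theta[of "b * U.tw []" "[]"] U.Sdeg_mult[OF that U.Sdeg_tw[of "[]"]]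
      P.pD(4)[OF U.Sdeg_S[OF that] U.tvar_S[OF U.word_closed[of "[]"]]] p_tw[of "[]"]
    by (simp del: wprod.simps)
  have bth: "b * U.tw [] \<in> carrier U.S" if "b \<in> U.Sdeg 0" for b
    using U.Sdeg_S[OF U.Sdeg_mult[OF that U.Sdeg_tw[of "[]"]]] .
  consider (ker) b where "X = U.theta (b * U.tw []) []" "b \<in> U.Sdeg 0" "p b = 0"
    | (K) b where "X = U.theta (U.tK ^ e) eK \<ominus>\<^bsub>U.AA\<^esub> U.theta (b * U.tw []) []" "b \<in> U.Sdeg 0"
        "p b = u.tK ^ e / u.tw []"
    | (E) "X = U.theta (U.tw [] ^ e) eE" | (F) "X = U.theta (U.tw [Gen_Kinv] ^ e) eF"
    using assms unfolding Jgens_eq by blast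
  then show ?thesis
  proof cases
    case ker
    have "u.theta 0 [] = \<zero>\<^bsub>u.TT\<^esub>"
      using lin_hom_zero[OF u.theta_lin u.S.cmod_axioms u.BH.T.cmod_axioms, of "[]"] by simp
    then show ?thesis using th[OF ker(2)] ker(1,3) by simp
  next
    case K
    have "p (U.tK ^ e) = u.tK ^ e" using pw[OF U.tvar_S[OF U.word_closed], of "[Gen_K]"] p_tw[of "[Gen_K]"] by simp
    moreover have "p b * u.tw [] = u.tK ^ e" using u.tw_nonzero[of "[]"] K(3) by simp
    moreover have "u.theta (u.tK ^ e) eK = u.theta (u.tK ^ e) []"
      by (rule u.theta_cong) (use u.Sdeg_S[OF u.tK_deg(1)] u_words(1)[of "[]" "[]"] in simp_all)
    moreover have "P.Phi (U.theta (U.tK ^ e) eK) = u.theta (p (U.tK ^ e)) eK"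
      by (rule P.Phi_theta) (use U.tK_deg(1)[of e] in simp)
    moreover have "P.Phi X = P.Phi (U.theta (U.tK ^ e) eK) \<ominus>\<^bsub>u.AA\<^esub> P.Phi (U.theta (b * U.tw []) [])"
      unfolding K(1)
      by (rule alg_hom_minus[OF P.Phi_hom U.AA.calg_axioms u.AA.calg_axioms])
        (use U.theta_closed[OF bth[OF K(2)]] U.theta_closed[OF U.Sdeg_S[OF U.tK_deg(1)]] in simp_all)
    moreover have "u.theta (u.tK ^ e) [] \<in> carrier u.AA"
      using u.theta_closed[OF u.Sdeg_S[OF u.tK_deg(1)]] by simp
    ultimately show ?thesis using th[OF K(2)] by (simp only: u.AA.r_neg u.AA.minus_eq)
  next
    case E
    have "P.Phi X = u.theta (p (U.tw [] ^ e)) eE" unfolding E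
      by (rule P.Phi_theta) (use t1_deg(1)[of e] U.Sdeg_parity[OF t1_deg(1)] in simp)
    moreover have "p (U.tw [] ^ e) \<in> carrier u.S"
      using P.pD(1)[of "U.tw [] ^ e"] U.Sdeg_S[OF t1_deg(1)] by simp
    ultimately show ?thesis
      using u.theta_zero_word[of "p (U.tw [] ^ e)" eE] u_words(2)[of "[]" "[]"] by simp
  next
    case F
    have "P.Phi X = u.theta (p (U.tw [Gen_Kinv] ^ e)) eF" unfolding F
      by (rule P.Phi_theta) (use tL_deg(1)[of e] in simp)
    moreover have "p (U.tw [Gen_Kinv] ^ e) \<in> carrier u.S"
      using P.pD(1)[of "U.tw [Gen_Kinv] ^ e"] U.Sdeg_S[OF tL_deg(1)] by simp
    ultimately show ?thesis
      using u.theta_zero_word[of "p (U.tw [Gen_Kinv] ^ e)" eF] u_words(3)[of "[]" "[]"] by simp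
  qed
qed

lemma Phi_J: "X \<in> J \<Longrightarrow> P.Phi X = \<zero>\<^bsub>u.AA\<^esub>"
  unfolding J_def
  by (rule genideal_hom_zero[OF P.Phi_hom U.AA.calg_axioms u.AA.calg_axioms Jgens_carrier Phi_Jgens])

abbreviation "JQ \<equiv> alg_quot U.AA J"
abbreviation jc where "jc X \<equiv> J +>\<^bsub>U.AA\<^esub> X"

text \<open>The coefficient is changed first, then the element; both differences lie in
  \<open>J\<close>.\<close>

lemma jc_eq:
  assumes "b \<in> U.Sdeg 0" "b' \<in> U.Sdeg 0" "x \<in> carrier UU" "x' \<in> carrier UU" "p b = p b'" "\<psi> x = \<psi> x'"
  shows "jc (U.ge b x) = jc (U.ge b' x')"
proof -
  have c: "U.ge b x \<in> carrier U.AA" "U.ge b' x \<in> carrier U.AA" "U.ge b' x' \<in> carrier U.AA"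
    using U.ge_closed assms by simp_all
  have "U.ge b x \<ominus>\<^bsub>U.AA\<^esub> U.ge b' x \<in> J"
  proof -
    have m: "b \<ominus>\<^bsub>U.B\<^esub> b' \<in> U.Sdeg 0" using U.B.minus_closed[of b b'] assms(1,2) by simp
    have "p (b \<ominus>\<^bsub>U.B\<^esub> b') = \<zero>\<^bsub>u.B\<^esub>"
      using lin_hom_minus[OF P.p_base_lin U.B.cmod_axioms u.B.cmod_axioms, of b b'] assms(1,2,5)
        u.B.r_neg[of "p b'"] P.p_Sdeg[OF assms(2)] by (simp add: u.B.minus_eq)
    then have "U.ge (b \<ominus>\<^bsub>U.B\<^esub> b') x \<in> J" using J_ge_ker[OF m _ assms(3)] by simp
    then show ?thesis
      using lin_hom_minus[OF blinD(2)[OF U.ge_blin assms(3)] U.B.cmod_axioms U.BH.T.cmod_axioms, of b b']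
        tt_minus[of "U.ge b x" "U.ge b' x"] c assms(1,2) by simp
  qed
  moreover have "U.ge b' x \<ominus>\<^bsub>U.AA\<^esub> U.ge b' x' \<in> J"
  proof -
    have "\<psi> (x \<ominus>\<^bsub>UU\<^esub> x') = \<zero>\<^bsub>ud q e\<^esub>"
      using alg_hom_minus[OF ud_proj_hom U.calg_axioms u.calg_axioms assms(3,4)] assms(6)
        u.r_neg[OF alg_homD(1)[OF ud_proj_hom assms(4)]] by (simp add: u.minus_eq)
    then have "U.ge b' (x \<ominus>\<^bsub>UU\<^esub> x') \<in> J"
      using J_ge_ud_ideal[OF assms(2)] ud_proj_zero_iff assms(3,4) by simp
    then show ?thesis
      using lin_hom_minus[OF blinD(1)[OF U.ge_blin] U.cmod_axioms U.BH.T.cmod_axioms, of b' x x']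
        tt_minus[of "U.ge b' x" "U.ge b' x'"] c assms(2-4) by simp
  qed
  ultimately show ?thesis
    by (rule trans[OF iffD2[OF coset_eq_iff[OF U.AA.calg_axioms ideal_J c(1,2)]]
        iffD2[OF coset_eq_iff[OF U.AA.calg_axioms ideal_J c(2,3)]]])
qed

text \<open>Lifts are chosen arbitrarily; \<open>jc_eq\<close> makes the class independent of
  them.\<close>

definition Psi where
  "Psi c y = jc (U.ge (SOME b. b \<in> U.Sdeg 0 \<and> p b = c) (SOME x. x \<in> carrier UU \<and> \<psi> x = y))"

lemma Psi_eq: "b \<in> U.Sdeg 0 \<Longrightarrow> x \<in> carrier UU \<Longrightarrow> Psi (p b) (\<psi> x) = jc (U.ge b x)"
  unfolding Psi_def
  using someI[of "\<lambda>b'. b' \<in> U.Sdeg 0 \<and> p b' = p b" b] someI[of "\<lambda>x'. x' \<in> carrier UU \<and> \<psi> x' = \<psi> x" x]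
  by (intro jc_eq) simp_all

lemma ud_proj_surj:
  assumes "y \<in> carrier (ud q e)" shows "\<exists>x. x \<in> carrier UU \<and> \<psi> x = y"
  using assms unfolding ud_proj_carrier by (elim imageE, intro exI conjI) (assumption, rule sym)

lemma Psi_blin: "blin u.B (ud q e) JQ Psi"
proof -
  note Q = alg_quot_simps[OF U.AA.calg_axioms ideal_J]
  note cov = ud_proj_surj
  have covb: "\<exists>b. b \<in> U.Sdeg 0 \<and> p b = c" if "c \<in> carrier u.B" for c
    using p_base_surj[of c] that by simp blast
  note l = alg_homD[OF ud_proj_hom]
  note pl = lin_homD[OF P.p_base_lin]
  note g1 = lin_homD[OF blinD(1)[OF U.ge_blin]] and g2 = lin_homD[OF blinD(2)[OF U.ge_blin]]
  show ?thesis
  proof (rule blinI; rule lin_homI)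
    fix c y assume "c \<in> carrier u.B" "y \<in> carrier (ud q e)"
    then obtain b x where b: "b \<in> U.Sdeg 0" "p b = c" and x: "x \<in> carrier UU" "\<psi> x = y"
      using cov covb by metis
    have k: "U.ge b x \<in> carrier U.AA" using U.ge_closed b x by simp
    show 1: "Psi c y \<in> carrier JQ" unfolding b(2)[symmetric] x(2)[symmetric] Psi_eq[OF b(1) x(1)]
      using k by (auto simp: Q(1))
    then show "Psi c y \<in> carrier JQ" .
    fix z
    have zx: "z \<odot>\<^bsub>UU\<^esub> x \<in> carrier UU" "\<psi> (z \<odot>\<^bsub>UU\<^esub> x) = z \<odot>\<^bsub>ud q e\<^esub> y" using l x by simp_all
    have zb: "z \<odot>\<^bsub>U.B\<^esub> b \<in> U.Sdeg 0" "p (z \<odot>\<^bsub>U.B\<^esub> b) = z \<odot>\<^bsub>u.B\<^esub> c"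
      using U.B.smult_closed[of b z] pl(3)[of b z] b by simp_all
    have "z \<odot>\<^bsub>JQ\<^esub> jc (U.ge b x) = jc (z \<odot>\<^bsub>U.AA\<^esub> U.ge b x)" by (rule Q(6)[OF k])
    then have s: "z \<odot>\<^bsub>JQ\<^esub> Psi c y = jc (z \<odot>\<^bsub>U.AA\<^esub> U.ge b x)"
      using Psi_eq[OF b(1) x(1)] b(2) x(2) by (simp only:)
    show "Psi c (z \<odot>\<^bsub>ud q e\<^esub> y) = z \<odot>\<^bsub>JQ\<^esub> Psi c y"
      using Psi_eq[OF b(1) zx(1)] zx(2) b(2) s g1(3)[of b x z] b(1) x(1) by (simp only: U.base_simps U.gen_ext_simps)
    show "Psi (z \<odot>\<^bsub>u.B\<^esub> c) y = z \<odot>\<^bsub>JQ\<^esub> Psi c y"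
      using Psi_eq[OF zb(1) x(1)] zb(2) x(2) s g2(3)[of x b z] b(1) x(1) by (simp only: U.base_simps U.gen_ext_simps)
  next
    fix c y y' assume "c \<in> carrier u.B" "y \<in> carrier (ud q e)" "y' \<in> carrier (ud q e)"
    then obtain b x x' where b: "b \<in> U.Sdeg 0" "p b = c" and x: "x \<in> carrier UU" "\<psi> x = y"
      and x': "x' \<in> carrier UU" "\<psi> x' = y'"
      using cov covb by metis
    have k: "U.ge b x \<in> carrier U.AA" "U.ge b x' \<in> carrier U.AA" using U.ge_closed b x x' by simp_all
    have xx: "x \<oplus>\<^bsub>UU\<^esub> x' \<in> carrier UU" "\<psi> (x \<oplus>\<^bsub>UU\<^esub> x') = y \<oplus>\<^bsub>ud q e\<^esub> y'" using l x x' by simp_all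
    have "Psi c y \<oplus>\<^bsub>JQ\<^esub> Psi c y' = jc (U.ge b x \<oplus>\<^bsub>U.AA\<^esub> U.ge b x')"
      using Q(4)[OF k] Psi_eq[OF b(1) x(1)] Psi_eq[OF b(1) x'(1)] x(2) x'(2) b(2) by (simp only:)
    then show "Psi c (y \<oplus>\<^bsub>ud q e\<^esub> y') = Psi c y \<oplus>\<^bsub>JQ\<^esub> Psi c y'"
      using Psi_eq[OF b(1) xx(1)] xx(2) b(2) g1(2)[of b x x'] b(1) x(1) x'(1) by (simp only: U.base_simps U.gen_ext_simps)
  next
    fix y c c' assume "y \<in> carrier (ud q e)" "c \<in> carrier u.B" "c' \<in> carrier u.B"
    then obtain b b' x where b: "b \<in> U.Sdeg 0" "p b = c" and b': "b' \<in> U.Sdeg 0" "p b' = c'"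
      and x: "x \<in> carrier UU" "\<psi> x = y"
      using cov covb by metis
    have k: "U.ge b x \<in> carrier U.AA" "U.ge b' x \<in> carrier U.AA" using U.ge_closed b b' x by simp_all
    have bb: "b \<oplus>\<^bsub>U.B\<^esub> b' \<in> U.Sdeg 0" "p (b \<oplus>\<^bsub>U.B\<^esub> b') = c \<oplus>\<^bsub>u.B\<^esub> c'"
      using U.B.a_closed[of b b'] pl(2)[of b b'] b b' by simp_all
    have "Psi c y \<oplus>\<^bsub>JQ\<^esub> Psi c' y = jc (U.ge b x \<oplus>\<^bsub>U.AA\<^esub> U.ge b' x)"
      using Q(4)[OF k] Psi_eq[OF b(1) x(1)] Psi_eq[OF b'(1) x(1)] x(2) b(2) b'(2) by (simp only:)
    then show "Psi (c \<oplus>\<^bsub>u.B\<^esub> c') y = Psi c y \<oplus>\<^bsub>JQ\<^esub> Psi c' y"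
      using Psi_eq[OF bb(1) x(1)] bb(2) x(2) g2(2)[of x b b'] b(1) b'(1) x(1) by (simp only: U.base_simps U.gen_ext_simps)
  qed
qed

lemma Psi_Phi:
  assumes "X \<in> carrier U.TT" shows "tlift JQ Psi (P.Phi X) = jc X"
proof -
  note Q = alg_quot_simps[OF U.AA.calg_axioms ideal_J]
  interpret Q: calg JQ by (rule calg_alg_quot[OF U.AA.calg_axioms ideal_J])
  note tl = lin_homD[OF u.BH.tlift_lin_hom[OF Psi_blin Q.cmod_axioms]]
  show ?thesis using assms
  proof (induction rule: U.BH.tensor_induct)
    case (pure b x)
    then have bx: "b \<in> U.Sdeg 0" "x \<in> carrier UU" by simp_all
    have "p b \<in> carrier u.B" "\<psi> x \<in> carrier (ud q e)"
      using P.p_Sdeg[OF bx(1)] alg_homD(1)[OF ud_proj_hom bx(2)] by simp_all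
    then show ?case
      using u.BH.tlift_pure[OF Psi_blin Q.cmod_axioms] P.Phi_ge[OF bx] Psi_eq[OF bx]
      by (simp only: U.ge_pure u.ge_pure)
  next
    case (add X Y)
    have XY: "P.Phi (X \<oplus>\<^bsub>U.TT\<^esub> Y) = P.Phi X \<oplus>\<^bsub>u.TT\<^esub> P.Phi Y" "P.Phi X \<in> carrier u.TT" "P.Phi Y \<in> carrier u.TT"
      using lin_homD[OF P.Phi_lin] add(1,2) by blast+
    show ?case
      using tl(2)[OF XY(2,3)] Q(4)[of X Y] add by (simp only: XY(1) U.gen_ext_simps)
  qed
qed

text \<open>\<open>Psi\<close> induces a left inverse of \<open>Phi\<close> modulo \<open>J\<close>,
  so nothing outside \<open>J\<close> is killed.\<close>

lemma Phi_kernel: "a_kernel U.AA u.AA P.Phi = J"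
proof -
  interpret Q: calg JQ by (rule calg_alg_quot[OF U.AA.calg_axioms ideal_J])
  have "X \<in> J" if X: "X \<in> carrier U.TT" "P.Phi X = \<zero>\<^bsub>u.AA\<^esub>" for X
  proof -
    have "tlift JQ Psi \<zero>\<^bsub>u.TT\<^esub> = \<zero>\<^bsub>JQ\<^esub>"
      by (rule lin_hom_zero[OF u.BH.tlift_lin_hom[OF Psi_blin Q.cmod_axioms] u.BH.T.cmod_axioms Q.cmod_axioms])
    then have "jc X = J"
      using Psi_Phi[OF X(1)] X(2) alg_quot_simps(2)[OF U.AA.calg_axioms ideal_J] by simp
    then show ?thesis using coset_zero_iff[OF U.AA.calg_axioms ideal_J] X(1) by simp
  qed
  moreover have "J \<subseteq> carrier U.AA" using ideal.axioms(1)[OF ideal_J] additive_subgroup.a_subset by blast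
  ultimately show ?thesis unfolding a_kernel_def' using Phi_J by auto
qed

lemma Phi_surj: "P.Phi ` carrier U.AA = carrier u.AA"
proof (rule subset_antisym)
  show "P.Phi ` carrier U.AA \<subseteq> carrier u.AA" using alg_homD(1)[OF P.Phi_hom] by blast
  have "Y \<in> P.Phi ` carrier U.TT" if "Y \<in> carrier u.TT" for Y
    using that
  proof (induction rule: u.BH.tensor_induct)
    case (pure c y)
    obtain b where b: "b \<in> U.Sdeg 0" "p b = c" using p_base_surj[of c] pure(1) by auto
    obtain x where x: "x \<in> carrier UU" "\<psi> x = y" using ud_proj_surj[OF pure(2)] by blast
    have "pure u.B (ud q e) c y = P.Phi (U.ge b x)" using P.Phi_ge[OF b(1) x(1)] b(2) x(2) u.ge_pure by simp
    then show ?case using U.ge_closed[OF b(1) x(1)] by blast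
  next
    case (add X Y)
    obtain X' Y' where *: "X' \<in> carrier U.TT" "X = P.Phi X'" "Y' \<in> carrier U.TT" "Y = P.Phi Y'"
      using add(3,4) by blast
    then have "X \<oplus>\<^bsub>u.TT\<^esub> Y = P.Phi (X' \<oplus>\<^bsub>U.TT\<^esub> Y')" using lin_homD(2)[OF P.Phi_lin] by (simp only:)
    then show ?case using U.BH.T.a_closed[OF *(1,3)] by blast
  qed
  then show "carrier u.AA \<subseteq> P.Phi ` carrier U.AA" by auto
qed

theorem gen_ext_quotient:
  "P.Phi \<in> alg_hom U.AA u.AA \<and> P.Phi ` carrier U.AA = carrier u.AA \<and> a_kernel U.AA u.AA P.Phi = J
    \<and> (\<lambda>X. the_elem (P.Phi ` X)) \<in> ring_iso (U.AA Quot J) u.AA"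
proof -
  interpret h: ring_hom_ring U.AA u.AA P.Phi
    by (rule alg_hom_ring_hom[OF P.Phi_hom]) unfold_locales
  show ?thesis
    using P.Phi_hom Phi_surj Phi_kernel h.FactRing_iso_set[OF Phi_surj] by (simp only: simp_thms)
qed

end

theorem theorem8p13:
  fixes q :: complex and d e :: nat
  assumes "d \<ge> 3"
    and "q ^ d = 1" and "\<And>k. 0 < k \<Longrightarrow> k < d \<Longrightarrow> q ^ k \<noteq> 1"
    and "e = (if odd d then d else d div 2)"
  shows
    "let U = Uq q; u = ud q e; \<pi> = ud_proj q e;
         E = Uq_gen q Gen_E; F = Uq_gen q Gen_F; K = Uq_gen q Gen_K; i = \<one>\<^bsub>U\<^esub>;
         t = tvar U; B = base_alg U; A = gen_ext U;
         p = S_map U u \<pi>; \<Phi> = gen_ext_map U u \<pi>;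
         J = Idl\<^bsub>A\<^esub>
           ({gen_elem U b i | b. b \<in> carrier B \<and> p b = 0}
          \<union> {gen_elem U 1 K [^]\<^bsub>A\<^esub> e \<ominus>\<^bsub>A\<^esub> gen_elem U b i | b.
               b \<in> carrier B \<and> p b = tvar u (\<pi> K) ^ e / tvar u \<one>\<^bsub>u\<^esub>}
          \<union> {(gen_elem U 1 E \<ominus>\<^bsub>A\<^esub> gen_elem U (t E / t K) K) [^]\<^bsub>A\<^esub> e}
          \<union> {(gen_elem U 1 F \<ominus>\<^bsub>A\<^esub> gen_elem U (t F / t i) i) [^]\<^bsub>A\<^esub> e})
     in \<Phi> \<in> alg_hom A (gen_ext u)
        \<and> \<Phi> ` carrier A = carrier (gen_ext u)
        \<and> a_kernel A (gen_ext u) \<Phi> = J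
        \<and> (\<lambda>X. the_elem (\<Phi> ` X)) \<in> ring_iso (A Quot J) (gen_ext u)"
proof -
  have order: "d dvd k" if "q ^ k = 1" for k
  proof -
    have "q ^ k = (q ^ d) ^ (k div d) * q ^ (k mod d)"
      by (simp flip: power_mult power_add)
    then have "q ^ (k mod d) = 1" using that assms(2) by simp
    then show ?thesis using assms(1,3) by (metis mod_less_divisor dvd_eq_mod_eq_0 gr0I less_le_trans zero_less_numeral)
  qed
  interpret rootq q e
  proof
    show "0 < e" using assms(1,4) by auto
    show "q ^ (2 * e) = 1"
      using assms(2,4) power_mult[of q d 2] by (auto simp: mult.commute)
    show "q ^ (2 * j) \<noteq> 1" if j: "0 < j" "j < e" for j
    proof
      assume "q ^ (2 * j) = 1"
      then have "d dvd 2 * j" by (rule order)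
      show False
      \<comment> \<open>For odd \<open>d\<close>, 2 is invertible modulo \<open>d\<close>, so
        \<open>d\<close> would divide \<open>j < e = d\<close>; for even \<open>d\<close>, already
        \<open>2 j < d\<close>.\<close>
      proof (cases "odd d")
        case True
        then have "d dvd j" using \<open>d dvd 2 * j\<close> by (simp add: coprime_dvd_mult_right_iff)
        then show ?thesis using j assms(4) True by (auto dest: dvd_imp_le)
      next
        case False
        then show ?thesis using dvd_imp_le[OF \<open>d dvd 2 * j\<close>] j assms(4) by auto
      qed
    qed
    show "q ^ 2 \<noteq> 1" using assms(1) assms(3)[of 2] by simp
  qed
  show ?thesis
    unfolding Let_def by (rule gen_ext_quotient[unfolded J_def Jgens_def])
qed

end
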